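(* Let $x>0$ and $\lambda>0$ be real, and let \[ \hat\phi(s)=\frac{x^s}{s}\exp\left(\frac{\lambda^2 s^2}{2}\right). \] Let $\hat\Phi:\mathbb{C}\setminus\mathbb{R}_{\le 0}\to\mathbb{C}$ be the unique holomorphic function such that $\hat\Phi'(s)=\hat\phi(s)$ and $\lim_{t\to\infty}\left[\hat\Phi(\sigma+it)+\hat\Phi(\sigma-it)\right]=0$ for every fixed real $\sigma$. Then \[ \frac{1}{2\pi i}\int_{2-i\infty}^{2+i\infty}\hat\phi(s)\log\zeta(s)\,{\rm d}s=\hat\Phi(1)-\sum_{\rho}\Re\,\hat\Phi(\rho)-\log 2+\frac{1}{2\pi i}\int_{-1-i\infty}^{-1+i\infty}\hat\phi(s)\log(-\zeta(s))\,{\rm d}s, \] where the sum runs over the non-trivial zeros $\rho$ of the Riemann zeta function $\zeta$.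
   Context: $x^s=\exp(s\log x)$ with $\log x$ real. On the line $\Re s=2$, $\log\zeta(s)$ is the branch given by the absolutely convergent series $\sum_{n\ge2}\Lambda(n)/(n^s\log n)$, where $\Lambda$ is the von Mangoldt function. On the line $\Re s=-1$, $\log(-\zeta(s))$ is the branch obtained by analytic continuation from the real interval $(-2,1)$, where $-\zeta(s)>0$ and the logarithm is taken real. The sum over zeros is taken with multiplicity. *)

theory Defs
  imports "HOL-Complex_Analysis.Complex_Analysis" "HOL-Number_Theory.Prime_Powers"
    "HOL-Real_Asymp.Real_Asymp"
begin

text \<open>
  The Riemann zeta function is the analytic continuation of the Dirichlet series to the plane
  punctured at \<open>1\<close>. Its value at the pole is normalised to \<open>0\<close>, which makes it a total function
  and the description unique.
\<close>

definition zeta :: "complex \<Rightarrow> complex" where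
  "zeta = (THE f. f holomorphic_on - {1} \<and>
                  (\<forall>s. Re s > 1 \<longrightarrow> (\<lambda>n. of_nat (Suc n) powr (- s)) sums f s) \<and>
                  f 1 = 0)"

definition nontrivial_zeros :: "complex set" where
  "nontrivial_zeros = {s. s \<noteq> 1 \<and> zeta s = 0 \<and> (\<forall>n::nat. n \<ge> 1 \<longrightarrow> s \<noteq> - (2 * of_nat n))}"

text \<open>The branch of \<open>log \<zeta>\<close> on \<open>Re s = 2\<close> (indeed on \<open>Re s > 1\<close>).\<close>

definition log_zeta :: "complex \<Rightarrow> complex" where
  "log_zeta s = (\<Sum>\<^sub>\<infinity>n\<in>{2..}. mangoldt n / (of_nat n powr s * of_real (ln (real n))))"

text \<open>
  The branch of \<open>log (- \<zeta>)\<close> on \<open>Re s = -1\<close>: the value at \<open>s\<close> of a holomorphic logarithm of \<open>-\<zeta>\<close> on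
  some domain \<open>U\<close> that contains the interval \<open>(-2, 1)\<close> and the line, normalised to be the real
  logarithm on the interval. The value does not depend on \<open>U\<close>: two such logarithms are continuous
  on the line \<open>Re s = -1\<close> and agree at its point \<open>-1\<close>. Off this line the constant has no meaning.
\<close>

definition log_neg_zeta :: "complex \<Rightarrow> complex" where
  "log_neg_zeta s = (THE w. \<exists>U L. open U \<and> connected U \<and>
      complex_of_real ` {-2<..<1} \<subseteq> U \<and> {z. Re z = -1} \<subseteq> U \<and>
      L holomorphic_on U \<and> (\<forall>z\<in>U. exp (L z) = - zeta z) \<and>
      (\<forall>\<sigma>\<in>{-2<..<1::real}. L (of_real \<sigma>) = of_real (ln (Re (- zeta (of_real \<sigma>))))) \<and>
      w = L s)"

text \<open>The integral of \<open>f\<close> along the upward vertical line \<open>Re s = c\<close>, where \<open>ds = \<i> dt\<close>.\<close>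

definition vline_integrable :: "real \<Rightarrow> (complex \<Rightarrow> complex) \<Rightarrow> bool" where
  "vline_integrable c f \<longleftrightarrow> integrable lborel (\<lambda>t. f (Complex c t))"

definition vline_integral :: "real \<Rightarrow> (complex \<Rightarrow> complex) \<Rightarrow> complex" where
  "vline_integral c f = \<i> * (\<integral>t. f (Complex c t) \<partial>lborel)"

text \<open>For \<open>x > 0\<close>, \<open>of_real x powr s = exp (s * of_real (ln x))\<close>.\<close>

definition phi_hat :: "real \<Rightarrow> real \<Rightarrow> complex \<Rightarrow> complex" where
  "phi_hat x lam s = of_real x powr s / s * exp ((of_real lam)\<^sup>2 * s\<^sup>2 / 2)"

definition is_Phi_hat :: "real \<Rightarrow> real \<Rightarrow> (complex \<Rightarrow> complex) \<Rightarrow> bool" where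
  "is_Phi_hat x lam \<Phi> \<longleftrightarrow>
     \<Phi> holomorphic_on - \<real>\<^sub>\<le>\<^sub>0 \<and>
     (\<forall>s\<in>- \<real>\<^sub>\<le>\<^sub>0. deriv \<Phi> s = phi_hat x lam s) \<and>
     (\<forall>\<sigma>::real. ((\<lambda>t. \<Phi> (Complex \<sigma> t) + \<Phi> (Complex \<sigma> (- t))) \<longlongrightarrow> 0) at_top)"

text \<open>
  Such a function exists, and any two of them agree on the slit plane; their values on the slit are
  irrelevant.
\<close>

lemma slit_plane_eq: "- \<real>\<^sub>\<le>\<^sub>0 = - (complex_of_real ` {..0})"
  by (auto simp: nonpos_Reals_def)

lemma open_slit: "open (- \<real>\<^sub>\<le>\<^sub>0 :: complex set)"
  by (simp add: open_Compl)

lemma starlike_slit: "starlike (- \<real>\<^sub>\<le>\<^sub>0 :: complex set)"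
  by (simp add: slit_plane_eq starlike_slotted_complex_plane_left)

lemma connected_slit: "connected (- \<real>\<^sub>\<le>\<^sub>0 :: complex set)"
  by (rule starlike_imp_connected[OF starlike_slit])

lemma is_Phi_hat_unique:
  assumes "is_Phi_hat x lam \<Phi>" "is_Phi_hat x lam \<Psi>" "s \<notin> \<real>\<^sub>\<le>\<^sub>0"
  shows "\<Phi> s = \<Psi> s"
proof -
  define D where "D = (\<lambda>z. \<Phi> z - \<Psi> z)"
  have hol: "\<Phi> holomorphic_on - \<real>\<^sub>\<le>\<^sub>0" "\<Psi> holomorphic_on - \<real>\<^sub>\<le>\<^sub>0"
    using assms by (auto simp: is_Phi_hat_def)
  have der: "(D has_field_derivative 0) (at z)" if "z \<in> - \<real>\<^sub>\<le>\<^sub>0" for z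
  proof -
    have "(\<Phi> has_field_derivative phi_hat x lam z) (at z)"
         "(\<Psi> has_field_derivative phi_hat x lam z) (at z)"
      using holomorphic_derivI[OF hol(1) open_slit that] holomorphic_derivI[OF hol(2) open_slit that]
        assms that by (auto simp: is_Phi_hat_def)
    thus ?thesis unfolding D_def by (auto intro!: derivative_eq_intros)
  qed
  obtain c where c: "\<And>z. z \<in> - \<real>\<^sub>\<le>\<^sub>0 \<Longrightarrow> D z = c"
    using DERIV_zero_connected_constant[OF connected_slit open_slit finite.emptyI, of D]
      der by (metis Diff_empty DERIV_isCont continuous_at_imp_continuous_on)
  have "((\<lambda>t. (\<Phi> (Complex 0 t) + \<Phi> (Complex 0 (- t))) - (\<Psi> (Complex 0 t) + \<Psi> (Complex 0 (- t))))
           \<longlongrightarrow> 0 - 0) at_top"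
    using assms unfolding is_Phi_hat_def by (intro tendsto_diff) blast+
  moreover have "eventually (\<lambda>t. (\<Phi> (Complex 0 t) + \<Phi> (Complex 0 (- t)))
      - (\<Psi> (Complex 0 t) + \<Psi> (Complex 0 (- t))) = 2 * c) at_top"
    using eventually_gt_at_top[of "0::real"]
  proof eventually_elim
    case (elim t)
    have "D (Complex 0 t) = c" "D (Complex 0 (- t)) = c"
      using elim by (auto intro!: c simp: complex_nonpos_Reals_iff)
    hence "D (Complex 0 t) + D (Complex 0 (- t)) = c + c" by simp
    thus ?case by (simp only: D_def) (simp add: algebra_simps)
  qed
  ultimately have "((\<lambda>t::real. 2 * c) \<longlongrightarrow> 0) at_top"
    by (auto elim: Lim_transform_eventually)
  hence "2 * c = 0" by (simp add: tendsto_const_iff)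
  with c[of s] assms(3) show ?thesis by (simp add: D_def)
qed

lemma phi_hat_bound:
  assumes "x > 0" "lam > 0"
  obtains K where "K \<ge> 0"
    "\<And>\<sigma> t. \<bar>\<sigma>\<bar> \<le> S \<Longrightarrow> \<bar>t\<bar> \<ge> 1 \<Longrightarrow> norm (phi_hat x lam (Complex \<sigma> t)) \<le> K / t\<^sup>2"
proof
  define K where "K = exp (S * \<bar>ln x\<bar> + lam\<^sup>2 * S\<^sup>2 / 2) * (2 / lam\<^sup>2)"
  show "K \<ge> 0" by (simp add: K_def)
  fix \<sigma> t :: real assume s: "\<bar>\<sigma>\<bar> \<le> S" and t: "\<bar>t\<bar> \<ge> 1"
  let ?s = "Complex \<sigma> t"
  have n1: "norm (of_real x powr ?s) = exp (\<sigma> * ln x)"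
    using assms by (simp add: norm_powr_real_powr powr_def)
  have "Re ((of_real lam)\<^sup>2 * ?s\<^sup>2 / 2) = lam\<^sup>2 * (\<sigma>\<^sup>2 - t\<^sup>2) / 2"
    by (simp add: power2_eq_square algebra_simps)
  hence n2: "norm (exp ((of_real lam)\<^sup>2 * ?s\<^sup>2 / 2)) = exp (lam\<^sup>2 * (\<sigma>\<^sup>2 - t\<^sup>2) / 2)"
    by (simp only: norm_exp_eq_Re)
  have n3: "norm ?s \<ge> 1" using t abs_Im_le_cmod[of ?s] by simp
  have "norm (phi_hat x lam ?s) = exp (\<sigma> * ln x) * exp (lam\<^sup>2 * (\<sigma>\<^sup>2 - t\<^sup>2) / 2) / norm ?s"
    by (simp only: phi_hat_def norm_mult norm_divide n1 n2) simp
  also have "\<dots> \<le> exp (\<sigma> * ln x) * exp (lam\<^sup>2 * (\<sigma>\<^sup>2 - t\<^sup>2) / 2) / 1"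
    using n3 by (intro divide_left_mono) auto
  also have "\<dots> = exp (\<sigma> * ln x + lam\<^sup>2 * \<sigma>\<^sup>2 / 2) * exp (- (lam\<^sup>2 * t\<^sup>2 / 2))"
    by (simp add: exp_add [symmetric] algebra_simps diff_divide_distrib)
  also have "\<dots> \<le> exp (S * \<bar>ln x\<bar> + lam\<^sup>2 * S\<^sup>2 / 2) * (1 / (lam\<^sup>2 * t\<^sup>2 / 2))"
  proof (intro mult_mono)
    have "\<sigma> * ln x \<le> \<bar>\<sigma>\<bar> * \<bar>ln x\<bar>" by (metis abs_ge_self abs_mult)
    also have "\<dots> \<le> S * \<bar>ln x\<bar>" using s by (intro mult_right_mono) auto
    finally have 1: "\<sigma> * ln x \<le> S * \<bar>ln x\<bar>" .
    have "\<sigma>\<^sup>2 \<le> S\<^sup>2" using s by (metis abs_ge_zero power2_abs power_mono)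
    hence "lam\<^sup>2 * \<sigma>\<^sup>2 \<le> lam\<^sup>2 * S\<^sup>2" by (intro mult_left_mono) auto
    with 1 show "exp (\<sigma> * ln x + lam\<^sup>2 * \<sigma>\<^sup>2 / 2) \<le> exp (S * \<bar>ln x\<bar> + lam\<^sup>2 * S\<^sup>2 / 2)" by simp
    have pos: "lam\<^sup>2 * t\<^sup>2 / 2 > 0" using assms t by auto
    have "lam\<^sup>2 * t\<^sup>2 / 2 \<le> exp (lam\<^sup>2 * t\<^sup>2 / 2)"
      using exp_ge_add_one_self[of "lam\<^sup>2 * t\<^sup>2 / 2"] by linarith
    thus "exp (- (lam\<^sup>2 * t\<^sup>2 / 2)) \<le> 1 / (lam\<^sup>2 * t\<^sup>2 / 2)"
      using pos by (simp only: exp_minus inverse_eq_divide) (intro divide_left_mono, auto)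
  qed auto
  also have "\<dots> = K / t\<^sup>2" by (simp add: K_def)
  finally show "norm (phi_hat x lam ?s) \<le> K / t\<^sup>2" .
qed

lemma tendsto_at_top_of_quadratic_decay:
  fixes g :: "real \<Rightarrow> complex"
  assumes "K \<ge> 0"
    and g: "\<And>s t. 1 \<le> s \<Longrightarrow> s \<le> t \<Longrightarrow> norm (g t - g s) \<le> K / s\<^sup>2 * (t - s)"
  obtains l where "(g \<longlongrightarrow> l) at_top"
proof -
  define a where "a = (\<lambda>n. g (real (Suc n)))"
  have "norm (a (Suc n) - a n) \<le> K * (1 / real (Suc n) ^ 2)" for n
    using g[of "real (Suc n)" "real (Suc (Suc n))"] by (simp add: a_def)
  moreover have "summable (\<lambda>n. K * (1 / real (Suc n) ^ 2))"
    by (intro summable_mult) (use inverse_squares_sums in \<open>simp add: sums_iff\<close>)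
  ultimately have "summable (\<lambda>n. a (Suc n) - a n)"
    by (intro summable_comparison_test[of "\<lambda>n. a (Suc n) - a n"]) auto
  hence "convergent a" by (simp add: telescope_summable' summable_iff_convergent
      sum_lessThan_telescope convergent_diff_const_right_iff)
  then obtain l where l: "a \<longlonglongrightarrow> l" by (auto simp: convergent_def)
  have fl: "filterlim (\<lambda>t::real. nat \<lfloor>t\<rfloor> - 1) sequentially at_top"
    by (rule filterlim_compose[OF filterlim_minus_const_nat_at_top
        filterlim_compose[OF filterlim_nat_sequentially filterlim_floor_sequentially]])
  have 1: "((\<lambda>t::real. a (nat \<lfloor>t\<rfloor> - 1)) \<longlongrightarrow> l) at_top"
    by (rule filterlim_compose[OF l fl])
  have "((\<lambda>t. g t - a (nat \<lfloor>t\<rfloor> - 1)) \<longlongrightarrow> 0) at_top"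
  proof (rule Lim_null_comparison)
    show "eventually (\<lambda>t. norm (g t - a (nat \<lfloor>t\<rfloor> - 1)) \<le> K / (t - 1)\<^sup>2) at_top"
      using eventually_gt_at_top[of "1::real"]
    proof eventually_elim
      case (elim t)
      define s where "s = real_of_int \<lfloor>t\<rfloor>"
      have s: "1 \<le> s" "s \<le> t" "t - s \<le> 1" "t - 1 \<le> s"
        using elim unfolding s_def by (simp_all add: le_floor_iff) linarith+
      have as: "a (nat \<lfloor>t\<rfloor> - 1) = g s"
      proof -
        have "\<lfloor>t\<rfloor> \<ge> 1" using elim by linarith
        hence "real (Suc (nat \<lfloor>t\<rfloor> - 1)) = s" unfolding s_def by simp
        thus ?thesis by (simp only: a_def)
      qed
      have "norm (g t - g s) \<le> K / s\<^sup>2 * (t - s)" by (rule g) (use s in auto)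
      also have "\<dots> \<le> K / s\<^sup>2 * 1" using s assms(1) by (intro mult_left_mono) auto
      also have "\<dots> \<le> K / (t - 1)\<^sup>2" using s elim assms(1)
        by (simp, intro divide_left_mono power_mono) auto
      finally show ?case by (simp only: as)
    qed
    show "((\<lambda>t. K / (t - 1)\<^sup>2) \<longlongrightarrow> 0) at_top"
      by real_asymp
  qed
  from tendsto_add[OF this 1] show ?thesis using that by simp
qed

lemma is_Phi_hat_exists:
  assumes "x > 0" "lam > 0"
  shows "\<exists>\<Phi>. is_Phi_hat x lam \<Phi>"
proof -
  let ?f = "phi_hat x lam"
  have hol: "?f holomorphic_on - \<real>\<^sub>\<le>\<^sub>0"
    unfolding phi_hat_def using assms by (intro holomorphic_intros) auto
  have "\<exists>F. \<forall>z\<in>- \<real>\<^sub>\<le>\<^sub>0. (F has_field_derivative ?f z) (at z)"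
    by (rule holomorphic_starlike_primitive[OF holomorphic_on_imp_continuous_on[OF hol]
          starlike_slit open_slit finite.emptyI])
       (use hol open_slit in \<open>auto simp: holomorphic_on_open field_differentiable_def\<close>)
  then obtain F where F: "\<And>z. z \<in> - \<real>\<^sub>\<le>\<^sub>0 \<Longrightarrow> (F has_field_derivative ?f z) (at z)" by blast
  have slit: "Complex \<sigma> t \<in> - \<real>\<^sub>\<le>\<^sub>0" if "\<bar>t\<bar> \<ge> 1" for \<sigma> t
    using that by (auto simp: complex_nonpos_Reals_iff)
  obtain K where K: "K \<ge> 0"
    "\<And>\<sigma> t. \<bar>\<sigma>\<bar> \<le> 0 \<Longrightarrow> \<bar>t\<bar> \<ge> 1 \<Longrightarrow> norm (?f (Complex \<sigma> t)) \<le> K / t\<^sup>2"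
    using phi_hat_bound[OF assms, where S = 0] by blast
  have ex: "\<exists>l. ((\<lambda>t. F (Complex 0 (e * t))) \<longlongrightarrow> l) at_top" if e: "\<bar>e\<bar> = 1" for e
  proof -
    have "norm (F (Complex 0 (e * t)) - F (Complex 0 (e * s))) \<le> K / s\<^sup>2 * (t - s)"
      if st: "1 \<le> s" "s \<le> t" for s t
    proof -
      let ?S = "closed_segment (Complex 0 (e * s)) (Complex 0 (e * t))"
      have *: "\<exists>u\<ge>s. z = Complex 0 (e * u)" if z: "z \<in> ?S" for z
      proof -
        obtain v where v: "0 \<le> v" "v \<le> 1"
          "z = (1 - v) *\<^sub>R Complex 0 (e * s) + v *\<^sub>R Complex 0 (e * t)"
          using z unfolding in_segment by blast
        have "0 \<le> v * (t - s)" using v st by simp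
        thus ?thesis using v
          by (intro exI[of _ "s + v * (t - s)"]) (auto simp: complex_eq_iff algebra_simps)
      qed
      have **: "\<bar>e * u\<bar> = \<bar>u\<bar>" for u using e by (simp add: abs_mult)
      have "norm (F (Complex 0 (e * t)) - F (Complex 0 (e * s)))
              \<le> K / s\<^sup>2 * norm (Complex 0 (e * t) - Complex 0 (e * s))"
      proof (rule field_differentiable_bound[where S = ?S and f' = ?f])
        fix z assume "z \<in> ?S"
        then obtain u where u: "u \<ge> s" "z = Complex 0 (e * u)" using * by blast
        have u1: "\<bar>e * u\<bar> \<ge> 1" using u st by (simp add: **)
        show "(F has_field_derivative ?f z) (at z within ?S)"
          using F[OF slit[OF u1]] u(2) by (simp add: has_field_derivative_at_within)
        have "norm (?f z) \<le> K / (e * u)\<^sup>2" using K(2)[of 0, OF _ u1] u(2) by simp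
        also have "(e * u)\<^sup>2 = u\<^sup>2" by (metis ** power2_abs)
        also have "K / u\<^sup>2 \<le> K / s\<^sup>2" using u st K(1)
          by (intro divide_left_mono power_mono) auto
        finally show "norm (?f z) \<le> K / s\<^sup>2" .
      qed auto
      also have "norm (Complex 0 (e * t) - Complex 0 (e * s)) = t - s"
      proof -
        have "Complex 0 (e * t) - Complex 0 (e * s) = Complex 0 (e * (t - s))"
          by (simp add: complex_eq_iff algebra_simps)
        thus ?thesis using st by (simp add: cmod_def **)
      qed
      finally show ?thesis .
    qed
    from tendsto_at_top_of_quadratic_decay[OF K(1) this] show ?thesis by blast
  qed
  obtain l1 l2 where l: "((\<lambda>t. F (Complex 0 t)) \<longlongrightarrow> l1) at_top"
      "((\<lambda>t. F (Complex 0 (- t))) \<longlongrightarrow> l2) at_top"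
    using ex[of 1] ex[of "-1"] by auto
  have shift: "((\<lambda>t. F (Complex \<sigma> (e * t)) - F (Complex 0 (e * t))) \<longlongrightarrow> 0) at_top"
    if e: "\<bar>e\<bar> = 1" for \<sigma> e
  proof -
    obtain K where K: "K \<ge> 0"
      "\<And>\<tau> t. \<bar>\<tau>\<bar> \<le> \<bar>\<sigma>\<bar> \<Longrightarrow> \<bar>t\<bar> \<ge> 1 \<Longrightarrow> norm (?f (Complex \<tau> t)) \<le> K / t\<^sup>2"
      using phi_hat_bound[OF assms, where S = "\<bar>\<sigma>\<bar>"] by blast
    show ?thesis
    proof (rule Lim_null_comparison)
      show "eventually (\<lambda>t. norm (F (Complex \<sigma> (e * t)) - F (Complex 0 (e * t)))
                \<le> K * \<bar>\<sigma>\<bar> / t\<^sup>2) at_top"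
        using eventually_ge_at_top[of "1::real"]
      proof eventually_elim
        case (elim t)
        let ?S = "closed_segment (Complex 0 (e * t)) (Complex \<sigma> (e * t))"
        have et: "\<bar>e * t\<bar> = t" using e elim by (simp add: abs_mult)
        have "norm (F (Complex \<sigma> (e * t)) - F (Complex 0 (e * t)))
                \<le> K / t\<^sup>2 * norm (Complex \<sigma> (e * t) - Complex 0 (e * t))"
        proof (rule field_differentiable_bound[where S = ?S and f' = ?f])
          fix z assume "z \<in> ?S"
          then obtain v where v: "0 \<le> v" "v \<le> 1"
            "z = (1 - v) *\<^sub>R Complex 0 (e * t) + v *\<^sub>R Complex \<sigma> (e * t)"
            unfolding in_segment by blast
          have z: "z = Complex (v * \<sigma>) (e * t)"
            using v(3) by (simp add: complex_eq_iff algebra_simps)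
          have vs: "\<bar>v * \<sigma>\<bar> \<le> \<bar>\<sigma>\<bar>" using v by (simp add: abs_mult mult_left_le_one_le)
          have t1: "\<bar>e * t\<bar> \<ge> 1" using et elim by simp
          show "(F has_field_derivative ?f z) (at z within ?S)"
            using F[OF slit[OF t1]] z by (simp add: has_field_derivative_at_within)
          have "norm (?f z) \<le> K / (e * t)\<^sup>2" using K(2)[OF vs t1] z by simp
          also have "(e * t)\<^sup>2 = t\<^sup>2" by (metis et power2_abs)
          finally show "norm (?f z) \<le> K / t\<^sup>2" .
        qed auto
        also have "norm (Complex \<sigma> (e * t) - Complex 0 (e * t)) = \<bar>\<sigma>\<bar>"
          by (simp add: cmod_def)
        finally show ?case by simp
      qed
      show "((\<lambda>t. K * \<bar>\<sigma>\<bar> / t\<^sup>2) \<longlongrightarrow> 0) at_top"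
        by real_asymp
    qed
  qed
  define \<Phi> where "\<Phi> = (\<lambda>z. F z - (l1 + l2) / 2)"
  have der: "(\<Phi> has_field_derivative ?f z) (at z)" if "z \<in> - \<real>\<^sub>\<le>\<^sub>0" for z
    unfolding \<Phi>_def using F[OF that] by (auto intro!: derivative_eq_intros)
  have lim: "((\<lambda>t. \<Phi> (Complex \<sigma> t) + \<Phi> (Complex \<sigma> (- t))) \<longlongrightarrow> 0) at_top" for \<sigma>
  proof -
    have "((\<lambda>t. (F (Complex \<sigma> (1 * t)) - F (Complex 0 (1 * t)))
             + (F (Complex \<sigma> (- 1 * t)) - F (Complex 0 (- 1 * t)))
             + F (Complex 0 t) + F (Complex 0 (- t)) - (l1 + l2))
           \<longlongrightarrow> 0 + 0 + l1 + l2 - (l1 + l2)) at_top"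
      by (intro tendsto_add tendsto_diff tendsto_const shift l) auto
    hence "((\<lambda>t. F (Complex \<sigma> t) + F (Complex \<sigma> (- t)) - (l1 + l2)) \<longlongrightarrow> 0) at_top"
      by (simp add: algebra_simps)
    moreover have "\<Phi> a + \<Phi> b = F a + F b - (l1 + l2)" for a b
      by (simp add: \<Phi>_def field_simps)
    ultimately show ?thesis by simp
  qed
  have "is_Phi_hat x lam \<Phi>"
    unfolding is_Phi_hat_def
    using der lim open_slit by (auto simp: holomorphic_on_open intro!: DERIV_imp_deriv)
  thus ?thesis by blast
qed

end

theory Submission
  imports Defs
begin

text \<open>
  No contour is drawn between zeros. Put \<open>xi s = (s - 1) * zeta s\<close>, an entire function with
  \<open>log \<bar>xi s\<bar> = O((1 + \<bar>s\<bar>)^2)\<close>, and in the disc of radius \<open>R = 4 * T\<close> factor it as the finite product of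
  \<open>(1 - s / \<rho>)^m\<close> times \<open>exp g\<close>; the number of zeros and, by Borel-Caratheodory, \<open>g\<close> are of polynomial
  size in \<open>R\<close>. On both lines, up to height \<open>T\<close>, the logarithms of \<open>xi\<close> obtained by adding
  \<open>Ln (s - 1)\<close> to \<open>log \<zeta>\<close> and \<open>Ln (1 - s)\<close> to \<open>log (- \<zeta>)\<close> are then the finite sums of
  \<open>m * (Ln (\<plusminus> (s - \<rho>)) - ln \<bar>\<rho>\<bar>)\<close> over the nontrivial zeros plus one and the same function \<open>H\<close>,
  which is holomorphic between the lines.

  Shifting the line of integration for \<open>H\<close> picks up the residue \<open>H 0 = - ln 2\<close> of \<open>\<phi>\<close> at \<open>0\<close>. For a single
  zero, the difference of the integrals of \<open>\<phi> s * Ln (s - \<rho>)\<close> over \<open>Re s = 2\<close> and of \<open>\<phi> s * Ln (\<rho> - s)\<close>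
  over \<open>Re s = -1\<close> is \<open>2 * pi * \<i> * (Ln \<rho> - \<Phi> \<rho>)\<close>: differentiate in \<open>\<rho>\<close>, and let \<open>\<rho>\<close> tend to \<open>i \<infinity>\<close> to find
  the constant. The pole of \<open>\<zeta>\<close> contributes in the same way with \<open>\<rho> = 1\<close>. All errors are bounded by a
  power of \<open>T\<close> times \<open>exp (- T / 4)\<close>, because \<open>\<phi>\<close> has Gaussian decay.
\<close>

section \<open>The trapezoidal rule for the Dirichlet series\<close>

text \<open>The usual route carries log zeta across the strip along horizontal lines between zeros
  and needs local estimates near each of them. Here every zero is carried across by itself, and only
  a crude count of zeros remains. What makes the branches manageable is that all nontrivial zeros
  satisfy \<open>0 \<le> Re \<rho> \<le> 1\<close>: then \<open>s - \<rho>\<close> on the right line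
  and \<open>\<rho> - s\<close> on the left line have real part at least 1, so principal logarithms
  are continuous along the whole line, and two continuous logarithms need only be compared at the
  real point of that line. The normalising terms \<open>ln \<bar>\<rho>\<bar>\<close> reappear
  through \<open>Ln \<rho>\<close> in the contribution of a zero and cancel, because conjugate pairs
  leave only real parts; this is also how \<open>Re (\<Phi> \<rho>)\<close> arises. The prescribed
  behaviour of \<open>\<Phi>\<close> at infinity enters as decay of \<open>Re \<Phi>\<close>
  upwards, which fixes the constant of integration and makes the sum over zeros converge absolutely.
  The functional equation supplies the growth and the zeros in the left half-plane and the sign of
  zeta on \<open>(-2, 0)\<close>.\<close>

lemma norm_of_real_powr: "x > 0 \<Longrightarrow> norm (of_real x powr s :: complex) = x powr Re s"
  by (simp add: norm_powr_real_powr)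

text \<open>The error of the trapezoidal rule for \<open>w powr (- s)\<close> on
  \<open>[a, a + 1]\<close>, written with its Peano kernel \<open>u * (1 - u) / 2\<close>. This form
  is entire in \<open>s\<close>, also at 1, and gains two powers of \<open>a\<close>, so that the
  sum over \<open>a\<close> converges for \<open>Re s > -1\<close>.\<close>

definition trap_err :: "real \<Rightarrow> complex \<Rightarrow> complex" where
  "trap_err a s = s * (s + 1) / 2 *
     integral {0..1} (\<lambda>u. of_real (u * (1 - u)) * of_real (a + u) powr (- s - 2))"

lemma trap_err_has_integral:
  fixes s :: complex
  assumes "a > 0" "s \<noteq> 1"
  shows "((\<lambda>u. s * (s + 1) / 2 * (of_real (u * (1 - u)) * of_real (a + u) powr (- s - 2)))
     has_integral (of_real a powr (- s) + of_real (a + 1) powr (- s)) / 2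
        - (of_real (a + 1) powr (1 - s) - of_real a powr (1 - s)) / (1 - s)) {0..1}"
proof -
  \<comment> \<open>Two integrations by parts: with \<open>f = w powr (- s)\<close>, the function
    \<open>(u * (1 - u) * f' - (1 - 2 * u) * f) / 2\<close> minus a primitive of \<open>f\<close>
    has derivative \<open>u * (1 - u) * f'' / 2\<close>.\<close>
  define H :: "complex \<Rightarrow> complex" where
    "H = (\<lambda>u. (u * (1 - u) * (- s * (of_real a + u) powr (- s - 1))
                 - (1 - 2 * u) * (of_real a + u) powr (- s)) / 2
             - (of_real a + u) powr (1 - s) / (1 - s))"
  have H': "(H has_field_derivative
      s * (s + 1) / 2 * (u * (1 - u) * (of_real a + u) powr (- s - 2))) (at u)"
    if "of_real a + u \<notin> \<real>\<^sub>\<le>\<^sub>0" for u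
  proof -
    have nz: "of_real a + u \<noteq> 0" using that by auto
    have e1: "(of_real a + u) powr (- s) = (of_real a + u) powr (- s - 2) * (of_real a + u)\<^sup>2"
      using powr_add[of "of_real a + u" "-s-2" 2] nz by (simp add: powr_numeral)
    have e2: "(of_real a + u) powr (- s - 1) = (of_real a + u) powr (- s - 2) * (of_real a + u)"
    proof -
      have *: "- s - 1 = (- s - 2) + 1" by simp
      show ?thesis by (subst *, subst powr_add) (use nz in simp)
    qed
    have e3: "(of_real a + u) powr (1 - s - 1) = (of_real a + u) powr (- s)" by simp
    have "(H has_field_derivative
        (((1 - 2 * u) * (- s * (of_real a + u) powr (- s - 1))
          + u * (1 - u) * (- s * ((- s - 1) * (of_real a + u) powr (- s - 2)))
          + 2 * (of_real a + u) powr (- s)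
          - (1 - 2 * u) * (- s * (of_real a + u) powr (- s - 1))) / 2
         - (of_real a + u) powr (- s))) (at u)"
    proof -
      have d: "((\<lambda>u. (of_real a + u) powr w) has_field_derivative w * (of_real a + u) powr (w - 1)) (at u)" for w
        using that by (auto intro!: derivative_eq_intros)
      have d1: "((\<lambda>u. (of_real a + u) powr (1 - s) / (1 - s)) has_field_derivative (of_real a + u) powr (- s)) (at u)"
        using DERIV_cdivide[OF d[of "1 - s"], of "1 - s"] assms(2) by simp
      have d2: "((\<lambda>u. (of_real a + u) powr (- s - 1)) has_field_derivative (- s - 1) * (of_real a + u) powr (- s - 2)) (at u)"
      proof -
        have *: "- s - 1 - 1 = - s - 2" by simp
        show ?thesis using d[of "- s - 1"] by (simp only: *)
      qed
      have p1: "((\<lambda>u. u * (1 - u)) has_field_derivative 1 - 2 * u) (at u)"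
        by (auto intro!: derivative_eq_intros)
      have p2: "((\<lambda>u. 1 - 2 * u) has_field_derivative - 2) (at u)"
        by (auto intro!: derivative_eq_intros)
      show ?thesis unfolding H_def
        by (rule DERIV_cong[OF DERIV_diff[OF DERIV_cdivide[OF DERIV_diff[OF
              DERIV_mult[OF p1 DERIV_cmult[OF d2]] DERIV_mult[OF p2 d[of "- s"]]]] d1]])
           (simp add: algebra_simps)
    qed
    also have "(((1 - 2 * u) * (- s * (of_real a + u) powr (- s - 1))
          + u * (1 - u) * (- s * ((- s - 1) * (of_real a + u) powr (- s - 2)))
          + 2 * (of_real a + u) powr (- s)
          - (1 - 2 * u) * (- s * (of_real a + u) powr (- s - 1))) / 2
         - (of_real a + u) powr (- s)) =
        s * (s + 1) / 2 * (u * (1 - u) * (of_real a + u) powr (- s - 2))"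
      by (simp add: field_simps)
    finally show ?thesis .
  qed
  have "((\<lambda>u. s * (s + 1) / 2 * (of_real u * (1 - of_real u) * (of_real a + of_real u) powr (- s - 2)))
     has_integral H (of_real 1) - H (of_real 0)) {0..1}"
  proof (rule fundamental_theorem_of_calculus)
    fix u :: real assume "u \<in> {0..1}"
    hence "of_real a + of_real u \<notin> (\<real>\<^sub>\<le>\<^sub>0 :: complex set)"
      using assms by (auto simp: complex_nonpos_Reals_iff)
    from has_vector_derivative_real_field[OF H'[OF this]]
    show "((\<lambda>u. H (of_real u)) has_vector_derivative s * (s + 1) / 2 *
        (of_real u * (1 - of_real u) * (of_real a + of_real u) powr (- s - 2))) (at u within {0..1})"
      by (simp add: has_vector_derivative_at_within)
  qed auto
  also have "H (of_real 1) - H (of_real 0) = (of_real a powr (- s) + of_real (a + 1) powr (- s)) / 2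
        - (of_real (a + 1) powr (1 - s) - of_real a powr (1 - s)) / (1 - s)"
    by (simp add: H_def diff_divide_distrib add_divide_distrib algebra_simps)
  finally show ?thesis by (simp add: of_real_diff)
qed

lemma continuous_on_trap_integrand:
  assumes "a > 0"
  shows "continuous_on (UNIV \<times> {0..1}) (\<lambda>(s, u). complex_of_real (u * (1 - u)) * of_real (a + u) powr (- s - 2))"
proof -
  have "continuous_on (UNIV \<times> {0..1}) (\<lambda>x::complex \<times> real. complex_of_real (snd x * (1 - snd x)) *
      exp ((- fst x - 2) * of_real (ln (a + snd x))))"
    by (intro continuous_intros) (use assms in \<open>auto simp: add_pos_nonneg\<close>)
  also have "?this \<longleftrightarrow> ?thesis"
    using assms by (intro continuous_on_cong)
      (auto simp: powr_def Ln_of_real add_pos_nonneg simp del: of_real_add of_real_mult of_real_diff)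
  finally show ?thesis .
qed

lemma trap_integrand_integrable:
  assumes "a > 0"
  shows "(\<lambda>u. complex_of_real (u * (1 - u)) * of_real (a + u) powr (- s - 2)) integrable_on {0..1}"
proof (rule integrable_continuous_real)
  have "continuous_on {0..1} ((\<lambda>(s, u). complex_of_real (u * (1 - u)) * of_real (a + u) powr (- s - 2)) \<circ> Pair s)"
    by (intro continuous_on_compose continuous_intros
          continuous_on_subset[OF continuous_on_trap_integrand[OF assms]]) auto
  thus "continuous_on {0..1} (\<lambda>u. complex_of_real (u * (1 - u)) * of_real (a + u) powr (- s - 2))"
    by (simp add: o_def)
qed

lemma trap_err_eq:
  assumes "a > 0" "s \<noteq> 1"
  shows "trap_err a s = (of_real a powr (- s) + of_real (a + 1) powr (- s)) / 2
        - (of_real (a + 1) powr (1 - s) - of_real a powr (1 - s)) / (1 - s)"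
  using integral_unique[OF trap_err_has_integral[OF assms]] unfolding trap_err_def
  by (simp add: integral_mult_right)

lemma trap_err_holomorphic: "a > 0 \<Longrightarrow> trap_err a holomorphic_on UNIV"
proof -
  assume a: "a > 0"
  have "(\<lambda>s. integral (cbox 0 1) (\<lambda>u. complex_of_real (u * (1 - u)) * of_real (a + u) powr (- s - 2)))
           holomorphic_on UNIV"
  proof (rule leibniz_rule_holomorphic)
    fix s :: complex and u :: real assume u: "u \<in> cbox 0 1"
    show "((\<lambda>s. complex_of_real (u * (1 - u)) * of_real (a + u) powr (- s - 2)) has_field_derivative
       - (complex_of_real (u * (1 - u)) * (of_real (ln (a + u)) * of_real (a + u) powr (- s - 2)))) (at s within UNIV)"
    proof -
      have w: "a + u > 0" using u a by auto
      have "((\<lambda>s. complex_of_real (u * (1 - u)) * exp ((- s - 2) * of_real (ln (a + u)))) has_field_derivative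
       - (complex_of_real (u * (1 - u)) * (of_real (ln (a + u)) * exp ((- s - 2) * of_real (ln (a + u)))))) (at s within UNIV)"
        by (auto intro!: derivative_eq_intros)
      thus ?thesis using w by (simp add: powr_def Ln_of_real del: of_real_add of_real_diff of_real_mult)
    qed
  next
    fix s :: complex
    show "(\<lambda>u. complex_of_real (u * (1 - u)) * of_real (a + u) powr (- s - 2)) integrable_on cbox 0 1"
      using trap_integrand_integrable[OF a] by simp
  next
    have "continuous_on (UNIV \<times> {0..1}) (\<lambda>x::complex \<times> real. 
        (complex_of_real (ln (a + snd x)) * (case x of (s, u) \<Rightarrow> complex_of_real (u * (1 - u)) * of_real (a + u) powr (- s - 2))))"
      by (intro continuous_intros continuous_on_trap_integrand a) (use a in \<open>auto simp: add_pos_nonneg\<close>)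
    hence "continuous_on (UNIV \<times> {0..1}) (\<lambda>x::complex \<times> real. 
        - (complex_of_real (ln (a + snd x)) * (case x of (s, u) \<Rightarrow> complex_of_real (u * (1 - u)) * of_real (a + u) powr (- s - 2))))"
      by (rule continuous_on_minus)
    thus "continuous_on (UNIV \<times> cbox 0 1) (\<lambda>(s::complex, u). 
        - (complex_of_real (u * (1 - u)) * (of_real (ln (a + u)) * of_real (a + u) powr (- s - 2))))"
      by (simp add: case_prod_unfold mult_ac)
  qed auto
  thus ?thesis unfolding trap_err_def[abs_def] by (auto intro!: holomorphic_intros)
qed

text \<open>The kernel \<open>u * (1 - u)\<close> is at most \<open>1 / 4\<close>. The explicit
  factor matters in \<open>Re_zeta_neg_right\<close>, where the errors must add up to less than
  \<open>1 / 2\<close>.\<close>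

lemma norm_trap_err_le_eighth:
  assumes "a > 0" "Re s \<ge> -2"
  shows "norm (trap_err a s) \<le> norm s * norm (s + 1) / 8 * a powr (- Re s - 2)"
proof -
  have "norm (integral {0..1} (\<lambda>u. complex_of_real (u * (1 - u)) * of_real (a + u) powr (- s - 2)))
          \<le> integral {0..1} (\<lambda>u::real. 1 / 4 * a powr (- Re s - 2))"
  proof (rule integral_norm_bound_integral)
    fix u :: real assume u: "u \<in> {0..1}"
    have "norm (complex_of_real (u * (1 - u)) * of_real (a + u) powr (- s - 2)) =
        \<bar>u * (1 - u)\<bar> * (a + u) powr (- Re s - 2)"
      using u assms by (simp add: norm_mult norm_of_real_powr del: of_real_add of_real_mult of_real_diff)
    also have "\<dots> \<le> 1 / 4 * a powr (- Re s - 2)"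
    proof (intro mult_mono)
      show "(a + u) powr (- Re s - 2) \<le> a powr (- Re s - 2)"
        using u assms by (intro powr_mono2') auto
      have "(u - 1 / 2)\<^sup>2 \<ge> 0" by simp
      hence "u * (1 - u) \<le> 1 / 4" by (simp add: power2_eq_square field_simps)
      moreover have "u * (1 - u) \<ge> 0" using u by simp
      ultimately show "\<bar>u * (1 - u)\<bar> \<le> 1 / 4" by simp
    qed auto
    finally show "norm (complex_of_real (u * (1 - u)) * of_real (a + u) powr (- s - 2)) \<le> 1 / 4 * a powr (- Re s - 2)"
      by simp
  qed (use trap_integrand_integrable[OF assms(1)] in auto)
  hence "norm (integral {0..1} (\<lambda>u. complex_of_real (u * (1 - u)) * of_real (a + u) powr (- s - 2)))
           \<le> 1 / 4 * a powr (- Re s - 2)" by simp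
  hence "(norm s * norm (s + 1) / 2) * norm (integral {0..1} (\<lambda>u. complex_of_real (u * (1 - u)) * of_real (a + u) powr (- s - 2)))
       \<le> (norm s * norm (s + 1) / 2) * (1 / 4 * a powr (- Re s - 2))"
    by (rule mult_left_mono) simp
  also have "(norm s * norm (s + 1) / 2) * (1 / 4 * a powr (- Re s - 2)) = norm s * norm (s + 1) / 8 * a powr (- Re s - 2)"
    by simp
  finally show ?thesis unfolding trap_err_def norm_mult norm_divide norm_numeral .
qed

lemma norm_trap_err_le:
  assumes "a > 0" "Re s \<ge> -2"
  shows "norm (trap_err a s) \<le> norm s * norm (s + 1) * a powr (- Re s - 2)"
  by (rule order_trans[OF norm_trap_err_le_eighth[OF assms]]) (intro mult_right_mono, auto)

definition zeta_trap :: "complex \<Rightarrow> complex" where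
  "zeta_trap s = (\<Sum>n. trap_err (real (Suc n)) s)"

lemma summable_Suc_powr: "p < -1 \<Longrightarrow> summable (\<lambda>n. real (Suc n) powr p)"
  using summable_real_powr_iff[of p] by (subst summable_Suc_iff) simp

lemma summable_trap_err:
  assumes "Re s > -1"
  shows "summable (\<lambda>n. norm (trap_err (real (Suc n)) s))"
proof (rule summable_comparison_test)
  show "summable (\<lambda>n. norm s * norm (s + 1) * real (Suc n) powr (- Re s - 2))"
    using assms by (intro summable_mult summable_Suc_powr) auto
  show "\<exists>N. \<forall>n\<ge>N. norm (norm (trap_err (real (Suc n)) s)) \<le> norm s * norm (s + 1) * real (Suc n) powr (- Re s - 2)"
    using norm_trap_err_le[of "real (Suc n)" s for n] assms by auto
qed

lemma zeta_trap_holomorphic: "zeta_trap holomorphic_on {s. Re s > -1}"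
proof -
  have op: "open {s. Re s > -1}" by (simp add: open_halfspace_Re_gt)
  have "\<exists>g g'. \<forall>s\<in>{s. Re s > -1}. ((\<lambda>n. trap_err (real (Suc n)) s) sums g s) \<and>
      ((\<lambda>n. deriv (trap_err (real (Suc n))) s) sums g' s) \<and> (g has_field_derivative g' s) (at s)"
  proof (rule series_and_derivative_comparison_local[OF op])
    fix n s
    show "(trap_err (real (Suc n)) has_field_derivative deriv (trap_err (real (Suc n))) s) (at s)"
      by (rule holomorphic_derivI[OF trap_err_holomorphic]) auto
  next
    fix s assume s: "s \<in> {s. Re s > -1}"
    \<comment> \<open>Half the distance to the line \<open>Re s = -1\<close>, so that the exponent
      of the majorant stays below -1 on the whole ball.\<close>
    define d where "d = (Re s + 1) / 2"
    have d: "d > 0" using s by (simp add: d_def)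
    define h where "h = (\<lambda>n. (norm s + d) * (norm s + d + 1) * real (Suc n) powr (- (Re s - d) - 2))"
    have "norm (trap_err (real (Suc n)) y) \<le> h n" if y: "y \<in> ball s d" for n y
    proof -
      have dy: "norm (s - y) < d" using y by (simp add: dist_norm)
      have ry: "Re y \<ge> Re s - d" using dy abs_Re_le_cmod[of "s - y"] by auto
      have ny: "norm y \<le> norm s + d" using dy norm_triangle_ineq2[of y s] by (simp add: norm_minus_commute)
      have "norm (trap_err (real (Suc n)) y) \<le> norm y * norm (y + 1) * real (Suc n) powr (- Re y - 2)"
        using ry d s by (intro norm_trap_err_le) (auto simp: d_def field_simps)
      also have "\<dots> \<le> (norm s + d) * (norm s + d + 1) * real (Suc n) powr (- (Re s - d) - 2)"
        using ny ry norm_triangle_ineq[of y 1] d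
        by (intro mult_mono powr_mono mult_nonneg_nonneg add_nonneg_nonneg) auto
      finally show ?thesis by (simp add: h_def)
    qed
    moreover have "summable h" unfolding h_def
      using s by (intro summable_mult summable_Suc_powr) (auto simp: d_def field_simps)
    ultimately show "\<exists>d h. 0 < d \<and> summable h \<and> (\<forall>\<^sub>F n in sequentially.
          \<forall>y\<in>ball s d \<inter> {s. Re s > -1}. norm (trap_err (real (Suc n)) y) \<le> h n)"
      using d by (intro exI[of _ d] exI[of _ h]) auto
  qed
  then obtain g g' where g: "\<And>s. Re s > -1 \<Longrightarrow> (\<lambda>n. trap_err (real (Suc n)) s) sums g s"
      "\<And>s. Re s > -1 \<Longrightarrow> (g has_field_derivative g' s) (at s)" by blast
  have "g holomorphic_on {s. Re s > -1}"
    using g(2) op by (auto simp: holomorphic_on_open)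
  moreover have "zeta_trap s = g s" if "s \<in> {s. Re s > -1}" for s
    using g(1)[of s] that by (simp add: zeta_trap_def sums_iff)
  ultimately show ?thesis by (metis holomorphic_cong)
qed

text \<open>The Euler-Maclaurin formula of second order: \<open>1 / (s - 1)\<close> is the integral
  from 1 to infinity, and \<open>1 / 2\<close> appears because the trapezoidal rule counts the
  endpoint 1 only half.\<close>

definition zeta_right :: "complex \<Rightarrow> complex" where
  "zeta_right s = 1 / (s - 1) + 1 / 2 + zeta_trap s"

lemma zeta_right_holomorphic: "zeta_right holomorphic_on {s. Re s > -1} - {1}"
  unfolding zeta_right_def[abs_def]
  by (intro holomorphic_intros holomorphic_on_subset[OF zeta_trap_holomorphic]) auto

lemma tendsto_Suc_powr_0:
  assumes "Re s > 0"
  shows "(\<lambda>n. complex_of_real (real (Suc n)) powr (- s)) \<longlonglongrightarrow> 0"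
proof (rule tendsto_norm_zero_cancel)
  have "(\<lambda>n. real (Suc n) powr (- Re s)) \<longlonglongrightarrow> 0"
    using assms by real_asymp
  thus "(\<lambda>n. norm (complex_of_real (real (Suc n)) powr (- s))) \<longlonglongrightarrow> 0"
    by (simp only: norm_of_real_powr of_nat_0_less_iff zero_less_Suc uminus_complex.sel)
qed

lemma zeta_right_sums:
  assumes "Re s > 1"
  shows "(\<lambda>n. of_nat (Suc n) powr (- s)) sums zeta_right s"
proof -
  have s1: "s \<noteq> 1" using assms by auto
  define p where "p = (\<lambda>n. complex_of_real (real (Suc n)) powr (- s))"
  define q where "q = (\<lambda>n. complex_of_real (real (Suc n)) powr (- (s - 1)))"
  \<comment> \<open>The trapezoid is \<open>p n\<close> plus half a telescoping difference, and the
    integral over the unit interval is a telescoping difference of \<open>q\<close>.\<close>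
  have te: "trap_err (real (Suc n)) s = p n + (p (Suc n) - p n) / 2 - (q (Suc n) - q n) / (1 - s)" for n
    using trap_err_eq[of "real (Suc n)" s] s1 by (simp add: p_def q_def add_ac field_simps)
  have t: "(\<lambda>n. trap_err (real (Suc n)) s) sums zeta_trap s"
    using summable_norm_cancel[OF summable_trap_err[of s]] assms unfolding zeta_trap_def
    by (simp add: summable_sums)
  have p: "(\<lambda>n. p (Suc n) - p n) sums (0 - p 0)"
    using assms unfolding p_def by (intro telescope_sums tendsto_Suc_powr_0) auto
  have q: "(\<lambda>n. q (Suc n) - q n) sums (0 - q 0)"
    using assms unfolding q_def by (intro telescope_sums tendsto_Suc_powr_0) auto
  have "(\<lambda>n. trap_err (real (Suc n)) s - (p (Suc n) - p n) / 2 + (q (Suc n) - q n) / (1 - s))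
         sums (zeta_trap s - (0 - p 0) / 2 + (0 - q 0) / (1 - s))"
    by (intro sums_add sums_diff sums_divide t p q)
  also have "(\<lambda>n. trap_err (real (Suc n)) s - (p (Suc n) - p n) / 2 + (q (Suc n) - q n) / (1 - s)) = p"
    by (simp only: te) (simp add: fun_eq_iff)
  also have "(zeta_trap s - (0 - p 0) / 2 + (0 - q 0) / (1 - s)) = zeta_right s"
    using s1 by (simp add: zeta_right_def p_def q_def field_simps)
  finally show ?thesis by (simp add: p_def)
qed

lemma zeta_trap_0: "zeta_trap 0 = 0"
  by (simp add: zeta_trap_def trap_err_def)

lemma norm_zeta_trap_le:
  assumes "Re s \<ge> -1/2"
  shows "norm (zeta_trap s) \<le> norm s * norm (s + 1) * (\<Sum>n. real (Suc n) powr (-3/2))"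
proof -
  have sm: "summable (\<lambda>n. norm s * norm (s + 1) * real (Suc n) powr (-3/2))"
    by (intro summable_mult summable_Suc_powr) auto
  have "norm (zeta_trap s) \<le> (\<Sum>n. norm s * norm (s + 1) * real (Suc n) powr (-3/2))"
    unfolding zeta_trap_def
  proof -
    have *: "norm (trap_err (real (Suc n)) s) \<le> norm s * norm (s + 1) * real (Suc n) powr (-3/2)" for n
    proof -
    have "norm (trap_err (real (Suc n)) s) \<le> norm s * norm (s + 1) * real (Suc n) powr (- Re s - 2)"
      using assms by (intro norm_trap_err_le) auto
    also have "\<dots> \<le> norm s * norm (s + 1) * real (Suc n) powr (-3/2)"
    proof -
      have "- Re s - 2 \<le> -3/2" using assms by (simp add: field_simps)
      thus ?thesis by (intro mult_left_mono powr_mono) auto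
    qed
    finally show ?thesis .
    qed
    show "norm (\<Sum>n. trap_err (real (Suc n)) s) \<le> (\<Sum>n. norm s * norm (s + 1) * real (Suc n) powr (-3/2))"
      by (rule order_trans[OF summable_norm suminf_le[OF * _ sm]])
         (use summable_trap_err[of s] assms in auto)
  qed
  also have "\<dots> = norm s * norm (s + 1) * (\<Sum>n. real (Suc n) powr (-3/2))"
    by (intro suminf_mult summable_Suc_powr) auto
  finally show ?thesis .
qed

section \<open>The functional equation on a real segment\<close>

text \<open>Euler's reflection formula differentiated. The entire \<open>rGamma\<close> and the
  factor \<open>sin\<close> on the left avoid quotients.\<close>

lemma Digamma_reflection:
  fixes z :: complex
  assumes "z \<notin> \<int>"
  shows "(Digamma (1 - z) - Digamma z) * sin (of_real pi * z) = of_real pi * cos (of_real pi * z)"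
proof -
  have z1: "z \<notin> \<int>\<^sub>\<le>\<^sub>0" using assms by (auto elim!: nonpos_Ints_cases)
  have z2: "1 - z \<notin> \<int>\<^sub>\<le>\<^sub>0"
  proof
    assume "1 - z \<in> \<int>\<^sub>\<le>\<^sub>0"
    then obtain n where "1 - z = of_int n" by (auto elim!: nonpos_Ints_cases)
    hence "z = of_int (1 - n)" by (simp add: algebra_simps)
    with assms show False by simp
  qed
  have "((\<lambda>z. rGamma z * rGamma (1 - z)) has_field_derivative
           rGamma z * rGamma (1 - z) * (Digamma (1 - z) - Digamma z)) (at z)"
    using z1 z2 by (auto intro!: derivative_eq_intros simp: algebra_simps)
  moreover have "((\<lambda>z. sin (of_real pi * z) / of_real pi) has_field_derivative cos (of_real pi * z)) (at z)"
    by (auto intro!: derivative_eq_intros)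
  ultimately have "rGamma z * rGamma (1 - z) * (Digamma (1 - z) - Digamma z) = cos (of_real pi * z)"
    unfolding rGamma_reflection_complex by (rule DERIV_unique)
  thus ?thesis unfolding rGamma_reflection_complex by (simp add: field_simps)
qed

text \<open>At \<open>z = \<i> * x / (2 * pi)\<close> the reflection formula turns
  \<open>Digamma (1 - z) - Digamma z\<close> into a hyperbolic cotangent, while the limit formula
  for \<open>Digamma\<close> expands it into the pairs
  \<open>1 / (n + z) - 1 / (n - z)\<close>.\<close>

lemma coth_partial_fraction:
  fixes x :: real
  assumes x: "x > 0"
  shows "(\<lambda>n. 2 * x / (x\<^sup>2 + (2 * pi * real (Suc n))\<^sup>2)) sums (1 / (exp x - 1) - 1 / x + 1 / 2)"
proof -
  define z :: complex where "z = \<i> * of_real (x / (2 * pi))"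
  define T where "T = (\<lambda>n. 2 * x / (x\<^sup>2 + (2 * pi * real (Suc n))\<^sup>2))"
  have Imz: "Im z = x / (2 * pi)" "Re z = 0" by (simp_all add: z_def)
  have Imz': "Im z \<noteq> 0" using x Imz by simp
  have zInt: "z \<notin> \<int>" using Imz' by (auto elim!: Ints_cases)
  have nz: "of_nat n + z \<noteq> 0" "of_nat n - z \<noteq> 0" for n
    using Imz' by (auto simp: complex_eq_iff)
  have nz': "z \<noteq> 0" using nz(1)[of 0] by simp
  have nz1: "1 - z \<noteq> 0" using nz(2)[of 1] by simp
  have trm: "1 / (of_nat k + z) - 1 / (of_nat k - z) = - (2 * of_real pi * \<i>) * of_real (2 * x / (x\<^sup>2 + (2 * pi * real k)\<^sup>2))"
    for k
  proof -
    have zz: "z\<^sup>2 = - (of_real x)\<^sup>2 / (4 * of_real pi ^ 2)"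
      by (simp add: z_def power_mult_distrib power_divide)
    have pos: "x\<^sup>2 + (2 * pi * real k)\<^sup>2 > 0" using x by (intro add_pos_nonneg) auto
    have "1 / (of_nat k + z) - 1 / (of_nat k - z) = - 2 * z / ((of_nat k + z) * (of_nat k - z))"
      using nz[of k] by (simp add: field_simps)
    also have "(of_nat k + z) * (of_nat k - z) = of_nat k ^ 2 - z\<^sup>2" by (simp add: power2_eq_square algebra_simps)
    also have "\<dots> = of_real ((x\<^sup>2 + (2 * pi * real k)\<^sup>2) / (4 * pi\<^sup>2))"
      by (simp add: zz field_simps power_mult_distrib)
    also have "- 2 * z / of_real ((x\<^sup>2 + (2 * pi * real k)\<^sup>2) / (4 * pi\<^sup>2)) =
        - (2 * of_real pi * \<i>) * of_real (2 * x / (x\<^sup>2 + (2 * pi * real k)\<^sup>2))"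
    proof -
      define d where "d = x\<^sup>2 + (2 * pi * real k)\<^sup>2"
      have "d \<noteq> 0" using pos unfolding d_def by linarith
      thus ?thesis unfolding d_def[symmetric] z_def by (simp add: field_simps power2_eq_square)
    qed
    finally show ?thesis .
  qed
  \<comment> \<open>The second sum starts at \<open>1 - z\<close>, one step ahead of the first.
    Hence \<open>1 / z\<close> and the last term \<open>1 / (Suc m - z)\<close> stay unpaired; the
    latter tends to 0.\<close>
  have part: "(\<Sum>n<Suc m. inverse (z + of_nat n)) - (\<Sum>n<Suc m. inverse (1 - z + of_nat n))
     = 1 / z - 1 / (of_nat (Suc m) - z) - (2 * of_real pi * \<i>) * of_real (\<Sum>n<m. T n)" for m
  proof (induction m)
    case 0
    show ?case by (simp add: inverse_eq_divide)
  next
    case (Suc m)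
    define k where "k = Suc m"
    have "(\<Sum>n<Suc k. inverse (z + of_nat n)) - (\<Sum>n<Suc k. inverse (1 - z + of_nat n)) =
      ((\<Sum>n<k. inverse (z + of_nat n)) - (\<Sum>n<k. inverse (1 - z + of_nat n)))
        + (1 / (of_nat k + z) - 1 / (of_nat (Suc k) - z))"
      by (simp add: inverse_eq_divide algebra_simps)
    also have "\<dots> = 1 / z - (2 * of_real pi * \<i>) * of_real (\<Sum>n<m. T n)
        + (1 / (of_nat k + z) - 1 / (of_nat k - z)) - 1 / (of_nat (Suc k) - z)"
      unfolding k_def Suc.IH by simp
    also have "\<dots> = 1 / z - 1 / (of_nat (Suc k) - z) - (2 * of_real pi * \<i>) * of_real (\<Sum>n<k. T n)"
      unfolding trm by (simp add: k_def T_def algebra_simps)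
    finally show ?case by (simp only: k_def)
  qed
  have "(\<lambda>m. (of_real (ln (real m)) - (\<Sum>n<m. inverse (1 - z + of_nat n)))
         - (of_real (ln (real m)) - (\<Sum>n<m. inverse (z + of_nat n)))) \<longlonglongrightarrow> Digamma (1 - z) - Digamma z"
    by (intro tendsto_diff Digamma_LIMSEQ nz' nz1)
  hence "(\<lambda>m. (\<Sum>n<m. inverse (z + of_nat n)) - (\<Sum>n<m. inverse (1 - z + of_nat n)))
      \<longlonglongrightarrow> Digamma (1 - z) - Digamma z" by (simp add: algebra_simps)
  hence "(\<lambda>m. (\<Sum>n<Suc m. inverse (z + of_nat n)) - (\<Sum>n<Suc m. inverse (1 - z + of_nat n)))
      \<longlonglongrightarrow> Digamma (1 - z) - Digamma z" by (rule LIMSEQ_Suc)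
  hence l1: "(\<lambda>m. 1 / z - 1 / (of_nat (Suc m) - z) - (2 * of_real pi * \<i>) * of_real (\<Sum>n<m. T n))
      \<longlonglongrightarrow> Digamma (1 - z) - Digamma z" by (simp only: part)
  have l2: "(\<lambda>m. 1 / (of_nat (Suc m) - z)) \<longlonglongrightarrow> 0"
  proof -
    have "filterlim (\<lambda>m. of_nat (Suc m) + (- z)) at_infinity sequentially"
      by (rule tendsto_add_filterlim_at_infinity'[OF filterlim_compose[OF tendsto_of_nat filterlim_Suc] tendsto_const])
    thus ?thesis by (auto intro: tendsto_divide_0[OF tendsto_const])
  qed
  have "(\<lambda>m. (1 / z - (1 / z - 1 / (of_nat (Suc m) - z) - (2 * of_real pi * \<i>) * of_real (\<Sum>n<m. T n))
            - 1 / (of_nat (Suc m) - z)) / (2 * of_real pi * \<i>))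
     \<longlonglongrightarrow> (1 / z - (Digamma (1 - z) - Digamma z) - 0) / (2 * of_real pi * \<i>)"
    by (intro tendsto_intros l1 l2) auto
  also have "(\<lambda>m. (1 / z - (1 / z - 1 / (of_nat (Suc m) - z) - (2 * of_real pi * \<i>) * of_real (\<Sum>n<m. T n))
            - 1 / (of_nat (Suc m) - z)) / (2 * of_real pi * \<i>)) = (\<lambda>m. complex_of_real (\<Sum>n<m. T n))"
    by (simp add: fun_eq_iff)
  also have "(1 / z - (Digamma (1 - z) - Digamma z) - 0) / (2 * of_real pi * \<i>) =
      of_real (1 / (exp x - 1) - 1 / x + 1 / 2)"
  proof -
    have pz: "of_real pi * z = \<i> * of_real (x / 2)" by (simp add: z_def)
    define E where "E = exp (x / 2)"
    have E: "E > 1" using x by (simp add: E_def)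
    have E2: "exp x = E * E" by (simp add: E_def exp_add[symmetric])
    have ex: "exp (\<i> * (\<i> * of_real (x/2))) = of_real (1 / E)" "exp (- (\<i> * (\<i> * of_real (x/2)))) = of_real E"
    proof -
      have i2: "\<i> * (\<i> * of_real (x/2)) = of_real (- (x/2))" by simp
      show "exp (\<i> * (\<i> * of_real (x/2))) = of_real (1 / E)"
        unfolding i2 exp_of_real E_def by (simp add: exp_minus inverse_eq_divide)
      show "exp (- (\<i> * (\<i> * of_real (x/2)))) = of_real E"
        unfolding i2 of_real_minus minus_minus exp_of_real E_def ..
    qed
    have s: "sin (of_real pi * z) = \<i> * of_real ((E - 1 / E) / 2)"
      unfolding pz sin_exp_eq ex by (simp add: field_simps)
    have c: "cos (of_real pi * z) = of_real ((E + 1 / E) / 2)"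
      unfolding pz cos_exp_eq ex by (simp add: field_simps)
    have EE: "E - 1 / E > 0" using E by (smt (verit) divide_less_eq_1_pos)
    define A where "A = (E - 1 / E) / 2"
    define B where "B = (E + 1 / E) / 2"
    have A0: "A > 0" using EE by (simp add: A_def)
    have DA: "(Digamma (1 - z) - Digamma z) * (\<i> * of_real A) = of_real pi * of_real B"
      using Digamma_reflection[OF zInt] unfolding s c A_def B_def .
    have "(Digamma (1 - z) - Digamma z) * of_real A = - \<i> * ((Digamma (1 - z) - Digamma z) * (\<i> * of_real A))"
      by (simp add: algebra_simps)
    hence "(Digamma (1 - z) - Digamma z) * of_real A = - \<i> * of_real (pi * B)"
      unfolding DA by simp
    hence D: "Digamma (1 - z) - Digamma z = - \<i> * of_real (pi * B / A)"
    proof -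
      assume *: "(Digamma (1 - z) - Digamma z) * of_real A = - \<i> * of_real (pi * B)"
      have "Digamma (1 - z) - Digamma z = (- \<i> * of_real (pi * B)) / of_real A"
        by (rule eq_divide_imp[OF _ *]) (use A0 in simp)
      thus ?thesis by simp
    qed
    have z': "1 / z = - \<i> * of_real (2 * pi / x)" using x by (simp add: z_def field_simps)
    have "(1 / z - (Digamma (1 - z) - Digamma z) - 0) / (2 * of_real pi * \<i>) = 
        of_real (B / A / 2 - 1 / x)"
      unfolding D z' using A0 x by (simp add: field_simps)
    also have "B / A / 2 = 1 / (exp x - 1) + 1 / 2"
    proof -
      have "E * E \<noteq> 1" using E by (metis less_1_mult less_irrefl)
      thus ?thesis unfolding A_def B_def E2 using E by (simp add: field_simps)
    qed
    finally show ?thesis by (simp add: algebra_simps)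
  qed
  finally have "(\<lambda>m. \<Sum>n<m. T n) \<longlonglongrightarrow> 1 / (exp x - 1) - 1 / x + 1 / 2"
    by (simp only: tendsto_of_real_iff)
  thus ?thesis by (simp add: sums_def T_def)
qed

section \<open>Integrals behind the functional equation\<close>

lemma nn_integral_powr_exp:
  assumes "a > 0" "p > (0::real)"
  shows "(\<integral>\<^sup>+x. ennreal (indicator {0<..} x * (x powr (p - 1) * exp (- (a * x)))) \<partial>lborel)
          = ennreal (Gamma p * a powr (- p))"
proof -
  have "ennreal (Gamma p) = (\<integral>\<^sup>+t. ennreal (indicator {0..} t * t powr (p - 1) / exp t) \<partial>lborel)"
    by (rule Gamma_conv_nn_integral_real) fact
  also have "\<dots> = \<bar>a\<bar> * (\<integral>\<^sup>+t. ennreal (indicator {0..} (0 + a * t) * (0 + a * t) powr (p - 1) / exp (0 + a * t)) \<partial>lborel)"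
    using assms by (intro nn_integral_real_affine) auto
  also have "(\<lambda>t. ennreal (indicator {0..} (0 + a * t) * (0 + a * t) powr (p - 1) / exp (0 + a * t))) =
      (\<lambda>t. ennreal (a powr (p - 1)) * ennreal (indicator {0<..} t * (t powr (p - 1) * exp (- (a * t)))))"
  proof
    fix t :: real
    consider "t > 0" | "t = 0" | "t < 0" by linarith
    thus "ennreal (indicator {0..} (0 + a * t) * (0 + a * t) powr (p - 1) / exp (0 + a * t)) =
        ennreal (a powr (p - 1)) * ennreal (indicator {0<..} t * (t powr (p - 1) * exp (- (a * t))))"
      using assms by cases (auto simp: indicator_def ennreal_mult'[symmetric] powr_mult exp_minus field_simps zero_le_mult_iff mult_less_0_iff)
  qed
  also have "\<bar>a\<bar> * (\<integral>\<^sup>+t. ennreal (a powr (p - 1)) * ennreal (indicator {0<..} t * (t powr (p - 1) * exp (- (a * t)))) \<partial>lborel)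
     = ennreal (a powr p) * (\<integral>\<^sup>+t. ennreal (indicator {0<..} t * (t powr (p - 1) * exp (- (a * t)))) \<partial>lborel)"
    using assms by (subst nn_integral_cmult)
       (auto simp: mult.assoc[symmetric] ennreal_mult'[symmetric] powr_diff)
  finally have *: "ennreal (Gamma p) = ennreal (a powr p) * (\<integral>\<^sup>+t. ennreal (indicator {0<..} t * (t powr (p - 1) * exp (- (a * t)))) \<partial>lborel)" .
  have "ennreal (a powr (- p)) * ennreal (Gamma p) = 
     (ennreal (a powr (- p)) * ennreal (a powr p)) * (\<integral>\<^sup>+t. ennreal (indicator {0<..} t * (t powr (p - 1) * exp (- (a * t)))) \<partial>lborel)"
    unfolding * by (simp only: mult.assoc)
  also have "ennreal (a powr (- p)) * ennreal (a powr p) = 1"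
    using assms by (simp add: ennreal_mult'[symmetric] powr_add[symmetric] del: powr_minus)
  finally show ?thesis using assms by (simp add: ennreal_mult'[symmetric] mult.commute)
qed

lemma Gamma_reflection_real: "Gamma x * Gamma (1 - x) = pi / sin (pi * x)" for x :: real
proof -
  have "complex_of_real (Gamma x * Gamma (1 - x)) = Gamma (of_real x) * Gamma (1 - of_real x)"
    using Gamma_complex_of_real[of x] Gamma_complex_of_real[of "1 - x"] by simp
  also have "\<dots> = of_real pi / sin (of_real (pi * x))"
    using Gamma_reflection_complex[of "of_real x"] by simp
  also have "\<dots> = of_real (pi / sin (pi * x))" unfolding sin_of_real by simp
  finally show ?thesis by (simp only: of_real_eq_iff)
qed

text \<open>The substitution \<open>x = a * sqrt (t / (1 - t))\<close> maps \<open>(0, 1)\<close>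
  onto the half-line and produces \<open>Beta ((1 + s) / 2) ((1 - s) / 2)\<close>. The two arguments
  add up to 1, so Gamma reflection evaluates it.\<close>

lemma nn_integral_powr_over_square:
  fixes s a :: real
  assumes s: "-1 < s" "s < 0" and a: "a > 0"
  shows "(\<integral>\<^sup>+x. ennreal (indicator {0<..} x * (x powr s / (x\<^sup>2 + a\<^sup>2))) \<partial>lborel)
          = ennreal (a powr (s - 1) * (pi / (2 * cos (pi * s / 2))))"
proof -
  define p where "p = (1 + s) / 2"
  define q where "q = (1 - s) / 2"
  have pq: "p > 0" "q > 0" "p + q = 1" using s by (simp_all add: p_def q_def field_simps)
  define f where "f = (\<lambda>x::real. x powr s / (x\<^sup>2 + a\<^sup>2))"
  define g where "g = (\<lambda>t::real. a * (t powr (1/2) * (1 - t) powr (-1/2)))"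
  define g' where "g' = (\<lambda>t::real. a / 2 * (t powr (-1/2) * (1 - t) powr (-3/2)))"
  have der: "(g has_field_derivative g' t) (at t within {0<..<1})" if "t \<in> {0<..<1}" for t
  proof -
    have t: "0 < t" "t < 1" using that by auto
    have "(g has_field_derivative a * (1/2 * t powr (1/2 - 1) * (1 - t) powr (-1/2)
             + t powr (1/2) * (-1/2 * (1 - t) powr (-1/2 - 1) * (-1)))) (at t within {0<..<1})"
      unfolding g_def using t by (auto intro!: derivative_eq_intros)
    also have "t powr (1/2) = t powr (-1/2) * t" using t powr_add[of t "-1/2" 1] by simp
    also have "(1 - t) powr (-1/2) = (1 - t) powr (-3/2) * (1 - t)"
      using t powr_add[of "1 - t" "-3/2" 1] by simp
    finally show ?thesis by (simp add: g'_def algebra_simps)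
  qed
  have gsq: "(g t)\<^sup>2 = a\<^sup>2 * (t / (1 - t))" if "t \<in> {0<..<1}" for t
  proof -
    have t: "0 < t" "t < 1" using that by auto
    have "(t powr (1/2))\<^sup>2 = t" "((1 - t) powr (-1/2))\<^sup>2 = 1 / (1 - t)"
      using t by (simp_all add: powr_half_sqrt powr_minus_divide power_divide)
    thus ?thesis by (simp add: g_def power_mult_distrib)
  qed
  have gpos: "g t > 0" if "t \<in> {0<..<1}" for t using that a by (auto simp: g_def)
  have inj: "inj_on g {0<..<1}"
  proof (rule inj_onI)
    fix t u assume tu: "t \<in> {0<..<1}" "u \<in> {0<..<1}" "g t = g u"
    have "a\<^sup>2 * (t / (1 - t)) = a\<^sup>2 * (u / (1 - u))" using gsq[OF tu(1)] gsq[OF tu(2)] tu(3) by simp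
    thus "t = u" using tu(1,2) a by (simp add: field_simps)
  qed
  have img: "g ` {0<..<1} = {0<..}"
  proof (intro equalityI subsetI)
    fix y assume "y \<in> g ` {0<..<1}" thus "y \<in> {0<..}" using gpos by auto
  next
    fix y :: real assume "y \<in> {0<..}"
    hence y: "y > 0" by simp
    define t where "t = y\<^sup>2 / (y\<^sup>2 + a\<^sup>2)"
    have pos: "y\<^sup>2 + a\<^sup>2 > 0" using y by (intro add_pos_nonneg) auto
    have t: "t \<in> {0<..<1}" using y a pos by (simp add: t_def)
    have "1 - t = (y\<^sup>2 + a\<^sup>2) / (y\<^sup>2 + a\<^sup>2) - y\<^sup>2 / (y\<^sup>2 + a\<^sup>2)"
      using divide_self[OF less_imp_neq[OF pos, symmetric]] unfolding t_def by linarith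
    hence "1 - t = a\<^sup>2 / (y\<^sup>2 + a\<^sup>2)" by (simp only: diff_divide_distrib[symmetric] add_diff_cancel_left')
    hence "a\<^sup>2 * (t / (1 - t)) = y\<^sup>2" using pos a by (simp add: t_def)
    hence "(g t)\<^sup>2 = y\<^sup>2" using gsq[OF t] by simp
    hence "g t = y" using gpos[OF t] y by (simp add: power2_eq_iff_nonneg)
    thus "y \<in> g ` {0<..<1}" using t by blast
  qed
  have key: "\<bar>g' t\<bar> * f (g t) = a powr (s - 1) / 2 * (t powr (p - 1) * (1 - t) powr (q - 1))"
    if "t \<in> {0<..<1}" for t
  proof -
    have t: "0 < t" "t < 1" using that by auto
    have k1: "(g t)\<^sup>2 + a\<^sup>2 = a\<^sup>2 * (1 - t) powr (-1)"
      unfolding gsq[OF that] using t by (simp add: powr_minus_divide field_simps)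
    have k2: "g t powr s = a powr s * (t powr (s / 2) * (1 - t) powr (- s / 2))"
      using t a by (simp add: g_def powr_mult powr_powr)
    have k3: "\<bar>g' t\<bar> = a / 2 * (t powr (-1/2) * (1 - t) powr (-3/2))"
      using t a by (simp add: g'_def)
    have "\<bar>g' t\<bar> * f (g t) = (a powr s * a / a\<^sup>2) / 2 * ((t powr (-1/2) * t powr (s / 2)) *
        ((1 - t) powr (-3/2) * (1 - t) powr (- s / 2) / (1 - t) powr (-1)))"
      unfolding f_def k1 k2 k3 by (simp add: mult_ac)
    also have "a powr s * a / a\<^sup>2 = a powr (s - 1)"
      using a by (simp add: powr_diff power2_eq_square)
    also have "t powr (-1/2) * t powr (s / 2) = t powr (p - 1)"
      by (simp add: powr_add[symmetric] p_def field_simps)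
    also have "(1 - t) powr (-3/2) * (1 - t) powr (- s / 2) / (1 - t) powr (-1) = (1 - t) powr (q - 1)"
      by (simp only: powr_add[symmetric] powr_diff[symmetric]) (simp add: q_def field_simps)
    finally show ?thesis .
  qed
  have beta: "((\<lambda>t. a powr (s - 1) / 2 * (t powr (p - 1) * (1 - t) powr (q - 1))) has_integral
       a powr (s - 1) / 2 * Beta p q) {0<..<1}"
    using has_integral_mult_right[OF has_integral_Beta_real[OF pq(1,2)], of "a powr (s - 1) / 2"]
    by (simp add: has_integral_Icc_iff_Ioo)
  have hi: "((\<lambda>t. \<bar>g' t\<bar> * f (g t)) has_integral a powr (s - 1) / 2 * Beta p q) {0<..<1}"
    using beta by (rule has_integral_cong[THEN iffD2, rotated]) (simp add: key)
  have nn: "\<bar>g' t\<bar> * f (g t) \<ge> 0" for t by (simp add: f_def)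
  have "(\<lambda>t. \<bar>g' t\<bar> * f (g t)) absolutely_integrable_on {0<..<1}"
    using hi nn by (intro nonnegative_absolutely_integrable_1) auto
  moreover have "integral {0<..<1} (\<lambda>t. \<bar>g' t\<bar> * f (g t)) = a powr (s - 1) / 2 * Beta p q"
    using hi by (rule integral_unique)
  ultimately have F: "f absolutely_integrable_on (g ` {0<..<1}) \<and> integral (g ` {0<..<1}) f = a powr (s - 1) / 2 * Beta p q"
    using has_absolute_integral_change_of_variables_1'[OF _ der inj, where b = "a powr (s - 1) / 2 * Beta p q" and f = f]
    by simp
  have "f integrable_on {0<..}" using F set_lebesgue_integral_eq_integral(1) unfolding img by blast
  hence "(f has_integral a powr (s - 1) / 2 * Beta p q) {0<..}"
    using F integrable_integral[of f "{0<..}"] unfolding img by metis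
  hence "(\<integral>\<^sup>+x. ennreal (indicator {0<..} x * f x) \<partial>lborel) = ennreal (a powr (s - 1) / 2 * Beta p q)"
    by (intro nn_integral_has_integral_lebesgue) (auto simp: f_def)
  also have "Beta p q = pi / cos (pi * s / 2)"
  proof -
    have "q = 1 - p" using pq(3) by simp
    hence "Beta p q = Gamma p * Gamma (1 - p)" by (simp add: Beta_def)
    also have "\<dots> = pi / sin (pi * p)" by (rule Gamma_reflection_real)
    finally have "Beta p q = pi / sin (pi * p)" .
    also have "pi * p = pi * s / 2 + pi / 2" by (simp add: p_def field_simps)
    also have "sin \<dots> = cos (pi * s / 2)" by (simp add: sin_add)
    finally show ?thesis .
  qed
  finally show ?thesis by (simp add: f_def)
qed

lemma nn_integral_bump_exp:
  fixes x :: real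
  assumes x: "x > 0"
  shows "(\<integral>\<^sup>+u. ennreal (indicator {0..1} u * (u * (1 - u) * exp (- (u * x)))) \<partial>lborel)
          = ennreal ((1 + exp (- x)) / x\<^sup>2 - 2 * (1 - exp (- x)) / x ^ 3)"
proof (rule nn_integral_has_integral_lebesgue)
  \<comment> \<open>With a name for the reciprocal, the derivative of \<open>H\<close> is a
    polynomial identity modulo \<open>x * i = 1\<close>.\<close>
  define i where "i = 1 / x"
  have xi: "x * i = 1" using x by (simp add: i_def)
  define H where "H = (\<lambda>u. exp (- (u * x)) * ((u\<^sup>2 - u) * i + (2 * u - 1) * i\<^sup>2 + 2 * i ^ 3))"
  have "((\<lambda>u. u * (1 - u) * exp (- (u * x))) has_integral H 1 - H 0) {0..1}"
  proof (rule fundamental_theorem_of_calculus)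
    fix u :: real assume "u \<in> {0..1}"
    have "(H has_field_derivative exp (- (u * x)) *
        (- x * ((u\<^sup>2 - u) * i + (2 * u - 1) * i\<^sup>2 + 2 * i ^ 3) + ((2 * u - 1) * i + 2 * i\<^sup>2))) (at u within {0..1})"
      unfolding H_def by (auto intro!: derivative_eq_intros simp: algebra_simps)
    also have "- x * ((u\<^sup>2 - u) * i + (2 * u - 1) * i\<^sup>2 + 2 * i ^ 3) + ((2 * u - 1) * i + 2 * i\<^sup>2) = u * (1 - u)"
      using xi by algebra
    finally show "(H has_vector_derivative u * (1 - u) * exp (- (u * x))) (at u within {0..1})"
      by (simp add: has_real_derivative_iff_has_vector_derivative mult_ac)
  qed auto
  also have "H 1 - H 0 = (1 + exp (- x)) / x\<^sup>2 - 2 * (1 - exp (- x)) / x ^ 3"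
    by (simp add: H_def i_def power_divide diff_divide_distrib add_divide_distrib algebra_simps)
  finally show "((\<lambda>u. u * (1 - u) * exp (- (u * x))) has_integral (1 + exp (- x)) / x\<^sup>2 - 2 * (1 - exp (- x)) / x ^ 3) {0..1}" .
qed auto

text \<open>
  Tonelli: writing the power on the left as a Gamma integral, summing the geometric series over \<open>n\<close> and
  expanding the resulting hyperbolic cotangent into partial fractions gives the right-hand side.
\<close>

lemma bump_zeta_series:
  fixes s :: real
  assumes s: "-1 < s" "s < 0"
  shows "(\<Sum>n. \<integral>\<^sup>+u. ennreal (indicator {0..1} u * (u * (1 - u) * (real n + u) powr (- s - 2))) \<partial>lborel)
       = (\<Sum>n. ennreal (4 / Gamma (s + 2) * ((2 * pi * real (Suc n)) powr (s - 1) * (pi / (2 * cos (pi * s / 2))))))"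
proof -
  define G where "G = Gamma (s + 2)"
  have G: "G > 0" using s by (simp add: G_def Gamma_real_pos)
  define k where "k = (\<lambda>x u n. indicator {0<..} x * (indicator {0..1} u * (u * (1 - u) / G * (x powr (s + 1) * exp (- ((real n + u) * x))))) :: real)"
  have k_nonneg: "k x u n \<ge> 0" for x u n using G by (auto simp: k_def indicator_def)
  have [measurable]: "(\<lambda>(x,u). k x u n) \<in> borel_measurable (lborel \<Otimes>\<^sub>M lborel)"
    "(\<lambda>(u,x). k x u n) \<in> borel_measurable (lborel \<Otimes>\<^sub>M lborel)" for n
    unfolding k_def case_prod_unfold by measurable
  have [measurable]: "(\<lambda>u. k x u n) \<in> borel_measurable lborel" "(\<lambda>x. k x u n) \<in> borel_measurable lborel" for x u n
    unfolding k_def by measurable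
  have 1: "(\<integral>\<^sup>+u. ennreal (indicator {0..1} u * (u * (1 - u) * (real n + u) powr (- s - 2))) \<partial>lborel)
     = (\<integral>\<^sup>+u. \<integral>\<^sup>+x. ennreal (k x u n) \<partial>lborel \<partial>lborel)" for n
  proof (rule nn_integral_cong)
    fix u :: real
    show "ennreal (indicator {0..1} u * (u * (1 - u) * (real n + u) powr (- s - 2))) = (\<integral>\<^sup>+x. ennreal (k x u n) \<partial>lborel)"
    proof (cases "u \<in> {0<..1}")
      case False
      hence "u = 0 \<or> u \<notin> {0..1}" by auto
      thus ?thesis by (auto simp: k_def)
    next
      case True
      have "(\<integral>\<^sup>+x. ennreal (k x u n) \<partial>lborel) = (\<integral>\<^sup>+x. ennreal (u * (1 - u) / G) *
          ennreal (indicator {0<..} x * (x powr (s + 1) * exp (- ((real n + u) * x)))) \<partial>lborel)"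
        using True G by (intro nn_integral_cong) (auto simp: k_def ennreal_mult'[symmetric] indicator_def)
      also have "\<dots> = ennreal (u * (1 - u) / G) * ennreal (Gamma (s + 2) * (real n + u) powr (- (s + 2)))"
      proof -
        have e: "s + 2 - 1 = s + 1" by simp
        show ?thesis using True s
          by (subst nn_integral_cmult, measurable)
             (subst nn_integral_powr_exp[of "real n + u" "s + 2", unfolded e], auto)
      qed
      also have "\<dots> = ennreal (u * (1 - u) * (real n + u) powr (- s - 2))"
      proof -
        have "- (s + 2) = - s - 2" by simp
        thus ?thesis using True G by (simp add: ennreal_mult'[symmetric] G_def[symmetric])
      qed
      finally show ?thesis using True by simp
    qed
  qed
  have "(\<Sum>n. \<integral>\<^sup>+u. ennreal (indicator {0..1} u * (u * (1 - u) * (real n + u) powr (- s - 2))) \<partial>lborel)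
     = (\<Sum>n. \<integral>\<^sup>+x. \<integral>\<^sup>+u. ennreal (k x u n) \<partial>lborel \<partial>lborel)"
    unfolding 1 by (intro suminf_cong lborel_pair.Fubini') measurable
  also have "\<dots> = (\<integral>\<^sup>+x. (\<Sum>n. \<integral>\<^sup>+u. ennreal (k x u n) \<partial>lborel) \<partial>lborel)"
    by (intro nn_integral_suminf[symmetric] lborel.borel_measurable_nn_integral) measurable
  also have "\<dots> = (\<integral>\<^sup>+x. (\<Sum>n. ennreal (4 / G) * ennreal (indicator {0<..} x * (x powr s / (x\<^sup>2 + (2 * pi * real (Suc n))\<^sup>2)))) \<partial>lborel)"
  proof (rule nn_integral_cong)
    fix x :: real
    show "(\<Sum>n. \<integral>\<^sup>+u. ennreal (k x u n) \<partial>lborel) =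
       (\<Sum>n. ennreal (4 / G) * ennreal (indicator {0<..} x * (x powr s / (x\<^sup>2 + (2 * pi * real (Suc n))\<^sup>2))))"
    proof (cases "x > 0")
      case False
      thus ?thesis by (simp add: k_def)
    next
      case True
      define M where "M = (1 + exp (- x)) / x\<^sup>2 - 2 * (1 - exp (- x)) / x ^ 3"
      have Mnn: "ennreal M = (\<integral>\<^sup>+u. ennreal (indicator {0..1} u * (u * (1 - u) * exp (- (u * x)))) \<partial>lborel)"
        unfolding M_def using nn_integral_bump_exp[OF True] by simp
      define K where "K = 1 / (exp x - 1) - 1 / x + 1 / 2"
      have ex: "exp x > 1" using True by simp
      \<comment> \<open>The quotient is the geometric sum over \<open>n\<close> applied to the bump
        integral. It is \<open>2 / x^2\<close> times the function expanded in
        \<open>coth_partial_fraction\<close>, whose positive terms also yield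
        \<open>M \<ge> 0\<close>.\<close>
      have MK: "M / (1 - exp (- x)) = 2 / x\<^sup>2 * K"
      proof -
        define y where "y = exp x"
        define i where "i = 1 / x"
        have y: "y > 1" "exp (- x) = 1 / y" using ex by (simp_all add: y_def exp_minus inverse_eq_divide)
        have M': "M = (1 + 1 / y) * i\<^sup>2 - 2 * (1 - 1 / y) * i ^ 3"
          unfolding M_def y(2) i_def by (simp add: power_divide)
        have K': "2 / x\<^sup>2 * K = 2 * i\<^sup>2 * (1 / (y - 1) - i + 1 / 2)"
          unfolding K_def y_def i_def by (simp add: power_divide)
        have "(1 + 1 / y) / (1 - 1 / y) = 2 * (1 / (y - 1) + 1 / 2)" "1 - 1 / y \<noteq> 0"
          using y(1) by (simp_all add: divide_simps) (simp add: algebra_simps)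
        moreover have "(a * b - 2 * d * c) / d = a / d * b - 2 * c" if "d \<noteq> 0" for a b c d :: real
          using that by (simp add: diff_divide_distrib)
        from this[OF calculation(2)] have "M / (1 - 1 / y) = (1 + 1 / y) / (1 - 1 / y) * i\<^sup>2 - 2 * i ^ 3"
          unfolding M' .
        ultimately have "M / (1 - 1 / y) = 2 * (1 / (y - 1) + 1 / 2) * i\<^sup>2 - 2 * i ^ 3" by simp
        also have "\<dots> = 2 * i\<^sup>2 * (1 / (y - 1) - i + 1 / 2)" by (simp add: algebra_simps power2_eq_square power3_eq_cube)
        finally show ?thesis unfolding y(2) K' .
      qed
      have Ksums: "(\<lambda>n. 2 * x / (x\<^sup>2 + (2 * pi * real (Suc n))\<^sup>2)) sums K"
        unfolding K_def by (rule coth_partial_fraction[OF True])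
      have tpos: "2 * x / (x\<^sup>2 + (2 * pi * real (Suc n))\<^sup>2) \<ge> 0" for n using True by simp
      have K0: "K \<ge> 0" by (rule sums_le[OF tpos sums_zero Ksums])
      have e1: "1 - exp (- x) > 0" using True by simp
      have "M = 2 / x\<^sup>2 * K * (1 - exp (- x))" using e1 unfolding MK[symmetric] by simp
      hence M0: "M \<ge> 0" using K0 e1 by simp
      have "(\<integral>\<^sup>+u. ennreal (k x u n) \<partial>lborel) = ennreal (x powr (s + 1) / G * M * exp (- x) ^ n)" for n
      proof -
        have "(\<integral>\<^sup>+u. ennreal (k x u n) \<partial>lborel) = (\<integral>\<^sup>+u. ennreal (x powr (s + 1) / G * exp (- x) ^ n) *
          ennreal (indicator {0..1} u * (u * (1 - u) * exp (- (u * x)))) \<partial>lborel)"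
        proof (rule nn_integral_cong)
          fix u :: real
          have "exp (- ((real n + u) * x)) = exp (real n * (- x) + - (u * x))"
            by (simp add: algebra_simps)
          also have "\<dots> = exp (- x) ^ n * exp (- (u * x))"
            unfolding exp_add exp_of_nat_mult ..
          finally have "k x u n = x powr (s + 1) / G * exp (- x) ^ n * (indicator {0..1} u * (u * (1 - u) * exp (- (u * x))))"
            using True unfolding k_def by simp
          hence kk: "k x u n = (x powr (s + 1) / G * exp (- x) ^ n) * (indicator {0..1} u * (u * (1 - u) * exp (- (u * x))))" by simp
          show "ennreal (k x u n) = ennreal (x powr (s + 1) / G * exp (- x) ^ n) *
              ennreal (indicator {0..1} u * (u * (1 - u) * exp (- (u * x))))"
            unfolding kk by (rule ennreal_mult') (use G in simp)
        qed
        also have "\<dots> = ennreal (x powr (s + 1) / G * exp (- x) ^ n) * ennreal M"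
          unfolding Mnn by (subst nn_integral_cmult) auto
        finally show ?thesis using G M0 by (simp add: ennreal_mult'[symmetric] mult_ac)
      qed
      hence "(\<Sum>n. \<integral>\<^sup>+u. ennreal (k x u n) \<partial>lborel) = (\<Sum>n. ennreal (x powr (s + 1) / G * M * exp (- x) ^ n))"
        by simp
      also have "\<dots> = ennreal (x powr (s + 1) / G * M * (1 / (1 - exp (- x))))"
      proof (rule suminf_ennreal_eq)
        show "(\<lambda>n. x powr (s + 1) / G * M * exp (- x) ^ n) sums (x powr (s + 1) / G * M * (1 / (1 - exp (- x))))"
          using True by (intro sums_mult geometric_sums) simp
      qed (use G M0 in auto)
      also have "x powr (s + 1) / G * M * (1 / (1 - exp (- x))) = x powr (s + 1) / G * (2 / x\<^sup>2 * K)"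
        unfolding MK[symmetric] by simp
      also have "\<dots> = 4 / G * (x powr s / (2 * x)) * K"
        using True G by (simp add: powr_add power2_eq_square field_simps)
      also have "ennreal \<dots> = (\<Sum>n. ennreal (4 / G * (x powr s / (2 * x)) * (2 * x / (x\<^sup>2 + (2 * pi * real (Suc n))\<^sup>2))))"
        by (rule suminf_ennreal_eq[symmetric, OF _ sums_mult[OF Ksums]]) (use True G in simp)
      also have "\<dots> = (\<Sum>n. ennreal (4 / G) * ennreal (indicator {0<..} x * (x powr s / (x\<^sup>2 + (2 * pi * real (Suc n))\<^sup>2))))"
        using True G by (intro suminf_cong) (simp add: ennreal_mult'[symmetric] field_simps)
      finally show ?thesis .
    qed
  qed
  also have "\<dots> = (\<Sum>n. \<integral>\<^sup>+x. ennreal (4 / G) * ennreal (indicator {0<..} x * (x powr s / (x\<^sup>2 + (2 * pi * real (Suc n))\<^sup>2))) \<partial>lborel)"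
    by (rule nn_integral_suminf) measurable
  also have "\<dots> = (\<Sum>n. ennreal (4 / G * ((2 * pi * real (Suc n)) powr (s - 1) * (pi / (2 * cos (pi * s / 2))))))"
  proof (rule suminf_cong)
    fix n
    have "(\<integral>\<^sup>+x. ennreal (4 / G) * ennreal (indicator {0<..} x * (x powr s / (x\<^sup>2 + (2 * pi * real (Suc n))\<^sup>2))) \<partial>lborel)
      = ennreal (4 / G) * ennreal ((2 * pi * real (Suc n)) powr (s - 1) * (pi / (2 * cos (pi * s / 2))))"
      using s by (subst nn_integral_cmult, measurable) (subst nn_integral_powr_over_square, auto)
    thus "(\<integral>\<^sup>+x. ennreal (4 / G) * ennreal (indicator {0<..} x * (x powr s / (x\<^sup>2 + (2 * pi * real (Suc n))\<^sup>2))) \<partial>lborel)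
      = ennreal (4 / G * ((2 * pi * real (Suc n)) powr (s - 1) * (pi / (2 * cos (pi * s / 2)))))"
      using G by (simp add: ennreal_mult'[symmetric])
  qed
  finally show ?thesis by (simp only: G_def)
qed

text \<open>For negative \<open>s\<close> the trapezoidal error on \<open>[0, 1]\<close> exists as
  well and equals \<open>1 / (s - 1) + 1 / 2\<close>. Hence \<open>zeta_right s\<close> is the sum
  of the errors over all \<open>n \<ge> 0\<close>, which \<open>bump_zeta_series\<close> evaluates
  as a multiple of the Dirichlet series at \<open>1 - s\<close>.\<close>

lemma zeta_right_reflection_real:
  fixes s :: real
  assumes s: "-1 < s" "s < 0"
  shows "zeta_right (of_real s) = of_real (2 * (2 * pi) powr (s - 1) * sin (pi * s / 2) * Gamma (1 - s)) * zeta_right (1 - of_real s)"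
proof -
  define r where "r = (\<lambda>n. integral {0..1} (\<lambda>u. u * (1 - u) * (real n + u) powr (- s - 2)))"
  define c where "c = 4 / Gamma (s + 2) * ((2 * pi) powr (s - 1) * (pi / (2 * cos (pi * s / 2))))"
  define Z where "Z = (\<Sum>n. real (Suc n) powr (s - 1))"
  have G: "Gamma (s + 2) > 0" using s by (simp add: Gamma_real_pos)
  have cosp: "cos (pi * s / 2) > 0"
    using mult_strict_left_mono[OF s(1) pi_gt_zero] mult_pos_neg[OF pi_gt_zero s(2)] s
    by (intro cos_gt_zero_pi) auto
  have c0: "c > 0" using G cosp by (simp add: c_def)
  have Zs: "(\<lambda>n. real (Suc n) powr (s - 1)) sums Z" unfolding Z_def
    using s by (intro summable_sums summable_Suc_powr) auto
  have cos_nonneg: "((\<lambda>u. u * (1 - u) * (real n + u) powr (- s - 2)) has_integral r n) {0..1}"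
    if n: "n > 0" for n
    unfolding r_def using n
    by (intro integrable_integral integrable_continuous_real continuous_intros) auto
  \<comment> \<open>For \<open>n = 0\<close> the integrand is singular at \<open>u = 0\<close>, so
    continuity does not give integrability; it is the Beta integrand with parameters
    \<open>- s\<close> and 2.\<close>
  have r0: "((\<lambda>u. u * (1 - u) * (real 0 + u) powr (- s - 2)) has_integral 1 / (- s * (1 - s))) {0..1}"
  proof -
    have "Beta (- s) 2 = 1 / (- s * (1 - s))"
    proof -
      have "Gamma (2 - s) = (1 - s) * (- s * Gamma (- s))"
      proof -
        have "1 - s \<notin> \<int>\<^sub>\<le>\<^sub>0" "- s \<notin> \<int>\<^sub>\<le>\<^sub>0" using s by (auto elim!: nonpos_Ints_cases)
        thus ?thesis using Gamma_plus1[of "1 - s"] Gamma_plus1[of "- s"] by simp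
      qed
      moreover have "Gamma (- s) > 0" using s by (intro Gamma_real_pos) auto
      hence "Gamma (- s) \<noteq> 0" by linarith
      ultimately show ?thesis using s Gamma_numeral[of "num.Bit0 num.One", where ?'a = real]
        by (simp add: Beta_def)
    qed
    moreover have "((\<lambda>u. u powr (- s - 1) * (1 - u) powr (2 - 1)) has_integral Beta (- s) 2) {0..1}"
      using s by (intro has_integral_Beta_real) auto
    ultimately have b: "((\<lambda>u. u powr (- s - 1) * (1 - u) powr (2 - 1)) has_integral 1 / (- s * (1 - s))) {0..1}" by simp
    show ?thesis
    proof (rule has_integral_eq[OF _ b])
      fix u :: real assume u: "u \<in> {0..1}"
      show "u powr (- s - 1) * (1 - u) powr (2 - 1) = u * (1 - u) * (real 0 + u) powr (- s - 2)"
      proof (cases "u = 0")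
        case False
        have "- s - 1 = (- s - 2) + 1" by simp
        hence "u powr (- s - 1) = u powr (- s - 2) * u" using u False by (metis powr_add powr_one atLeastAtMost_iff)
        thus ?thesis using u by simp
      qed auto
    qed
  qed
  have hr: "((\<lambda>u. u * (1 - u) * (real n + u) powr (- s - 2)) has_integral r n) {0..1}" for n
    using cos_nonneg[of n] r0 unfolding r_def by (cases "n = 0") (auto simp: has_integral_iff)
  have rn: "r n \<ge> 0" for n using hr[of n] by (rule has_integral_nonneg) auto
  have nnr: "(\<integral>\<^sup>+u. ennreal (indicator {0..1} u * (u * (1 - u) * (real n + u) powr (- s - 2))) \<partial>lborel) = ennreal (r n)" for n
    using hr[of n] by (intro nn_integral_has_integral_lebesgue) auto
  have "(\<Sum>n. ennreal (r n)) = (\<Sum>n. ennreal (4 / Gamma (s + 2) * ((2 * pi * real (Suc n)) powr (s - 1) * (pi / (2 * cos (pi * s / 2))))))"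
    using bump_zeta_series[OF s] unfolding nnr .
  also have "\<dots> = (\<Sum>n. ennreal (c * real (Suc n) powr (s - 1)))"
    by (intro suminf_cong) (simp add: c_def powr_mult mult_ac del: of_nat_Suc)
  also have "\<dots> = ennreal (c * Z)"
    by (rule suminf_ennreal_eq) (use c0 in \<open>auto intro!: sums_mult Zs simp del: of_nat_Suc\<close>)
  finally have sr: "(\<Sum>n. ennreal (r n)) = ennreal (c * Z)" .
  have "summable r" by (rule summable_suminf_not_top) (use rn sr in auto)
  have Z0: "Z \<ge> 0" unfolding Z_def by (intro suminf_nonneg sums_summable[OF Zs]) auto
  have "ennreal (\<Sum>n. r n) = ennreal (c * Z)"
    using sr suminf_ennreal2[OF rn \<open>summable r\<close>] by simp
  hence "(\<Sum>n. r n) = c * Z" using c0 Z0 suminf_nonneg[OF \<open>summable r\<close> rn] by simp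
  hence rs: "r sums (c * Z)" using \<open>summable r\<close> by (simp add: sums_iff)
  have r00: "r 0 = 1 / (- s * (1 - s))" using hr[of 0] r0 has_integral_unique by blast
  have te: "trap_err (real (Suc n)) (of_real s) = of_real (s * (s + 1) / 2 * r (Suc n))" for n
  proof -
    have "((\<lambda>u. complex_of_real (u * (1 - u) * (real (Suc n) + u) powr (- s - 2))) has_integral of_real (r (Suc n))) {0..1}"
      using has_integral_linear[OF hr[of "Suc n"] bounded_linear_of_real[where 'a = complex]]
      by (simp add: o_def del: of_nat_Suc)
    hence "((\<lambda>u. complex_of_real (u * (1 - u)) * of_real (real (Suc n) + u) powr (- of_real s - 2)) has_integral of_real (r (Suc n))) {0..1}"
    proof (rule has_integral_eq[rotated])
      fix u :: real assume "u \<in> {0..1}"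
      thus "complex_of_real (u * (1 - u) * (real (Suc n) + u) powr (- s - 2)) = complex_of_real (u * (1 - u)) * of_real (real (Suc n) + u) powr (- of_real s - 2)"
        using powr_of_real[of "real (Suc n) + u" "- s - 2"] by simp
    qed
    thus ?thesis by (simp add: trap_err_def integral_unique)
  qed
  have "(\<lambda>n. of_real (s * (s + 1) / 2 * r (Suc n))) sums (of_real (s * (s + 1) / 2 * (c * Z - r 0)) :: complex)"
    using rs by (intro sums_of_real sums_mult) (simp add: sums_Suc_iff)
  hence zt: "zeta_trap (of_real s) = of_real (s * (s + 1) / 2 * (c * Z - r 0))"
    unfolding te[symmetric] zeta_trap_def by (simp add: sums_iff)
  have "zeta_right (of_real s) = of_real (1 / (s - 1) + 1 / 2 + s * (s + 1) / 2 * (c * Z - r 0))"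
    unfolding zeta_right_def zt by simp
  also have "1 / (s - 1) + 1 / 2 + s * (s + 1) / 2 * (c * Z - r 0) = s * (s + 1) / 2 * c * Z"
  proof -
    have "1 / (s - 1) + 1 / 2 - s * (s + 1) / 2 * r 0 = 0"
      unfolding r00 using s by (simp add: divide_simps) (simp add: algebra_simps)
    moreover have "s * (s + 1) / 2 * (c * Z - r 0) = s * (s + 1) / 2 * c * Z - s * (s + 1) / 2 * r 0"
      by (simp only: right_diff_distrib mult.assoc)
    ultimately show ?thesis by linarith
  qed
  \<comment> \<open>Gamma reflection together with the double angle formula cancels the cosine and
    leaves the usual factor of the functional equation.\<close>
  also have "s * (s + 1) / 2 * c = 2 * (2 * pi) powr (s - 1) * sin (pi * s / 2) * Gamma (1 - s)"
  proof -
    have G1: "Gamma (s + 2) = (s + 1) * (s * Gamma s)"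
    proof -
      have "s \<notin> \<int>\<^sub>\<le>\<^sub>0" "s + 1 \<notin> \<int>\<^sub>\<le>\<^sub>0" using s by (auto elim!: nonpos_Ints_cases)
      thus ?thesis using Gamma_plus1[of "s + 1"] Gamma_plus1[of s] by (simp add: add_ac)
    qed
    have refl: "Gamma s * Gamma (1 - s) = pi / sin (pi * s)" by (rule Gamma_reflection_real)
    have sinp: "sin (pi * s) = 2 * sin (pi * s / 2) * cos (pi * s / 2)"
      using sin_double[of "pi * s / 2"] by simp
    have "sin (- (pi * s / 2)) > 0"
    proof -
      have "- pi < pi * s" "pi * s < 0"
        using s mult_strict_left_mono[OF s(1) pi_gt_zero] mult_pos_neg[OF pi_gt_zero s(2)] by auto
      thus ?thesis using pi_gt_zero by (intro sin_gt_zero) linarith+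
    qed
    hence sn: "sin (pi * s / 2) \<noteq> 0" by simp
    have Gs: "Gamma s \<noteq> 0" "s \<noteq> 0" "s + 1 \<noteq> 0" using G1 G s by auto
    have "s * (s + 1) / 2 * c = (2 * pi) powr (s - 1) * (pi / cos (pi * s / 2)) / Gamma s"
    proof -
      define q where "q = s + 1"
      have "s * q / 2 * (4 / (q * (s * G)) * X) = 2 * X / G" if "G \<noteq> 0" "q \<noteq> 0" for G X :: real
        using that Gs by simp
      from this[OF Gs(1), of "(2 * pi) powr (s - 1) * (pi / (2 * cos (pi * s / 2)))"]
      show ?thesis using Gs unfolding c_def G1 q_def by simp
    qed
    also have "pi / cos (pi * s / 2) = 2 * sin (pi * s / 2) * (Gamma s * Gamma (1 - s))"
      unfolding refl sinp using sn cosp by (simp add: field_simps)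
    finally show ?thesis using Gs by simp
  qed
  also have "complex_of_real (2 * (2 * pi) powr (s - 1) * sin (pi * s / 2) * Gamma (1 - s) * Z) =
     of_real (2 * (2 * pi) powr (s - 1) * sin (pi * s / 2) * Gamma (1 - s)) * zeta_right (1 - of_real s)"
  proof -
    have "(\<lambda>n. complex_of_nat (Suc n) powr (- (1 - of_real s))) sums zeta_right (1 - of_real s)"
      using s by (intro zeta_right_sums) auto
    moreover have "complex_of_nat (Suc n) powr (- (1 - of_real s)) = of_real (real (Suc n) powr (s - 1))" for n
      using powr_of_real[of "real (Suc n)" "s - 1"] by simp
    ultimately have "(\<lambda>n. of_real (real (Suc n) powr (s - 1))) sums zeta_right (1 - of_real s)" by simp
    moreover have "(\<lambda>n. complex_of_real (real (Suc n) powr (s - 1))) sums of_real Z" by (intro sums_of_real Zs)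
    ultimately have "zeta_right (1 - of_real s) = of_real Z" by (rule sums_unique2)
    thus ?thesis by simp
  qed
  finally show ?thesis .
qed

section \<open>The zeta function\<close>

lemma of_real_islimpt_segment:
  assumes "a < c" "c < b"
  shows "(of_real c :: complex) islimpt (of_real ` {a<..<b})"
  unfolding islimpt_approachable
proof (intro allI impI)
  fix e :: real assume e: "e > 0"
  define d where "d = min (e / 2) ((b - c) / 2)"
  have d: "d > 0" "d < e" "c + d < b" using e assms by (auto simp: d_def min_def field_simps)
  have "dist (of_real (c + d) :: complex) (of_real c) = d" using d by (simp add: dist_norm)
  thus "\<exists>x'\<in>complex_of_real ` {a<..<b}. x' \<noteq> of_real c \<and> dist x' (of_real c) < e"
    using d assms by (intro bexI[OF _ imageI[of "c + d"]]) auto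
qed

lemma holomorphic_eq_if_eq_on_segment:
  assumes hol: "f holomorphic_on S" "g holomorphic_on S" and S: "open S" "connected S"
    and sub: "of_real ` {a<..<b} \<subseteq> S" "a < (b::real)"
    and eq: "\<And>x. a < x \<Longrightarrow> x < b \<Longrightarrow> f (of_real x) = g (of_real x)"
    and s: "s \<in> S"
  shows "f s = g s"
proof -
  have "(\<lambda>z. f z - g z) holomorphic_on S" by (intro holomorphic_intros hol)
  moreover have "of_real ((a + b) / 2) \<in> S"
    by (rule subsetD[OF sub(1)], rule imageI) (use sub(2) in simp)
  moreover have "complex_of_real ((a + b) / 2) islimpt of_real ` {a<..<b}"
    by (rule of_real_islimpt_segment) (use sub(2) in simp_all)
  ultimately have "f s - g s = 0"
  proof (rule analytic_continuation[OF _ S sub(1) _ _ _ s])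
    fix z assume "z \<in> complex_of_real ` {a<..<b}"
    thus "f z - g z = 0" using eq by auto
  qed
  thus ?thesis by simp
qed

text \<open>The functional equation taken as a definition. For \<open>Re s < 0\<close> the point
  \<open>1 - s\<close> lies to the right of 1, away from the pole of \<open>zeta_right\<close> and
  the poles of \<open>Gamma\<close>.\<close>

definition zeta_left :: "complex \<Rightarrow> complex" where
  "zeta_left s = 2 * of_real (2 * pi) powr (s - 1) * sin (of_real pi * s / 2) * Gamma (1 - s) * zeta_right (1 - s)"

lemma zeta_left_holomorphic: "zeta_left holomorphic_on {s. Re s < 0}"
proof -
  have "zeta_right \<circ> (\<lambda>s. 1 - s) holomorphic_on {s. Re s < 0}"
    by (intro holomorphic_on_compose_gen[OF _ zeta_right_holomorphic] holomorphic_intros) auto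
  thus ?thesis unfolding zeta_left_def[abs_def] o_def
    by (intro holomorphic_intros) (auto elim!: nonpos_Ints_cases simp: complex_eq_iff)
qed

text \<open>Both sides are holomorphic in the strip and agree on its real segment by
  \<open>zeta_right_reflection_real\<close>; the identity theorem does the rest.\<close>

lemma zeta_right_eq_left:
  assumes "-1 < Re s" "Re s < 0"
  shows "zeta_right s = zeta_left s"
proof (rule holomorphic_eq_if_eq_on_segment[where f = zeta_right and g = zeta_left and S = "{s. -1 < Re s} \<inter> {s. Re s < 0}" and a = "-1" and b = 0])
  show "zeta_right holomorphic_on {s. -1 < Re s} \<inter> {s. Re s < 0}"
    by (rule holomorphic_on_subset[OF zeta_right_holomorphic]) auto
  show "zeta_left holomorphic_on {s. -1 < Re s} \<inter> {s. Re s < 0}"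
    by (rule holomorphic_on_subset[OF zeta_left_holomorphic]) auto
  show "open ({s. -1 < Re s} \<inter> {s. Re s < 0})"
    by (intro open_Int open_halfspace_Re_gt open_halfspace_Re_lt)
  show "connected ({s. -1 < Re s} \<inter> {s. Re s < 0})"
    by (intro convex_connected convex_Int convex_halfspace_Re_gt convex_halfspace_Re_lt)
next
  fix x :: real assume x: "-1 < x" "x < 0"
  have "complex_of_real ((2 * pi) powr (x - 1)) = of_real (2 * pi) powr (of_real x - 1)"
    using powr_of_real[of "2 * pi" "x - 1"] by simp
  moreover have "complex_of_real (Gamma (1 - x)) = Gamma (1 - of_real x)"
    using Gamma_complex_of_real[of "1 - x"] by simp
  moreover have "complex_of_real (sin (pi * x / 2)) = sin (of_real pi * of_real x / 2)"
    using sin_of_real[of "pi * x / 2", where 'a = complex, symmetric] by simp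
  ultimately show "zeta_right (of_real x) = zeta_left (of_real x)"
    unfolding zeta_right_reflection_real[OF x] zeta_left_def by simp
qed (use assms in auto)

definition zeta_cont :: "complex \<Rightarrow> complex" where
  "zeta_cont s = (if s = 1 then 0 else if Re s > -1 then zeta_right s else zeta_left s)"

lemma zeta_cont_holomorphic: "zeta_cont holomorphic_on - {1}"
proof -
  have o: "open ({s. Re s > -1} - {1::complex})" "open {s. Re s < 0}"
    by (auto intro: open_halfspace_Re_gt open_halfspace_Re_lt)
  have "zeta_cont holomorphic_on {s. Re s > -1} - {1}"
    by (rule holomorphic_transform[OF zeta_right_holomorphic]) (auto simp: zeta_cont_def)
  moreover have "zeta_cont holomorphic_on {s. Re s < 0}"
    by (rule holomorphic_transform[OF zeta_left_holomorphic]) (auto simp: zeta_cont_def zeta_right_eq_left)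
  ultimately have "zeta_cont holomorphic_on ({s. Re s > -1} - {1}) \<union> {s. Re s < 0}"
    using o by (intro holomorphic_on_Un)
  moreover have "({s. Re s > -1} - {1}) \<union> {s. Re s < 0} = - {1::complex}" by auto
  ultimately show ?thesis by simp
qed

lemma connected_punctured_complex: "connected (- {1::complex})"
  by (rule connected_punctured_universe) simp

text \<open>The glued function meets the three conditions of the description. A competitor agrees
  with it for \<open>Re s > 1\<close>, hence on the connected punctured plane, and at 1 by the
  normalisation.\<close>

lemma zeta_eq_zeta_cont: "zeta = zeta_cont"
  unfolding zeta_def
proof (rule the_equality)
  show *: "zeta_cont holomorphic_on - {1} \<and>
    (\<forall>s. 1 < Re s \<longrightarrow> (\<lambda>n. of_nat (Suc n) powr - s) sums zeta_cont s) \<and> zeta_cont 1 = 0"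
    using zeta_cont_holomorphic zeta_right_sums by (auto simp: zeta_cont_def simp del: of_nat_Suc)
  fix f :: "complex \<Rightarrow> complex"
  assume f: "f holomorphic_on - {1} \<and> (\<forall>s. 1 < Re s \<longrightarrow> (\<lambda>n. of_nat (Suc n) powr - s) sums f s) \<and> f 1 = 0"
  show "f = zeta_cont"
  proof
    fix s :: complex
    show "f s = zeta_cont s"
    proof (cases "s = 1")
      case False
      show ?thesis
      proof (rule analytic_continuation_open[where f = f and g = zeta_cont and s = "{s. Re s > 1}" and s' = "- {1}"])
        have "(2 :: complex) \<in> {s. Re s > 1}" by simp
        thus "{s. 1 < Re s} \<noteq> ({} :: complex set)" by blast
        fix z assume "z \<in> {s. 1 < Re s}"
        hence "(\<lambda>n. of_nat (Suc n) powr - z) sums f z" "(\<lambda>n. of_nat (Suc n) powr - z) sums zeta_cont z"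
          using f * by blast+
        thus "f z = zeta_cont z" by (rule sums_unique2)
      next
        show "{s. 1 < Re s} \<subseteq> - {1}" by auto
        show "f holomorphic_on - {1}" "zeta_cont holomorphic_on - {1}" using f * by blast+
      qed (use False connected_punctured_complex in \<open>simp_all add: open_halfspace_Re_gt open_Compl\<close>)
    next
      case True
      have "zeta_cont 1 = 0" unfolding zeta_cont_def by (rule if_P) (rule refl)
      moreover have "f 1 = 0" using f by blast
      ultimately have "f 1 = zeta_cont 1" by simp
      thus ?thesis unfolding True .
    qed
  qed
qed

lemma zeta_holomorphic: "zeta holomorphic_on - {1}"
  unfolding zeta_eq_zeta_cont by (rule zeta_cont_holomorphic)

lemma zeta_eq_right: "s \<noteq> 1 \<Longrightarrow> Re s > -1 \<Longrightarrow> zeta s = zeta_right s"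
  by (simp add: zeta_eq_zeta_cont zeta_cont_def)

lemma zeta_sums: "Re s > 1 \<Longrightarrow> (\<lambda>n. of_nat (Suc n) powr (- s)) sums zeta s"
  using zeta_right_sums[of s] zeta_eq_right[of s] by (cases "s = 1") (auto simp del: of_nat_Suc)

lemma zeta_reflection:
  assumes "Re s < 0"
  shows "zeta s = 2 * of_real (2 * pi) powr (s - 1) * sin (of_real pi * s / 2) * Gamma (1 - s) * zeta (1 - s)"
proof -
  have "zeta s = zeta_left s"
    using assms by (auto simp: zeta_eq_zeta_cont zeta_cont_def zeta_right_eq_left)
  moreover have "zeta (1 - s) = zeta_right (1 - s)" using assms by (intro zeta_eq_right) auto
  ultimately show ?thesis by (simp add: zeta_left_def)
qed

lemma zeta_cnj: "zeta (cnj s) = cnj (zeta s)"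
proof (cases "s = 1")
  case True
  have "zeta 1 = 0" unfolding zeta_eq_zeta_cont zeta_cont_def by (rule if_P) (rule refl)
  thus ?thesis unfolding True by (simp only: complex_cnj_one complex_cnj_zero)
next
  case False
  have h: "cnj \<circ> zeta \<circ> cnj holomorphic_on - {1}"
  proof (rule holomorphic_on_compose_cnj_cnj)
    have "cnj ` (- {1}) = - {1}"
      unfolding image_cnj_conv_vimage_cnj by auto
    thus "zeta holomorphic_on cnj ` (- {1})" using zeta_holomorphic by simp
  qed auto
  have "(cnj \<circ> zeta \<circ> cnj) s = zeta s"
  proof (rule analytic_continuation_open[where s = "{s. Re s > 1}" and s' = "- {1}", OF _ _ _ _ _ h zeta_holomorphic])
    have "(2 :: complex) \<in> {s. Re s > 1}" by simp
    thus "{s. 1 < Re s} \<noteq> ({} :: complex set)" by blast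
  next
    fix z assume z: "z \<in> {s. 1 < Re s}"
    have "(\<lambda>n. cnj (of_nat (Suc n) powr (- cnj z))) sums cnj (zeta (cnj z))"
      using z by (subst sums_cnj) (auto intro!: zeta_sums simp del: of_nat_Suc)
    moreover have "cnj (of_nat (Suc n) powr (- cnj z)) = of_nat (Suc n) powr (- z)" for n
      by (simp add: cnj_powr del: of_nat_Suc)
    ultimately have "(\<lambda>n. of_nat (Suc n) powr (- z)) sums cnj (zeta (cnj z))" by simp
    moreover have "(\<lambda>n. of_nat (Suc n) powr (- z)) sums zeta z" using z by (intro zeta_sums) simp
    ultimately show "(cnj \<circ> zeta \<circ> cnj) z = zeta z"
      unfolding o_def by (rule sums_unique2)
  next
    show "{s. 1 < Re s} \<subseteq> - {1}" by auto
  qed (use False connected_punctured_complex in \<open>simp_all add: open_halfspace_Re_gt open_Compl\<close>)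
  hence "cnj (cnj (zeta (cnj s))) = cnj (zeta s)" unfolding o_def by (rule arg_cong)
  thus ?thesis by (simp only: complex_cnj_cnj)
qed

lemma zeta_0: "zeta 0 = -1/2"
  using zeta_eq_right[of 0] by (simp add: zeta_right_def zeta_trap_0)

section \<open>The logarithm of zeta to the right of 1\<close>

text \<open>The convolution identity: the von Mangoldt function summed over the divisors of
  \<open>n\<close> is \<open>ln n\<close>. Absolute convergence allows the double series to be
  reindexed by \<open>(m, n) \<mapsto> (m * n, m)\<close> and summed over divisors first.\<close>

lemma mangoldt_powr_has_sum_ln:
  assumes s: "Re s > 1"
    and M: "(\<lambda>n. norm (mangoldt n * of_nat n powr (- s))) summable_on (UNIV :: nat set)"
    and Z: "(\<lambda>n. norm (of_nat n powr (- s))) summable_on (UNIV :: nat set)"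
  shows "((\<lambda>n. of_real (ln (real n)) * of_nat n powr (- s)) has_sum
      (\<Sum>\<^sub>\<infinity>n. mangoldt n * of_nat n powr (- s)) * (\<Sum>\<^sub>\<infinity>n. of_nat n powr (- s))) {1..}"
proof -
  define a where "a = (\<lambda>n::nat. mangoldt n * of_nat n powr (- s) :: complex)"
  define b where "b = (\<lambda>n::nat. of_nat n powr (- s) :: complex)"
  have a: "(a has_sum (\<Sum>\<^sub>\<infinity>n. a n)) UNIV" and b: "(b has_sum (\<Sum>\<^sub>\<infinity>n. b n)) UNIV"
    unfolding a_def b_def
    by (rule has_sum_infsum[OF abs_summable_summable[OF M]], rule has_sum_infsum[OF abs_summable_summable[OF Z]])
  have a1: "(a has_sum (\<Sum>\<^sub>\<infinity>n. a n)) {1..}"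
    using a by (subst has_sum_cong_neutral[where T = UNIV and g = a]) (auto simp: a_def not_le)
  have b1: "(b has_sum (\<Sum>\<^sub>\<infinity>n. b n)) {1..}"
    using b by (subst has_sum_cong_neutral[where T = UNIV and g = b]) (auto simp: b_def not_le)
  have nn: "(\<Sum>\<^sub>\<infinity>y. cmod (of_nat y powr - s)) \<ge> 0" by (intro infsum_nonneg) auto
  have ab: "(\<lambda>(m, n). a m * b n) summable_on {1..} \<times> {1..}"
  proof -
    have A: "(\<lambda>n. norm (a n)) summable_on UNIV" and B: "(\<lambda>n. norm (b n)) summable_on UNIV"
      using M Z by (simp_all only: a_def b_def)
    define S where "S = (\<Sum>\<^sub>\<infinity>n. norm (b n))"
    have S: "S \<ge> 0" unfolding S_def by (intro infsum_nonneg) auto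
    have 1: "(\<Sum>\<^sub>\<infinity>n. norm (a m * b n)) = norm (a m) * S" for m
      unfolding norm_mult S_def by (rule infsum_cmult_right) (use B in blast)
    have "(\<lambda>(m, n). norm (a m * b n)) summable_on UNIV \<times> UNIV"
    proof (rule summable_on_SigmaI)
      show "((\<lambda>n. case (m, n) of (m, n) \<Rightarrow> norm (a m * b n)) has_sum norm (a m) * S) UNIV" for m
        unfolding norm_mult S_def prod.case by (intro has_sum_cmult_right has_sum_infsum B)
      show "(\<lambda>m. norm (a m) * S) summable_on UNIV" by (intro summable_on_cmult_left A)
    qed auto
    hence "(\<lambda>mn. norm (case mn of (m, n) \<Rightarrow> a m * b n)) summable_on UNIV \<times> UNIV"
      by (simp add: case_prod_unfold)
    from summable_on_subset[OF abs_summable_summable[OF this]] show ?thesis by blast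
  qed
  have 1: "((\<lambda>(m, n). a m * b n) has_sum (\<Sum>\<^sub>\<infinity>n. a n) * (\<Sum>\<^sub>\<infinity>n. b n)) ({1..} \<times> {1..})"
    by (rule has_sum_SigmaI[OF _ has_sum_cmult_left[OF a1] ab]) (use has_sum_cmult_right[OF b1] in auto)
  also have "?this \<longleftrightarrow> ((\<lambda>(n, d). a d * b (n div d)) has_sum (\<Sum>\<^sub>\<infinity>n. a n) * (\<Sum>\<^sub>\<infinity>n. b n)) (SIGMA n:{1..}. {d. d dvd n})"
    by (rule has_sum_reindex_bij_witness[of _ "\<lambda>(n, d). (d, n div d)" "\<lambda>(m, n). (m * n, m)"])
       (auto elim!: dvdE)
  finally have 2: "((\<lambda>(n, d). a d * b (n div d)) has_sum (\<Sum>\<^sub>\<infinity>n. a n) * (\<Sum>\<^sub>\<infinity>n. b n)) (SIGMA n:{1..}. {d. d dvd n})" .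
  have "((\<lambda>n. of_real (ln (real n)) * of_nat n powr (- s)) has_sum (\<Sum>\<^sub>\<infinity>n. a n) * (\<Sum>\<^sub>\<infinity>n. b n)) {1..}"
  proof (rule has_sum_SigmaD[OF 2])
    fix n :: nat assume n: "n \<in> {1..}"
    hence "finite {d. d dvd n}" by auto
    moreover have "(\<Sum>d | d dvd n. a d * b (n div d)) = (\<Sum>d | d dvd n. mangoldt d * of_nat n powr (- s))"
    proof (rule sum.cong)
      fix d assume "d \<in> {d. d dvd n}"
      then obtain k where k: "n = d * k" by auto
      with n have "d > 0" "k > 0" by (auto intro: Nat.gr0I)
      thus "a d * b (n div d) = mangoldt d * of_nat n powr (- s)"
        using powr_times_real[of "of_nat d" "of_nat k" "- s"] by (simp add: a_def b_def k)
    qed auto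
    moreover have "(\<Sum>d | d dvd n. mangoldt d * of_nat n powr (- s)) = of_real (ln (real n)) * of_nat n powr (- s)"
      using n mangoldt_sum[of n, where ?'a = complex] by (simp add: sum_distrib_right[symmetric])
    ultimately show "((\<lambda>y. case (n, y) of (n, d) \<Rightarrow> a d * b (n div d)) has_sum of_real (ln (real n)) * of_nat n powr (- s)) {d. d dvd n}"
      by (intro has_sum_finiteI) auto
  qed
  thus ?thesis by (simp add: a_def b_def)
qed

definition log_zeta_coeff :: "nat \<Rightarrow> complex" where
  "log_zeta_coeff n = mangoldt n / of_real (ln (real n))"

lemma norm_log_zeta_coeff_le: "norm (log_zeta_coeff n) \<le> 1"
proof (cases "n \<ge> 2")
  case True
  have "mangoldt n \<le> ln (real n)" using mangoldt_le[of n] True by simp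
  moreover have "ln (real n) > 0" using True by simp
  ultimately show ?thesis by (simp add: log_zeta_coeff_def norm_divide)
next
  case False
  hence "n = 0 \<or> n = 1" by auto
  thus ?thesis by (auto simp: log_zeta_coeff_def)
qed

section \<open>Dirichlet series with bounded coefficients\<close>

lemma summable_nat_powr: "p < -1 \<Longrightarrow> summable (\<lambda>n. real n powr p)"
  using summable_real_powr_iff[of p] by simp

lemma norm_nat_powr: "norm (of_nat n powr (- s) :: complex) = real n powr (- Re s)"
  using norm_of_real_powr[of "real n" "- s"] by (cases "n = 0") auto

lemma dirichlet_series_derivative:
  assumes c: "\<And>n. norm (c n) \<le> 1"
  shows "\<exists>g g'. \<forall>s\<in>{s. Re s > 1}. ((\<lambda>n. c n * of_nat n powr (- s)) sums g s) \<and>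
      ((\<lambda>n. - (of_real (ln (real n)) * c n * of_nat n powr (- s))) sums g' s) \<and> (g has_field_derivative g' s) (at s)"
proof -
  have op: "open {s. Re s > 1}" by (simp add: open_halfspace_Re_gt)
  show ?thesis
  proof (rule series_and_derivative_comparison_local[OF op])
    fix n :: nat and s :: complex
    show "((\<lambda>s. c n * of_nat n powr (- s)) has_field_derivative - (of_real (ln (real n)) * c n * of_nat n powr (- s))) (at s)"
    proof (cases "n = 0")
      case False
      have "((\<lambda>s. c n * exp (- s * of_real (ln (real n)))) has_field_derivative
          - (of_real (ln (real n)) * c n * exp (- s * of_real (ln (real n))))) (at s)"
        by (auto intro!: derivative_eq_intros)
      thus ?thesis using False Ln_of_nat[of n] by (simp add: powr_def)
    qed auto
  next
    fix s assume s: "s \<in> {s. Re s > 1}"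
    define d where "d = (Re s - 1) / 2"
    have d: "d > 0" using s by (simp add: d_def)
    have "norm (c n * of_nat n powr (- y)) \<le> real n powr (- (Re s - d))" if y: "y \<in> ball s d" for n :: nat and y
    proof -
      have "Re y \<ge> Re s - d" using y abs_Re_le_cmod[of "s - y"] by (auto simp: dist_norm)
      hence "real n powr (- Re y) \<le> real n powr (- (Re s - d))"
        by (cases "n = 0") (auto intro!: powr_mono)
      moreover have "norm (c n * of_nat n powr (- y)) \<le> 1 * real n powr (- Re y)"
        unfolding norm_mult norm_nat_powr by (intro mult_right_mono c) auto
      ultimately show ?thesis by simp
    qed
    moreover have "summable (\<lambda>n. real n powr (- (Re s - d)))"
      using s by (intro summable_nat_powr) (auto simp: d_def field_simps)
    ultimately show "\<exists>d h. 0 < d \<and> summable h \<and> (\<forall>\<^sub>F n in sequentially.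
          \<forall>y\<in>ball s d \<inter> {s. Re s > 1}. norm (c n * of_nat n powr (- y)) \<le> h n)"
      using d by (intro exI[of _ d] exI[of _ "\<lambda>n. real n powr (- (Re s - d))"]) auto
  qed
qed

lemma abs_summable_nat_powr:
  assumes c: "\<And>n. norm (c n) \<le> 1" and s: "Re s > 1"
  shows "summable (\<lambda>n. norm (c n * of_nat n powr (- s)))"
proof (rule summable_comparison_test)
  show "summable (\<lambda>n. real n powr (- Re s))" using s by (intro summable_nat_powr) auto
  have "norm (c n * of_nat n powr (- s)) \<le> 1 * real n powr (- Re s)" for n
    unfolding norm_mult norm_nat_powr by (intro mult_right_mono c) auto
  thus "\<exists>N. \<forall>n\<ge>N. norm (norm (c n * of_nat n powr (- s))) \<le> real n powr (- Re s)" by auto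
qed

text \<open>A series starting at index 2 decays like \<open>2 powr (- Re s)\<close>. This determines
  constants of integration far to the right and bounds \<open>log_zeta\<close> on
  \<open>Re s = 2\<close>.\<close>

lemma dirichlet_series_tail_bound:
  assumes c: "\<And>n. norm (c n) \<le> 1" "c 0 = 0" "c 1 = 0" and s: "Re s \<ge> 2"
    and sums: "(\<lambda>n. c n * of_nat n powr (- s)) sums S"
  shows "norm S \<le> 2 powr (2 - Re s) * (\<Sum>n. real n powr (-2))"
proof -
  have sm: "summable (\<lambda>n. 2 powr (2 - Re s) * real n powr (-2))"
    by (intro summable_mult summable_nat_powr) auto
  have le: "norm (c n * of_nat n powr (- s)) \<le> 2 powr (2 - Re s) * real n powr (-2)" for n
  proof (cases "n \<ge> 2")
    case True
    have "norm (c n * of_nat n powr (- s)) \<le> 1 * real n powr (- Re s)"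
      unfolding norm_mult norm_nat_powr by (intro mult_right_mono c) auto
    also have "\<dots> = real n powr (2 - Re s) * real n powr (-2)"
      by (simp add: powr_add[symmetric])
    also have "\<dots> \<le> 2 powr (2 - Re s) * real n powr (-2)"
      using True s by (intro mult_right_mono powr_mono2') auto
    finally show ?thesis .
  next
    case False
    hence "n = 0 \<or> n = 1" by auto
    thus ?thesis using c by auto
  qed
  have "norm S = norm (\<Sum>n. c n * of_nat n powr (- s))" using sums by (simp add: sums_iff)
  also have "\<dots> \<le> (\<Sum>n. norm (c n * of_nat n powr (- s)))"
    using s by (intro summable_norm abs_summable_nat_powr c) auto
  also have "\<dots> \<le> (\<Sum>n. 2 powr (2 - Re s) * real n powr (-2))"
    using s by (intro suminf_le le abs_summable_nat_powr c sm) auto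
  also have "\<dots> = 2 powr (2 - Re s) * (\<Sum>n. real n powr (-2))"
    by (intro suminf_mult summable_nat_powr) auto
  finally show ?thesis .
qed

lemma log_zeta_sums:
  assumes "Re s > 1"
  shows "(\<lambda>n. log_zeta_coeff n * of_nat n powr (- s)) sums log_zeta s"
proof -
  have sm: "summable (\<lambda>n. norm (log_zeta_coeff n * of_nat n powr (- s)))"
    by (intro abs_summable_nat_powr norm_log_zeta_coeff_le assms)
  hence hs: "((\<lambda>n. log_zeta_coeff n * of_nat n powr (- s)) has_sum (\<Sum>n. log_zeta_coeff n * of_nat n powr (- s))) UNIV"
    by (intro norm_summable_imp_has_sum summable_sums[OF summable_norm_cancel])
  have "log_zeta s = (\<Sum>\<^sub>\<infinity>n\<in>UNIV. log_zeta_coeff n * of_nat n powr (- s))"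
    unfolding log_zeta_def
  proof (rule infsum_cong_neutral)
    fix n :: nat assume "n \<in> UNIV - {2..}"
    hence "n = 0 \<or> n = 1" by auto
    thus "log_zeta_coeff n * of_nat n powr (- s) = 0" by (auto simp: log_zeta_coeff_def)
  qed (auto simp: log_zeta_coeff_def powr_minus field_simps)
  also have "\<dots> = (\<Sum>n. log_zeta_coeff n * of_nat n powr (- s))" by (rule infsumI[OF hs])
  finally show ?thesis using summable_sums[OF summable_norm_cancel[OF sm]] by simp
qed

lemma zeta_sums_0:
  assumes "Re s > 1"
  shows "(\<lambda>n. of_nat n powr (- s)) sums zeta s"
  using zeta_sums[OF assms] by (subst (asm) sums_Suc_iff) simp

text \<open>Termwise, the derivative of \<open>log_zeta\<close> is minus the series of the von
  Mangoldt function. Multiplied by \<open>zeta\<close> it becomes minus the series of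
  \<open>ln n\<close>, which is the derivative of \<open>zeta\<close>.\<close>

lemma log_zeta_derivative:
  assumes s: "Re s > 1"
  obtains D where "(log_zeta has_field_derivative D) (at s)" "(zeta has_field_derivative D * zeta s) (at s)"
proof -
  have op: "open {s. Re s > 1}" by (simp add: open_halfspace_Re_gt)
  obtain l l' where l: "\<And>s. Re s > 1 \<Longrightarrow> (\<lambda>n. log_zeta_coeff n * of_nat n powr (- s)) sums l s"
    "\<And>s. Re s > 1 \<Longrightarrow> (\<lambda>n. - (of_real (ln (real n)) * log_zeta_coeff n * of_nat n powr (- s))) sums l' s"
    "\<And>s. Re s > 1 \<Longrightarrow> (l has_field_derivative l' s) (at s)"
    using dirichlet_series_derivative[of log_zeta_coeff, OF norm_log_zeta_coeff_le] by blast
  obtain z z' where z: "\<And>s. Re s > 1 \<Longrightarrow> (\<lambda>n. 1 * of_nat n powr (- s)) sums z s"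
    "\<And>s. Re s > 1 \<Longrightarrow> (\<lambda>n. - (of_real (ln (real n)) * 1 * of_nat n powr (- s))) sums z' s"
    "\<And>s. Re s > 1 \<Longrightarrow> (z has_field_derivative z' s) (at s)"
  proof -
    have "norm (1 :: complex) \<le> 1" by simp
    from dirichlet_series_derivative[of "\<lambda>_. 1", OF this] show ?thesis using that by blast
  qed
  have dl: "(log_zeta has_field_derivative l' s) (at s)"
    by (rule has_field_derivative_transform_within_open[OF l(3)[OF s] op])
       (use s l(1) log_zeta_sums in \<open>auto intro: sums_unique2\<close>)
  have zz: "z t = zeta t" if "Re t > 1" for t
    using z(1)[OF that] zeta_sums_0[OF that] by (simp add: sums_unique2)
  have dz: "(zeta has_field_derivative z' s) (at s)"
    by (rule has_field_derivative_transform_within_open[OF z(3)[OF s] op]) (use s zz in auto)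
  have lc: "of_real (ln (real n)) * log_zeta_coeff n = mangoldt n" for n
  proof (cases "n \<ge> 2")
    case True
    thus ?thesis by (simp add: log_zeta_coeff_def)
  next
    case False
    hence "n = 0 \<or> n = 1" by auto
    thus ?thesis by (auto simp: log_zeta_coeff_def)
  qed
  have absZ: "(\<lambda>n. norm (of_nat n powr (- s))) summable_on (UNIV :: nat set)"
    using norm_summable_imp_summable_on[of "\<lambda>n. norm (of_nat n powr (- s) :: complex)"]
      abs_summable_nat_powr[of "\<lambda>_. 1" s] s by simp
  have absM: "(\<lambda>n. norm (mangoldt n * of_nat n powr (- s) :: complex)) summable_on (UNIV :: nat set)"
  proof -
    have "summable (\<lambda>n. norm (mangoldt n * of_nat n powr (- s) :: complex))"
    proof (rule summable_comparison_test_ev)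
      \<comment> \<open>Half of the room to the right of 1 pays for the logarithm that bounds
        \<open>mangoldt n\<close>.\<close>
      define e where "e = (Re s - 1) / 2"
      have e: "e > 0" using s by (simp add: e_def)
      have "eventually (\<lambda>n. ln (real n) \<le> real n powr e) at_top" using e by real_asymp
      thus "eventually (\<lambda>n. norm (norm (mangoldt n * of_nat n powr (- s) :: complex)) \<le> real n powr (e - Re s)) at_top"
        using eventually_gt_at_top[of 0]
      proof eventually_elim
        case (elim n)
        have "norm (mangoldt n * of_nat n powr (- s) :: complex) = mangoldt n * real n powr (- Re s)"
          unfolding norm_mult norm_nat_powr by simp
        also have "\<dots> \<le> real n powr e * real n powr (- Re s)"
          using elim mangoldt_le[of n] by (intro mult_right_mono) auto
        finally show ?case by (simp add: powr_add[symmetric])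
      qed
      show "summable (\<lambda>n. real n powr (e - Re s))"
        using s by (intro summable_nat_powr) (auto simp: e_def field_simps)
    qed
    hence "summable (\<lambda>n. norm (norm (mangoldt n * of_nat n powr (- s) :: complex)))"
      unfolding real_norm_def abs_norm_cancel .
    thus ?thesis by (rule norm_summable_imp_summable_on)
  qed
  have sumM: "(\<Sum>\<^sub>\<infinity>n. mangoldt n * of_nat n powr (- s)) = - l' s"
  proof -
    have "(\<lambda>n. mangoldt n * of_nat n powr (- s)) sums (\<Sum>\<^sub>\<infinity>n. mangoldt n * of_nat n powr (- s))"
      by (rule has_sum_imp_sums[OF has_sum_infsum[OF abs_summable_summable[OF absM]]])
    moreover have "(\<lambda>n. mangoldt n * of_nat n powr (- s)) sums (- l' s)"
      using sums_minus[OF l(2)[OF s]] unfolding lc minus_minus .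
    ultimately show ?thesis by (rule sums_unique2)
  qed
  have sumZ: "(\<Sum>\<^sub>\<infinity>n. of_nat n powr (- s)) = zeta s"
  proof -
    have "(\<lambda>n. of_nat n powr (- s)) sums (\<Sum>\<^sub>\<infinity>n. of_nat n powr (- s))"
      by (rule has_sum_imp_sums[OF has_sum_infsum[OF abs_summable_summable[OF absZ]]])
    thus ?thesis using zeta_sums_0[OF s] by (rule sums_unique2)
  qed
  have "((\<lambda>n. of_real (ln (real n)) * of_nat n powr (- s)) has_sum - l' s * zeta s) {1..}"
    using mangoldt_powr_has_sum_ln[OF s absM absZ] unfolding sumM sumZ .
  also have "?this \<longleftrightarrow> ((\<lambda>n. of_real (ln (real n)) * of_nat n powr (- s)) has_sum - l' s * zeta s) UNIV"
    by (rule has_sum_cong_neutral) auto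
  finally have "(\<lambda>n. of_real (ln (real n)) * of_nat n powr (- s)) sums (- l' s * zeta s)"
    by (rule has_sum_imp_sums)
  moreover have "(\<lambda>n. of_real (ln (real n)) * of_nat n powr (- s)) sums (- z' s)"
    using sums_minus[OF z(2)[OF s]] unfolding mult_1_right minus_minus .
  ultimately have "- l' s * zeta s = - z' s" by (rule sums_unique2)
  hence "z' s = l' s * zeta s" unfolding mult_minus_left neg_equal_iff_equal by (rule sym)
  thus ?thesis using that[OF dl] dz by simp
qed

text \<open>The quotient \<open>zeta s * exp (- log_zeta s)\<close> has derivative 0 on a convex
  set, and along the integers it tends to 1.\<close>

lemma exp_log_zeta:
  assumes s: "Re s > 1"
  shows "exp (log_zeta s) = zeta s"
proof -
  define G where "G = (\<lambda>s. zeta s * exp (- log_zeta s))"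
  have "(G has_field_derivative 0) (at s)" if s: "Re s > 1" for s
  proof -
    obtain D where "(log_zeta has_field_derivative D) (at s)" "(zeta has_field_derivative D * zeta s) (at s)"
      using log_zeta_derivative[OF s] by blast
    thus ?thesis unfolding G_def by (auto intro!: derivative_eq_intros simp: algebra_simps)
  qed
  hence "\<exists>c. \<forall>s\<in>{s. Re s > 1}. G s = c"
    by (intro has_field_derivative_zero_constant[OF convex_halfspace_Re_gt])
       (auto simp: has_field_derivative_at_within)
  then obtain c where c: "\<And>s. Re s > 1 \<Longrightarrow> G s = c" by blast
  define C where "C = (\<Sum>n. real n powr (-2))"
  have l0: "(\<lambda>k. log_zeta (of_nat (k + 2))) \<longlonglongrightarrow> 0"
  proof (rule Lim_null_comparison)
    show "eventually (\<lambda>k. norm (log_zeta (of_nat (k + 2))) \<le> 2 powr (- real k) * C) sequentially"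
    proof (intro always_eventually allI)
      fix k :: nat
      have "norm (log_zeta (of_nat (k + 2))) \<le> 2 powr (2 - Re (of_nat (k + 2))) * (\<Sum>n. real n powr (-2))"
        by (rule dirichlet_series_tail_bound[OF norm_log_zeta_coeff_le _ _ _ log_zeta_sums])
           (auto simp: log_zeta_coeff_def)
      thus "norm (log_zeta (of_nat (k + 2))) \<le> 2 powr (- real k) * C" by (simp add: C_def)
    qed
    show "(\<lambda>k. 2 powr (- real k) * C) \<longlonglongrightarrow> 0" by real_asymp
  qed
  have z1: "(\<lambda>k. zeta (of_nat (k + 2))) \<longlonglongrightarrow> 1"
  proof -
    have "(\<lambda>k. zeta (of_nat (k + 2)) - 1) \<longlonglongrightarrow> 0"
    proof (rule Lim_null_comparison)
      show "eventually (\<lambda>k. norm (zeta (of_nat (k + 2)) - 1) \<le> 2 powr (- real k) * C) sequentially"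
      proof (intro always_eventually allI)
        fix k :: nat
        define c where "c = (\<lambda>n::nat. if n < 2 then 0 else 1 :: complex)"
        have "(\<lambda>n. of_nat n powr (- of_nat (k + 2)) - (if n = 1 then 1 else 0)) sums (zeta (of_nat (k + 2)) - 1)"
          using sums_single[of 1 "\<lambda>_. 1 :: complex"] by (intro sums_diff zeta_sums_0) auto
        also have "(\<lambda>n. of_nat n powr (- of_nat (k + 2)) - (if n = 1 then 1 else 0)) =
            (\<lambda>n. c n * of_nat n powr (- of_nat (k + 2)) :: complex)"
          by (auto simp: c_def fun_eq_iff less_2_cases_iff)
        finally have "norm (zeta (of_nat (k + 2)) - 1) \<le> 2 powr (2 - Re (of_nat (k + 2))) * (\<Sum>n. real n powr (-2))"
          by (rule dirichlet_series_tail_bound[rotated -1]) (auto simp: c_def)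
        thus "norm (zeta (of_nat (k + 2)) - 1) \<le> 2 powr (- real k) * C" by (simp add: C_def)
      qed
      show "(\<lambda>k. 2 powr (- real k) * C) \<longlonglongrightarrow> 0" by real_asymp
    qed
    thus ?thesis by (simp add: LIM_zero_iff)
  qed
  have "(\<lambda>k. G (of_nat (k + 2))) \<longlonglongrightarrow> 1 * exp (- 0)"
    unfolding G_def by (intro tendsto_intros l0 z1)
  moreover have "(\<lambda>k. G (of_nat (k + 2))) = (\<lambda>k. c)" by (auto simp: fun_eq_iff intro!: c)
  ultimately have "c = 1" by (simp add: LIMSEQ_const_iff)
  hence "zeta s * exp (- log_zeta s) = 1" using c[OF s] by (simp add: G_def)
  thus ?thesis by (simp add: exp_minus field_simps)
qed

lemma zeta_nonzero_right: "Re s > 1 \<Longrightarrow> zeta s \<noteq> 0"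
  using exp_log_zeta[of s] by (metis exp_not_eq_zero)

lemma log_zeta_continuous: "continuous_on {s. Re s > 1} log_zeta"
proof (intro continuous_at_imp_continuous_on ballI)
  fix s assume "s \<in> {s. Re s > 1}"
  then obtain D where "(log_zeta has_field_derivative D) (at s)" using log_zeta_derivative by blast
  thus "isCont log_zeta s" by (rule DERIV_isCont)
qed

lemma norm_log_zeta_le:
  assumes "Re s = 2"
  shows "norm (log_zeta s) \<le> (\<Sum>n. real n powr (-2))"
proof -
  have "norm (log_zeta s) \<le> 2 powr (2 - Re s) * (\<Sum>n. real n powr (-2))"
    by (rule dirichlet_series_tail_bound[OF norm_log_zeta_coeff_le _ _ _ log_zeta_sums])
       (use assms in \<open>auto simp: log_zeta_coeff_def\<close>)
  thus ?thesis using assms by simp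
qed

text \<open>Selects the branch: on \<open>Re s = 2\<close> continuous logarithms are compared at the
  real point 2.\<close>

lemma log_zeta_2_real: "Im (log_zeta 2) = 0"
proof -
  have "(\<lambda>n. Im (log_zeta_coeff n * of_nat n powr (- 2))) sums Im (log_zeta 2)"
    by (intro sums_Im log_zeta_sums) auto
  moreover have "Im (log_zeta_coeff n * of_nat n powr (- 2)) = 0" for n
  proof -
    have "(of_nat n :: complex) powr (- 2) = of_real (real n powr (- 2))"
      using powr_of_real[of "real n" "- 2"] by simp
    moreover have "log_zeta_coeff n = of_real (mangoldt n / ln (real n))"
      by (simp add: log_zeta_coeff_def)
    ultimately show ?thesis by simp
  qed
  ultimately show ?thesis by (simp add: sums_iff)
qed

section \<open>Zeros and growth of (s - 1) zeta(s)\<close>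

text \<open>Not Riemann's completed function: only the pole is removed, and the trivial zeros
  remain. The value 1 at the point 1 is the residue of \<open>zeta\<close>.\<close>

definition xi :: "complex \<Rightarrow> complex" where
  "xi s = (if s = 1 then 1 else (s - 1) * zeta s)"

lemma xi_eq_right:
  assumes "Re s > -1"
  shows "xi s = 1 + (s - 1) * (1 / 2 + zeta_trap s)"
proof (cases "s = 1")
  case False
  thus ?thesis unfolding xi_def zeta_eq_right[OF False assms] zeta_right_def
    by (simp add: field_simps)
qed (simp add: xi_def)

lemma xi_holomorphic: "xi holomorphic_on UNIV"
proof -
  have "(\<lambda>s. 1 + (s - 1) * (1 / 2 + zeta_trap s)) holomorphic_on {s. Re s > -1}"
    by (intro holomorphic_intros zeta_trap_holomorphic)
  hence 1: "xi holomorphic_on {s. Re s > -1}"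
    by (rule holomorphic_transform) (simp add: xi_eq_right)
  have "(\<lambda>s. (s - 1) * zeta s) holomorphic_on - {1}"
    by (intro holomorphic_intros zeta_holomorphic)
  hence 2: "xi holomorphic_on - {1}"
    by (rule holomorphic_transform) (simp add: xi_def)
  have "xi holomorphic_on {s. Re s > -1} \<union> - {1}"
    by (rule holomorphic_on_Un[OF 1 2]) (auto intro: open_halfspace_Re_gt)
  moreover have "{s. Re s > -1} \<union> - {1} = (UNIV :: complex set)" by auto
  ultimately show ?thesis by simp
qed

lemma xi_0: "xi 0 = 1 / 2"
  by (simp add: xi_def zeta_0)

lemma xi_1: "xi 1 = 1"
  by (simp add: xi_def)

lemma xi_cnj: "xi (cnj s) = cnj (xi s)"
proof (cases "s = 1")
  case False
  hence "cnj s \<noteq> 1" by (metis complex_cnj_cnj complex_cnj_one)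
  thus ?thesis using False by (simp add: xi_def zeta_cnj)
qed (simp add: xi_def)

lemma xi_eq_0_iff: "xi s = 0 \<longleftrightarrow> s \<noteq> 1 \<and> zeta s = 0"
  by (auto simp: xi_def)

section \<open>Sign of zeta on the real axis and location of the zeros\<close>

lemma Im_zeta_of_real: "Im (zeta (of_real x)) = 0"
proof -
  have "cnj (zeta (of_real x)) = zeta (of_real x)"
    using zeta_cnj[of "of_real x"] by simp
  thus ?thesis by (simp add: complex_eq_iff)
qed

lemma Re_zeta_pos:
  assumes "x > (1::real)"
  shows "Re (zeta (of_real x)) > 0"
proof -
  have s: "(\<lambda>n. Re (of_nat n powr (- of_real x))) sums Re (zeta (of_real x))"
    using assms by (intro sums_Re zeta_sums_0) simp
  have e: "Re (of_nat n powr (- of_real x)) = real n powr (- x)" for n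
    using powr_of_real[of "real n" "- x"] by simp
  have "(\<lambda>n. real n powr (- x)) sums Re (zeta (of_real x))" using s unfolding e .
  moreover have "(\<lambda>n. if n = 1 then 1 else 0 :: real) sums 1"
    using sums_single[of 1 "\<lambda>_. 1 :: real"] by simp
  ultimately have "1 \<le> Re (zeta (of_real x))"
  proof -
    assume a: "(\<lambda>n. real n powr (- x)) sums Re (zeta (of_real x))" and b: "(\<lambda>n. if n = 1 then 1 else 0 :: real) sums 1"
    have "(if n = 1 then 1 else 0) \<le> real n powr (- x)" for n by simp
    from sums_le[OF this b a] show ?thesis .
  qed
  thus ?thesis by simp
qed

lemma zeta_of_real_eq: "zeta (of_real x) = of_real (Re (zeta (of_real x)))"
  by (simp add: complex_eq_iff Im_zeta_of_real)

text \<open>In the functional equation every factor is positive except the sine, which is negative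
  for \<open>-2 < x < 0\<close>.\<close>

lemma Re_zeta_neg_left:
  assumes x: "-2 < x" "x < (0::real)"
  shows "Re (zeta (of_real x)) < 0"
proof -
  have p: "complex_of_real ((2 * pi) powr (x - 1)) = of_real (2 * pi) powr (of_real x - 1)"
    using powr_of_real[of "2 * pi" "x - 1"] by simp
  have G: "complex_of_real (Gamma (1 - x)) = Gamma (1 - of_real x)"
    using Gamma_complex_of_real[of "1 - x"] by simp
  have S: "complex_of_real (sin (pi * x / 2)) = sin (of_real pi * of_real x / 2)"
    using sin_of_real[of "pi * x / 2", where 'a = complex, symmetric] by simp
  have Z: "zeta (1 - of_real x) = of_real (Re (zeta (of_real (1 - x))))"
    using zeta_of_real_eq[of "1 - x"] by simp
  have "zeta (of_real x) = 2 * of_real (2 * pi) powr (of_real x - 1) * sin (of_real pi * of_real x / 2)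
      * Gamma (1 - of_real x) * zeta (1 - of_real x)"
    using x by (intro zeta_reflection) simp
  also have "\<dots> = of_real (2 * (2 * pi) powr (x - 1) * sin (pi * x / 2) * Gamma (1 - x) * Re (zeta (of_real (1 - x))))"
    unfolding p[symmetric] G[symmetric] S[symmetric] Z by simp
  finally have e: "Re (zeta (of_real x)) = 2 * (2 * pi) powr (x - 1) * sin (pi * x / 2) * Gamma (1 - x) * Re (zeta (of_real (1 - x)))"
    by (simp only: Re_complex_of_real)
  have "0 < - (pi * x / 2)" "- (pi * x / 2) < pi"
    using mult_strict_left_mono[OF x(1) pi_gt_zero] mult_pos_neg[OF pi_gt_zero x(2)] by linarith+
  hence "sin (- (pi * x / 2)) > 0" by (rule sin_gt_zero)
  hence s: "sin (pi * x / 2) < 0" by simp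
  have g: "Gamma (1 - x) > 0" using x by (intro Gamma_real_pos) simp
  have z: "Re (zeta (of_real (1 - x))) > 0" using x by (intro Re_zeta_pos) simp
  have "2 * (2 * pi) powr (x - 1) * sin (pi * x / 2) < 0" using s by (intro mult_pos_neg) auto
  from mult_neg_pos[OF mult_neg_pos[OF this g] z] show ?thesis unfolding e .
qed

text \<open>The main part \<open>1 / (x - 1) + 1 / 2\<close> is at most \<open>-1 / 2\<close>, while
  the trapezoidal errors add up to at most \<open>pi^2 / 24 < 1 / 2\<close>.\<close>

lemma Re_zeta_neg_right:
  assumes x: "0 \<le> x" "x < (1::real)"
  shows "Re (zeta (of_real x)) < 0"
proof -
  have sm: "summable (\<lambda>n. 1 / 4 * (1 / real (Suc n) ^ 2))"
    by (intro summable_mult) (use inverse_squares_sums in \<open>simp add: sums_iff\<close>)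
  have le: "norm (trap_err (real (Suc n)) (of_real x)) \<le> 1 / 4 * (1 / real (Suc n) ^ 2)" for n
  proof -
    have "norm (trap_err (real (Suc n)) (of_real x)) \<le>
        norm (of_real x :: complex) * norm (of_real x + 1 :: complex) / 8 * real (Suc n) powr (- Re (of_real x) - 2)"
      using x by (intro norm_trap_err_le_eighth) auto
    also have "norm (of_real x + 1 :: complex) = x + 1"
      using x norm_of_real[of "x + 1", where 'a = complex] by simp
    also have "norm (of_real x :: complex) * (x + 1) / 8 * real (Suc n) powr (- Re (of_real x) - 2)
       \<le> 1 * 2 / 8 * real (Suc n) powr (-2)"
      using x by (intro mult_mono divide_right_mono powr_mono) auto
    also have "\<dots> = 1 / 4 * (1 / real (Suc n) ^ 2)"
      by (simp add: powr_minus_divide powr_numeral del: of_nat_Suc)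
    finally show ?thesis .
  qed
  have "norm (zeta_trap (of_real x)) \<le> (\<Sum>n. norm (trap_err (real (Suc n)) (of_real x)))"
    unfolding zeta_trap_def using x by (intro summable_norm summable_trap_err) simp
  also have "\<dots> \<le> (\<Sum>n. 1 / 4 * (1 / real (Suc n) ^ 2))"
    using x by (intro suminf_le le summable_trap_err sm) simp
  also have "\<dots> = 1 / 4 * (pi\<^sup>2 / 6)"
    using sums_mult[OF inverse_squares_sums, of "1/4"] by (simp add: sums_iff)
  also have "\<dots> < 1 / 2"
  proof -
    have "pi < 3.3" using pi_approx by simp
    hence "pi * pi < 3.3 * 3.3" using pi_gt_zero by (intro mult_strict_mono) auto
    thus ?thesis by (simp add: power2_eq_square)
  qed
  finally have zt: "Re (zeta_trap (of_real x)) < 1 / 2"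
    using complex_Re_le_cmod[of "zeta_trap (of_real x)"] by linarith
  have "zeta (of_real x) = zeta_right (of_real x)" using x by (intro zeta_eq_right) auto
  also have "Re \<dots> = 1 / (x - 1) + 1 / 2 + Re (zeta_trap (of_real x))"
  proof -
    have "1 / (complex_of_real x - 1) = of_real (1 / (x - 1))" by simp
    thus ?thesis unfolding zeta_right_def by (simp del: of_real_divide of_real_diff)
  qed
  also have "1 / (x - 1) \<le> -1" using x by (simp add: divide_simps)
  finally show ?thesis using zt by linarith
qed

lemma Re_zeta_neg:
  assumes "-2 < x" "x < (1::real)"
  shows "Re (zeta (of_real x)) < 0"
  using Re_zeta_neg_left[of x] Re_zeta_neg_right[of x] assms by linarith

text \<open>In the functional equation only the sine can vanish when \<open>Re s < 0\<close>, and
  its zeros there are the negative even integers.\<close>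

lemma zeta_zero_left:
  assumes s: "Re s < 0" and z: "zeta s = 0"
  shows "\<exists>n::nat. n \<ge> 1 \<and> s = - (2 * of_nat n)"
proof -
  have "zeta (1 - s) \<noteq> 0" using s by (intro zeta_nonzero_right) simp
  moreover have "Gamma (1 - s) \<noteq> 0"
    using s by (subst Gamma_eq_zero_iff) (auto elim!: nonpos_Ints_cases simp: complex_eq_iff)
  ultimately have "sin (of_real pi * s / 2) = 0"
    using z zeta_reflection[OF s] by auto
  then obtain k :: int where k: "of_real pi * s / 2 = of_real (k * pi)" unfolding sin_eq_0 by blast
  have "of_real pi * s = of_real pi * (2 * of_int k)" using k by (simp add: field_simps)
  hence sk: "s = 2 * of_int k" by simp
  with s have "k < 0" by simp
  hence "s = - (2 * of_nat (nat (- k)))" "nat (- k) \<ge> 1" by (simp_all add: sk)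
  thus ?thesis by blast
qed

text \<open>Real points are excluded by the sign of zeta on \<open>[0, 1)\<close>. So nontrivial
  zeros avoid the slit, where \<open>\<Phi>\<close> and \<open>Ln\<close> are not controlled, and
  each differs from its conjugate.\<close>

lemma nontrivial_zeros_strip:
  assumes "s \<in> nontrivial_zeros"
  shows "0 \<le> Re s" "Re s \<le> 1" "Im s \<noteq> 0"
proof -
  have s: "s \<noteq> 1" "zeta s = 0" "\<And>n::nat. n \<ge> 1 \<Longrightarrow> s \<noteq> - (2 * of_nat n)"
    using assms by (auto simp: nontrivial_zeros_def)
  show 0: "0 \<le> Re s" using zeta_zero_left[of s] s by force
  show 1: "Re s \<le> 1" using zeta_nonzero_right[of s] s by force
  show "Im s \<noteq> 0"
  proof
    assume im: "Im s = 0"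
    hence e: "s = of_real (Re s)" by (simp add: complex_eq_iff)
    have "Re s \<noteq> 1" using im s(1) by (auto simp: complex_eq_iff)
    hence "Re (zeta (of_real (Re s))) < 0" using 0 1 by (intro Re_zeta_neg) auto
    thus False using s(2) e by simp
  qed
qed

lemma xi_zero_cases:
  assumes "xi s = 0"
  obtains "s \<in> nontrivial_zeros" | "Im s = 0" "Re s \<le> -2"
proof (cases "s \<in> nontrivial_zeros")
  case False
  have "s \<noteq> 1" "zeta s = 0" using assms by (auto simp: xi_eq_0_iff)
  then obtain n :: nat where "n \<ge> 1" "s = - (2 * of_nat n)"
    using False by (auto simp: nontrivial_zeros_def)
  thus ?thesis using that(2) by simp
qed (use that in blast)

lemma xi_nonzero_strip:
  assumes "-2 < Re s" "Re s < 0"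
  shows "xi s \<noteq> 0"
proof
  assume "xi s = 0"
  thus False
    by (rule xi_zero_cases) (use assms nontrivial_zeros_strip(1)[of s] in auto)
qed

section \<open>Growth in the whole plane\<close>

lemma norm_sin_le_exp: "norm (sin z) \<le> exp (norm z)" for z :: complex
proof -
  have "norm (sin z) \<le> exp \<bar>Im z\<bar>" using cmod_sin_le_exp[of 1 z] by simp
  also have "\<dots> \<le> exp (norm z)" using abs_Im_le_cmod by simp
  finally show ?thesis .
qed

text \<open>In the Gamma integral \<open>t powr (Re z - 1)\<close> is at most
  \<open>1 + t ^ n\<close>: the first summand serves for \<open>t \<le> 1\<close>, the second
  beyond.\<close>

lemma norm_Gamma_le:
  assumes z: "1 \<le> Re z" "Re z \<le> real n + 1"
  shows "norm (Gamma z :: complex) \<le> 1 + fact n"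
proof -
  have 1: "((\<lambda>t. of_real t powr (z - 1) / of_real (exp t)) has_integral Gamma z) {0..}"
    using z by (intro Gamma_integral_complex) auto
  have 2: "((\<lambda>t. t powr (1 - 1) / exp t + t powr (real (Suc n) - 1) / exp t) has_integral
       (Gamma 1 + Gamma (real (Suc n)))) {0..}"
    by (intro has_integral_add Gamma_integral_real) auto
  have 3: "norm (of_real t powr (z - 1) / of_real (exp t) :: complex) \<le>
      t powr (1 - 1) / exp t + t powr (real (Suc n) - 1) / exp t" if "t \<in> {0..}" for t
  proof (cases "t = 0")
    case False
    hence t: "t > 0" using that by simp
    have "norm (of_real t powr (z - 1) / of_real (exp t) :: complex) = t powr (Re z - 1) / exp t"
      unfolding norm_divide using norm_of_real_powr[OF t, of "z - 1"] by simp
    also have "t powr (Re z - 1) \<le> t powr (1 - 1) + t powr (real (Suc n) - 1)"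
    proof (cases "t \<le> 1")
      case True
      have "t powr (Re z - 1) \<le> 1" using True t z by (intro powr_le1) auto
      moreover have "t powr (real (Suc n) - 1) \<ge> 0" by (rule powr_ge_zero)
      moreover have "t powr (1 - 1) = 1" using t by simp
      ultimately show ?thesis by linarith
    next
      case False
      have "t powr (Re z - 1) \<le> t powr (real (Suc n) - 1)" using False z by (intro powr_mono) auto
      moreover have "t powr (1 - 1) \<ge> 0" by (rule powr_ge_zero)
      ultimately show ?thesis by linarith
    qed
    finally show ?thesis by (simp add: divide_right_mono add_divide_distrib)
  qed simp
  have "norm (Gamma z) \<le> Gamma 1 + Gamma (real (Suc n))"
    using integral_norm_bound_integral[OF has_integral_integrable[OF 1] has_integral_integrable[OF 2] 3]
    unfolding integral_unique[OF 1] integral_unique[OF 2] .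
  also have "Gamma (real (Suc n)) = fact n" using Gamma_fact[of n, where 'a = real] by (simp add: add.commute)
  finally show ?thesis by simp
qed

lemma norm_zeta_right_half_plane:
  assumes "Re s \<ge> 3/2"
  shows "norm (zeta s) \<le> (\<Sum>n. real n powr (-3/2))"
proof -
  have sm: "summable (\<lambda>n. norm (1 * of_nat n powr (- s) :: complex))"
    using assms by (intro abs_summable_nat_powr) auto
  have "norm (zeta s) = norm (\<Sum>n. of_nat n powr (- s) :: complex)"
    using zeta_sums_0[of s] assms by (simp add: sums_iff)
  also have "\<dots> \<le> (\<Sum>n. norm (of_nat n powr (- s) :: complex))"
    using sm by (intro summable_norm) simp
  also have "\<dots> \<le> (\<Sum>n. real n powr (-3/2))"
  proof (rule suminf_le)
    fix n :: nat
    show "norm (of_nat n powr (- s) :: complex) \<le> real n powr (-3/2)"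
      unfolding norm_nat_powr using assms by (cases "n = 0") (auto intro!: powr_mono)
  qed (use sm in \<open>auto intro: summable_nat_powr\<close>)
  finally show ?thesis .
qed

text \<open>To the right of \<open>Re s = -1/2\<close> the trapezoidal formula gives polynomial
  growth. To the left the functional equation applies with \<open>Re (1 - s) \<ge> 3/2\<close>,
  where zeta is bounded and \<open>Gamma\<close> is estimated by a factorial, generously by
  \<open>exp\<close> of a multiple of \<open>r^2\<close>.\<close>

lemma xi_growth:
  obtains C where "C > 0" "\<And>s. norm (xi s) \<le> exp (C * (1 + norm s)\<^sup>2)"
proof -
  define K1 where "K1 = (\<Sum>n. real (Suc n) powr (-3/2))"
  define K2 where "K2 = (\<Sum>n. real n powr (-3/2))"
  have K1: "K1 \<ge> 0" unfolding K1_def by (intro suminf_nonneg summable_Suc_powr) auto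
  have K2: "K2 \<ge> 0" unfolding K2_def by (intro suminf_nonneg summable_nat_powr) auto
  \<comment> \<open>Dominates the exponents \<open>5 + K1\<close> and \<open>11 + K2\<close> reached
    in the two half-planes.\<close>
  define C where "C = K1 + K2 + 20"
  have ex: "x \<le> exp x" for x :: real using exp_ge_add_one_self[of x] by linarith
  have "norm (xi s) \<le> exp (C * (1 + norm s)\<^sup>2)" for s
  proof -
    define r where "r = 1 + norm s"
    have r: "r \<ge> 1" by (simp add: r_def)
    have "r * 1 \<le> r * r" using r by (intro mult_left_mono) auto
    hence r2: "r \<le> r\<^sup>2" "1 \<le> r\<^sup>2" using r unfolding power2_eq_square by linarith+
    have up: "exp (a * b) \<le> exp (a * r\<^sup>2)" if "a \<ge> 0" "b \<le> r\<^sup>2" for a b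
      using that by (simp add: mult_left_mono)
    have n1: "norm (s - 1) \<le> r" "norm (s + 1) \<le> r"
      using norm_triangle_ineq4[of s 1] norm_triangle_ineq[of s 1] by (simp_all add: r_def)
    have xn: "norm (xi s) \<le> exp (C * r\<^sup>2)"
    proof (cases "Re s \<ge> -1/2")
      case True
      have zt: "norm (zeta_trap s) \<le> r * r * K1"
      proof -
        have "norm (zeta_trap s) \<le> norm s * norm (s + 1) * K1"
          unfolding K1_def using True by (intro norm_zeta_trap_le) simp
        also have "\<dots> \<le> r * r * K1" using n1 K1 r by (intro mult_right_mono mult_mono) (auto simp: r_def)
        finally show ?thesis .
      qed
      have "norm (xi s) \<le> 1 + norm (s - 1) * (1 / 2 + norm (zeta_trap s))"
      proof -
        have "xi s = 1 + (s - 1) * (1 / 2 + zeta_trap s)" using True by (intro xi_eq_right) simp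
        hence "norm (xi s) \<le> 1 + norm (s - 1) * norm (1 / 2 + zeta_trap s)"
          by (metis norm_triangle_ineq norm_one norm_mult)
        also have "norm (1 / 2 + zeta_trap s) \<le> 1 / 2 + norm (zeta_trap s)"
          using norm_triangle_ineq[of "1/2" "zeta_trap s"] by simp
        finally show ?thesis by (simp add: mult_left_mono)
      qed
      also have "\<dots> \<le> r ^ 3 + r * (r\<^sup>2 + r * r * K1)"
      proof (intro add_mono mult_mono)
        show "1 \<le> r ^ 3" using r by simp
        show "1 / 2 \<le> r\<^sup>2" using r2 by linarith
      qed (use n1 zt r K1 in auto)
      also have "\<dots> = (2 + K1) * r ^ 3" by (simp add: algebra_simps power2_eq_square power3_eq_cube)
      also have "\<dots> \<le> exp ((2 + K1) * r\<^sup>2) * exp (3 * r\<^sup>2)"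
      proof (intro mult_mono)
        have "2 + K1 \<le> exp ((2 + K1) * 1)" using ex[of "2 + K1"] by simp
        also have "\<dots> \<le> exp ((2 + K1) * r\<^sup>2)" using K1 r2 by (intro up) auto
        finally show "2 + K1 \<le> exp ((2 + K1) * r\<^sup>2)" .
        have "r ^ 3 \<le> exp r ^ 3" using r ex[of r] by (intro power_mono) auto
        also have "\<dots> = exp (3 * r)" by (simp add: exp_of_nat_mult[symmetric])
        also have "\<dots> \<le> exp (3 * r\<^sup>2)" using r2 by (intro up) auto
        finally show "r ^ 3 \<le> exp (3 * r\<^sup>2)" .
      qed (use r in auto)
      also have "\<dots> = exp ((5 + K1) * r\<^sup>2)" by (simp add: exp_add[symmetric] algebra_simps)
      also have "\<dots> \<le> exp (C * r\<^sup>2)" unfolding C_def using K2 by (simp add: mult_right_mono)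
      finally show ?thesis .
    next
      case False
      hence s: "Re s < -1/2" by simp
      have s1: "s \<noteq> 1" using s by auto
      define n where "n = nat \<lceil>Re (1 - s)\<rceil>"
      have rs: "Re (1 - s) \<le> r" using complex_Re_le_cmod[of "- s"] by (simp add: r_def)
      have nr: "Re (1 - s) \<le> real n" "real n \<le> r + 1"
      proof -
        define u where "u = Re (1 - s)"
        have "\<lceil>u\<rceil> \<ge> 0" using s unfolding u_def by simp
        hence n: "real n = of_int \<lceil>u\<rceil>" unfolding n_def u_def[symmetric] by simp
        show "Re (1 - s) \<le> real n" unfolding n u_def[symmetric] by (rule le_of_int_ceiling)
        show "real n \<le> r + 1" using rs of_int_ceiling_le_add_one[of u] unfolding n u_def[symmetric] by linarith
      qed
      have n0: "n \<ge> 1" using nr s by (cases n) auto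
      have G: "norm (Gamma (1 - s)) \<le> exp (6 * r\<^sup>2)"
      proof -
        have "norm (Gamma (1 - s)) \<le> 1 + fact n" using s nr by (intro norm_Gamma_le) auto
        also have "\<dots> \<le> 2 * fact n" using fact_ge_1[of n, where 'a = real] by linarith
        also have "\<dots> \<le> exp (2 * r\<^sup>2) * exp (4 * r\<^sup>2)"
        proof (rule mult_mono)
          have "fact n \<le> real n ^ n" using fact_le_power[of n, where 'a = real] by simp
          also have "real n ^ n \<le> exp (real n) ^ n" by (intro power_mono ex) auto
          also have "\<dots> = exp (real n * real n)" by (simp add: exp_of_nat_mult[symmetric])
          also have "\<dots> \<le> exp ((2 * r) * (2 * r))"
          proof -
            have "real n * real n \<le> (2 * r) * (2 * r)" using nr r by (intro mult_mono) auto
            thus ?thesis by simp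
          qed
          also have "(2 * r) * (2 * r) = 4 * r\<^sup>2" by (simp add: power2_eq_square)
          finally show "fact n \<le> exp (4 * r\<^sup>2)" .
          have "(2::real) \<le> exp 2" by (rule ex)
          also have "exp (2::real) \<le> exp (2 * r\<^sup>2)" using r2 by simp
          finally show "2 \<le> exp (2 * r\<^sup>2)" .
        qed auto
        also have "\<dots> = exp (6 * r\<^sup>2)" by (simp add: exp_add[symmetric])
        finally show ?thesis .
      qed
      have S: "norm (sin (of_real pi * s / 2)) \<le> exp (2 * r\<^sup>2)"
      proof -
        have "norm (of_real pi * s / 2) = pi / 2 * norm s" by (simp add: norm_mult)
        also have "\<dots> \<le> 2 * r" using pi_less_4 r by (intro mult_mono) (auto simp: r_def)
        also have "\<dots> \<le> 2 * r\<^sup>2" using r2 by simp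
        finally show ?thesis using norm_sin_le_exp[of "of_real pi * s / 2"] by (meson order_trans exp_le_cancel_iff)
      qed
      have P: "norm (of_real (2 * pi) powr (s - 1) :: complex) \<le> 1"
      proof -
        have "norm (of_real (2 * pi) powr (s - 1) :: complex) = (2 * pi) powr (Re s - 1)"
          using norm_of_real_powr[of "2 * pi" "s - 1"] by simp
        also have "\<dots> \<le> (2 * pi) powr 0" using s pi_gt3 by (intro powr_mono) auto
        finally show ?thesis by simp
      qed
      have Z: "norm (zeta (1 - s)) \<le> exp (K2 * r\<^sup>2)"
      proof -
        have "norm (zeta (1 - s)) \<le> K2" unfolding K2_def using s by (intro norm_zeta_right_half_plane) simp
        also have "\<dots> \<le> exp (K2 * 1)" using ex[of K2] by simp
        also have "\<dots> \<le> exp (K2 * r\<^sup>2)" using K2 r2 by (intro up) auto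
        finally show ?thesis .
      qed
      have "exp r \<le> exp (1 * r\<^sup>2)" "exp (2::real) \<le> exp (2 * r\<^sup>2)" using r2 by simp_all
      hence nsm: "norm (s - 1) \<le> exp (1 * r\<^sup>2)" and two: "(2::real) \<le> exp (2 * r\<^sup>2)"
        using n1(1) ex[of r] ex[of 2] by linarith+
      have "norm (xi s) = norm (s - 1) * (2 * norm (of_real (2 * pi) powr (s - 1) :: complex) * norm (sin (of_real pi * s / 2))
          * norm (Gamma (1 - s)) * norm (zeta (1 - s)))"
        using s1 s by (simp add: xi_def zeta_reflection norm_mult)
      also have "\<dots> \<le> exp (1 * r\<^sup>2) * (exp (2 * r\<^sup>2) * 1 * exp (2 * r\<^sup>2) * exp (6 * r\<^sup>2) * exp (K2 * r\<^sup>2))"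
        by (intro mult_mono P S G Z two nsm) auto
      also have "\<dots> = exp ((11 + K2) * r\<^sup>2)" by (simp add: exp_add[symmetric] algebra_simps)
      also have "\<dots> \<le> exp (C * r\<^sup>2)" unfolding C_def using K1 by (simp add: mult_right_mono)
      finally show ?thesis .
    qed
    thus ?thesis by (simp add: r_def)
  qed
  moreover have "C > 0" using K1 K2 by (simp add: C_def)
  ultimately show ?thesis using that by blast
qed

section \<open>Entire functions and their zeros in a disc\<close>

text \<open>Two continuous logarithms of one function differ by values in
  \<open>2 * pi * \<i> * \<int>\<close>; a continuous function with such a discrete range is
  constant on a connected set. All branch identifications rest on this.\<close>

lemma continuous_log_unique:
  fixes f g :: "'a::topological_space \<Rightarrow> complex"
  assumes S: "connected S" and f: "continuous_on S f" and g: "continuous_on S g"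
    and eq: "\<And>x. x \<in> S \<Longrightarrow> exp (f x) = exp (g x)"
    and a: "a \<in> S" "f a = g a" and x: "x \<in> S"
  shows "f x = g x"
proof -
  have "(\<lambda>x. f x - g x) constant_on S"
  proof (rule continuous_discrete_range_constant[OF S])
    show "continuous_on S (\<lambda>x. f x - g x)" by (intro continuous_intros f g)
    fix x assume x: "x \<in> S"
    show "\<exists>e>0. \<forall>y. y \<in> S \<and> f y - g y \<noteq> f x - g x \<longrightarrow> e \<le> norm (f y - g y - (f x - g x))"
    proof (intro exI[of _ "2 * pi"] conjI allI impI)
      fix y assume y: "y \<in> S \<and> f y - g y \<noteq> f x - g x"
      have "exp (f y - g y) = exp (f x - g x)" using eq x y by (simp add: exp_diff)
      then obtain n :: int where n: "f y - g y = f x - g x + (of_int (2 * n) * pi) * \<i>"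
        unfolding exp_eq by blast
      have "n \<noteq> 0" using n y by auto
      hence "1 \<le> \<bar>real_of_int n\<bar>" by linarith
      have "norm (f y - g y - (f x - g x)) = norm ((of_int (2 * n) * pi) * \<i> :: complex)" using n by simp
      also have "\<dots> = \<bar>real_of_int n\<bar> * (2 * pi)" by (simp add: norm_mult)
      finally show "2 * pi \<le> norm (f y - g y - (f x - g x))"
        using mult_right_mono[OF \<open>1 \<le> \<bar>real_of_int n\<bar>\<close>, of "2 * pi"] by simp
    qed simp
  qed
  then obtain c where c: "\<And>x. x \<in> S \<Longrightarrow> f x - g x = c" unfolding constant_on_def by blast
  thus ?thesis using a c[OF x] c[OF a(1)] by simp
qed

text \<open>\<open>Re h < A\<close> says that \<open>h\<close> is closer to 0 than to
  \<open>2 * A\<close>, so \<open>w = h / (2 * A - h)\<close> maps the disc into the unit disc.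
  Schwarz's lemma gives \<open>norm w \<le> 1 / 2\<close> on the half disc, and solving for
  \<open>h\<close> yields the bound.\<close>

lemma borel_caratheodory:
  assumes h: "h holomorphic_on ball 0 R" and R: "R > 0" and h0: "h 0 = 0"
    and A: "\<And>z. norm z < R \<Longrightarrow> Re (h z) < A" and z: "norm z \<le> R / 2"
  shows "norm (h z) \<le> 2 * A"
proof -
  have A0: "A > 0" using A[of 0] R h0 by simp
  define w where "w = (\<lambda>z. h (of_real R * z) / (of_real (2 * A) - h (of_real R * z)))"
  have inb: "norm (of_real R * \<zeta>) < R" if "norm \<zeta> < 1" for \<zeta> :: complex
    using that R by (simp add: norm_mult)
  have nz: "of_real (2 * A) - h u \<noteq> 0" if "norm u < R" for u
  proof
    assume "of_real (2 * A) - h u = 0"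
    hence "Re (of_real (2 * A) - h u) = 0" by simp
    thus False using A[OF that] A0 by simp
  qed
  have lt: "norm (h u) < norm (of_real (2 * A) - h u)" if "norm u < R" for u
  proof -
    have "(norm (of_real (2 * A) - h u))\<^sup>2 - (norm (h u))\<^sup>2 = 4 * A * (A - Re (h u))"
      unfolding cmod_power2 by (simp add: power2_eq_square algebra_simps)
    also have "\<dots> > 0" using A[OF that] A0 by simp
    finally have "(norm (h u))\<^sup>2 < (norm (of_real (2 * A) - h u))\<^sup>2" by linarith
    thus ?thesis by (rule power_less_imp_less_base) simp
  qed
  have hc: "h \<circ> (\<lambda>z. of_real R * z) holomorphic_on ball 0 1"
    by (rule holomorphic_on_compose_gen[OF _ h]) (auto intro!: holomorphic_intros inb)
  have "w holomorphic_on ball 0 1"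
    unfolding w_def using hc[unfolded o_def] nz inb
    by (intro holomorphic_on_divide holomorphic_on_diff holomorphic_on_const) auto
  moreover have "w 0 = 0" by (simp add: w_def h0)
  moreover have "norm (w \<zeta>) < 1" if "norm \<zeta> < 1" for \<zeta>
    using lt[OF inb[OF that]] nz[OF inb[OF that]] by (simp add: w_def norm_divide divide_less_eq)
  moreover have "norm (z / of_real R) < 1" using z R by (simp add: norm_divide field_simps)
  ultimately have "norm (w (z / of_real R)) \<le> norm (z / of_real R)"
    using Schwarz_Lemma(1) by blast
  also have "norm (z / of_real R) \<le> 1 / 2" using z R by (simp add: norm_divide field_simps)
  finally have wz: "norm (w (z / of_real R)) \<le> 1 / 2" .
  have zR: "norm z < R" using z R by linarith
  have "norm (h z) / norm (of_real (2 * A) - h z) \<le> 1 / 2"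
    using wz R by (simp add: w_def norm_divide)
  hence "norm (h z) \<le> 1 / 2 * norm (of_real (2 * A) - h z)"
    using nz[OF zR] by (simp add: divide_le_eq)
  also have "norm (of_real (2 * A) - h z) \<le> 2 * A + norm (h z)"
    using norm_triangle_ineq4[of "of_real (2 * A)" "h z"] A0 by simp
  finally show ?thesis by simp
qed

section \<open>Dividing out the zeros in a disc\<close>

definition zero_mult :: "(complex \<Rightarrow> complex) \<Rightarrow> complex \<Rightarrow> nat" where
  "zero_mult F z = nat (zorder F z)"

definition zeros_in :: "(complex \<Rightarrow> complex) \<Rightarrow> real \<Rightarrow> complex set" where
  "zeros_in F R = {z \<in> ball 0 R. F z = 0}"

text \<open>Normalised to 1 at the origin, so that the cofactor keeps the value
  \<open>F 0\<close>.\<close>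

definition zero_poly :: "(complex \<Rightarrow> complex) \<Rightarrow> real \<Rightarrow> complex \<Rightarrow> complex" where
  "zero_poly F R s = (\<Prod>z\<in>zeros_in F R. (1 - s / z) ^ zero_mult F z)"

locale entire_nonzero =
  fixes F :: "complex \<Rightarrow> complex"
  assumes hol: "F holomorphic_on UNIV" and F0: "F 0 \<noteq> 0"
begin

lemma zorder_zero:
  assumes "F z = 0"
  shows "zorder F z > 0" "zero_mult F z > 0" "int (zero_mult F z) = zorder F z"
proof -
  have "\<exists>w\<in>UNIV. F w \<noteq> 0" using F0 by blast
  from zorder_exist_zero[OF hol open_UNIV connected_UNIV UNIV_I this, of z] assms
  show *: "zorder F z > 0" by simp
  show "zero_mult F z > 0" "int (zero_mult F z) = zorder F z" using * by (simp_all add: zero_mult_def)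
qed

lemma finite_zeros_in: "finite (zeros_in F R)"
proof (cases "F constant_on UNIV")
  case True
  hence "F z \<noteq> 0" for z using F0 by (auto simp: constant_on_def)
  thus ?thesis by (simp add: zeros_in_def)
next
  case False
  have "finite {z \<in> cball 0 R. F z = 0}"
    by (rule holomorphic_compact_finite_zeros[OF hol]) (use False in auto)
  thus ?thesis by (rule finite_subset[rotated]) (auto simp: zeros_in_def)
qed

lemma zeros_in_nonzero: "z \<in> zeros_in F R \<Longrightarrow> z \<noteq> 0"
  using F0 by (auto simp: zeros_in_def)

lemma zero_poly_holomorphic: "zero_poly F R holomorphic_on A"
  unfolding zero_poly_def[abs_def] using zeros_in_nonzero by (intro holomorphic_intros) auto

lemma zero_poly_0: "zero_poly F R 0 = 1"
  by (simp add: zero_poly_def)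

lemma zero_poly_eq_0_iff: "zero_poly F R s = 0 \<longleftrightarrow> s \<in> zeros_in F R"
proof -
  have "(1 - s / z) ^ zero_mult F z = 0 \<longleftrightarrow> s = z" if "z \<in> zeros_in F R" for z
    using zeros_in_nonzero[OF that] zorder_zero(2)[of z] that by (auto simp: zeros_in_def)
  thus ?thesis unfolding zero_poly_def using finite_zeros_in by (subst prod_zero_iff) auto
qed

lemma zorder_zero_poly:
  assumes z: "z \<in> zeros_in F R"
  shows "zorder (zero_poly F R) z = zorder F z"
proof -
  define Q where "Q = (\<lambda>s. \<Prod>w\<in>zeros_in F R - {z}. (1 - s / w) ^ zero_mult F w)"
  define g where "g = (\<lambda>s. (- 1 / z) ^ zero_mult F z * Q s)"
  have z0: "z \<noteq> 0" using zeros_in_nonzero[OF z] .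
  have "zorder (zero_poly F R) z = int (zero_mult F z)"
  proof (rule zorder_eqI[OF open_UNIV UNIV_I])
    show "g holomorphic_on UNIV" unfolding g_def Q_def
      using zeros_in_nonzero z0 by (intro holomorphic_intros) auto
    have "Q z \<noteq> 0" unfolding Q_def using finite_zeros_in zeros_in_nonzero by (subst prod_zero_iff) auto
    thus "g z \<noteq> 0" using z0 by (simp add: g_def)
    fix w :: complex
    have "1 - w / z = - 1 / z * (w - z)" using z0 by (simp add: field_simps)
    hence "zero_poly F R w = (- 1 / z * (w - z)) ^ zero_mult F z * Q w"
      unfolding zero_poly_def Q_def by (subst prod.remove[OF finite_zeros_in z]) simp
    thus "zero_poly F R w = g w * (w - z) powi int (zero_mult F z)"
      unfolding g_def by (simp only: power_mult_distrib power_int_of_nat mult_ac)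
  qed
  also have "\<dots> = zorder F z" using z by (intro zorder_zero) (simp add: zeros_in_def)
  finally show ?thesis .
qed

text \<open>The cofactor is zero-free only in the disc, but it has to be entire because it is later
  estimated on the larger circle of radius \<open>3 * R\<close>. It is glued from the local
  factorisation and the plain quotient off the zeros.\<close>

lemma zero_poly_quotient:
  assumes R: "R > 0"
  obtains G where "G holomorphic_on UNIV" "\<And>s. F s = zero_poly F R s * G s"
    "\<And>s. norm s < R \<Longrightarrow> G s \<noteq> 0"
proof -
  have ana: "F analytic_on {z}" "zero_poly F R analytic_on {z}" for z
    using hol zero_poly_holomorphic[of R UNIV] analytic_on_subset[of _ UNIV] by (auto simp: analytic_on_open)
  obtain h where h: "h holomorphic_on ball 0 R" "\<And>z. z \<in> ball 0 R \<Longrightarrow> h z \<noteq> 0"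
      "\<And>z. z \<in> ball 0 R \<Longrightarrow> F z = h z * zero_poly F R z"
  proof (rule holomorphic_zorder_factorization[of F "ball 0 R" "zero_poly F R"])
    show "F holomorphic_on ball 0 R" using hol holomorphic_on_subset by blast
    show "zero_poly F R holomorphic_on ball 0 R" by (rule zero_poly_holomorphic)
    show iff: "zero_poly F R z = 0 \<longleftrightarrow> F z = 0" if "z \<in> ball 0 R" for z
      using that by (simp add: zero_poly_eq_0_iff zeros_in_def)
    show "zorder (zero_poly F R) z = zorder F z" if z: "z \<in> ball 0 R" for z
    proof (cases "F z = 0")
      case True
      thus ?thesis using z by (intro zorder_zero_poly) (simp add: zeros_in_def)
    next
      case False
      thus ?thesis using iff[OF z] ana by (simp add: zorder_eq_0I)
    qed
  qed auto
  define G where "G = (\<lambda>s. if s \<in> ball 0 R then h s else F s / zero_poly F R s)"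
  have eq: "G s = F s / zero_poly F R s" if "s \<notin> zeros_in F R" for s
    using that h(3)[of s] zero_poly_eq_0_iff[of R s] by (auto simp: G_def)
  have "G holomorphic_on ball 0 R"
    by (rule holomorphic_transform[OF h(1)]) (simp add: G_def)
  moreover have "G holomorphic_on - zeros_in F R"
  proof (rule holomorphic_transform)
    show "(\<lambda>s. F s / zero_poly F R s) holomorphic_on - zeros_in F R"
      using holomorphic_on_subset[OF hol] zero_poly_eq_0_iff
      by (intro holomorphic_intros zero_poly_holomorphic) auto
  qed (simp add: eq)
  moreover have "open (- zeros_in F R)" using finite_zeros_in by (intro open_Compl finite_imp_closed)
  ultimately have "G holomorphic_on ball 0 R \<union> - zeros_in F R"
    by (intro holomorphic_on_Un) auto
  moreover have "ball 0 R \<union> - zeros_in F R = UNIV" by (auto simp: zeros_in_def)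
  ultimately have "G holomorphic_on UNIV" by simp
  moreover have "F s = zero_poly F R s * G s" for s
  proof (cases "s \<in> ball 0 R")
    case True
    thus ?thesis using h(3)[of s] by (simp add: G_def)
  next
    case False
    hence "s \<notin> zeros_in F R" by (simp add: zeros_in_def)
    thus ?thesis using eq[of s] zero_poly_eq_0_iff[of R s] by simp
  qed
  moreover have "G s \<noteq> 0" if "norm s < R" for s using h(2)[of s] that by (simp add: G_def)
  ultimately show ?thesis using that by blast
qed

text \<open>On the circle of radius \<open>3 * R\<close> every factor has modulus at least
  \<open>3 - 1 = 2\<close>. This gain, raised to the number of zeros, plays the part of Jensen's
  formula.\<close>

lemma norm_zero_poly_ge:
  assumes R: "R > 0" and s: "norm s = 3 * R"
  shows "norm (zero_poly F R s) \<ge> 2 ^ (\<Sum>z\<in>zeros_in F R. zero_mult F z)"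
proof -
  have "2 ^ zero_mult F z \<le> norm ((1 - s / z) ^ zero_mult F z)" if z: "z \<in> zeros_in F R" for z
  proof -
    have nz: "0 < norm z" "norm z < R" using zeros_in_nonzero[OF z] z by (auto simp: zeros_in_def)
    have "norm (s / z) \<ge> 3" using nz s by (simp add: norm_divide le_divide_eq)
    hence "norm (1 - s / z) \<ge> 2" using norm_triangle_ineq2[of "s / z" 1] by (simp add: norm_minus_commute)
    thus ?thesis unfolding norm_power by (intro power_mono) auto
  qed
  hence "(\<Prod>z\<in>zeros_in F R. 2 ^ zero_mult F z) \<le> (\<Prod>z\<in>zeros_in F R. norm ((1 - s / z) ^ zero_mult F z))"
    by (intro prod_mono) auto
  thus ?thesis by (simp add: zero_poly_def prod_norm power_sum)
qed

text \<open>By the maximum principle on the circle of radius \<open>3 * R\<close>, the cofactor is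
  at most \<open>M / 2 ^ N\<close> inside. At the origin this bounds the number \<open>N\<close> of
  zeros; in the disc it bounds the real part of the logarithm, hence \<open>g\<close> itself by
  \<open>borel_caratheodory\<close>.\<close>

theorem log_factorization:
  assumes R: "R > 0" and M: "\<And>s. norm s = 3 * R \<Longrightarrow> norm (F s) \<le> M"
  obtains g where "g holomorphic_on ball 0 R" "g 0 = Ln (F 0)"
    "\<And>s. norm s < R \<Longrightarrow> F s = zero_poly F R s * exp (g s)"
    "\<And>s. norm s \<le> R / 2 \<Longrightarrow> norm (g s - Ln (F 0)) \<le> 2 * (ln (M / norm (F 0)) + 1)"
    "2 ^ (\<Sum>z\<in>zeros_in F R. zero_mult F z) \<le> M / norm (F 0)"
proof -
  obtain G where G: "G holomorphic_on UNIV" "\<And>s. F s = zero_poly F R s * G s" "\<And>s. norm s < R \<Longrightarrow> G s \<noteq> 0"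
    using zero_poly_quotient[OF R] by blast
  define N where "N = (\<Sum>z\<in>zeros_in F R. zero_mult F z)"
  have G0: "G 0 = F 0" using G(2)[of 0] by (simp add: zero_poly_0)
  have sph: "norm (G s) \<le> M / 2 ^ N" if s: "norm s = 3 * R" for s
  proof -
    have "2 ^ N * norm (G s) \<le> norm (zero_poly F R s) * norm (G s)"
      unfolding N_def by (intro mult_right_mono norm_zero_poly_ge R s) auto
    also have "\<dots> \<le> M" using M[OF s] G(2)[of s] by (simp add: norm_mult)
    finally show ?thesis by (simp add: field_simps)
  qed
  have bd: "norm (G s) \<le> M / 2 ^ N" if s: "norm s \<le> 3 * R" for s
  proof (rule maximum_modulus_frontier[where S = "cball 0 (3 * R)" and f = G])
    show "G holomorphic_on interior (cball 0 (3 * R))" using G(1) holomorphic_on_subset by blast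
    show "continuous_on (closure (cball 0 (3 * R))) G"
      using G(1) holomorphic_on_imp_continuous_on continuous_on_subset by blast
    show "norm (G z) \<le> M / 2 ^ N" if "z \<in> frontier (cball 0 (3 * R))" for z
      using that R sph by simp
  qed (use s in auto)
  have F0p: "norm (F 0) > 0" using F0 by simp
  have "norm (F 0) \<le> M / 2 ^ N" using bd[of 0] R G0 by simp
  hence two: "2 ^ N \<le> M / norm (F 0)" using F0p by (simp add: field_simps)
  have one: "(1::real) \<le> 2 ^ N" by simp
  have MF: "M / norm (F 0) \<ge> 1" using two one by linarith
  have "norm (F 0) \<le> M" using MF F0p by (simp add: le_divide_eq)
  hence M0: "M > 0" using F0p by linarith
  obtain l where l: "l holomorphic_on ball 0 R" "\<And>s. s \<in> ball 0 R \<Longrightarrow> G s = exp (l s)"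
    by (rule contractible_imp_holomorphic_log[of G "ball 0 R"])
       (use G holomorphic_on_subset in \<open>auto intro: convex_imp_contractible\<close>)
  define g where "g = (\<lambda>s. l s - l 0 + Ln (F 0))"
  have "exp (l 0) = F 0" using l(2)[of 0] R G0 by simp
  hence eg: "exp (g s) = exp (l s)" for s using F0 by (simp add: g_def exp_add exp_diff)
  have gh: "g holomorphic_on ball 0 R" unfolding g_def by (intro holomorphic_intros l)
  have gF: "F s = zero_poly F R s * exp (g s)" if "norm s < R" for s
    using G(2)[of s] l(2)[of s] that eg[of s] by simp
  have "norm (g s - Ln (F 0)) \<le> 2 * (ln (M / norm (F 0)) + 1)" if s: "norm s \<le> R / 2" for s
  proof (rule borel_caratheodory[where R = R and h = "\<lambda>s. g s - Ln (F 0)"])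
    show "(\<lambda>s. g s - Ln (F 0)) holomorphic_on ball 0 R" by (intro holomorphic_intros gh)
    fix z :: complex assume z: "norm z < R"
    have "exp (Re (g z - Ln (F 0))) = norm (exp (g z - Ln (F 0)))" by (simp only: norm_exp_eq_Re)
    also have "\<dots> = norm (G z) / norm (F 0)"
      using F0 l(2)[of z] z eg[of z] by (simp add: exp_diff norm_divide)
    also have "\<dots> \<le> M / norm (F 0)"
    proof (rule divide_right_mono)
      have "norm (G z) \<le> M / 2 ^ N" using z R by (intro bd) auto
      also have "\<dots> \<le> M / 1" using M0 one by (intro divide_left_mono) auto
      finally show "norm (G z) \<le> M" by simp
    qed simp
    finally have "Re (g z - Ln (F 0)) \<le> ln (M / norm (F 0))"
      using MF by (simp add: ln_ge_iff)
    thus "Re (g z - Ln (F 0)) < ln (M / norm (F 0)) + 1" by simp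
  qed (use R s in \<open>auto simp: g_def\<close>)
  moreover have "g 0 = Ln (F 0)" by (simp add: g_def)
  ultimately show ?thesis using that gh gF two unfolding N_def by blast
qed

end

section \<open>Functions that commute with conjugation\<close>

lemma cnj_sum_symmetric:
  assumes "\<And>z. z \<in> Z \<Longrightarrow> cnj z \<in> Z" "\<And>z. z \<in> Z \<Longrightarrow> h (cnj z) = cnj (h z)"
  shows "Im (\<Sum>z\<in>Z. h z) = 0"
proof -
  define S where "S = (\<Sum>z\<in>Z. h z)"
  have "S = (\<Sum>z\<in>Z. cnj (h z))" unfolding S_def
    by (rule sum.reindex_bij_witness[of _ cnj cnj]) (use assms in auto)
  also have "\<dots> = cnj S" by (simp add: S_def)
  finally have "Im S = Im (cnj S)" by (rule arg_cong)
  thus ?thesis by (simp add: S_def[symmetric])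
qed

lemma cnj_prod_symmetric:
  assumes "\<And>z. z \<in> Z \<Longrightarrow> cnj z \<in> Z" "\<And>z. z \<in> Z \<Longrightarrow> h (cnj z) = cnj (h z)"
  shows "Im (\<Prod>z\<in>Z. h z) = 0"
proof -
  define S where "S = (\<Prod>z\<in>Z. h z)"
  have "S = (\<Prod>z\<in>Z. cnj (h z))" unfolding S_def
    by (rule prod.reindex_bij_witness[of _ cnj cnj]) (use assms in auto)
  also have "\<dots> = cnj S" by (simp add: S_def)
  finally have "Im S = Im (cnj S)" by (rule arg_cong)
  thus ?thesis by (simp add: S_def[symmetric])
qed

locale entire_symmetric = entire_nonzero +
  assumes sym: "\<And>s. F (cnj s) = cnj (F s)"
begin

lemma zeros_in_cnj: "z \<in> zeros_in F R \<Longrightarrow> cnj z \<in> zeros_in F R"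
  by (simp add: zeros_in_def sym)

text \<open>Conjugating the local factorisation at \<open>z\<close> on both sides gives one at
  \<open>cnj z\<close> with the same exponent.\<close>

lemma zorder_cnj_zero:
  assumes "F z = 0"
  shows "zorder F (cnj z) = zorder F z"
proof -
  have "\<exists>w\<in>UNIV. F w \<noteq> 0" using F0 by blast
  from zorder_exist_zero[OF hol open_UNIV connected_UNIV UNIV_I this, of z] assms
  obtain r where r: "zorder F z > 0" "r > 0" "zor_poly F z holomorphic_on cball z r"
    "\<And>w. w \<in> cball z r \<Longrightarrow> F w = zor_poly F z w * (w - z) ^ nat (zorder F z)"
    "\<And>w. w \<in> cball z r \<Longrightarrow> zor_poly F z w \<noteq> 0" by auto
  have im: "cnj w \<in> ball z r" if "w \<in> ball (cnj z) r" for w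
  proof -
    have "dist z (cnj w) = dist (cnj z) w"
      by (metis complex_cnj_cnj complex_cnj_diff complex_mod_cnj dist_norm)
    thus ?thesis using that by simp
  qed
  show ?thesis
  proof (rule zorder_eqI[of "ball (cnj z) r" _ "cnj \<circ> zor_poly F z \<circ> cnj"])
    have "zor_poly F z holomorphic_on cnj ` ball (cnj z) r"
      by (rule holomorphic_on_subset[OF r(3)]) (use im in force)
    thus "cnj \<circ> zor_poly F z \<circ> cnj holomorphic_on ball (cnj z) r"
      by (intro holomorphic_on_compose_cnj_cnj) auto
    fix w assume w: "w \<in> ball (cnj z) r"
    have "F w = cnj (F (cnj w))" by (simp add: sym)
    also have "F (cnj w) = zor_poly F z (cnj w) * (cnj w - z) ^ nat (zorder F z)"
      using im[OF w] by (intro r(4)) auto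
    finally have e: "F w = (cnj \<circ> zor_poly F z \<circ> cnj) w * (w - cnj z) ^ nat (zorder F z)" by simp
    have "(w - cnj z) ^ nat (zorder F z) = (w - cnj z) powi zorder F z"
      using r(1) power_int_of_nat[of "w - cnj z" "nat (zorder F z)"] by simp
    thus "F w = (cnj \<circ> zor_poly F z \<circ> cnj) w * (w - cnj z) powi zorder F z" using e by simp
  qed (use r in auto)
qed

lemma zero_mult_cnj: "F z = 0 \<Longrightarrow> zero_mult F (cnj z) = zero_mult F z"
  by (simp add: zero_mult_def zorder_cnj_zero)

lemma zero_poly_real: "Im (zero_poly F R (of_real x)) = 0"
  unfolding zero_poly_def
proof (rule cnj_prod_symmetric)
  fix z assume z: "z \<in> zeros_in F R"
  hence "F z = 0" by (simp add: zeros_in_def)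
  thus "(1 - complex_of_real x / cnj z) ^ zero_mult F (cnj z) = cnj ((1 - complex_of_real x / z) ^ zero_mult F z)"
    by (simp add: zero_mult_cnj)
qed (rule zeros_in_cnj)

text \<open>Along the segment \<open>g\<close> and its conjugate are continuous logarithms of the
  same zero-free real quotient, and they agree at 0, where \<open>Ln (F 0)\<close> is real.\<close>

lemma log_real_on_segment:
  assumes g: "g holomorphic_on ball 0 R" "g 0 = Ln (F 0)"
    "\<And>s. norm s < R \<Longrightarrow> F s = zero_poly F R s * exp (g s)"
    and ab: "a \<le> 0" "0 \<le> b" "- R < a" "b < R"
    and pos: "\<And>x. a \<le> x \<Longrightarrow> x \<le> b \<Longrightarrow> F (of_real x) \<noteq> 0"
    and F0pos: "F 0 \<in> \<real>\<^sub>\<ge>\<^sub>0"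
    and x: "a \<le> x" "x \<le> b"
  shows "Im (g (of_real x)) = 0"
proof -
  have inb: "of_real x \<in> ball (0::complex) R" if "x \<in> {a..b}" for x using that ab by auto
  have "continuous_on (ball 0 R) g" using g(1) holomorphic_on_imp_continuous_on by blast
  hence c: "continuous_on {a..b} (\<lambda>x. g (of_real x))"
    by (rule continuous_on_compose2) (use inb in \<open>auto intro!: continuous_intros\<close>)
  have r: "r0 \<in> \<real>\<^sub>\<ge>\<^sub>0 \<Longrightarrow> r0 \<noteq> 0 \<Longrightarrow> Im (Ln r0) = 0" for r0
    using Im_Ln_eq_0[of r0] by (auto simp: nonneg_Reals_def complex_eq_iff)
  have "(\<lambda>x. g (of_real x)) x = (\<lambda>x. cnj (g (of_real x))) x"
  proof (rule continuous_log_unique[where S = "{a..b}" and a = 0])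
    show "continuous_on {a..b} (\<lambda>x. cnj (g (of_real x)))" by (intro continuous_intros c)
    show "g (of_real 0) = cnj (g (of_real 0))"
      using r[OF F0pos F0] g(2) by (simp add: complex_eq_iff)
    fix y assume y: "y \<in> {a..b}"
    have nF: "F (of_real y) \<noteq> 0" using pos y by auto
    have e: "F (of_real y) = zero_poly F R (of_real y) * exp (g (of_real y))"
      using inb[OF y] by (intro g(3)) simp
    have P: "cnj (zero_poly F R (of_real y)) = zero_poly F R (of_real y)"
      using zero_poly_real by (simp add: complex_eq_iff)
    have "cnj (F (of_real y)) = F (of_real y)" using sym[of "of_real y"] by simp
    hence "zero_poly F R (of_real y) * exp (cnj (g (of_real y))) = zero_poly F R (of_real y) * exp (g (of_real y))"
      unfolding e by (simp add: P exp_cnj)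
    thus "exp (g (of_real y)) = exp (cnj (g (of_real y)))" using nF e by auto
  qed (use c ab x in auto)
  thus ?thesis by (simp add: complex_eq_iff)
qed

end

section \<open>The weight on vertical lines\<close>

lemma integrable_exp_abs:
  assumes a: "a > (0::real)"
  shows "integrable lborel (\<lambda>t. exp (- a * \<bar>t\<bar>))"
proof -
  have "((\<lambda>t. exp (- a * t)) has_integral exp (- a * 0) / a) {0..}"
    by (rule has_integral_exp_minus_to_infinity[OF a])
  hence "(\<lambda>t. exp (- a * t)) absolutely_integrable_on {0..}"
    by (intro nonnegative_absolutely_integrable_1) auto
  hence i1: "integrable lborel (\<lambda>t. indicator {0..} t *\<^sub>R exp (- a * t))"
    unfolding set_integrable_def by (subst (asm) integrable_completion) auto
  have i2: "integrable lborel (\<lambda>t. indicator {0..} (0 + (-1) * t) *\<^sub>R exp (- a * (0 + (-1) * t)))"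
    by (rule lborel_integrable_real_affine[OF i1]) simp
  show ?thesis
  proof (rule Bochner_Integration.integrable_bound[OF Bochner_Integration.integrable_add[OF i1 i2]])
    show "AE t in lborel. norm (exp (- a * \<bar>t\<bar>)) \<le> norm (indicator {0..} t *\<^sub>R exp (- a * t)
        + indicator {0..} (0 + (-1) * t) *\<^sub>R exp (- a * (0 + (-1) * t)))"
    proof (rule AE_I2)
      fix t :: real
      show "norm (exp (- a * \<bar>t\<bar>)) \<le> norm (indicator {0..} t *\<^sub>R exp (- a * t)
          + indicator {0..} (0 + (-1) * t) *\<^sub>R exp (- a * (0 + (-1) * t)))"
        by (cases "t = 0"; cases "t > 0") (auto simp: indicator_def)
    qed
  qed simp
qed

text \<open>Its value is 8. It is the mass of the decay that is left once
  \<open>exp (- T / 4)\<close> has been taken out of the tail.\<close>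

definition exp_const :: real where
  "exp_const = (\<integral>t. exp (- (1 / 4) * \<bar>t\<bar>) \<partial>lborel)"

lemma exp_const_nonneg: "exp_const \<ge> 0"
  unfolding exp_const_def by (rule Bochner_Integration.integral_nonneg) simp

lemma integrable_exp_decay:
  fixes f :: "real \<Rightarrow> complex"
  assumes f: "f \<in> borel_measurable lborel" and b: "\<And>t. norm (f t) \<le> A * exp (- \<bar>t\<bar> / 2)"
  shows "integrable lborel f"
proof (rule Bochner_Integration.integrable_bound[OF _ f])
  show "integrable lborel (\<lambda>t. A * exp (- (1 / 2) * \<bar>t\<bar>))"
    by (intro integrable_mult_right integrable_exp_abs) simp
  show "AE t in lborel. norm (f t) \<le> norm (A * exp (- (1 / 2) * \<bar>t\<bar>))"
  proof (rule AE_I2)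
    fix t :: real
    have "norm (f t) \<le> A * exp (- (1 / 2) * \<bar>t\<bar>)" using b[of t] by simp
    thus "norm (f t) \<le> norm (A * exp (- (1 / 2) * \<bar>t\<bar>))" by (simp only: real_norm_def)
  qed
qed

text \<open>Outside the interval \<open>\<bar>t\<bar> \<ge> T\<close>, so half of the exponent
  \<open>- \<bar>t\<bar> / 2\<close> is spent on \<open>- T / 4\<close> and the other half keeps the
  tail integrable.\<close>

lemma truncation_error:
  fixes f :: "real \<Rightarrow> complex"
  assumes f: "f \<in> borel_measurable lborel" and b: "\<And>t. norm (f t) \<le> A * exp (- \<bar>t\<bar> / 2)"
  shows "norm ((\<integral>t. f t \<partial>lborel) - integral {- T..T} f) \<le> A * exp (- T / 4) * exp_const"
proof -
  have A0: "A \<ge> 0" using b[of 0] norm_ge_zero[of "f 0"] by (simp del: norm_ge_zero)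
  have i: "integrable lborel f" by (rule integrable_exp_decay[OF f b])
  have si: "set_integrable lborel {- T..T} f"
    unfolding set_integrable_def by (intro integrable_mult_indicator i) simp
  have "integral {- T..T} f = (\<integral>t. indicator {- T..T} t *\<^sub>R f t \<partial>lborel)"
    using set_borel_integral_eq_integral(2)[OF si] by (simp add: set_lebesgue_integral_def)
  hence "(\<integral>t. f t \<partial>lborel) - integral {- T..T} f = (\<integral>t. f t - indicator {- T..T} t *\<^sub>R f t \<partial>lborel)"
    using Bochner_Integration.integral_diff[OF i si[unfolded set_integrable_def]] by simp
  also have "norm \<dots> \<le> (\<integral>t. A * exp (- T / 4) * exp (- (1 / 4) * \<bar>t\<bar>) \<partial>lborel)"
  proof (rule Bochner_Integration.integral_norm_bound_integral)
    show "integrable lborel (\<lambda>t. f t - indicator {- T..T} t *\<^sub>R f t)"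
      using Bochner_Integration.integrable_diff[OF i si[unfolded set_integrable_def]] .
    show "integrable lborel (\<lambda>t. A * exp (- T / 4) * exp (- (1 / 4) * \<bar>t\<bar>))"
      by (intro integrable_mult_right integrable_exp_abs) simp
    fix t :: real
    show "norm (f t - indicator {- T..T} t *\<^sub>R f t) \<le> A * exp (- T / 4) * exp (- (1 / 4) * \<bar>t\<bar>)"
    proof (cases "t \<in> {- T..T}")
      case True
      thus ?thesis using A0 by simp
    next
      case False
      hence t: "\<bar>t\<bar> \<ge> T" by auto
      have "norm (f t - indicator {- T..T} t *\<^sub>R f t) \<le> A * exp (- \<bar>t\<bar> / 2)" using False b[of t] by simp
      also have "exp (- \<bar>t\<bar> / 2) \<le> exp (- T / 4 + - (1 / 4) * \<bar>t\<bar>)" using t by simp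
      also have "\<dots> = exp (- T / 4) * exp (- (1 / 4) * \<bar>t\<bar>)" by (rule exp_add)
      finally show ?thesis using A0 by (simp add: mult.assoc mult_left_mono)
    qed
  qed
  also have "\<dots> = A * exp (- T / 4) * exp_const"
    by (simp add: exp_const_def)
  finally show ?thesis .
qed

lemma one_plus_abs_le_exp: "(1 + \<bar>t\<bar>) * exp (- \<bar>t\<bar>) \<le> 2 * exp (- \<bar>t\<bar> / 2)" for t :: real
proof -
  have "1 + \<bar>t\<bar> \<le> 2 * exp (\<bar>t\<bar> / 2)" using exp_ge_add_one_self[of "\<bar>t\<bar> / 2"] by linarith
  hence "(1 + \<bar>t\<bar>) * exp (- \<bar>t\<bar>) \<le> 2 * exp (\<bar>t\<bar> / 2) * exp (- \<bar>t\<bar>)" by (intro mult_right_mono) auto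
  also have "\<dots> = 2 * exp (\<bar>t\<bar> / 2 + - \<bar>t\<bar>)" unfolding exp_add by simp
  also have "\<bar>t\<bar> / 2 + - \<bar>t\<bar> = - \<bar>t\<bar> / 2" by simp
  finally show ?thesis .
qed

lemma norm_Ln_le:
  assumes "norm z \<ge> 1"
  shows "norm (Ln z) \<le> norm z + 4"
proof -
  have z: "z \<noteq> 0" using assms by auto
  have "norm (Ln z) \<le> \<bar>Re (Ln z)\<bar> + \<bar>Im (Ln z)\<bar>" by (rule cmod_le)
  also have "\<bar>Re (Ln z)\<bar> = ln (norm z)" using z assms by simp
  also have "ln (norm z) \<le> norm z" using assms ln_bound[of "norm z"] by linarith
  also have "\<bar>Im (Ln z)\<bar> \<le> 4" using mpi_less_Im_Ln[OF z] Im_Ln_le_pi[OF z] pi_less_4 by linarith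
  finally show ?thesis by simp
qed

text \<open>Cauchy's formula on the rectangle, divided by \<open>\<i>\<close> because the vertical
  sides are parametrised by \<open>t\<close>; hence \<open>2 * pi\<close> in place of
  \<open>2 * pi * \<i>\<close>. The two horizontal sides have length 3 and cost \<open>3 * B\<close>
  each.\<close>

lemma rectangle_cauchy_bound:
  fixes a :: complex
  assumes e: "e holomorphic_on S" and S: "cbox (Complex (-1) (- T)) (Complex 2 T) \<subseteq> S" "open S"
    and a: "a \<in> box (Complex (-1) (- T)) (Complex 2 T)"
    and B: "\<And>\<sigma>. -1 \<le> \<sigma> \<Longrightarrow> \<sigma> \<le> 2 \<Longrightarrow> norm (e (Complex \<sigma> T) / (Complex \<sigma> T - a)) \<le> B"
           "\<And>\<sigma>. -1 \<le> \<sigma> \<Longrightarrow> \<sigma> \<le> 2 \<Longrightarrow> norm (e (Complex \<sigma> (- T)) / (Complex \<sigma> (- T) - a)) \<le> B"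
  shows "norm (integral {- T..T} (\<lambda>t. e (Complex 2 t) / (Complex 2 t - a))
      - integral {- T..T} (\<lambda>t. e (Complex (-1) t) / (Complex (-1) t - a)) - 2 * of_real pi * e a) \<le> 6 * B"
proof -
  have T: "T > 0" using a by (auto simp: in_box_complex_iff)
  define f where "f = (\<lambda>s. e s / (s - a))"
  define p1 where "p1 = Complex (-1) (- T)"
  define p2 where "p2 = Complex 2 (- T)"
  define p3 where "p3 = Complex 2 T"
  define p4 where "p4 = Complex (-1) T"
  define Q where "Q = cbox p1 p3"
  have QS: "Q \<subseteq> S" using S by (simp add: Q_def p1_def p3_def)
  have eQ: "e holomorphic_on Q" by (rule holomorphic_on_subset[OF e QS])
  have rp: "rectpath p1 p3 = linepath p1 p2 +++ linepath p2 p3 +++ linepath p3 p4 +++ linepath p4 p1"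
    by (simp add: rectpath_def Let_def p1_def p2_def p3_def p4_def)
  have pim: "path_image (rectpath p1 p3) \<subseteq> Q - {a}"
  proof -
    have "path_image (rectpath p1 p3) = cbox p1 p3 - box p1 p3"
      using T by (intro path_image_rectpath_cbox_minus_box) (auto simp: p1_def p3_def)
    thus ?thesis using a by (auto simp: Q_def p1_def p3_def)
  qed
  have "((\<lambda>s. e s / (s - a)) has_contour_integral of_real (2 * pi) * \<i> * winding_number (rectpath p1 p3) a * e a) (rectpath p1 p3)"
  proof (rule Cauchy_integral_formula_convex_simple[where S = Q])
    show "convex Q" by (simp add: Q_def)
    show "a \<in> interior Q" using a by (simp add: Q_def interior_cbox p1_def p3_def)
  qed (use eQ pim in auto)
  also have "winding_number (rectpath p1 p3) a = 1"
    using a by (intro winding_number_rectpath) (simp add: p1_def p3_def)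
  finally have ci: "contour_integral (rectpath p1 p3) f = 2 * of_real pi * \<i> * e a"
    by (simp add: contour_integral_unique f_def)
  have cf: "continuous_on (Q - {a}) f"
    unfolding f_def using holomorphic_on_imp_continuous_on[OF eQ]
    by (intro continuous_intros) (auto intro: continuous_on_subset)
  have segs: "closed_segment p1 p2 \<subseteq> Q - {a}" "closed_segment p2 p3 \<subseteq> Q - {a}"
    "closed_segment p3 p4 \<subseteq> Q - {a}" "closed_segment p4 p1 \<subseteq> Q - {a}"
    using pim unfolding rp by (auto simp: path_image_join)
  have int: "f contour_integrable_on linepath p1 p2" "f contour_integrable_on linepath p2 p3"
    "f contour_integrable_on linepath p3 p4" "f contour_integrable_on linepath p4 p1"
    by (rule contour_integrable_continuous_linepath, rule continuous_on_subset[OF cf], rule segs)+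
  have c1: "contour_integral (rectpath p1 p3) f = contour_integral (linepath p1 p2) f + (contour_integral (linepath p2 p3) f
      + (contour_integral (linepath p3 p4) f + contour_integral (linepath p4 p1) f))"
    unfolding rp using int by (simp add: contour_integral_join contour_integrable_join)
  have c2: "contour_integral (linepath p2 p3) f = \<i> * integral {- T..T} (\<lambda>t. f (Complex 2 t))"
    using T by (intro contour_integral_linepath_same_Re) (auto simp: p2_def p3_def)
  have c3: "contour_integral (linepath p1 p4) f = \<i> * integral {- T..T} (\<lambda>t. f (Complex (-1) t))"
    using T by (intro contour_integral_linepath_same_Re) (auto simp: p1_def p4_def)
  have c4: "contour_integral (linepath p4 p1) f = - contour_integral (linepath p1 p4) f"
    by (rule contour_integral_reverse_linepath)
       (rule continuous_on_subset[OF cf segs(4)])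
  define X where "X = integral {- T..T} (\<lambda>t. f (Complex 2 t))"
  define Y where "Y = integral {- T..T} (\<lambda>t. f (Complex (-1) t))"
  define E where "E = e a"
  have "\<i> * (X - Y - 2 * of_real pi * E) = \<i> * X - \<i> * Y - 2 * of_real pi * \<i> * E"
    by (simp add: algebra_simps)
  also have "\<dots> = contour_integral (linepath p2 p3) f - contour_integral (linepath p1 p4) f - contour_integral (rectpath p1 p3) f"
    unfolding c2 c3 ci X_def Y_def E_def ..
  also have "\<dots> = - (contour_integral (linepath p1 p2) f + contour_integral (linepath p3 p4) f)"
    unfolding c1 c4 by simp
  finally have eq: "\<i> * (X - Y - 2 * of_real pi * E)
      = - (contour_integral (linepath p1 p2) f + contour_integral (linepath p3 p4) f)" .
  have hseg: "z = Complex (Re z) y \<and> -1 \<le> Re z \<and> Re z \<le> 2"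
    if z: "z \<in> closed_segment p q" and pq: "-1 \<le> Re p" "Re p \<le> 2" "Im p = y" "-1 \<le> Re q" "Re q \<le> 2" "Im q = y"
    for z p q y
  proof -
    have "closed_segment p q \<subseteq> ({z. Re z \<ge> -1} \<inter> {z. Re z \<le> 2}) \<inter> ({z. Im z \<ge> y} \<inter> {z. Im z \<le> y})"
    proof (rule closed_segment_subset)
      show "convex (({z. Re z \<ge> -1} \<inter> {z. Re z \<le> 2}) \<inter> ({z. Im z \<ge> y} \<inter> {z. Im z \<le> y}))"
        by (intro convex_Int convex_halfspace_Re_ge convex_halfspace_Re_le convex_halfspace_Im_ge convex_halfspace_Im_le)
    qed (simp_all add: pq)
    with z have "z \<in> ({z. Re z \<ge> -1} \<inter> {z. Re z \<le> 2}) \<inter> ({z. Im z \<ge> y} \<inter> {z. Im z \<le> y})" by (rule rev_subsetD)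
    thus ?thesis by (simp add: complex_eq_iff)
  qed
  have B0: "B \<ge> 0" using order_trans[OF norm_ge_zero B(1)[of 0]] by simp
  have b1: "norm (contour_integral (linepath p1 p2) f) \<le> B * norm (p2 - p1)"
  proof (rule contour_integral_bound_linepath[OF int(1) B0])
    fix z assume "z \<in> closed_segment p1 p2"
    hence z: "z = Complex (Re z) (- T)" "-1 \<le> Re z" "Re z \<le> 2"
      using hseg[of z p1 p2 "- T"] by (simp_all add: p1_def p2_def)
    show "norm (f z) \<le> B" unfolding f_def using B(2)[OF z(2,3)] unfolding z(1)[symmetric] .
  qed
  have b2: "norm (contour_integral (linepath p3 p4) f) \<le> B * norm (p4 - p3)"
  proof (rule contour_integral_bound_linepath[OF int(3) B0])
    fix z assume "z \<in> closed_segment p3 p4"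
    hence z: "z = Complex (Re z) T" "-1 \<le> Re z" "Re z \<le> 2"
      using hseg[of z p3 p4 T] by (simp_all add: p3_def p4_def)
    show "norm (f z) \<le> B" unfolding f_def using B(1)[OF z(2,3)] unfolding z(1)[symmetric] .
  qed
  have n: "norm (p2 - p1) = 3" "norm (p4 - p3) = 3"
    by (simp_all add: p1_def p2_def p3_def p4_def cmod_def)
  have "norm (X - Y - 2 * of_real pi * E) = norm (\<i> * (X - Y - 2 * of_real pi * E))"
    by (simp only: norm_mult norm_ii mult_1_left)
  also have "\<dots> \<le> norm (contour_integral (linepath p1 p2) f) + norm (contour_integral (linepath p3 p4) f)"
    unfolding eq norm_minus_cancel by (rule norm_triangle_ineq)
  also have "\<dots> \<le> B * 3 + B * 3" using b1 b2 unfolding n by (rule add_mono)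
  finally show ?thesis unfolding X_def Y_def E_def f_def by simp
qed

section \<open>The kernel and its decay between the lines\<close>

locale smoothed =
  fixes x lam :: real and \<Phi> :: "complex \<Rightarrow> complex"
  assumes x: "x > 0" and lam: "lam > 0" and Phi: "is_Phi_hat x lam \<Phi>"
begin

abbreviation \<phi> where "\<phi> \<equiv> phi_hat x lam"

text \<open>The entire numerator of \<open>\<phi>\<close>. With it the pole of \<open>\<phi>\<close>
  at 0 becomes a Cauchy kernel at the point 0.\<close>

definition weight :: "complex \<Rightarrow> complex" where
  "weight s = of_real x powr s * exp ((of_real lam)\<^sup>2 * s\<^sup>2 / 2)"

lemma phi_eq_weight: "\<phi> s = weight s / s"
  by (simp add: phi_hat_def weight_def)

lemma weight_holomorphic: "weight holomorphic_on A"
  unfolding weight_def[abs_def] using x by (intro holomorphic_intros) auto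

lemma weight_0: "weight 0 = 1"
  using x by (simp add: weight_def)

lemma phi_holomorphic: "\<phi> holomorphic_on - {0}"
  unfolding phi_eq_weight[abs_def] by (intro holomorphic_intros weight_holomorphic) auto

lemma phi_cnj: "\<phi> (cnj s) = cnj (\<phi> s)"
  unfolding phi_hat_def using x by (simp add: cnj_powr exp_cnj)

text \<open>Trades the Gaussian for \<open>exp (- \<bar>t\<bar>)\<close>: for
  \<open>\<bar>\<sigma>\<bar> \<le> 2\<close> the first two terms bound the part of the exponent
  depending on \<open>\<sigma>\<close>, and completing the square in
  \<open>lam * \<bar>t\<bar>\<close> gives \<open>1 / (2 * lam^2)\<close>.\<close>

definition decay_const :: real where
  "decay_const = exp (2 * \<bar>ln x\<bar> + 2 * lam\<^sup>2 + 1 / (2 * lam\<^sup>2))"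

lemma decay_const_pos: "decay_const > 0"
  by (simp add: decay_const_def)

lemma norm_weight_le:
  assumes s: "-1 \<le> \<sigma>" "\<sigma> \<le> 2"
  shows "norm (weight (Complex \<sigma> t)) \<le> decay_const * exp (- \<bar>t\<bar>)"
proof -
  let ?s = "Complex \<sigma> t"
  have n1: "norm (of_real x powr ?s) = exp (\<sigma> * ln x)"
    using x by (simp add: norm_powr_real_powr powr_def)
  have "Re ((of_real lam)\<^sup>2 * ?s\<^sup>2 / 2) = lam\<^sup>2 * (\<sigma>\<^sup>2 - t\<^sup>2) / 2"
    by (simp add: power2_eq_square algebra_simps)
  hence n2: "norm (exp ((of_real lam)\<^sup>2 * ?s\<^sup>2 / 2)) = exp (lam\<^sup>2 * (\<sigma>\<^sup>2 - t\<^sup>2) / 2)"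
    by (simp only: norm_exp_eq_Re)
  have a: "\<sigma> * ln x \<le> 2 * \<bar>ln x\<bar>"
  proof -
    have "\<sigma> * ln x \<le> \<bar>\<sigma>\<bar> * \<bar>ln x\<bar>" by (metis abs_ge_self abs_mult)
    also have "\<dots> \<le> 2 * \<bar>ln x\<bar>" using s by (intro mult_right_mono) auto
    finally show ?thesis .
  qed
  have b: "lam\<^sup>2 * \<sigma>\<^sup>2 / 2 \<le> 2 * lam\<^sup>2"
  proof -
    have "\<bar>\<sigma>\<bar> \<le> 2" using s by auto
    hence "\<sigma>\<^sup>2 \<le> 2\<^sup>2" by (metis abs_ge_zero power2_abs power_mono)
    hence "lam\<^sup>2 * \<sigma>\<^sup>2 \<le> lam\<^sup>2 * 4" by (intro mult_left_mono) auto
    thus ?thesis by linarith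
  qed
  have c: "- (lam\<^sup>2 * t\<^sup>2 / 2) \<le> - \<bar>t\<bar> + 1 / (2 * lam\<^sup>2)"
  proof -
    have "0 \<le> (lam * \<bar>t\<bar> - 1 / lam)\<^sup>2" by simp
    also have "\<dots> = lam\<^sup>2 * t\<^sup>2 - 2 * \<bar>t\<bar> + 1 / lam\<^sup>2"
      using lam by (simp add: power2_diff power_mult_distrib power_divide)
    finally show ?thesis by simp
  qed
  have "norm (weight ?s) = exp (\<sigma> * ln x + lam\<^sup>2 * (\<sigma>\<^sup>2 - t\<^sup>2) / 2)"
    by (simp only: weight_def norm_mult n1 n2 exp_add)
  also have "\<sigma> * ln x + lam\<^sup>2 * (\<sigma>\<^sup>2 - t\<^sup>2) / 2 \<le> (2 * \<bar>ln x\<bar> + 2 * lam\<^sup>2 + 1 / (2 * lam\<^sup>2)) + - \<bar>t\<bar>"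
    using a b c by (simp add: right_diff_distrib diff_divide_distrib)
  also have "exp \<dots> = decay_const * exp (- \<bar>t\<bar>)" unfolding decay_const_def by (rule exp_add)
  finally show ?thesis by simp
qed

lemma norm_phi_le:
  assumes "-1 \<le> \<sigma>" "\<sigma> \<le> 2" "norm (Complex \<sigma> t) \<ge> 1"
  shows "norm (\<phi> (Complex \<sigma> t)) \<le> decay_const * exp (- \<bar>t\<bar>)"
proof -
  have "norm (\<phi> (Complex \<sigma> t)) \<le> norm (weight (Complex \<sigma> t)) / 1"
    unfolding phi_eq_weight norm_divide using assms(3) by (intro divide_left_mono) auto
  thus ?thesis using norm_weight_le[OF assms(1,2), of t] by simp
qed

lemma norm_phi_line:
  assumes "c = -1 \<or> c = 2"
  shows "norm (\<phi> (Complex c t)) \<le> decay_const * exp (- \<bar>t\<bar>)"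
  using assms abs_Re_le_cmod[of "Complex c t"] by (intro norm_phi_le) auto

lemma continuous_phi_line:
  assumes "c \<noteq> 0"
  shows "continuous_on UNIV (\<lambda>t. \<phi> (Complex c t))"
proof -
  have "continuous_on (- {0}) \<phi>" by (rule holomorphic_on_imp_continuous_on[OF phi_holomorphic])
  moreover have "continuous_on UNIV (\<lambda>t. Complex c t)"
    unfolding Complex_eq by (intro continuous_intros)
  ultimately show ?thesis
    by (rule continuous_on_compose2) (use assms in \<open>auto simp: complex_eq_iff\<close>)
qed

text \<open>Linear growth covers constants and the principal logarithms of linear factors; it is
  absorbed by half of the exponential decay.\<close>

lemma phi_line_mult:
  fixes h :: "real \<Rightarrow> complex"
  assumes c: "c = -1 \<or> c = 2" and h: "continuous_on UNIV h" and b: "\<And>t. norm (h t) \<le> A * (1 + \<bar>t\<bar>)"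
  shows "integrable lborel (\<lambda>t. \<phi> (Complex c t) * h t)"
    and "norm ((\<integral>t. \<phi> (Complex c t) * h t \<partial>lborel) - integral {- T..T} (\<lambda>t. \<phi> (Complex c t) * h t))
       \<le> 2 * decay_const * A * exp (- T / 4) * exp_const"
proof -
  have A: "A \<ge> 0" using order_trans[OF norm_ge_zero b[of 0]] by simp
  have m: "(\<lambda>t. \<phi> (Complex c t) * h t) \<in> borel_measurable lborel"
    using c by (simp, intro borel_measurable_continuous_onI continuous_intros continuous_phi_line h) auto
  have bd: "norm (\<phi> (Complex c t) * h t) \<le> 2 * decay_const * A * exp (- \<bar>t\<bar> / 2)" for t
  proof -
    have "norm (\<phi> (Complex c t) * h t) \<le> (decay_const * exp (- \<bar>t\<bar>)) * (A * (1 + \<bar>t\<bar>))"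
      unfolding norm_mult using decay_const_pos by (intro mult_mono norm_phi_line c b) auto
    also have "\<dots> = decay_const * A * ((1 + \<bar>t\<bar>) * exp (- \<bar>t\<bar>))" by simp
    also have "\<dots> \<le> decay_const * A * (2 * exp (- \<bar>t\<bar> / 2))"
      using A decay_const_pos by (intro mult_left_mono one_plus_abs_le_exp) auto
    finally show ?thesis by simp
  qed
  show "integrable lborel (\<lambda>t. \<phi> (Complex c t) * h t)" by (rule integrable_exp_decay[OF m bd])
  show "norm ((\<integral>t. \<phi> (Complex c t) * h t \<partial>lborel) - integral {- T..T} (\<lambda>t. \<phi> (Complex c t) * h t))
       \<le> 2 * decay_const * A * exp (- T / 4) * exp_const"
    by (rule truncation_error[OF m bd])
qed

text \<open>Cauchy's formula for \<open>weight * h\<close> with kernel point 0. The residue is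
  \<open>h 0\<close> because \<open>weight 0 = 1\<close>.\<close>

lemma shift_bound:
  assumes h: "h holomorphic_on S" and S: "open S" "cbox (Complex (-1) (- T)) (Complex 2 T) \<subseteq> S" and T: "T \<ge> 1"
    and B: "\<And>s. -1 \<le> Re s \<Longrightarrow> Re s \<le> 2 \<Longrightarrow> \<bar>Im s\<bar> = T \<Longrightarrow> norm (h s) \<le> B"
  shows "norm (integral {- T..T} (\<lambda>t. \<phi> (Complex 2 t) * h (Complex 2 t))
      - integral {- T..T} (\<lambda>t. \<phi> (Complex (-1) t) * h (Complex (-1) t)) - 2 * of_real pi * h 0)
    \<le> 6 * (decay_const * exp (- T) * B)"
proof -
  have bd: "norm (weight (Complex \<sigma> t) * h (Complex \<sigma> t) / (Complex \<sigma> t - 0)) \<le> decay_const * exp (- T) * B"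
    if "-1 \<le> \<sigma>" "\<sigma> \<le> 2" "\<bar>t\<bar> = T" for \<sigma> t
  proof -
    have n: "norm (Complex \<sigma> t) \<ge> 1" using abs_Im_le_cmod[of "Complex \<sigma> t"] that T by simp
    have "weight (Complex \<sigma> t) * h (Complex \<sigma> t) / (Complex \<sigma> t - 0) = \<phi> (Complex \<sigma> t) * h (Complex \<sigma> t)"
      by (simp add: phi_eq_weight)
    thus ?thesis unfolding norm_mult
      using norm_phi_le[OF that(1,2) n] B[of "Complex \<sigma> t"] that decay_const_pos
      by (simp only: norm_mult) (intro mult_mono, auto)
  qed
  have "norm (integral {- T..T} (\<lambda>t. weight (Complex 2 t) * h (Complex 2 t) / (Complex 2 t - 0))
      - integral {- T..T} (\<lambda>t. weight (Complex (-1) t) * h (Complex (-1) t) / (Complex (-1) t - 0))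
      - 2 * of_real pi * (weight 0 * h 0)) \<le> 6 * (decay_const * exp (- T) * B)"
    by (rule rectangle_cauchy_bound[where S = S])
       (use S T bd in \<open>auto intro!: holomorphic_on_mult weight_holomorphic h simp: in_box_complex_iff\<close>)
  thus ?thesis by (simp add: phi_eq_weight weight_0)
qed

end

section \<open>The contribution of a single zero\<close>

lemma integral_real_if_symmetric:
  fixes f :: "real \<Rightarrow> complex"
  assumes "\<And>t. f (- t) = cnj (f t)"
  shows "Im (\<integral>t. f t \<partial>lborel) = 0"
proof -
  have "(\<integral>t. f t \<partial>lborel) = \<bar>-1\<bar> *\<^sub>R (\<integral>t. f (0 + (-1) * t) \<partial>lborel)"
    by (rule lborel_integral_real_affine) simp
  also have "\<dots> = (\<integral>t. cnj (f t) \<partial>lborel)" using assms by simp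
  also have "\<dots> = cnj (\<integral>t. f t \<partial>lborel)" by (rule Bochner_Integration.integral_cnj)
  finally have "Im (\<integral>t. f t \<partial>lborel) = Im (cnj (\<integral>t. f t \<partial>lborel))" by (rule arg_cong)
  thus ?thesis unfolding cnj.sel by linarith
qed

lemma continuous_Complex: "continuous_on A (\<lambda>t. Complex c t)"
  unfolding Complex_eq by (intro continuous_intros)

lemma Ln_line_continuous:
  assumes "Re \<rho> < 2"
  shows "continuous_on UNIV (\<lambda>t. Ln (Complex 2 t - \<rho>))"
  by (intro continuous_on_Ln continuous_intros continuous_Complex) (use assms in \<open>auto simp: complex_nonpos_Reals_iff\<close>)

lemma Ln_line_continuous':
  assumes "-1 < Re \<rho>"
  shows "continuous_on UNIV (\<lambda>t. Ln (\<rho> - Complex (-1) t))"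
  by (intro continuous_on_Ln continuous_intros continuous_Complex) (use assms in \<open>auto simp: complex_nonpos_Reals_iff\<close>)

context smoothed
begin

lemma Phi_holomorphic: "\<Phi> holomorphic_on - \<real>\<^sub>\<le>\<^sub>0"
  and Phi_lim: "((\<lambda>t. \<Phi> (Complex \<sigma> t) + \<Phi> (Complex \<sigma> (- t))) \<longlongrightarrow> 0) at_top"
  using Phi by (auto simp: is_Phi_hat_def)

lemma Phi_derivative:
  assumes "s \<notin> \<real>\<^sub>\<le>\<^sub>0"
  shows "(\<Phi> has_field_derivative \<phi> s) (at s)"
proof -
  have s: "s \<in> - \<real>\<^sub>\<le>\<^sub>0" using assms by simp
  have "(\<Phi> has_field_derivative deriv \<Phi> s) (at s)"
    by (rule holomorphic_derivI[OF Phi_holomorphic open_slit s])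
  moreover have "deriv \<Phi> s = \<phi> s" using Phi s unfolding is_Phi_hat_def by blast
  ultimately show ?thesis by simp
qed

lemma cnj_slit_iff: "cnj s \<in> \<real>\<^sub>\<le>\<^sub>0 \<longleftrightarrow> s \<in> \<real>\<^sub>\<le>\<^sub>0"
  by (simp add: complex_nonpos_Reals_iff)

text \<open>The reflected function \<open>cnj \<circ> \<Phi> \<circ> cnj\<close> satisfies the
  conditions that characterise \<open>\<Phi>\<close>, so it agrees with \<open>\<Phi>\<close> off
  the slit.\<close>

lemma Phi_cnj:
  assumes "s \<notin> \<real>\<^sub>\<le>\<^sub>0"
  shows "\<Phi> (cnj s) = cnj (\<Phi> s)"
proof -
  define \<Psi> where "\<Psi> = cnj \<circ> \<Phi> \<circ> cnj"
  have d: "(\<Psi> has_field_derivative \<phi> z) (at z)" if z: "z \<in> - \<real>\<^sub>\<le>\<^sub>0" for z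
  proof -
    have "(\<Psi> has_field_derivative cnj (\<phi> (cnj z))) (at z)" unfolding \<Psi>_def
      by (rule has_field_derivative_cnj_cnj, rule Phi_derivative) (use z cnj_slit_iff in simp)
    thus ?thesis by (simp add: phi_cnj)
  qed
  have "is_Phi_hat x lam \<Psi>"
    unfolding is_Phi_hat_def
  proof (intro conjI ballI allI)
    show "\<Psi> holomorphic_on - \<real>\<^sub>\<le>\<^sub>0" using d open_slit by (auto simp: holomorphic_on_open)
    show "deriv \<Psi> z = \<phi> z" if "z \<in> - \<real>\<^sub>\<le>\<^sub>0" for z by (rule DERIV_imp_deriv[OF d[OF that]])
    fix \<sigma> :: real
    have c: "cnj (Complex \<sigma> t) = Complex \<sigma> (- t)" "cnj (Complex \<sigma> (- t)) = Complex \<sigma> t" for t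
      by (simp_all add: complex_eq_iff)
    have "((\<lambda>t. cnj (\<Phi> (Complex \<sigma> t) + \<Phi> (Complex \<sigma> (- t)))) \<longlongrightarrow> cnj 0) at_top"
      by (intro tendsto_cnj Phi_lim)
    moreover have "\<Psi> (Complex \<sigma> t) + \<Psi> (Complex \<sigma> (- t)) = cnj (\<Phi> (Complex \<sigma> t) + \<Phi> (Complex \<sigma> (- t)))" for t
      by (simp add: \<Psi>_def c add.commute)
    ultimately show "((\<lambda>t. \<Psi> (Complex \<sigma> t) + \<Psi> (Complex \<sigma> (- t))) \<longlongrightarrow> 0) at_top" by simp
  qed
  from is_Phi_hat_unique[OF this Phi assms] show ?thesis
    unfolding \<Psi>_def o_def by (metis complex_cnj_cnj)
qed

lemma Complex_notin_slit: "t \<noteq> 0 \<Longrightarrow> Complex \<sigma> t \<notin> \<real>\<^sub>\<le>\<^sub>0"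
  by (simp add: complex_nonpos_Reals_iff)

text \<open>By \<open>Phi_cnj\<close> the prescribed sum of values at conjugate points is twice the
  real part. In this form the normalisation of \<open>\<Phi>\<close> enters the formula.\<close>

lemma Re_Phi_tendsto: "((\<lambda>t. Re (\<Phi> (Complex \<sigma> t))) \<longlongrightarrow> 0) at_top"
proof -
  have "((\<lambda>t. Re (\<Phi> (Complex \<sigma> t) + \<Phi> (Complex \<sigma> (- t))) / 2) \<longlongrightarrow> Re 0 / 2) at_top"
    by (intro tendsto_divide tendsto_Re Phi_lim tendsto_const) simp
  moreover have "eventually (\<lambda>t. Re (\<Phi> (Complex \<sigma> t) + \<Phi> (Complex \<sigma> (- t))) / 2 = Re (\<Phi> (Complex \<sigma> t))) at_top"
    using eventually_gt_at_top[of "0::real"]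
  proof eventually_elim
    case (elim t)
    have "\<Phi> (Complex \<sigma> (- t)) = cnj (\<Phi> (Complex \<sigma> t))"
      using Phi_cnj[OF Complex_notin_slit[of t \<sigma>]] elim by (simp add: complex_cnj)
    thus ?case by simp
  qed
  ultimately show ?thesis using Lim_transform_eventually by force
qed

lemma Re_Phi_derivative:
  assumes "t \<noteq> 0"
  shows "((\<lambda>t. Re (\<Phi> (Complex \<sigma> t))) has_real_derivative Re (\<i> * \<phi> (Complex \<sigma> t))) (at t)"
proof -
  have "((\<lambda>t. Complex \<sigma> t) has_vector_derivative \<i>) (at t)"
    unfolding Complex_eq by (auto intro!: derivative_eq_intros)
  from field_vector_diff_chain_at[OF this Phi_derivative[OF Complex_notin_slit[OF assms]]]
  have "((\<lambda>t. \<Phi> (Complex \<sigma> t)) has_vector_derivative (\<i> * \<phi> (Complex \<sigma> t))) (at t)"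
    by (simp only: o_def)
  from bounded_linear.has_vector_derivative[OF bounded_linear_Re this]
  show ?thesis by (simp only: has_real_derivative_iff_has_vector_derivative)
qed

text \<open>With either sign, \<open>\<plusminus> Re \<Phi> + decay_const * exp (- t)\<close> is
  nonincreasing upwards, since the bound on \<open>\<phi>\<close> controls the derivative, and it
  tends to 0. Hence it is nonnegative.\<close>

lemma Re_Phi_bound_pos:
  assumes s: "-1 \<le> \<sigma>" "\<sigma> \<le> 2" and t: "t \<ge> 1"
  shows "\<bar>Re (\<Phi> (Complex \<sigma> t))\<bar> \<le> decay_const * exp (- t)"
proof -
  have key: "0 \<le> e * Re (\<Phi> (Complex \<sigma> t)) + decay_const * exp (- t)" if e: "\<bar>e\<bar> = 1" for e :: real
  proof -
    define g where "g = (\<lambda>t. e * Re (\<Phi> (Complex \<sigma> t)) + decay_const * exp (- t))"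
    have mono: "g u \<le> g t" if u: "t \<le> u" for u
    proof (rule DERIV_nonpos_imp_nonincreasing[OF u])
      fix v assume v: "t \<le> v" "v \<le> u"
      have n: "norm (Complex \<sigma> v) \<ge> 1" using abs_Im_le_cmod[of "Complex \<sigma> v"] v t by simp
      have "DERIV g v :> e * Re (\<i> * \<phi> (Complex \<sigma> v)) + decay_const * (exp (- v) * (- 1))"
        unfolding g_def using v t
        by (intro DERIV_add DERIV_cmult Re_Phi_derivative DERIV_fun_exp) (auto intro!: derivative_eq_intros)
      moreover have "e * Re (\<i> * \<phi> (Complex \<sigma> v)) \<le> decay_const * exp (- v)"
      proof -
        have "e * Re (\<i> * \<phi> (Complex \<sigma> v)) \<le> \<bar>e\<bar> * \<bar>Re (\<i> * \<phi> (Complex \<sigma> v))\<bar>"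
          by (metis abs_ge_self abs_mult)
        also have "\<dots> \<le> norm (\<i> * \<phi> (Complex \<sigma> v))" unfolding e mult_1_left by (rule abs_Re_le_cmod)
        also have "\<dots> = norm (\<phi> (Complex \<sigma> v))" by (simp add: norm_mult)
        also have "\<dots> \<le> decay_const * exp (- \<bar>v\<bar>)" by (rule norm_phi_le[OF s n])
        finally show ?thesis using v t by simp
      qed
      ultimately show "\<exists>y. DERIV g v :> y \<and> y \<le> 0" by force
    qed
    have "(g \<longlongrightarrow> e * 0 + decay_const * 0) at_top"
      unfolding g_def
    proof (intro tendsto_add tendsto_mult tendsto_const Re_Phi_tendsto)
      show "((\<lambda>t::real. exp (- t)) \<longlongrightarrow> 0) at_top" by real_asymp
    qed
    hence "(g \<longlongrightarrow> 0) at_top" by simp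
    moreover have "eventually (\<lambda>u. g u \<le> g t) at_top"
      using eventually_ge_at_top[of t] by eventually_elim (rule mono)
    ultimately have "0 \<le> g t" by (rule tendsto_upperbound) simp
    thus ?thesis by (simp add: g_def)
  qed
  from key[of 1] key[of "-1"] show ?thesis by (simp add: abs_le_iff)
qed

lemma Re_Phi_bound:
  assumes s: "-1 \<le> \<sigma>" "\<sigma> \<le> 2" and t: "\<bar>t\<bar> \<ge> 1"
  shows "\<bar>Re (\<Phi> (Complex \<sigma> t))\<bar> \<le> decay_const * exp (- \<bar>t\<bar>)"
proof (cases "t \<ge> 1")
  case True
  thus ?thesis using Re_Phi_bound_pos[OF s True] by simp
next
  case False
  hence t': "- t \<ge> 1" using t by auto
  have "Complex \<sigma> (- t) = cnj (Complex \<sigma> t)" by (simp add: complex_cnj)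
  hence "\<Phi> (Complex \<sigma> (- t)) = cnj (\<Phi> (Complex \<sigma> t))"
    using Phi_cnj[OF Complex_notin_slit[of t \<sigma>]] t' by simp
  thus ?thesis using Re_Phi_bound_pos[OF s t'] t' by simp
qed

text \<open>What one factor \<open>s - \<rho>\<close> contributes to the difference of the two line
  integrals, without the factor \<open>\<i>\<close> of \<open>ds\<close>. For
  \<open>0 \<le> Re \<rho> \<le> 1\<close> both arguments of \<open>Ln\<close> have real part at
  least 1, so neither integrand meets the cut.\<close>

definition log_int :: "complex \<Rightarrow> complex" where
  "log_int \<rho> = (\<integral>t. \<phi> (Complex 2 t) * Ln (Complex 2 t - \<rho>) \<partial>lborel)
     - (\<integral>t. \<phi> (Complex (-1) t) * Ln (\<rho> - Complex (-1) t) \<partial>lborel)"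

definition log_int_trunc :: "complex \<Rightarrow> real \<Rightarrow> complex" where
  "log_int_trunc \<rho> T = integral {- T..T} (\<lambda>t. \<phi> (Complex 2 t) * Ln (Complex 2 t - \<rho>))
     - integral {- T..T} (\<lambda>t. \<phi> (Complex (-1) t) * Ln (\<rho> - Complex (-1) t))"

lemma Ln_line_bound:
  assumes "0 \<le> Re \<rho>" "Re \<rho> \<le> 1"
  shows "norm (Ln (Complex 2 t - \<rho>)) \<le> (6 + norm \<rho>) * (1 + \<bar>t\<bar>)"
    and "norm (Ln (\<rho> - Complex (-1) t)) \<le> (6 + norm \<rho>) * (1 + \<bar>t\<bar>)"
proof -
  have fin: "2 + \<bar>t\<bar> + norm \<rho> + 4 \<le> (6 + norm \<rho>) * (1 + \<bar>t\<bar>)"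
  proof -
    have "(6 + norm \<rho>) * (1 + \<bar>t\<bar>) = 6 + norm \<rho> + 6 * \<bar>t\<bar> + norm \<rho> * \<bar>t\<bar>" by (simp add: algebra_simps)
    moreover have "norm \<rho> * \<bar>t\<bar> \<ge> 0" by simp
    ultimately show ?thesis by simp
  qed
  have c: "norm (Complex 2 t) \<le> 2 + \<bar>t\<bar>" "norm (Complex (-1) t) \<le> 2 + \<bar>t\<bar>"
    using cmod_le[of "Complex 2 t"] cmod_le[of "Complex (-1) t"] by auto
  have "norm (Complex 2 t - \<rho>) \<ge> 1" using abs_Re_le_cmod[of "Complex 2 t - \<rho>"] assms by simp
  from norm_Ln_le[OF this] show "norm (Ln (Complex 2 t - \<rho>)) \<le> (6 + norm \<rho>) * (1 + \<bar>t\<bar>)"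
    using norm_triangle_ineq4[of "Complex 2 t" \<rho>] c fin by linarith
  have "norm (\<rho> - Complex (-1) t) \<ge> 1" using abs_Re_le_cmod[of "\<rho> - Complex (-1) t"] assms by simp
  from norm_Ln_le[OF this] show "norm (Ln (\<rho> - Complex (-1) t)) \<le> (6 + norm \<rho>) * (1 + \<bar>t\<bar>)"
    using norm_triangle_ineq4[of \<rho> "Complex (-1) t"] c fin by linarith
qed

lemma log_int_truncation:
  assumes "0 \<le> Re \<rho>" "Re \<rho> \<le> 1"
  shows "norm (log_int \<rho> - log_int_trunc \<rho> T) \<le> 4 * decay_const * (6 + norm \<rho>) * exp (- T / 4) * exp_const"
proof -
  define q where "q = decay_const * (6 + norm \<rho>) * exp (- T / 4) * exp_const"
  have 1: "norm ((\<integral>t. \<phi> (Complex 2 t) * Ln (Complex 2 t - \<rho>) \<partial>lborel)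
      - integral {- T..T} (\<lambda>t. \<phi> (Complex 2 t) * Ln (Complex 2 t - \<rho>)))
      \<le> 2 * q"
    unfolding q_def mult.assoc[symmetric]
    by (rule phi_line_mult(2)) (use assms in \<open>auto intro!: Ln_line_continuous Ln_line_bound\<close>)
  have 2: "norm ((\<integral>t. \<phi> (Complex (-1) t) * Ln (\<rho> - Complex (-1) t) \<partial>lborel)
      - integral {- T..T} (\<lambda>t. \<phi> (Complex (-1) t) * Ln (\<rho> - Complex (-1) t)))
      \<le> 2 * q"
    unfolding q_def mult.assoc[symmetric]
    by (rule phi_line_mult(2)) (use assms in \<open>auto intro!: Ln_line_continuous' Ln_line_bound\<close>)
  have "norm ((a - b) - (c - d)) \<le> norm (a - c) + norm (b - d)" for a b c d :: complex
    using norm_triangle_ineq4[of "a - c" "b - d"] by (simp add: algebra_simps)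
  from order_trans[OF this add_mono[OF 1 2]]
  have "norm (log_int \<rho> - log_int_trunc \<rho> T) \<le> 2 * q + 2 * q"
    unfolding log_int_def log_int_trunc_def .
  also have "2 * q + 2 * q = 4 * decay_const * (6 + norm \<rho>) * exp (- T / 4) * exp_const"
    unfolding q_def by simp
  finally show ?thesis .
qed

lemma phi_line_continuous_on:
  assumes "c \<noteq> 0" shows "continuous_on A (\<lambda>t. \<phi> (Complex c t))"
  by (rule continuous_on_subset[OF continuous_phi_line[OF assms]]) simp

text \<open>The range of integration is compact, so the Leibniz rule applies. The opposite signs
  inside the two logarithms lead to the same kernel \<open>1 / (s - \<rho>)\<close>, and the sides
  of a Cauchy integral appear.\<close>

lemma log_int_trunc_derivative:
  assumes \<rho>: "-1 < Re \<rho>" "Re \<rho> < 2"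
  shows "((\<lambda>\<rho>. log_int_trunc \<rho> T) has_field_derivative
     - (integral {- T..T} (\<lambda>t. \<phi> (Complex 2 t) / (Complex 2 t - \<rho>))
      - integral {- T..T} (\<lambda>t. \<phi> (Complex (-1) t) / (Complex (-1) t - \<rho>)))) (at \<rho>)"
proof -
  define U where "U = {s. -1 < Re s} \<inter> {s. Re s < 2}"
  have U: "\<rho> \<in> U" "convex U" "open U" using \<rho>
    by (auto simp: U_def intro!: convex_Int convex_halfspace_Re_gt convex_halfspace_Re_lt
          open_Int open_halfspace_Re_gt open_halfspace_Re_lt)
  have nz: "Complex 2 t - s \<noteq> 0" "Complex (-1) t - s \<noteq> 0" if "s \<in> U" for s t
    using that by (auto simp: U_def complex_eq_iff)
  have c1: "continuous_on (U \<times> cbox (- T) T) (\<lambda>(s, t). - (\<phi> (Complex 2 t) / (Complex 2 t - s)))"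
    unfolding case_prod_unfold
  proof (intro continuous_on_minus continuous_on_divide continuous_on_diff)
    show "continuous_on (U \<times> cbox (- T) T) (\<lambda>p. \<phi> (Complex 2 (snd p)))"
      by (rule continuous_on_compose2[OF continuous_phi_line[of 2]]) (auto intro!: continuous_intros)
    show "continuous_on (U \<times> cbox (- T) T) (\<lambda>p. Complex 2 (snd p))"
      by (rule continuous_on_compose2[OF continuous_Complex[of UNIV]]) (auto intro!: continuous_intros)
  qed (use nz in \<open>auto intro: continuous_intros\<close>)
  have c2: "continuous_on (U \<times> cbox (- T) T) (\<lambda>(s, t). - (\<phi> (Complex (-1) t) / (Complex (-1) t - s)))"
    unfolding case_prod_unfold
  proof (intro continuous_on_minus continuous_on_divide continuous_on_diff)
    show "continuous_on (U \<times> cbox (- T) T) (\<lambda>p. \<phi> (Complex (-1) (snd p)))"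
      by (rule continuous_on_compose2[OF continuous_phi_line[of "-1"]]) (auto intro!: continuous_intros)
    show "continuous_on (U \<times> cbox (- T) T) (\<lambda>p. Complex (-1) (snd p))"
      by (rule continuous_on_compose2[OF continuous_Complex[of UNIV]]) (auto intro!: continuous_intros)
  qed (use nz in \<open>auto intro: continuous_intros\<close>)
  have "((\<lambda>s. integral (cbox (- T) T) (\<lambda>t. \<phi> (Complex 2 t) * Ln (Complex 2 t - s))) has_field_derivative
      integral (cbox (- T) T) (\<lambda>t. - (\<phi> (Complex 2 t) / (Complex 2 t - \<rho>)))) (at \<rho> within U)"
  proof (rule leibniz_rule_field_derivative[where f = "\<lambda>s t. \<phi> (Complex 2 t) * Ln (Complex 2 t - s)"
        and fx = "\<lambda>s t. - (\<phi> (Complex 2 t) / (Complex 2 t - s))" and U = U, OF _ _ c1 U(1,2)])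
    fix s :: complex and t :: real assume s: "s \<in> U"
    have "Complex 2 t - s \<notin> \<real>\<^sub>\<le>\<^sub>0" using s by (simp add: U_def complex_nonpos_Reals_iff)
    hence "((\<lambda>s. \<phi> (Complex 2 t) * Ln (Complex 2 t - s)) has_field_derivative
        \<phi> (Complex 2 t) * ((0 - 1) / (Complex 2 t - s))) (at s within U)"
      by (auto intro!: derivative_eq_intros simp: divide_inverse)
    thus "((\<lambda>s. \<phi> (Complex 2 t) * Ln (Complex 2 t - s)) has_field_derivative
        - (\<phi> (Complex 2 t) / (Complex 2 t - s))) (at s within U)" by simp
  next
    fix s assume s: "s \<in> U"
    show "(\<lambda>t. \<phi> (Complex 2 t) * Ln (Complex 2 t - s)) integrable_on cbox (- T) T"
      by (intro integrable_continuous continuous_on_mult phi_line_continuous_on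
            continuous_on_subset[OF Ln_line_continuous]) (use s in \<open>auto simp: U_def\<close>)
  qed
  moreover have "((\<lambda>s. integral (cbox (- T) T) (\<lambda>t. \<phi> (Complex (-1) t) * Ln (s - Complex (-1) t))) has_field_derivative
      integral (cbox (- T) T) (\<lambda>t. - (\<phi> (Complex (-1) t) / (Complex (-1) t - \<rho>)))) (at \<rho> within U)"
  proof (rule leibniz_rule_field_derivative[where f = "\<lambda>s t. \<phi> (Complex (-1) t) * Ln (s - Complex (-1) t)"
        and fx = "\<lambda>s t. - (\<phi> (Complex (-1) t) / (Complex (-1) t - s))" and U = U, OF _ _ c2 U(1,2)])
    fix s :: complex and t :: real assume s: "s \<in> U"
    have "s - Complex (-1) t \<notin> \<real>\<^sub>\<le>\<^sub>0" using s by (simp add: U_def complex_nonpos_Reals_iff)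
    hence "((\<lambda>s. \<phi> (Complex (-1) t) * Ln (s - Complex (-1) t)) has_field_derivative
        \<phi> (Complex (-1) t) * ((1 - 0) / (s - Complex (-1) t))) (at s within U)"
      by (auto intro!: derivative_eq_intros simp: divide_inverse)
    moreover have "a * ((1 - 0) / (s - w)) = - (a / (w - s))" for a w :: complex
    proof -
      have "- (a / (w - s)) = a / - (w - s)" by (rule minus_divide_right)
      thus ?thesis by simp
    qed
    ultimately show "((\<lambda>s. \<phi> (Complex (-1) t) * Ln (s - Complex (-1) t)) has_field_derivative
        - (\<phi> (Complex (-1) t) / (Complex (-1) t - s))) (at s within U)" by (simp only:)
  next
    fix s assume s: "s \<in> U"
    show "(\<lambda>t. \<phi> (Complex (-1) t) * Ln (s - Complex (-1) t)) integrable_on cbox (- T) T"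
      by (intro integrable_continuous continuous_on_mult phi_line_continuous_on
            continuous_on_subset[OF Ln_line_continuous']) (use s in \<open>auto simp: U_def\<close>)
  qed
  ultimately have "((\<lambda>s. log_int_trunc s T) has_field_derivative
      (integral (cbox (- T) T) (\<lambda>t. - (\<phi> (Complex 2 t) / (Complex 2 t - \<rho>)))
        - integral (cbox (- T) T) (\<lambda>t. - (\<phi> (Complex (-1) t) / (Complex (-1) t - \<rho>))))) (at \<rho> within U)"
    unfolding log_int_trunc_def cbox_interval[symmetric] by (rule DERIV_diff)
  hence "((\<lambda>s. log_int_trunc s T) has_field_derivative
      (integral (cbox (- T) T) (\<lambda>t. - (\<phi> (Complex 2 t) / (Complex 2 t - \<rho>)))
        - integral (cbox (- T) T) (\<lambda>t. - (\<phi> (Complex (-1) t) / (Complex (-1) t - \<rho>))))) (at \<rho>)"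
    by (simp only: at_within_open[OF U(1,3)])
  moreover have "integral (cbox (- T) T) (\<lambda>t. - (\<phi> (Complex 2 t) / (Complex 2 t - \<rho>)))
        - integral (cbox (- T) T) (\<lambda>t. - (\<phi> (Complex (-1) t) / (Complex (-1) t - \<rho>)))
     = - (integral {- T..T} (\<lambda>t. \<phi> (Complex 2 t) / (Complex 2 t - \<rho>))
      - integral {- T..T} (\<lambda>t. \<phi> (Complex (-1) t) / (Complex (-1) t - \<rho>)))"
    unfolding integral_neg cbox_interval by simp
  ultimately show ?thesis by (simp only:)
qed

text \<open>Partial fractions write \<open>\<phi> s / (s - \<rho>)\<close> as
  \<open>weight s\<close> times \<open>(1 / (s - \<rho>) - 1 / s) / \<rho>\<close>. Two applications
  of Cauchy's formula follow, each with error \<open>6 * decay_const * exp (- T)\<close>.\<close>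

lemma residue_bound:
  assumes \<rho>: "-1 < Re \<rho>" "Re \<rho> < 2" "\<rho> \<noteq> 0" and T: "T \<ge> 1" "\<bar>Im \<rho>\<bar> \<le> T - 1"
  shows "norm (integral {- T..T} (\<lambda>t. \<phi> (Complex 2 t) / (Complex 2 t - \<rho>))
      - integral {- T..T} (\<lambda>t. \<phi> (Complex (-1) t) / (Complex (-1) t - \<rho>)) - 2 * of_real pi * (\<phi> \<rho> - 1 / \<rho>))
     \<le> 12 * decay_const * exp (- T) / norm \<rho>"
proof -
  have cauchy: "norm (integral {- T..T} (\<lambda>t. weight (Complex 2 t) / (Complex 2 t - a))
      - integral {- T..T} (\<lambda>t. weight (Complex (-1) t) / (Complex (-1) t - a)) - 2 * of_real pi * weight a)
      \<le> 6 * (decay_const * exp (- T))"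
    if a: "-1 < Re a" "Re a < 2" "\<bar>Im a\<bar> \<le> T - 1" for a
  proof (rule rectangle_cauchy_bound[where S = UNIV])
    show "a \<in> box (Complex (-1) (- T)) (Complex 2 T)" using a by (auto simp: in_box_complex_iff)
    have *: "norm (weight (Complex \<sigma> t) / (Complex \<sigma> t - a)) \<le> decay_const * exp (- T)"
      if s: "-1 \<le> \<sigma>" "\<sigma> \<le> 2" and t: "\<bar>t\<bar> = T" for \<sigma> t
    proof -
      have "1 \<le> \<bar>Im (Complex \<sigma> t - a)\<bar>" using a t by simp
      hence "1 \<le> norm (Complex \<sigma> t - a)" using abs_Im_le_cmod[of "Complex \<sigma> t - a"] by linarith
      hence "norm (weight (Complex \<sigma> t) / (Complex \<sigma> t - a)) \<le> norm (weight (Complex \<sigma> t)) / 1"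
        unfolding norm_divide by (intro divide_left_mono) auto
      also have "\<dots> \<le> decay_const * exp (- \<bar>t\<bar>)" using norm_weight_le[OF s] by simp
      finally show ?thesis using t by simp
    qed
    show "norm (weight (Complex \<sigma> T) / (Complex \<sigma> T - a)) \<le> decay_const * exp (- T)"
      "norm (weight (Complex \<sigma> (- T)) / (Complex \<sigma> (- T) - a)) \<le> decay_const * exp (- T)"
      if "-1 \<le> \<sigma>" "\<sigma> \<le> 2" for \<sigma>
      using *[OF that, of T] *[OF that, of "- T"] T by simp_all
  qed (auto intro: weight_holomorphic)
  have split: "integral {- T..T} (\<lambda>t. \<phi> (Complex c t) / (Complex c t - \<rho>)) =
      (integral {- T..T} (\<lambda>t. weight (Complex c t) / (Complex c t - \<rho>))
        - integral {- T..T} (\<lambda>t. weight (Complex c t) / (Complex c t - 0))) / \<rho>"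
    if c: "c = -1 \<or> c = 2" for c
  proof -
    have nz: "Complex c t - \<rho> \<noteq> 0" "Complex c t \<noteq> 0" for t using c \<rho> by (auto simp: complex_eq_iff)
    have cw: "continuous_on {- T..T} (\<lambda>t. weight (Complex c t))"
      by (rule continuous_on_compose2[OF holomorphic_on_imp_continuous_on[OF weight_holomorphic[of UNIV]] continuous_Complex]) simp
    have i: "(\<lambda>t. weight (Complex c t) / (Complex c t - \<rho>)) integrable_on {- T..T}"
      "(\<lambda>t. weight (Complex c t) / (Complex c t - 0)) integrable_on {- T..T}"
      by (intro integrable_continuous_real continuous_on_divide cw continuous_intros continuous_Complex; use nz in simp)+
    have e: "\<phi> (Complex c t) / (Complex c t - \<rho>) =
       (weight (Complex c t) / (Complex c t - \<rho>) - weight (Complex c t) / (Complex c t - 0)) / \<rho>" for t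
      using nz[of t] \<rho>(3) unfolding phi_eq_weight by (simp add: field_simps)
    show ?thesis
      unfolding e integral_divide Henstock_Kurzweil_Integration.integral_diff[OF i] ..
  qed
  have cz: "norm (integral {- T..T} (\<lambda>t. weight (Complex 2 t) / (Complex 2 t - 0))
      - integral {- T..T} (\<lambda>t. weight (Complex (-1) t) / (Complex (-1) t - 0)) - 2 * of_real pi * 1)
      \<le> 6 * (decay_const * exp (- T))"
    using cauchy[of 0] T unfolding weight_0 by simp
  have alg: "norm ((a - b) / \<rho> - (c - d) / \<rho> - 2 * of_real pi * (w / \<rho> - 1 / \<rho>)) \<le> (e1 + e2) / norm \<rho>"
    if "norm (a - c - 2 * of_real pi * w) \<le> e1" "norm (b - d - 2 * of_real pi * 1) \<le> e2"
    for a b c d w :: complex and e1 e2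
  proof -
    have "(a - b) / \<rho> - (c - d) / \<rho> - 2 * of_real pi * (w / \<rho> - 1 / \<rho>) =
       ((a - c - 2 * of_real pi * w) - (b - d - 2 * of_real pi * 1)) / \<rho>"
      using \<rho>(3) by (simp add: field_simps)
    also have "norm \<dots> \<le> (e1 + e2) / norm \<rho>"
      unfolding norm_divide
      by (rule divide_right_mono[OF order_trans[OF norm_triangle_ineq4 add_mono[OF that]] norm_ge_zero])
    finally show ?thesis .
  qed
  have "6 * (decay_const * exp (- T)) + 6 * (decay_const * exp (- T)) = 12 * decay_const * exp (- T)" by simp
  with alg[OF cauchy[OF \<rho>(1,2) T(2)] cz] show ?thesis
    unfolding split[OF disjI2[OF refl]] split[OF disjI1[OF refl]] phi_eq_weight[of \<rho>] by (simp only:)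
qed

text \<open>
  Both sides have the same derivative in \<open>\<rho>\<close>: by the residue theorem the derivative of \<open>log_int\<close> is
  \<open>- 2 * pi * (\<phi> \<rho> - 1 / \<rho>)\<close>, with \<open>1 / \<rho>\<close> coming from the pole of \<open>\<phi>\<close> at \<open>0\<close>.
\<close>

lemma log_int_eq_const:
  assumes \<rho>: "0 \<le> Re \<rho>" "Re \<rho> \<le> 1" "Im \<rho> \<noteq> 0"
  shows "log_int \<rho> + 2 * of_real pi * (\<Phi> \<rho> - Ln \<rho>) = log_int 1 + 2 * of_real pi * \<Phi> 1"
proof -
  \<comment> \<open>Since \<open>Im \<rho> \<noteq> 0\<close>, this path avoids the slit; being
    compact, it keeps a distance \<open>b\<close> from 0, which bounds the factor
    \<open>1 / norm z\<close> below.\<close>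
  define Sg where "Sg = closed_segment 1 \<rho>"
  have Sg: "0 \<le> Re z \<and> Re z \<le> 1 \<and> \<bar>Im z\<bar> \<le> \<bar>Im \<rho>\<bar> \<and> z \<notin> \<real>\<^sub>\<le>\<^sub>0" if "z \<in> Sg" for z
  proof -
    obtain u where u: "0 \<le> u" "u \<le> 1" "z = (1 - u) *\<^sub>R 1 + u *\<^sub>R \<rho>"
      using \<open>z \<in> Sg\<close> unfolding Sg_def in_segment by blast
    have im: "Im z = u * Im \<rho>" and re: "Re z = (1 - u) + u * Re \<rho>" using u(3) by simp_all
    have "u * Re \<rho> \<le> u" using u(1) \<rho>(2) by (simp add: mult_left_le)
    moreover have "u * Re \<rho> \<ge> 0" using u(1) \<rho>(1) by simp
    ultimately have r: "0 \<le> Re z" "Re z \<le> 1" using re u by linarith+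
    have i: "\<bar>Im z\<bar> \<le> \<bar>Im \<rho>\<bar>" unfolding im abs_mult using u by (simp add: mult_left_le_one_le)
    have "z \<notin> \<real>\<^sub>\<le>\<^sub>0"
    proof
      assume z: "z \<in> \<real>\<^sub>\<le>\<^sub>0"
      hence "u * Im \<rho> = 0" "Re z \<le> 0" using im by (auto simp: complex_nonpos_Reals_iff)
      hence "u = 0" using \<rho>(3) by simp
      thus False using \<open>Re z \<le> 0\<close> re by simp
    qed
    thus ?thesis using r i by blast
  qed
  have cl: "closed Sg" unfolding Sg_def by (rule compact_imp_closed[OF compact_segment])
  have "(0::complex) \<in> \<real>\<^sub>\<le>\<^sub>0" by simp
  hence z_notin: "0 \<notin> Sg" using Sg[of 0] by blast
  obtain b where b: "b > 0" "\<And>z. z \<in> Sg \<Longrightarrow> b \<le> dist 0 z"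
    using separate_point_closed[OF cl z_notin] by blast
  \<comment> \<open>Differentiation is done on truncations, where it is legitimate. The derivative
    of \<open>EE\<close> along the segment is of size \<open>exp (- T)\<close>, so the difference of
    the end values vanishes in the limit.\<close>
  define EE where "EE = (\<lambda>z T. log_int_trunc z T + 2 * of_real pi * (\<Phi> z - Ln z))"
  have bound: "norm (EE \<rho> T - EE 1 T) \<le> 12 * decay_const * exp (- T) / b * norm (\<rho> - 1)"
    if T: "T \<ge> 1" "\<bar>Im \<rho>\<bar> \<le> T - 1" for T
  proof (rule field_differentiable_bound[where S = Sg and f' = "\<lambda>z. - (integral {- T..T} (\<lambda>t. \<phi> (Complex 2 t) / (Complex 2 t - z))
      - integral {- T..T} (\<lambda>t. \<phi> (Complex (-1) t) / (Complex (-1) t - z)) - 2 * of_real pi * (\<phi> z - 1 / z))"])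
    show "convex Sg" "\<rho> \<in> Sg" "1 \<in> Sg" by (simp_all add: Sg_def)
    fix z assume z: "z \<in> Sg"
    have z0: "z \<noteq> 0" using z z_notin by blast
    have d1: "((\<lambda>z. log_int_trunc z T) has_field_derivative
     - (integral {- T..T} (\<lambda>t. \<phi> (Complex 2 t) / (Complex 2 t - z))
      - integral {- T..T} (\<lambda>t. \<phi> (Complex (-1) t) / (Complex (-1) t - z)))) (at z)"
      using Sg[OF z] by (intro log_int_trunc_derivative) auto
    have d2: "((\<lambda>z. 2 * of_real pi * (\<Phi> z - Ln z)) has_field_derivative 2 * of_real pi * (\<phi> z - 1 / z)) (at z)"
      using Sg[OF z] z0 by (intro DERIV_cmult DERIV_diff Phi_derivative) (auto intro!: derivative_eq_intros simp: divide_inverse)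
    have "((\<lambda>z. EE z T) has_field_derivative - (integral {- T..T} (\<lambda>t. \<phi> (Complex 2 t) / (Complex 2 t - z))
      - integral {- T..T} (\<lambda>t. \<phi> (Complex (-1) t) / (Complex (-1) t - z)) - 2 * of_real pi * (\<phi> z - 1 / z))) (at z)"
      unfolding EE_def by (rule DERIV_cong[OF DERIV_add[OF d1 d2]]) simp
    thus "((\<lambda>z. EE z T) has_field_derivative - (integral {- T..T} (\<lambda>t. \<phi> (Complex 2 t) / (Complex 2 t - z))
      - integral {- T..T} (\<lambda>t. \<phi> (Complex (-1) t) / (Complex (-1) t - z)) - 2 * of_real pi * (\<phi> z - 1 / z))) (at z within Sg)"
      by (rule has_field_derivative_at_within)
    have "norm (- (integral {- T..T} (\<lambda>t. \<phi> (Complex 2 t) / (Complex 2 t - z))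
      - integral {- T..T} (\<lambda>t. \<phi> (Complex (-1) t) / (Complex (-1) t - z)) - 2 * of_real pi * (\<phi> z - 1 / z)))
      \<le> 12 * decay_const * exp (- T) / norm z"
      unfolding norm_minus_cancel using Sg[OF z] z0 T by (intro residue_bound) auto
    also have "\<dots> \<le> 12 * decay_const * exp (- T) / b"
      using b(1) b(2)[OF z] decay_const_pos z0 by (intro divide_left_mono mult_pos_pos) auto
    finally show "norm (- (integral {- T..T} (\<lambda>t. \<phi> (Complex 2 t) / (Complex 2 t - z))
      - integral {- T..T} (\<lambda>t. \<phi> (Complex (-1) t) / (Complex (-1) t - z)) - 2 * of_real pi * (\<phi> z - 1 / z)))
      \<le> 12 * decay_const * exp (- T) / b" .
  qed
  have tr: "((\<lambda>T. log_int_trunc r T) \<longlongrightarrow> log_int r) at_top" if "0 \<le> Re r" "Re r \<le> 1" for r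
  proof -
    have "((\<lambda>T. log_int r - log_int_trunc r T) \<longlongrightarrow> 0) at_top"
    proof (rule Lim_null_comparison)
      show "eventually (\<lambda>T. norm (log_int r - log_int_trunc r T) \<le>
          4 * decay_const * (6 + norm r) * exp (- T / 4) * exp_const) at_top"
        using log_int_truncation[OF that] by simp
      have "((\<lambda>T::real. exp (- T / 4)) \<longlongrightarrow> 0) at_top" by real_asymp
      from tendsto_mult[OF tendsto_mult[OF tendsto_const this] tendsto_const]
      show "((\<lambda>T. 4 * decay_const * (6 + norm r) * exp (- T / 4) * exp_const) \<longlongrightarrow> 0) at_top" by simp
    qed
    from tendsto_diff[OF tendsto_const[of "log_int r"] this] show ?thesis by simp
  qed
  have "((\<lambda>T. EE \<rho> T - EE 1 T) \<longlongrightarrow> (log_int \<rho> + 2 * of_real pi * (\<Phi> \<rho> - Ln \<rho>)) - (log_int 1 + 2 * of_real pi * (\<Phi> 1 - Ln 1))) at_top"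
    unfolding EE_def using \<rho> by (intro tendsto_diff tendsto_add tendsto_const tr) auto
  moreover have "((\<lambda>T. EE \<rho> T - EE 1 T) \<longlongrightarrow> 0) at_top"
  proof (rule Lim_null_comparison)
    show "eventually (\<lambda>T. norm (EE \<rho> T - EE 1 T) \<le> 12 * decay_const * exp (- T) / b * norm (\<rho> - 1)) at_top"
      using eventually_ge_at_top[of "\<bar>Im \<rho>\<bar> + 1"] by eventually_elim (rule bound, auto)
    have "((\<lambda>T::real. exp (- T)) \<longlongrightarrow> 0) at_top" by real_asymp
    from tendsto_mult[OF tendsto_divide[OF tendsto_mult[OF tendsto_const this] tendsto_const] tendsto_const, of b "12 * decay_const" "norm (\<rho> - 1)"]
    show "((\<lambda>T. 12 * decay_const * exp (- T) / b * norm (\<rho> - 1)) \<longlongrightarrow> 0) at_top" using b(1) by simp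
  qed
  ultimately have "(log_int \<rho> + 2 * of_real pi * (\<Phi> \<rho> - Ln \<rho>)) - (log_int 1 + 2 * of_real pi * (\<Phi> 1 - Ln 1)) = 0"
    using tendsto_unique[OF trivial_limit_at_top_linorder] by blast
  thus ?thesis by simp
qed

end

section \<open>The constant of integration\<close>

lemma Ln_shift_tendsto:
  "(\<lambda>n. Ln (Complex (3/2) (t - real (Suc n))) - of_real (ln (norm (Complex (1/2) (real (Suc n))))))
     \<longlonglongrightarrow> - (\<i> * of_real (pi / 2))"
proof -
  \<comment> \<open>Factoring \<open>- \<i> * Suc n\<close> out of the argument leaves
    \<open>v n\<close>, which tends to 1. As \<open>Im (v n) > 0\<close>, the arguments add without
    leaving the principal range.\<close>
  define v where "v = (\<lambda>n. Complex (1 - t / real (Suc n)) (3/2 / real (Suc n)))"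
  have Lv: "Ln (Complex (3/2) (t - real (Suc n))) = of_real (ln (real (Suc n))) + - (\<i> * of_real (pi / 2)) + Ln (v n)" for n
  proof (rule Ln_unique)
    have iv: "Im (v n) > 0" by (simp add: v_def)
    hence v0: "v n \<noteq> 0" by auto
    have im: "0 < Im (Ln (v n))" "Im (Ln (v n)) < pi" using Im_Ln_pos_lt_imp[OF iv] by auto
    have "exp (of_real (ln (real (Suc n))) + - (\<i> * of_real (pi / 2)) + Ln (v n)) =
        of_real (exp (ln (real (Suc n)))) * exp (- (\<i> * of_real (pi / 2))) * v n"
      unfolding exp_add exp_of_real exp_Ln[OF v0] ..
    also have "exp (ln (real (Suc n))) = real (Suc n)" by (rule exp_ln) simp
    also have "exp (- (\<i> * of_real (pi / 2))) = - \<i>"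
    proof -
      have "- (\<i> * of_real (pi / 2)) = \<i> * of_real (- (pi / 2))" by simp
      hence "exp (- (\<i> * of_real (pi / 2))) = cis (- (pi / 2))" by (simp only: cis_conv_exp)
      also have "\<dots> = - \<i>" by (simp add: complex_eq_iff)
      finally show ?thesis .
    qed
    also have "of_real (real (Suc n)) * - \<i> * v n = Complex (3/2) (t - real (Suc n))"
    proof -
      have *: "of_real y * - \<i> * Complex (1 - t / y) (3/2 / y) = Complex (3/2) (t - y)" if "y \<noteq> 0" for y
        using that by (simp add: complex_eq_iff right_diff_distrib)
      show ?thesis unfolding v_def by (rule *[of "real (Suc n)"]) simp
    qed
    finally show "exp (of_real (ln (real (Suc n))) + - (\<i> * of_real (pi / 2)) + Ln (v n)) = Complex (3/2) (t - real (Suc n))" .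
    have "Im (of_real (ln (real (Suc n))) + - (\<i> * of_real (pi / 2)) + Ln (v n)) = Im (Ln (v n)) - pi / 2" by simp
    thus "- pi < Im (of_real (ln (real (Suc n))) + - (\<i> * of_real (pi / 2)) + Ln (v n))"
      "Im (of_real (ln (real (Suc n))) + - (\<i> * of_real (pi / 2)) + Ln (v n)) \<le> pi"
      using im pi_gt_zero by linarith+
  qed
  have z: "(\<lambda>n. c / real (Suc n)) \<longlonglongrightarrow> 0" for c
    by (rule LIMSEQ_Suc[OF lim_const_over_n[of c]])
  have "v \<longlonglongrightarrow> Complex (1 - 0) 0"
    unfolding v_def by (intro tendsto_Complex tendsto_diff tendsto_const z)
  hence "(\<lambda>n. Ln (v n)) \<longlonglongrightarrow> Ln (Complex (1 - 0) 0)"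
    by (rule tendsto_Ln) (simp add: complex_nonpos_Reals_iff)
  moreover have "Complex (1 - 0) 0 = 1" by (simp add: complex_eq_iff)
  ultimately have l1: "(\<lambda>n. Ln (v n)) \<longlonglongrightarrow> 0" by simp
  have "(\<lambda>n. ln (real (Suc n)) - ln (sqrt ((1/2)\<^sup>2 + (real (Suc n))\<^sup>2))) \<longlonglongrightarrow> 0"
    by real_asymp
  hence "(\<lambda>n. of_real (ln (real (Suc n)) - ln (sqrt ((1/2)\<^sup>2 + (real (Suc n))\<^sup>2))) :: complex) \<longlonglongrightarrow> of_real 0"
    by (rule tendsto_of_real)
  from tendsto_add[OF tendsto_add[OF this l1] tendsto_const[of "- (\<i> * of_real (pi / 2))"]]
  have "(\<lambda>n. of_real (ln (real (Suc n)) - ln (sqrt ((1/2)\<^sup>2 + (real (Suc n))\<^sup>2))) + Ln (v n) + - (\<i> * of_real (pi / 2)))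
     \<longlonglongrightarrow> - (\<i> * of_real (pi / 2))" by simp
  moreover have "norm (Complex (1/2) y) = sqrt ((1/2)\<^sup>2 + y\<^sup>2)" for y by (simp add: cmod_def)
  moreover have "a + - b + w - c = a - c + w + - b" for a b c w :: complex by simp
  ultimately show ?thesis unfolding Lv of_real_diff by (simp only:)
qed

text \<open>A majorant uniform in \<open>n\<close> for dominated convergence: the two moduli are
  comparable up to a factor linear in \<open>\<bar>t\<bar>\<close>, so their logarithms differ by at
  most that factor, and the argument is at most 4.\<close>

lemma Ln_shift_bound:
  "norm (Ln (Complex (3/2) (t - real (Suc n))) - of_real (ln (norm (Complex (1/2) (real (Suc n)))))) \<le> 7 * (1 + \<bar>t\<bar>)"
proof -
  define Y where "Y = real (Suc n)"
  have Y: "Y \<ge> 1" by (simp add: Y_def)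
  define w where "w = Complex (3/2) (t - Y)"
  define r where "r = Complex (1/2) Y"
  have w1: "norm w \<ge> 1" using abs_Re_le_cmod[of w] by (simp add: w_def)
  have w0: "w \<noteq> 0" using w1 by auto
  have rY: "Y \<le> norm r" "norm r \<le> Y + 1/2"
    using abs_Im_le_cmod[of r] cmod_le[of r] Y by (simp_all add: r_def)
  have wt: "\<bar>t - Y\<bar> \<le> norm w" "norm w \<le> 3/2 + \<bar>t - Y\<bar>"
    using abs_Im_le_cmod[of w] cmod_le[of w] by (simp_all add: w_def)
  have r1: "norm r \<ge> 1" using rY Y by linarith
  have pos: "norm w > 0" "norm r > 0" using w1 r1 by linarith+
  have "norm w \<le> 3/2 + \<bar>t\<bar> + norm r" using wt rY Y by linarith
  also have "\<dots> \<le> (5/2 + \<bar>t\<bar>) * norm r"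
  proof -
    have "(3/2 + \<bar>t\<bar>) * 1 \<le> (3/2 + \<bar>t\<bar>) * norm r" using r1 by (intro mult_left_mono) auto
    thus ?thesis by (simp add: algebra_simps)
  qed
  finally have "norm w / norm r \<le> 5/2 + \<bar>t\<bar>" using r1 by (simp add: divide_le_eq)
  moreover have "ln (norm w / norm r) \<le> norm w / norm r"
  proof -
    have "norm w / norm r > 0" using w1 r1 by (intro divide_pos_pos) linarith+
    from ln_le_minus_one[OF this] show ?thesis by linarith
  qed
  moreover have "ln (norm w / norm r) = ln (norm w) - ln (norm r)" using pos by (simp add: ln_div)
  ultimately have u: "ln (norm w) - ln (norm r) \<le> 5/2 + \<bar>t\<bar>" by linarith
  have "norm r \<le> \<bar>t\<bar> + 1/2 + norm w" using wt rY Y by linarith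
  also have "\<dots> \<le> (3/2 + \<bar>t\<bar>) * norm w"
  proof -
    have "(1/2 + \<bar>t\<bar>) * 1 \<le> (1/2 + \<bar>t\<bar>) * norm w" using w1 by (intro mult_left_mono) auto
    thus ?thesis by (simp add: algebra_simps)
  qed
  finally have "norm r / norm w \<le> 3/2 + \<bar>t\<bar>" using w1 by (simp add: divide_le_eq)
  moreover have "ln (norm r / norm w) \<le> norm r / norm w"
  proof -
    have "norm r / norm w > 0" using w1 r1 by (intro divide_pos_pos) linarith+
    from ln_le_minus_one[OF this] show ?thesis by linarith
  qed
  moreover have "ln (norm r / norm w) = ln (norm r) - ln (norm w)" using pos by (simp add: ln_div)
  ultimately have l: "ln (norm r) - ln (norm w) \<le> 3/2 + \<bar>t\<bar>" by linarith
  have "norm (Ln w - of_real (ln (norm r))) \<le> \<bar>Re (Ln w - of_real (ln (norm r)))\<bar> + \<bar>Im (Ln w - of_real (ln (norm r)))\<bar>"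
    by (rule cmod_le)
  also have "\<dots> = \<bar>ln (norm w) - ln (norm r)\<bar> + \<bar>Im (Ln w)\<bar>" using w0 by simp
  also have "\<dots> \<le> (5/2 + \<bar>t\<bar>) + 4"
    using u l mpi_less_Im_Ln[OF w0] Im_Ln_le_pi[OF w0] pi_less_4 by linarith
  also have "\<dots> \<le> 3 + \<bar>t\<bar> + 4" by simp
  also have "\<dots> \<le> 7 * (1 + \<bar>t\<bar>)" by simp
  finally show ?thesis by (simp only: w_def r_def Y_def)
qed

context smoothed
begin

lemma phi_line_cnj: "\<phi> (Complex c (- t)) = cnj (\<phi> (Complex c t))"
  using phi_cnj[of "Complex c t"] by (simp add: complex_cnj)

lemma phi_line_integrable:
  assumes "c = -1 \<or> c = 2"
  shows "integrable lborel (\<lambda>t. \<phi> (Complex c t))"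
  using phi_line_mult(1)[OF assms, of "\<lambda>_. 1" 1] by simp

lemma phi_line_integral_real: "Im (\<integral>t. \<phi> (Complex c t) \<partial>lborel) = 0"
  by (rule integral_real_if_symmetric) (rule phi_line_cnj)

text \<open>The residue of \<open>\<phi>\<close> at 0 is 1: \<open>shift_bound\<close> with the
  constant function 1, as \<open>T\<close> tends to infinity.\<close>

lemma phi_line_diff: "(\<integral>t. \<phi> (Complex 2 t) \<partial>lborel) - (\<integral>t. \<phi> (Complex (-1) t) \<partial>lborel) = 2 * of_real pi"
proof -
  define I where "I = (\<lambda>c. \<integral>t. \<phi> (Complex c t) \<partial>lborel)"
  define J where "J = (\<lambda>c T. integral {- T..T} (\<lambda>t. \<phi> (Complex c t)))"
  have t: "norm (I c - J c T) \<le> 2 * decay_const * 1 * exp (- T / 4) * exp_const" if "c = -1 \<or> c = 2" for c T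
    using phi_line_mult(2)[OF that, of "\<lambda>_. 1" 1 T] by (simp add: I_def J_def)
  have s: "norm (J 2 T - J (-1) T - 2 * of_real pi) \<le> 6 * (decay_const * exp (- T) * 1)" if "T \<ge> 1" for T
    using shift_bound[of "\<lambda>_. 1" UNIV T 1] that by (simp add: J_def)
  have b: "norm (I 2 - I (-1) - 2 * of_real pi) \<le> 4 * decay_const * exp (- T / 4) * exp_const + 6 * (decay_const * exp (- T))"
    if T: "T \<ge> 1" for T
  proof -
    have "I 2 - I (-1) - 2 * of_real pi = (I 2 - J 2 T) - (I (-1) - J (-1) T) + (J 2 T - J (-1) T - 2 * of_real pi)" by simp
    also have "norm \<dots> \<le> norm (I 2 - J 2 T) + norm (I (-1) - J (-1) T) + norm (J 2 T - J (-1) T - 2 * of_real pi)"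
      by (rule order_trans[OF norm_triangle_ineq add_right_mono[OF norm_triangle_ineq4]])
    finally show ?thesis using t[of 2 T] t[of "-1" T] s[OF T] by simp
  qed
  have "eventually (\<lambda>T. norm (I 2 - I (-1) - 2 * of_real pi) \<le> 4 * decay_const * exp (- T / 4) * exp_const + 6 * (decay_const * exp (- T))) at_top"
    using eventually_ge_at_top[of "1::real"] by eventually_elim (rule b)
  moreover have "((\<lambda>T. 4 * decay_const * exp (- T / 4) * exp_const + 6 * (decay_const * exp (- T))) \<longlongrightarrow>
      4 * decay_const * 0 * exp_const + 6 * (decay_const * 0)) at_top"
  proof (intro tendsto_add tendsto_mult tendsto_const)
    show "((\<lambda>T::real. exp (- T / 4)) \<longlongrightarrow> 0) at_top" "((\<lambda>T::real. exp (- T)) \<longlongrightarrow> 0) at_top" by real_asymp+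
  qed
  ultimately have "norm (I 2 - I (-1) - 2 * of_real pi) \<le> 4 * decay_const * 0 * exp_const + 6 * (decay_const * 0)"
    by (intro tendsto_lowerbound) auto
  thus ?thesis by (simp add: I_def)
qed

lemma Im_const: "Im (log_int 1 + 2 * of_real pi * \<Phi> 1) = 0"
proof -
  have c: "Complex 2 (- t) = cnj (Complex 2 t)" "Complex (-1) (- t) = cnj (Complex (-1) t)" for t
    by (simp_all add: complex_cnj)
  have 1: "Im (\<integral>t. \<phi> (Complex 2 t) * Ln (Complex 2 t - 1) \<partial>lborel) = 0"
  proof (rule integral_real_if_symmetric)
    fix t :: real
    have "Complex 2 t - 1 \<notin> \<real>\<^sub>\<le>\<^sub>0" by (simp add: complex_nonpos_Reals_iff)
    from cnj_Ln[OF this] show "\<phi> (Complex 2 (- t)) * Ln (Complex 2 (- t) - 1) = cnj (\<phi> (Complex 2 t) * Ln (Complex 2 t - 1))"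
      unfolding c phi_cnj by simp
  qed
  have 2: "Im (\<integral>t. \<phi> (Complex (-1) t) * Ln (1 - Complex (-1) t) \<partial>lborel) = 0"
  proof (rule integral_real_if_symmetric)
    fix t :: real
    have "1 - Complex (-1) t \<notin> \<real>\<^sub>\<le>\<^sub>0" by (simp add: complex_nonpos_Reals_iff)
    from cnj_Ln[OF this] show "\<phi> (Complex (-1) (- t)) * Ln (1 - Complex (-1) (- t)) = cnj (\<phi> (Complex (-1) t) * Ln (1 - Complex (-1) t))"
      unfolding c phi_cnj by simp
  qed
  have "\<Phi> (cnj 1) = cnj (\<Phi> 1)" by (rule Phi_cnj) simp
  hence "Im (\<Phi> 1) = 0" by (simp add: complex_eq_iff)
  thus ?thesis using 1 2 by (simp add: log_int_def)
qed

text \<open>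
  The constant of \<open>log_int_eq_const\<close> is real by symmetry; its real part is read off from
  \<open>\<rho> = 1 / 2 + i n\<close> as \<open>n \<longlonglongrightarrow> \<infinity>\<close>, where \<open>Re (\<Phi> \<rho>)\<close> vanishes.
\<close>

lemma Re_const: "Re (log_int 1 + 2 * of_real pi * \<Phi> 1) = 0"
proof -
  define C where "C = log_int 1 + 2 * of_real pi * \<Phi> 1"
  define r where "r = (\<lambda>n. Complex (1/2) (real (Suc n)))"
  \<comment> \<open>Subtracting \<open>ln (norm (r n))\<close> keeps the logarithms bounded. By
    \<open>phi_line_diff\<close> it costs \<open>2 * pi * ln (norm (r n))\<close>, exactly the real
    part of the term with \<open>Ln (r n)\<close>.\<close>
  define L where "L = (\<lambda>n t. Ln (Complex (3/2) (t - real (Suc n))) - of_real (ln (norm (r n))))"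
  define p where "p = (\<integral>t. \<phi> (Complex 2 t) \<partial>lborel)"
  define q where "q = (\<integral>t. \<phi> (Complex (-1) t) \<partial>lborel)"
  have Lb: "norm (L n t) \<le> 7 * (1 + \<bar>t\<bar>)" for n t
    unfolding L_def r_def by (rule Ln_shift_bound)
  have Lc: "continuous_on UNIV (L n)" for n
    unfolding L_def by (intro continuous_intros continuous_on_Ln continuous_on_compose2[OF continuous_Complex[of UNIV]])
      (auto simp: complex_nonpos_Reals_iff)
  have Lt: "(\<lambda>n. L n t) \<longlonglongrightarrow> - (\<i> * of_real (pi / 2))" for t
    unfolding L_def r_def by (rule Ln_shift_tendsto)
  have dc: "(\<lambda>n. \<integral>t. \<phi> (Complex c t) * h n t \<partial>lborel) \<longlonglongrightarrow> (\<integral>t. \<phi> (Complex c t) * k \<partial>lborel)"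
    if c: "c = -1 \<or> c = 2" and h: "\<And>n. continuous_on UNIV (h n)" "\<And>n t. norm (h n t) \<le> 7 * (1 + \<bar>t\<bar>)"
      and lim: "\<And>t. (\<lambda>n. h n t) \<longlonglongrightarrow> k" for c h k
  proof (rule integral_dominated_convergence)
    have c0: "c \<noteq> 0" using c by auto
    show "(\<lambda>t. \<phi> (Complex c t) * k) \<in> borel_measurable lborel"
      by (simp, intro borel_measurable_continuous_onI continuous_on_mult continuous_phi_line[OF c0] continuous_on_const)
    show "(\<lambda>t. \<phi> (Complex c t) * h n t) \<in> borel_measurable lborel" for n
      by (simp, intro borel_measurable_continuous_onI continuous_on_mult continuous_phi_line[OF c0] h)
    show "integrable lborel (\<lambda>t. 14 * decay_const * exp (- (1/2) * \<bar>t\<bar>))"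
      by (intro integrable_mult_right integrable_exp_abs) simp
    show "AE t in lborel. (\<lambda>n. \<phi> (Complex c t) * h n t) \<longlonglongrightarrow> \<phi> (Complex c t) * k"
      by (intro AE_I2 tendsto_mult tendsto_const lim)
    show "AE t in lborel. norm (\<phi> (Complex c t) * h n t) \<le> 14 * decay_const * exp (- (1/2) * \<bar>t\<bar>)" for n
    proof (rule AE_I2)
      fix t :: real
      have "norm (\<phi> (Complex c t) * h n t) \<le> (decay_const * exp (- \<bar>t\<bar>)) * (7 * (1 + \<bar>t\<bar>))"
        unfolding norm_mult using decay_const_pos by (intro mult_mono norm_phi_line c h) auto
      also have "\<dots> = 7 * decay_const * ((1 + \<bar>t\<bar>) * exp (- \<bar>t\<bar>))" by simp
      also have "\<dots> \<le> 7 * decay_const * (2 * exp (- \<bar>t\<bar> / 2))"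
        using decay_const_pos by (intro mult_left_mono one_plus_abs_le_exp) auto
      finally show "norm (\<phi> (Complex c t) * h n t) \<le> 14 * decay_const * exp (- (1/2) * \<bar>t\<bar>)" by simp
    qed
  qed
  have l1: "(\<lambda>n. \<integral>t. \<phi> (Complex 2 t) * L n t \<partial>lborel) \<longlonglongrightarrow> (\<integral>t. \<phi> (Complex 2 t) * - (\<i> * of_real (pi / 2)) \<partial>lborel)"
    by (rule dc) (use Lc Lb Lt in auto)
  have l2: "(\<lambda>n. \<integral>t. \<phi> (Complex (-1) t) * cnj (L n t) \<partial>lborel) \<longlonglongrightarrow> (\<integral>t. \<phi> (Complex (-1) t) * cnj (- (\<i> * of_real (pi / 2))) \<partial>lborel)"
  proof (rule dc)
    show "continuous_on UNIV (\<lambda>t. cnj (L n t))" for n by (intro continuous_on_cnj Lc)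
    show "(\<lambda>n. cnj (L n t)) \<longlonglongrightarrow> cnj (- (\<i> * of_real (pi / 2)))" for t by (intro tendsto_cnj Lt)
  qed (use Lb in auto)
  have eq: "log_int (r n) - of_real (ln (norm (r n))) * (2 * of_real pi) =
      (\<integral>t. \<phi> (Complex 2 t) * L n t \<partial>lborel) - (\<integral>t. \<phi> (Complex (-1) t) * cnj (L n t) \<partial>lborel)" for n
  proof -
    have e1: "Complex 2 t - r n = Complex (3/2) (t - real (Suc n))" for t by (simp add: r_def complex_eq_iff)
    \<comment> \<open>The abscissa \<open>1/2\<close> is midway between the lines, so the two
      arguments are conjugate and one limit serves both.\<close>
    have e2: "r n - Complex (-1) t = cnj (Complex (3/2) (t - real (Suc n)))" for t by (simp add: r_def complex_eq_iff)
    have ns: "Complex (3/2) (t - real (Suc n)) \<notin> \<real>\<^sub>\<le>\<^sub>0" for t by (simp add: complex_nonpos_Reals_iff)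
    have f1: "\<phi> (Complex 2 t) * Ln (Complex 2 t - r n) = \<phi> (Complex 2 t) * L n t + \<phi> (Complex 2 t) * of_real (ln (norm (r n)))" for t
      unfolding e1 L_def by (simp add: algebra_simps)
    have f2: "\<phi> (Complex (-1) t) * Ln (r n - Complex (-1) t) = \<phi> (Complex (-1) t) * cnj (L n t) + \<phi> (Complex (-1) t) * of_real (ln (norm (r n)))" for t
      unfolding e2 cnj_Ln[OF ns, symmetric] L_def by (simp add: algebra_simps)
    have i1: "integrable lborel (\<lambda>t. \<phi> (Complex 2 t) * L n t)"
      by (rule phi_line_mult(1)[OF _ Lc Lb]) simp
    have i2: "integrable lborel (\<lambda>t. \<phi> (Complex (-1) t) * cnj (L n t))"
      by (rule phi_line_mult(1)[where A = 7]) (use Lb in \<open>auto intro!: continuous_on_cnj Lc\<close>)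
    have g1: "(\<integral>t. \<phi> (Complex 2 t) * Ln (Complex 2 t - r n) \<partial>lborel) = (\<integral>t. \<phi> (Complex 2 t) * L n t \<partial>lborel) + p * of_real (ln (norm (r n)))"
      unfolding f1 p_def using phi_line_integrable[of 2]
      by (subst Bochner_Integration.integral_add[OF i1]) (auto simp del: mult_minus_left)
    have g2: "(\<integral>t. \<phi> (Complex (-1) t) * Ln (r n - Complex (-1) t) \<partial>lborel) = (\<integral>t. \<phi> (Complex (-1) t) * cnj (L n t) \<partial>lborel) + q * of_real (ln (norm (r n)))"
      unfolding f2 q_def using phi_line_integrable[of "-1"]
      by (subst Bochner_Integration.integral_add[OF i2]) auto
    have "p - q = 2 * of_real pi" unfolding p_def q_def by (rule phi_line_diff)
    hence "of_real (ln (norm (r n))) * (2 * of_real pi) = of_real (ln (norm (r n))) * (p - q)" by simp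
    thus ?thesis unfolding log_int_def g1 g2 by (simp add: algebra_simps)
  qed
  have "(\<lambda>n. Re (log_int (r n) - of_real (ln (norm (r n))) * (2 * of_real pi))) \<longlonglongrightarrow>
      Re ((\<integral>t. \<phi> (Complex 2 t) * - (\<i> * of_real (pi / 2)) \<partial>lborel) - (\<integral>t. \<phi> (Complex (-1) t) * cnj (- (\<i> * of_real (pi / 2))) \<partial>lborel))"
    unfolding eq by (intro tendsto_Re tendsto_diff l1 l2)
  also have "Re ((\<integral>t. \<phi> (Complex 2 t) * - (\<i> * of_real (pi / 2)) \<partial>lborel) - (\<integral>t. \<phi> (Complex (-1) t) * cnj (- (\<i> * of_real (pi / 2))) \<partial>lborel)) = 0"
  proof -
    have a: "(\<integral>t. \<phi> (Complex 2 t) * - (\<i> * of_real (pi / 2)) \<partial>lborel) = p * - (\<i> * of_real (pi / 2))"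
      unfolding p_def by (rule Bochner_Integration.integral_mult_left) (use phi_line_integrable[of 2] in simp)
    have b: "(\<integral>t. \<phi> (Complex (-1) t) * cnj (- (\<i> * of_real (pi / 2))) \<partial>lborel) = q * cnj (- (\<i> * of_real (pi / 2)))"
      unfolding q_def by (rule Bochner_Integration.integral_mult_left) (use phi_line_integrable[of "-1"] in simp)
    \<comment> \<open>In the limit the logarithms are \<open>\<minusplus> \<i> * pi / 2\<close>;
      multiplied by real integrals they leave no real part.\<close>
    have "Im p = 0" "Im q = 0" unfolding p_def q_def by (rule phi_line_integral_real)+
    thus ?thesis unfolding a b by simp
  qed
  finally have lim0: "(\<lambda>n. Re (log_int (r n) - of_real (ln (norm (r n))) * (2 * of_real pi))) \<longlonglongrightarrow> 0" .
  have e: "Re (log_int (r n) - of_real (ln (norm (r n))) * (2 * of_real pi)) = Re C - 2 * pi * Re (\<Phi> (r n))" for n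
  proof -
    have "r n \<noteq> 0" by (simp add: r_def complex_eq_iff)
    hence "Re (Ln (r n)) = ln (norm (r n))" by simp
    moreover have "log_int (r n) + 2 * of_real pi * (\<Phi> (r n) - Ln (r n)) = C"
      unfolding C_def by (rule log_int_eq_const) (simp_all add: r_def)
    hence "Re (log_int (r n) + 2 * of_real pi * (\<Phi> (r n) - Ln (r n))) = Re C" by (rule arg_cong)
    hence "Re (log_int (r n)) + 2 * pi * (Re (\<Phi> (r n)) - Re (Ln (r n))) = Re C" by simp
    ultimately show ?thesis by (simp add: algebra_simps)
  qed
  have "(\<lambda>n. Re (\<Phi> (r n))) \<longlonglongrightarrow> 0"
    unfolding r_def by (rule filterlim_compose[OF Re_Phi_tendsto filterlim_compose[OF filterlim_real_sequentially filterlim_Suc]])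
  hence "(\<lambda>n. Re C - 2 * pi * Re (\<Phi> (r n))) \<longlonglongrightarrow> Re C - 2 * pi * 0" by (intro tendsto_intros)
  hence "(\<lambda>n. Re (log_int (r n) - of_real (ln (norm (r n))) * (2 * of_real pi))) \<longlonglongrightarrow> Re C" unfolding e by simp
  from LIMSEQ_unique[OF this lim0] show ?thesis by (simp add: C_def)
qed

lemma log_int_1: "log_int 1 = - (2 * of_real pi * \<Phi> 1)"
  using Re_const Im_const by (simp add: complex_eq_iff)

lemma log_int_eq:
  assumes "0 \<le> Re \<rho>" "Re \<rho> \<le> 1" "Im \<rho> \<noteq> 0"
  shows "log_int \<rho> = 2 * of_real pi * (Ln \<rho> - \<Phi> \<rho>)"
  using log_int_eq_const[OF assms] unfolding log_int_1 by (simp add: algebra_simps)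

end

section \<open>The logarithm of minus zeta\<close>

lemma exp_eq_real:
  assumes "exp a = exp b" "Im a = 0" "Im b = 0"
  shows "a = b"
proof -
  have "norm (exp a) = norm (exp b)" using assms(1) by simp
  hence "Re a = Re b" by (simp only: norm_exp_eq_Re exp_inj_iff)
  thus ?thesis using assms(2,3) by (simp add: complex_eq_iff)
qed

lemma zeta_real_continuous: "continuous_on {-2<..<1} (\<lambda>x::real. zeta (of_real x))"
proof (rule continuous_on_compose2[OF holomorphic_on_imp_continuous_on[OF zeta_holomorphic]])
  show "continuous_on {-2<..<1} (\<lambda>x::real. complex_of_real x)" by (intro continuous_intros)
  show "(\<lambda>x::real. complex_of_real x) ` {-2<..<1} \<subseteq> - {1}" by auto
qed

text \<open>The zero-free strip \<open>-2 < Re z < 0\<close> is joined to a thin box around the real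
  segment. Both are convex and contain -1, so the union is starlike and carries holomorphic
  logarithms.\<close>

lemma log_neg_zeta_domain:
  obtains U where "open U" "connected U" "contractible U" "complex_of_real ` {-2<..<1} \<subseteq> U" "{z. Re z = -1} \<subseteq> U"
    "\<And>z. z \<in> U \<Longrightarrow> z \<noteq> 1 \<and> zeta z \<noteq> 0"
proof -
  \<comment> \<open>The segment includes 1 to be compact. There \<open>xi\<close> is 1, so its
    closed zero set has positive distance \<open>d\<close> from the segment, the half height of the
    box.\<close>
  define K where "K = complex_of_real ` {0..1}"
  have K: "compact K" unfolding K_def by (intro compact_continuous_image continuous_intros) auto
  have Z: "closed {z. xi z = 0}"
  proof -
    have "continuous_on UNIV xi" by (rule holomorphic_on_imp_continuous_on[OF xi_holomorphic])
    hence "isCont xi x" for x by (simp add: continuous_on_eq_continuous_at)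
    hence "closed (xi -` {0})" by (intro continuous_closed_vimage) auto
    moreover have "xi -` {0} = {z. xi z = 0}" by auto
    ultimately show ?thesis by simp
  qed
  have KZ: "K \<inter> {z. xi z = 0} = {}"
  proof -
    have "xi (of_real x) \<noteq> 0" if "0 \<le> x" "x \<le> 1" for x :: real
    proof (cases "x = 1")
      case True
      thus ?thesis by (simp add: xi_1)
    next
      case False
      hence "Re (zeta (of_real x)) < 0" using that by (intro Re_zeta_neg) auto
      thus ?thesis by (auto simp: xi_eq_0_iff)
    qed
    thus ?thesis by (auto simp: K_def)
  qed
  obtain d where d: "d > 0" "\<And>x y. x \<in> K \<Longrightarrow> y \<in> {z. xi z = 0} \<Longrightarrow> d \<le> dist x y"
    using separate_compact_closed[OF K Z KZ] by blast
  define A where "A = {z. Re z > -2} \<inter> {z. Re z < 0}"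
  define B where "B = ({z. Re z > -2} \<inter> {z. Re z < 1}) \<inter> ({z. Im z > - d} \<inter> {z. Im z < d})"
  have A: "open A" "convex A" unfolding A_def
    by (intro open_Int open_halfspace_Re_gt open_halfspace_Re_lt, intro convex_Int convex_halfspace_Re_gt convex_halfspace_Re_lt)
  have B: "open B" "convex B" unfolding B_def
    by (intro open_Int open_halfspace_Re_gt open_halfspace_Re_lt open_halfspace_Im_gt open_halfspace_Im_lt,
        intro convex_Int convex_halfspace_Re_gt convex_halfspace_Re_lt convex_halfspace_Im_gt convex_halfspace_Im_lt)
  have m: "-1 \<in> A" "-1 \<in> B" using d(1) by (auto simp: A_def B_def)
  have st: "starlike (A \<union> B)"
    unfolding starlike_def
  proof (intro bexI[of _ "-1"] ballI)
    fix z assume "z \<in> A \<union> B"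
    thus "closed_segment (-1) z \<subseteq> A \<union> B"
      using closed_segment_subset[OF m(1) _ A(2), of z] closed_segment_subset[OF m(2) _ B(2), of z] by blast
  qed (use m in blast)
  have nz: "z \<noteq> 1 \<and> zeta z \<noteq> 0" if z: "z \<in> A \<union> B" for z
  proof
    show z1: "z \<noteq> 1" using z by (auto simp: A_def B_def)
    have "xi z \<noteq> 0"
    proof (cases "Re z < 0")
      case True
      thus ?thesis using z by (intro xi_nonzero_strip) (auto simp: A_def B_def)
    next
      case False
      hence zB: "z \<in> B" using z by (auto simp: A_def)
      show ?thesis
      proof
        assume "xi z = 0"
        moreover have "of_real (Re z) \<in> K" using False zB by (auto simp: K_def B_def)
        ultimately have "d \<le> dist (of_real (Re z)) z" using d(2) by blast
        moreover have "of_real (Re z) - z = - (\<i> * of_real (Im z))" by (simp add: complex_eq_iff)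
        hence "dist (of_real (Re z)) z = \<bar>Im z\<bar>" unfolding dist_norm by (simp add: norm_mult)
        ultimately show False using zB by (auto simp: B_def)
      qed
    qed
    thus "zeta z \<noteq> 0" using z1 by (simp add: xi_eq_0_iff)
  qed
  show ?thesis
  proof (rule that[of "A \<union> B"])
    show "open (A \<union> B)" using A(1) B(1) by (rule open_Un)
    show "connected (A \<union> B)" by (rule starlike_imp_connected[OF st])
    show "contractible (A \<union> B)" by (rule starlike_imp_contractible[OF st])
    show "complex_of_real ` {-2<..<1} \<subseteq> A \<union> B" using d(1) by (auto simp: B_def)
    show "{z. Re z = -1} \<subseteq> A \<union> B" by (auto simp: A_def)
  qed (rule nz)
qed

text \<open>A logarithm on the domain above, shifted by a constant to be real at -1, is admissible
  in the description. Any other admissible one agrees with it on the connected line, since both take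
  the same value at -1.\<close>

lemma log_neg_zeta_line:
  obtains L where "continuous_on {z. Re z = -1} L" "\<And>z. Re z = -1 \<Longrightarrow> exp (L z) = - zeta z"
    "Im (L (-1)) = 0" "\<And>z. Re z = -1 \<Longrightarrow> log_neg_zeta z = L z"
proof -
  obtain U where U: "open U" "connected U" "contractible U" "complex_of_real ` {-2<..<1} \<subseteq> U" "{z. Re z = -1} \<subseteq> U"
    "\<And>z. z \<in> U \<Longrightarrow> z \<noteq> 1 \<and> zeta z \<noteq> 0" using log_neg_zeta_domain by blast
  have "zeta holomorphic_on U" by (rule holomorphic_on_subset[OF zeta_holomorphic]) (use U(6) in blast)
  hence "(\<lambda>z. - zeta z) holomorphic_on U" by (rule holomorphic_on_minus)
  moreover have "- zeta z \<noteq> 0" if "z \<in> U" for z using U(6)[OF that] by simp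
  ultimately obtain L0 where L0: "L0 holomorphic_on U" "\<And>z. z \<in> U \<Longrightarrow> - zeta z = exp (L0 z)"
    using contractible_imp_holomorphic_log[OF _ U(3), of "\<lambda>z. - zeta z"] by blast
  define l where "l = (\<lambda>x::real. Re (- zeta (of_real x)))"
  have lpos: "l x > 0" and lz: "- zeta (of_real x) = of_real (l x)" if "x \<in> {-2<..<1}" for x
  proof -
    show "l x > 0" using Re_zeta_neg[of x] that by (simp add: l_def)
    show "- zeta (of_real x) = of_real (l x)" by (simp add: l_def complex_eq_iff Im_zeta_of_real)
  qed
  define L where "L = (\<lambda>z. L0 z - L0 (-1) + of_real (ln (l (-1))))"
  have m1: "(-1::complex) \<in> U" using U(5) by auto
  have LU: "L holomorphic_on U" unfolding L_def by (intro holomorphic_intros L0)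
  have eL: "exp (L z) = - zeta z" if "z \<in> U" for z
  proof -
    have "exp (of_real (ln (l (-1)))) = (of_real (l (-1)) :: complex)"
      unfolding exp_of_real using lpos[of "-1"] by simp
    moreover have "exp (L0 (-1)) = of_real (l (-1))" using L0(2)[OF m1] lz[of "-1"] by simp
    moreover have "of_real (l (-1)) \<noteq> (0::complex)" using lpos[of "-1"] by simp
    ultimately show ?thesis unfolding L_def exp_add exp_diff L0(2)[OF that] by simp
  qed
  have Lcont: "continuous_on U L" using LU by (rule holomorphic_on_imp_continuous_on)
  have Lreal: "L (of_real x) = of_real (ln (l x))" if x: "x \<in> {-2<..<1}" for x
  proof (rule continuous_log_unique[where S = "{-2<..<1}" and f = "\<lambda>x. L (of_real x)" and g = "\<lambda>x. of_real (ln (l x))" and a = "-1"])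
    show "continuous_on {-2<..<1} (\<lambda>x::real. L (of_real x))"
      by (rule continuous_on_compose2[OF Lcont]) (use U(4) in \<open>auto intro!: continuous_intros\<close>)
    have "continuous_on {-2<..<1} l" unfolding l_def by (intro continuous_on_Re continuous_on_minus zeta_real_continuous)
    thus "continuous_on {-2<..<1} (\<lambda>x. complex_of_real (ln (l x)))"
      using lpos by (intro continuous_on_of_real continuous_on_ln) (auto simp: less_imp_neq[symmetric])
    fix y :: real assume y: "y \<in> {-2<..<1}"
    have "of_real y \<in> U" using U(4) y by blast
    from eL[OF this] show "exp (L (of_real y)) = exp (complex_of_real (ln (l y)))"
      unfolding exp_of_real lz[OF y] using lpos[OF y] by simp
  qed (use x in \<open>auto simp: L_def\<close>)
  have lineconn: "connected {z. Re z = -1}"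
  proof -
    have "{z. Re z = -1} = {z. Re z \<ge> -1} \<inter> {z. Re z \<le> -1}" by auto
    moreover have "convex ({z. Re z \<ge> -1} \<inter> {z. Re z \<le> -1})"
      by (intro convex_Int convex_halfspace_Re_ge convex_halfspace_Re_le)
    ultimately show ?thesis using convex_connected by metis
  qed
  have Lline: "continuous_on {z. Re z = -1} L" by (rule continuous_on_subset[OF Lcont U(5)])
  have main: "log_neg_zeta s = L s" if s: "Re s = -1" for s
    unfolding log_neg_zeta_def
  proof (rule the_equality)
    show "\<exists>U L'. open U \<and> connected U \<and> complex_of_real ` {-2<..<1} \<subseteq> U \<and> {z. Re z = -1} \<subseteq> U \<and>
      L' holomorphic_on U \<and> (\<forall>z\<in>U. exp (L' z) = - zeta z) \<and>
      (\<forall>\<sigma>\<in>{-2<..<1::real}. L' (of_real \<sigma>) = of_real (ln (Re (- zeta (of_real \<sigma>))))) \<and> L s = L' s"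
      by (intro exI[of _ U] exI[of _ L] conjI ballI U(1) U(2) U(4) U(5) LU refl)
         (use eL Lreal in \<open>simp_all add: l_def\<close>)
    fix w
    assume "\<exists>U L'. open U \<and> connected U \<and> complex_of_real ` {-2<..<1} \<subseteq> U \<and> {z. Re z = -1} \<subseteq> U \<and>
      L' holomorphic_on U \<and> (\<forall>z\<in>U. exp (L' z) = - zeta z) \<and>
      (\<forall>\<sigma>\<in>{-2<..<1::real}. L' (of_real \<sigma>) = of_real (ln (Re (- zeta (of_real \<sigma>))))) \<and> w = L' s"
    then obtain V L' where V: "{z. Re z = -1} \<subseteq> V" "L' holomorphic_on V" "\<And>z. z \<in> V \<Longrightarrow> exp (L' z) = - zeta z"
      "\<And>\<sigma>::real. \<sigma> \<in> {-2<..<1} \<Longrightarrow> L' (of_real \<sigma>) = of_real (ln (Re (- zeta (of_real \<sigma>))))" "w = L' s"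
      by blast
    have "L' s = L s"
    proof (rule continuous_log_unique[OF lineconn _ Lline, where a = "-1"])
      show "continuous_on {z. Re z = -1} L'"
        by (rule continuous_on_subset[OF holomorphic_on_imp_continuous_on[OF V(2)] V(1)])
      show "exp (L' z) = exp (L z)" if "z \<in> {z. Re z = -1}" for z
        using V(3)[of z] eL[of z] V(1) U(5) that by (simp add: subset_iff)
      show "L' (-1) = L (-1)" using V(4)[of "-1"] Lreal[of "-1"] by (simp add: l_def)
    qed (use s in auto)
    thus "w = L s" using V(5) by simp
  qed
  have "Im (L (-1)) = 0" using Lreal[of "-1"] by simp
  thus ?thesis using that[of L] Lline main eL U(5) by blast
qed

section \<open>Multiplicities of the zeros\<close>

interpretation xi: entire_symmetric xi
proof
  show "xi holomorphic_on UNIV" by (rule xi_holomorphic)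
  show "xi 0 \<noteq> 0" by (simp add: xi_0)
  show "xi (cnj s) = cnj (xi s)" for s by (rule xi_cnj)
qed

text \<open>The factor \<open>s - 1\<close> has order 0 away from 1. This links the multiplicities
  of the theorem to those of the factorisation.\<close>

lemma zorder_zeta_eq:
  assumes z: "z \<noteq> 1"
  shows "zorder zeta z = zorder xi z"
proof -
  have "eventually (\<lambda>w. w \<noteq> 1) (at z)"
    by (rule eventually_at_in_open'[of "- {1}" z, simplified, THEN eventually_mono]) (use z in auto)
  moreover have "eventually (\<lambda>w. xi w \<noteq> 0 \<and> w \<in> UNIV) (at z)"
    by (rule non_zero_neighbour_alt[OF xi_holomorphic, of _ 0]) (auto simp: xi_0)
  ultimately have ev: "eventually (\<lambda>w. (w - 1) * zeta w \<noteq> 0 \<and> xi w = (w - 1) * zeta w) (at z)"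
    by eventually_elim (simp add: xi_def)
  have "zorder xi z = zorder (\<lambda>w. (w - 1) * zeta w) z"
    by (rule zorder_cong) (use ev in \<open>auto elim: eventually_mono\<close>)
  also have "\<dots> = zorder (\<lambda>w. w - 1) z + zorder zeta z"
  proof (rule zorder_times_analytic)
    show "zeta analytic_on {z}"
      by (rule analytic_on_subset[of _ "- {1}"])
         (use z zeta_holomorphic in \<open>auto simp: analytic_on_open open_Compl\<close>)
  qed (use ev in \<open>auto intro!: analytic_intros elim: eventually_mono\<close>)
  also have "zorder (\<lambda>w. w - 1) z = 0"
    by (rule zorder_eq_0I) (use z in \<open>auto intro!: analytic_intros\<close>)
  finally show ?thesis by simp
qed

lemma nontrivial_zero_xi: "\<rho> \<in> nontrivial_zeros \<Longrightarrow> xi \<rho> = 0"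
  by (simp add: nontrivial_zeros_def xi_eq_0_iff)

lemma of_int_zorder_zeta:
  assumes "\<rho> \<in> nontrivial_zeros"
  shows "of_int (zorder zeta \<rho>) = (of_nat (zero_mult xi \<rho>) :: real)"
proof -
  have z: "zeta \<rho> = 0" "\<rho> \<noteq> 1" using assms by (auto simp: nontrivial_zeros_def)
  have "zorder zeta \<rho> = int (zero_mult xi \<rho>)"
    unfolding zorder_zeta_eq[OF z(2)] using xi.zorder_zero(3)[OF nontrivial_zero_xi[OF assms]] by simp
  thus ?thesis by simp
qed

section \<open>Logarithms on the two lines\<close>

lemma Ln_xi_0: "Ln (xi 0) = - of_real (ln 2)"
proof -
  have "Ln (of_real (1 / 2)) = of_real (ln (1 / 2))" by (rule Ln_of_real) simp
  thus ?thesis by (simp add: xi_0 ln_div)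
qed

lemma abs_ln_le:
  assumes "r > (0::real)"
  shows "\<bar>ln r\<bar> \<le> r + 1 / r"
proof -
  have "ln r \<le> r" using ln_bound[OF assms] by simp
  moreover have "ln (1 / r) \<le> 1 / r" using ln_bound[of "1 / r"] assms by simp
  moreover have "ln (1 / r) = - ln r" using assms by (simp add: ln_div)
  moreover have "1 / r > 0" using assms by simp
  ultimately show ?thesis using assms by linarith
qed

text \<open>The threshold \<open>1 / 2\<close> comes from the factors \<open>1 - s / \<rho>\<close>
  at trivial zeros, whose real part is at least that for \<open>Re s \<ge> -1\<close>.\<close>

lemma norm_Ln_le_half:
  assumes "norm z \<ge> 1 / 2"
  shows "norm (Ln z) \<le> norm z + 6"
proof -
  have z: "z \<noteq> 0" using assms by auto
  have "norm (Ln z) \<le> \<bar>Re (Ln z)\<bar> + \<bar>Im (Ln z)\<bar>" by (rule cmod_le)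
  also have "\<bar>Re (Ln z)\<bar> = \<bar>ln (norm z)\<bar>" using z by simp
  also have "\<bar>ln (norm z)\<bar> \<le> norm z + 1 / norm z" using z by (intro abs_ln_le) simp
  also have "1 / norm z \<le> 2" using assms z by (simp add: field_simps)
  also have "\<bar>Im (Ln z)\<bar> \<le> 4" using mpi_less_Im_Ln[OF z] Im_Ln_le_pi[OF z] pi_less_4 by linarith
  finally show ?thesis by simp
qed

lemma xi_factorization:
  obtains K where "K \<ge> 0"
    "\<And>R. R \<ge> 1 \<Longrightarrow> \<exists>g. g holomorphic_on ball 0 R \<and> g 0 = Ln (xi 0) \<and>
       (\<forall>s. norm s < R \<longrightarrow> xi s = zero_poly xi R s * exp (g s)) \<and>
       (\<forall>s. norm s \<le> R / 2 \<longrightarrow> norm (g s) \<le> K * R\<^sup>2)"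
    "\<And>R. R \<ge> 1 \<Longrightarrow> real (\<Sum>z\<in>zeros_in xi R. zero_mult xi z) \<le> K * R\<^sup>2"
proof -
  obtain C where C: "C > 0" "\<And>s. norm (xi s) \<le> exp (C * (1 + norm s)\<^sup>2)"
    using xi_growth by blast
  \<comment> \<open>For \<open>R \<ge> 1\<close>, \<open>(1 + 3 * R)^2 \<le> 16 * R^2\<close>,
    doubled by \<open>borel_caratheodory\<close>; the 6 covers the additive terms from
    \<open>ln 2\<close> and 1.\<close>
  define K where "K = 32 * C + 6"
  have ln2: "ln 2 \<le> (1::real)" "ln 2 \<ge> (1/2::real)"
    using ln_2_less_1 ln_le_minus_one[of "1/2::real"] by (simp_all add: ln_div)
  have arith1: "a \<le> 32 * c + 6 * r" if "a \<le> b + l" "b \<le> 2 * ((l + q) + 1)" "l \<le> 1" "q \<le> 16 * c" "1 \<le> r" "0 \<le> c"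
    for a b c l q r :: real using that by simp
  have arith2: "a \<le> 32 * c + 6 * r" if "b \<le> l + q" "a * (1/2) \<le> b" "l \<le> 1" "q \<le> 16 * c" "1 \<le> r" "0 \<le> c"
    for a b c l q r :: real using that by simp
  have ex: "\<exists>g. g holomorphic_on ball 0 R \<and> g 0 = Ln (xi 0) \<and>
       (\<forall>s. norm s < R \<longrightarrow> xi s = zero_poly xi R s * exp (g s)) \<and>
       (\<forall>s. norm s \<le> R / 2 \<longrightarrow> norm (g s) \<le> K * R\<^sup>2) \<and>
       real (\<Sum>z\<in>zeros_in xi R. zero_mult xi z) \<le> K * R\<^sup>2" if R: "R \<ge> 1" for R
  proof -
    define M where "M = exp (C * (1 + 3 * R)\<^sup>2)"
    have R0: "R > 0" using R by simp
    have M: "norm (xi s) \<le> M" if "norm s = 3 * R" for s using C(2)[of s] that by (simp add: M_def)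
    obtain g where g: "g holomorphic_on ball 0 R" "g 0 = Ln (xi 0)"
       "\<And>s. norm s < R \<Longrightarrow> xi s = zero_poly xi R s * exp (g s)"
       "\<And>s. norm s \<le> R / 2 \<Longrightarrow> norm (g s - Ln (xi 0)) \<le> 2 * (ln (M / norm (xi 0)) + 1)"
       "2 ^ (\<Sum>z\<in>zeros_in xi R. zero_mult xi z) \<le> M / norm (xi 0)"
      using xi.log_factorization[OF R0 M] by blast
    define n where "n = (\<Sum>z\<in>zeros_in xi R. zero_mult xi z)"
    have q: "M / norm (xi 0) = 2 * M" by (simp add: xi_0)
    have lq: "ln (M / norm (xi 0)) = ln 2 + C * (1 + 3 * R)\<^sup>2" unfolding q
      by (simp add: ln_mult M_def)
    have R2: "1 \<le> R\<^sup>2" using R by simp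
    have "(1 + 3 * R)\<^sup>2 \<le> (4 * R)\<^sup>2" using R by (intro power_mono) auto
    hence "C * (1 + 3 * R)\<^sup>2 \<le> C * (16 * R\<^sup>2)" using C(1) by (intro mult_left_mono) (auto simp: power_mult_distrib)
    hence c: "C * (1 + 3 * R)\<^sup>2 \<le> 16 * (C * R\<^sup>2)" by simp
    have KR: "K * R\<^sup>2 = 32 * (C * R\<^sup>2) + 6 * R\<^sup>2" unfolding K_def by (simp add: algebra_simps)
    have CR: "C * R\<^sup>2 \<ge> 0" using C(1) by simp
    have "norm (g s) \<le> K * R\<^sup>2" if s: "norm s \<le> R / 2" for s
    proof -
      have "norm (g s) \<le> norm (g s - Ln (xi 0)) + norm (Ln (xi 0))"
        using norm_triangle_ineq[of "g s - Ln (xi 0)" "Ln (xi 0)"] by simp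
      also have "norm (Ln (xi 0)) = ln 2" by (simp add: Ln_xi_0)
      finally have 1: "norm (g s) \<le> norm (g s - Ln (xi 0)) + ln 2" .
      show ?thesis unfolding KR
        by (rule arith1[OF 1 g(4)[OF s, unfolded lq] ln2(1) c R2 CR])
    qed
    moreover have "real n \<le> K * R\<^sup>2"
    proof -
      have "real n * ln 2 = ln (2 ^ n)" by (simp add: ln_realpow)
      also have "\<dots> \<le> ln (M / norm (xi 0))" using g(5) by (intro ln_mono) (auto simp: n_def M_def xi_0)
      finally have 1: "real n * ln 2 \<le> ln 2 + C * (1 + 3 * R)\<^sup>2" unfolding lq .
      have 2: "real n * (1/2) \<le> real n * ln 2" using ln2 by (intro mult_left_mono) auto
      show ?thesis unfolding KR by (rule arith2[OF 1 2 ln2(1) c R2 CR])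
    qed
    ultimately show ?thesis using g(1,2,3) unfolding n_def by blast
  qed
  have "K \<ge> 0" using C(1) by (simp add: K_def)
  thus ?thesis using that[of K] ex by blast
qed

text \<open>Keeps \<open>ln (norm \<rho>)\<close> bounded below, uniformly over all zeros.\<close>

lemma xi_zeros_away_from_0:
  obtains d where "d > 0" "\<And>\<rho>. xi \<rho> = 0 \<Longrightarrow> d \<le> norm \<rho>"
proof -
  have "isCont xi 0"
    using holomorphic_on_imp_continuous_on[OF xi_holomorphic] by (simp add: continuous_on_eq_continuous_at)
  from continuous_at_avoid[OF this, of 0]
  obtain d where d: "d > 0" "\<And>z. dist 0 z < d \<Longrightarrow> xi z \<noteq> 0" by (auto simp: xi_0)
  show ?thesis
  proof (rule that[OF d(1)])
    fix \<rho> assume "xi \<rho> = 0"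
    thus "d \<le> norm \<rho>" using d(2)[of \<rho>] by force
  qed
qed

locale xi_log =
  fixes R :: real and g :: "complex \<Rightarrow> complex"
  assumes R: "R \<ge> 4"
    and g_hol: "g holomorphic_on ball 0 R" and g_0: "g 0 = Ln (xi 0)"
    and xi_eq: "\<And>s. norm s < R \<Longrightarrow> xi s = zero_poly xi R s * exp (g s)"
begin

text \<open>
  \<open>NT\<close> and \<open>TR\<close> are the nontrivial and the trivial zeros in the disc. With \<open>e = 1\<close> the principal
  logarithms in \<open>P\<close> are continuous to the right of all nontrivial zeros, with \<open>e = -1\<close> to the left. The
  terms \<open>ln (norm \<rho>)\<close> normalise both at once: replacing \<open>1 - s / \<rho>\<close> by \<open>e * (s - \<rho>) / norm \<rho>\<close> changes the
  product over \<open>NT\<close> by unimodular factors that cancel in conjugate pairs.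
\<close>

definition NT :: "complex set" where "NT = {\<rho> \<in> zeros_in xi R. Im \<rho> \<noteq> 0}"
definition TR :: "complex set" where "TR = {\<rho> \<in> zeros_in xi R. Im \<rho> = 0}"

abbreviation mu :: "complex \<Rightarrow> complex" where "mu \<rho> \<equiv> of_nat (zero_mult xi \<rho>)"

definition H :: "complex \<Rightarrow> complex" where
  "H s = (\<Sum>\<rho>\<in>TR. mu \<rho> * Ln (1 - s / \<rho>)) + g s"

definition P :: "complex \<Rightarrow> complex \<Rightarrow> complex" where
  "P e s = (\<Sum>\<rho>\<in>NT. mu \<rho> * (Ln (e * (s - \<rho>)) - of_real (ln (norm \<rho>))))"

lemma finite_NT: "finite NT" and finite_TR: "finite TR"
  using xi.finite_zeros_in[of R] by (simp_all add: NT_def TR_def)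

lemma NT_D:
  assumes "\<rho> \<in> NT"
  shows "\<rho> \<in> nontrivial_zeros" "0 \<le> Re \<rho>" "Re \<rho> \<le> 1" "Im \<rho> \<noteq> 0" "norm \<rho> < R" "\<rho> \<noteq> 0" "xi \<rho> = 0"
proof -
  show z: "xi \<rho> = 0" and "norm \<rho> < R" and i: "Im \<rho> \<noteq> 0" using assms by (auto simp: NT_def zeros_in_def)
  show nt: "\<rho> \<in> nontrivial_zeros" using xi_zero_cases[OF z] i by blast
  show "0 \<le> Re \<rho>" "Re \<rho> \<le> 1" using nontrivial_zeros_strip[OF nt] by auto
  show "\<rho> \<noteq> 0" using i by auto
qed

lemma NT_eq: "NT = {\<rho> \<in> nontrivial_zeros. norm \<rho> < R}"
proof (rule set_eqI)
  fix \<rho>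
  show "\<rho> \<in> NT \<longleftrightarrow> \<rho> \<in> {\<rho> \<in> nontrivial_zeros. norm \<rho> < R}"
  proof
    assume "\<rho> \<in> NT"
    from NT_D(1,5)[OF this] show "\<rho> \<in> {\<rho> \<in> nontrivial_zeros. norm \<rho> < R}" by simp
  next
    assume "\<rho> \<in> {\<rho> \<in> nontrivial_zeros. norm \<rho> < R}"
    hence nt: "\<rho> \<in> nontrivial_zeros" and "norm \<rho> < R" by simp_all
    with nontrivial_zero_xi[OF nt] nontrivial_zeros_strip(3)[OF nt] show "\<rho> \<in> NT"
      by (simp add: NT_def zeros_in_def)
  qed
qed

lemma NT_cnj: "\<rho> \<in> NT \<Longrightarrow> cnj \<rho> \<in> NT"
  using xi.zeros_in_cnj by (auto simp: NT_def)

lemma mu_cnj: "\<rho> \<in> NT \<Longrightarrow> mu (cnj \<rho>) = mu \<rho>"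
  using xi.zero_mult_cnj[OF NT_D(7)] by simp

lemma TR_D:
  assumes "\<rho> \<in> TR"
  shows "Im \<rho> = 0" "Re \<rho> \<le> -2" "\<rho> = of_real (Re \<rho>)"
proof -
  have z: "xi \<rho> = 0" and i: "Im \<rho> = 0" using assms by (auto simp: TR_def zeros_in_def)
  show "Im \<rho> = 0" by (rule i)
  have "\<rho> \<notin> nontrivial_zeros" using nontrivial_zeros_strip[of \<rho>] i by blast
  thus "Re \<rho> \<le> -2" using xi_zero_cases[OF z] by blast
  show "\<rho> = of_real (Re \<rho>)" using i by (simp add: complex_eq_iff)
qed

text \<open>Trivial zeros are real and at most -2, so to the right of -2 their factors stay in the
  right half-plane. Therefore their logarithms can be absorbed into the common function
  \<open>H\<close>.\<close>

lemma Re_TR_factor: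
  assumes "\<rho> \<in> TR" "- c \<le> Re s" "c \<le> 2" "0 \<le> c"
  shows "1 - c / 2 \<le> Re (1 - s / \<rho>)"
proof -
  define r where "r = - Re \<rho>"
  have r: "\<rho> = - of_real r" "r \<ge> 2" using TR_D[OF assms(1)] by (simp_all add: r_def complex_eq_iff)
  have "Re (1 - s / \<rho>) = 1 + Re s / r" unfolding r(1) by (simp add: Re_divide_of_real)
  moreover have "- c / 2 \<le> - c / r" using r(2) assms(4) by (simp add: field_simps mult_left_mono)
  moreover have "- c / r \<le> Re s / r" using r(2) assms(2) by (intro divide_right_mono) auto
  ultimately show ?thesis by linarith
qed

lemma TR_factor_slit:
  assumes "\<rho> \<in> TR" "-2 < Re s"
  shows "1 - s / \<rho> \<notin> \<real>\<^sub>\<le>\<^sub>0"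
proof -
  define c where "c = max 0 (- Re s)"
  have "1 - c / 2 \<le> Re (1 - s / \<rho>)" using assms by (intro Re_TR_factor) (auto simp: c_def)
  moreover have "1 - c / 2 > 0" using assms(2) by (auto simp: c_def max_def)
  ultimately have "Re (1 - s / \<rho>) > 0" by linarith
  thus ?thesis by (simp only: complex_nonpos_Reals_iff) linarith
qed

lemma H_hol: "H holomorphic_on (ball 0 R \<inter> {s. -2 < Re s})"
  unfolding H_def
proof (intro holomorphic_intros)
  fix \<rho> s assume "\<rho> \<in> TR" "s \<in> ball 0 R \<inter> {s. -2 < Re s}"
  thus "\<rho> \<noteq> 0" "1 - s / \<rho> \<notin> \<real>\<^sub>\<le>\<^sub>0" using TR_factor_slit[of \<rho> s] TR_D[of \<rho>] by auto
next
  show "g holomorphic_on (ball 0 R \<inter> {s. -2 < Re s})" by (rule holomorphic_on_subset[OF g_hol]) auto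
qed

lemma H_0: "H 0 = - of_real (ln 2)"
  unfolding H_def g_0 Ln_xi_0 by simp

lemma exp_sum_mu_Ln:
  assumes "\<And>\<rho>. \<rho> \<in> A \<Longrightarrow> exp (f \<rho>) = h \<rho>" "finite A"
  shows "exp (\<Sum>\<rho>\<in>A. mu \<rho> * f \<rho>) = (\<Prod>\<rho>\<in>A. h \<rho> ^ zero_mult xi \<rho>)"
  unfolding exp_sum[OF assms(2)] by (intro prod.cong refl) (simp add: assms(1) exp_of_nat_mult)

lemma xi_eq_NT_H:
  assumes "norm s < R" "-2 < Re s"
  shows "xi s = (\<Prod>\<rho>\<in>NT. (1 - s / \<rho>) ^ zero_mult xi \<rho>) * exp (H s)"
proof -
  have un: "zeros_in xi R = NT \<union> TR" "NT \<inter> TR = {}" by (auto simp: NT_def TR_def)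
  have "exp (\<Sum>\<rho>\<in>TR. mu \<rho> * Ln (1 - s / \<rho>)) = (\<Prod>\<rho>\<in>TR. (1 - s / \<rho>) ^ zero_mult xi \<rho>)"
  proof (rule exp_sum_mu_Ln[OF _ finite_TR])
    fix \<rho> assume "\<rho> \<in> TR"
    hence "1 - s / \<rho> \<notin> \<real>\<^sub>\<le>\<^sub>0" by (rule TR_factor_slit) (rule assms)
    thus "exp (Ln (1 - s / \<rho>)) = 1 - s / \<rho>" by (intro exp_Ln) auto
  qed
  hence "exp (H s) = (\<Prod>\<rho>\<in>TR. (1 - s / \<rho>) ^ zero_mult xi \<rho>) * exp (g s)"
    by (simp add: H_def exp_add)
  moreover have "zero_poly xi R s = (\<Prod>\<rho>\<in>NT. (1 - s / \<rho>) ^ zero_mult xi \<rho>) * (\<Prod>\<rho>\<in>TR. (1 - s / \<rho>) ^ zero_mult xi \<rho>)"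
    unfolding zero_poly_def un(1) by (rule prod.union_disjoint[OF finite_NT finite_TR un(2)])
  ultimately show ?thesis using xi_eq[OF assms(1)] by simp
qed

lemma unit_product:
  assumes e: "e = 1 \<or> e = (-1::complex)"
  shows "(\<Prod>\<rho>\<in>NT. (e * \<rho> / of_real (norm \<rho>)) ^ zero_mult xi \<rho>) = 1"
proof -
  \<comment> \<open>The sum of \<open>mu \<rho> * f \<rho>\<close> is real by conjugate pairing and
    has real part 0 because the factors are unimodular. So it vanishes, and its exponential is the
    product.\<close>
  define f where "f = (\<lambda>\<rho>. Ln (e * \<rho>) - of_real (ln (norm \<rho>)))"
  have ne: "e \<noteq> 0" "norm e = 1" "cnj e = e" using e by auto
  have slit: "e * \<rho> \<notin> \<real>\<^sub>\<le>\<^sub>0" if "\<rho> \<in> NT" for \<rho>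
    using e NT_D(4)[OF that] by (auto simp: complex_nonpos_Reals_iff)
  have "exp (\<Sum>\<rho>\<in>NT. mu \<rho> * f \<rho>) = (\<Prod>\<rho>\<in>NT. (e * \<rho> / of_real (norm \<rho>)) ^ zero_mult xi \<rho>)"
  proof (rule exp_sum_mu_Ln[OF _ finite_NT])
    fix \<rho> assume "\<rho> \<in> NT"
    thus "exp (f \<rho>) = e * \<rho> / of_real (norm \<rho>)"
      using NT_D(6) ne by (simp add: f_def exp_diff exp_of_real)
  qed
  moreover have "Im (\<Sum>\<rho>\<in>NT. mu \<rho> * f \<rho>) = 0"
  proof (rule cnj_sum_symmetric[OF NT_cnj])
    fix \<rho> assume \<rho>: "\<rho> \<in> NT"
    have "Ln (e * cnj \<rho>) = cnj (Ln (e * \<rho>))" using cnj_Ln[OF slit[OF \<rho>]] ne by simp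
    thus "mu (cnj \<rho>) * f (cnj \<rho>) = cnj (mu \<rho> * f \<rho>)" by (simp add: f_def mu_cnj[OF \<rho>])
  qed
  moreover have "Re (\<Sum>\<rho>\<in>NT. mu \<rho> * f \<rho>) = 0"
    unfolding Re_sum
  proof (rule sum.neutral, rule ballI)
    fix \<rho> assume "\<rho> \<in> NT"
    hence "Re (f \<rho>) = 0" using NT_D(6) ne by (simp add: f_def norm_mult)
    thus "Re (mu \<rho> * f \<rho>) = 0" by simp
  qed
  ultimately have "(\<Sum>\<rho>\<in>NT. mu \<rho> * f \<rho>) = 0" by (simp add: complex_eq_iff)
  thus ?thesis using \<open>exp _ = _\<close> by simp
qed

lemma exp_P_H:
  assumes s: "norm s < R" "-2 < Re s" and e: "e = 1 \<or> e = (-1::complex)"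
    and ne: "\<And>\<rho>. \<rho> \<in> NT \<Longrightarrow> s \<noteq> \<rho>"
  shows "exp (P e s + H s) = xi s"
proof -
  have "exp (P e s) = (\<Prod>\<rho>\<in>NT. ((1 - s / \<rho>) * (- e * \<rho> / of_real (norm \<rho>))) ^ zero_mult xi \<rho>)"
    unfolding P_def
  proof (rule exp_sum_mu_Ln[OF _ finite_NT])
    fix \<rho> assume \<rho>: "\<rho> \<in> NT"
    have "e * (s - \<rho>) \<noteq> 0" using e ne[OF \<rho>] by auto
    hence "exp (Ln (e * (s - \<rho>)) - of_real (ln (norm \<rho>))) = e * (s - \<rho>) / of_real (norm \<rho>)"
      using NT_D(6)[OF \<rho>] by (simp add: exp_diff exp_of_real)
    also have "\<dots> = (1 - s / \<rho>) * (- e * \<rho> / of_real (norm \<rho>))"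
      using NT_D(6)[OF \<rho>] by (simp add: field_simps)
    finally show "exp (Ln (e * (s - \<rho>)) - of_real (ln (norm \<rho>))) = (1 - s / \<rho>) * (- e * \<rho> / of_real (norm \<rho>))" .
  qed
  also have "\<dots> = (\<Prod>\<rho>\<in>NT. (1 - s / \<rho>) ^ zero_mult xi \<rho>)
      * (\<Prod>\<rho>\<in>NT. (- e * \<rho> / of_real (norm \<rho>)) ^ zero_mult xi \<rho>)"
    unfolding power_mult_distrib prod.distrib ..
  also have "(\<Prod>\<rho>\<in>NT. (- e * \<rho> / of_real (norm \<rho>)) ^ zero_mult xi \<rho>) = 1"
    by (rule unit_product) (use e in auto)
  finally show ?thesis using xi_eq_NT_H[OF s] by (simp add: exp_add)
qed

lemma P_continuous_on:
  assumes "continuous_on A f" "\<And>t \<rho>. t \<in> A \<Longrightarrow> \<rho> \<in> NT \<Longrightarrow> e * (f t - \<rho>) \<notin> \<real>\<^sub>\<le>\<^sub>0"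
  shows "continuous_on A (\<lambda>t. P e (f t))"
  unfolding P_def using assms by (intro continuous_intros) auto

lemma H_continuous_on:
  assumes "continuous_on A f" "\<And>t. t \<in> A \<Longrightarrow> norm (f t) < R \<and> -2 < Re (f t)"
  shows "continuous_on A (\<lambda>t. H (f t))"
  by (rule continuous_on_compose2[OF holomorphic_on_imp_continuous_on[OF H_hol] assms(1)]) (use assms(2) in auto)

lemma Im_P_real:
  assumes "\<And>\<rho>. \<rho> \<in> NT \<Longrightarrow> e * (of_real x - \<rho>) \<notin> \<real>\<^sub>\<le>\<^sub>0" "cnj e = e"
  shows "Im (P e (of_real x)) = 0"
  unfolding P_def
proof (rule cnj_sum_symmetric[OF NT_cnj])
  fix \<rho> assume \<rho>: "\<rho> \<in> NT"
  have "Ln (e * (of_real x - cnj \<rho>)) = cnj (Ln (e * (of_real x - \<rho>)))"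
    using cnj_Ln[OF assms(1)[OF \<rho>]] assms(2) by simp
  thus "mu (cnj \<rho>) * (Ln (e * (of_real x - cnj \<rho>)) - of_real (ln (norm (cnj \<rho>))))
      = cnj (mu \<rho> * (Ln (e * (of_real x - \<rho>)) - of_real (ln (norm \<rho>))))"
    by (simp add: mu_cnj[OF \<rho>])
qed

lemma Im_H_real:
  assumes x: "-1 \<le> x" "x \<le> 2"
  shows "Im (H (of_real x)) = 0"
proof -
  have "Im (g (of_real x)) = 0"
  proof (rule xi.log_real_on_segment[OF g_hol g_0 xi_eq, where a = "-1" and b = 2])
    fix y :: real assume y: "-1 \<le> y"
    show "xi (of_real y) \<noteq> 0"
    proof
      assume "xi (of_real y) = 0"
      from xi_zero_cases[OF this] nontrivial_zeros_strip[of "of_real y"] y show False by auto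
    qed
  qed (use x R in \<open>auto simp: xi_0\<close>)
  moreover have "Im (mu \<rho> * Ln (1 - of_real x / \<rho>)) = 0" if \<rho>: "\<rho> \<in> TR" for \<rho>
  proof -
    define y where "y = 1 - x / Re \<rho>"
    have e: "1 - of_real x / \<rho> = of_real y" using TR_D(3)[OF \<rho>] by (metis y_def of_real_1 of_real_diff of_real_divide)
    have "of_real y \<notin> (\<real>\<^sub>\<le>\<^sub>0 :: complex set)" unfolding e[symmetric] by (rule TR_factor_slit[OF \<rho>]) (use x in simp)
    hence "y > 0" by (simp add: complex_nonpos_Reals_iff)
    hence "Im (Ln (1 - of_real x / \<rho>)) = 0" unfolding e by (simp add: Ln_of_real)
    thus ?thesis by simp
  qed
  hence "Im (\<Sum>\<rho>\<in>TR. mu \<rho> * Ln (1 - of_real x / \<rho>)) = 0" unfolding Im_sum by (intro sum.neutral ballI)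
  ultimately show ?thesis by (simp add: H_def)
qed

end

section \<open>Identifying the branches on the two lines\<close>

context xi_log
begin

lemma norm_line_less:
  assumes "\<bar>c\<bar> \<le> 2" "\<bar>u\<bar> \<le> \<bar>t\<bar>" "\<bar>t\<bar> + 2 < R"
  shows "norm (Complex c u) < R"
proof -
  have "norm (Complex c u) \<le> \<bar>c\<bar> + \<bar>u\<bar>" using cmod_le[of "Complex c u"] by simp
  thus ?thesis using assms by simp
qed

text \<open>Both sides are continuous logarithms of \<open>xi\<close> along the vertical segment,
  and at \<open>t = 0\<close> both are real, hence equal.\<close>

lemma log_zeta_eq:
  assumes t: "\<bar>t\<bar> + 2 < R"
  shows "log_zeta (Complex 2 t) + Ln (Complex 2 t - 1) = P 1 (Complex 2 t) + H (Complex 2 t)"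
proof -
  define S where "S = {- \<bar>t\<bar>..\<bar>t\<bar>}"
  have slit: "1 * (Complex 2 u - \<rho>) \<notin> \<real>\<^sub>\<le>\<^sub>0" if "\<rho> \<in> NT" for u \<rho>
    using NT_D(3)[OF that] by (simp add: complex_nonpos_Reals_iff)
  have bnd: "norm (Complex 2 u) < R" if "u \<in> S" for u
    by (rule norm_line_less[OF _ _ t]) (use that in \<open>auto simp: S_def\<close>)
  show ?thesis
  proof (rule continuous_log_unique[where S = S and a = 0
        and f = "\<lambda>u. log_zeta (Complex 2 u) + Ln (Complex 2 u - 1)"
        and g = "\<lambda>u. P 1 (Complex 2 u) + H (Complex 2 u)"])
    show "connected S" by (simp add: S_def)
    show "continuous_on S (\<lambda>u. log_zeta (Complex 2 u) + Ln (Complex 2 u - 1))"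
    proof (rule continuous_on_add)
      show "continuous_on S (\<lambda>u. log_zeta (Complex 2 u))"
        by (rule continuous_on_compose2[OF log_zeta_continuous continuous_Complex]) auto
      show "continuous_on S (\<lambda>u. Ln (Complex 2 u - 1))"
        by (rule continuous_on_subset[OF Ln_line_continuous]) auto
    qed
    show "continuous_on S (\<lambda>u. P 1 (Complex 2 u) + H (Complex 2 u))"
    proof (rule continuous_on_add)
      show "continuous_on S (\<lambda>u. P 1 (Complex 2 u))"
        by (rule P_continuous_on[OF continuous_Complex slit])
      show "continuous_on S (\<lambda>u. H (Complex 2 u))"
        by (rule H_continuous_on[OF continuous_Complex]) (simp add: bnd)
    qed
    show "exp (log_zeta (Complex 2 u) + Ln (Complex 2 u - 1)) = exp (P 1 (Complex 2 u) + H (Complex 2 u))"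
      if u: "u \<in> S" for u
    proof -
      have ne: "Complex 2 u \<noteq> 1" by (simp add: complex_eq_iff)
      have "exp (P 1 (Complex 2 u) + H (Complex 2 u)) = xi (Complex 2 u)"
      proof (rule exp_P_H[OF bnd[OF u]])
        fix \<rho> assume "\<rho> \<in> NT"
        thus "Complex 2 u \<noteq> \<rho>" using NT_D(3)[of \<rho>] by auto
      qed simp_all
      also have "\<dots> = zeta (Complex 2 u) * (Complex 2 u - 1)" using ne by (simp add: xi_def)
      also have "zeta (Complex 2 u) = exp (log_zeta (Complex 2 u))" by (rule exp_log_zeta[symmetric]) simp
      finally show ?thesis using ne by (simp add: exp_add)
    qed
    have two: "Complex 2 0 = 2" "Complex 2 0 = of_real 2" by (simp_all add: complex_eq_iff)
    show "log_zeta (Complex 2 0) + Ln (Complex 2 0 - 1) = P 1 (Complex 2 0) + H (Complex 2 0)"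
    proof (rule exp_eq_real)
      have "0 \<in> S" by (simp add: S_def)
      thus "exp (log_zeta (Complex 2 0) + Ln (Complex 2 0 - 1)) = exp (P 1 (Complex 2 0) + H (Complex 2 0))"
        by (rule \<open>\<And>u. u \<in> S \<Longrightarrow> exp (log_zeta (Complex 2 u) + Ln (Complex 2 u - 1)) = exp (P 1 (Complex 2 u) + H (Complex 2 u))\<close>)
      show "Im (log_zeta (Complex 2 0) + Ln (Complex 2 0 - 1)) = 0"
        unfolding two(1) using log_zeta_2_real by simp
      have "Im (P 1 (of_real 2)) = 0" by (rule Im_P_real) (use slit[of _ 0] two in auto)
      moreover have "Im (H (of_real 2)) = 0" by (rule Im_H_real) auto
      ultimately show "Im (P 1 (Complex 2 0) + H (Complex 2 0)) = 0" unfolding two(2) by simp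
    qed
  qed (auto simp: S_def)
qed

text \<open>The argument of \<open>log_zeta_eq\<close> for \<open>(1 - s) * (- zeta s)\<close>,
  which is again \<open>xi s\<close>; now the real point is -1.\<close>

lemma log_neg_zeta_eq:
  assumes t: "\<bar>t\<bar> + 2 < R"
  shows "log_neg_zeta (Complex (-1) t) + Ln (1 - Complex (-1) t) = P (-1) (Complex (-1) t) + H (Complex (-1) t)"
proof -
  define S where "S = {- \<bar>t\<bar>..\<bar>t\<bar>}"
  obtain L where L: "continuous_on {z. Re z = -1} L" "\<And>z. Re z = -1 \<Longrightarrow> exp (L z) = - zeta z"
    "Im (L (-1)) = 0" "\<And>z. Re z = -1 \<Longrightarrow> log_neg_zeta z = L z"
    using log_neg_zeta_line by blast
  have slit: "- 1 * (Complex (-1) u - \<rho>) \<notin> \<real>\<^sub>\<le>\<^sub>0" if "\<rho> \<in> NT" for u \<rho>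
    using NT_D(2)[OF that] by (simp add: complex_nonpos_Reals_iff)
  have bnd: "norm (Complex (-1) u) < R" if "u \<in> S" for u
    by (rule norm_line_less[OF _ _ t]) (use that in \<open>auto simp: S_def\<close>)
  have "L (Complex (-1) t) + Ln (1 - Complex (-1) t) = P (-1) (Complex (-1) t) + H (Complex (-1) t)"
  proof (rule continuous_log_unique[where S = S and a = 0
        and f = "\<lambda>u. L (Complex (-1) u) + Ln (1 - Complex (-1) u)"
        and g = "\<lambda>u. P (-1) (Complex (-1) u) + H (Complex (-1) u)"])
    show "connected S" by (simp add: S_def)
    show "continuous_on S (\<lambda>u. L (Complex (-1) u) + Ln (1 - Complex (-1) u))"
    proof (rule continuous_on_add)
      show "continuous_on S (\<lambda>u. L (Complex (-1) u))"
        by (rule continuous_on_compose2[OF L(1) continuous_Complex]) auto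
      show "continuous_on S (\<lambda>u. Ln (1 - Complex (-1) u))"
        by (rule continuous_on_subset[OF Ln_line_continuous']) auto
    qed
    show "continuous_on S (\<lambda>u. P (-1) (Complex (-1) u) + H (Complex (-1) u))"
    proof (rule continuous_on_add)
      show "continuous_on S (\<lambda>u. P (-1) (Complex (-1) u))"
        by (rule P_continuous_on[OF continuous_Complex slit])
      show "continuous_on S (\<lambda>u. H (Complex (-1) u))"
        by (rule H_continuous_on[OF continuous_Complex]) (simp add: bnd)
    qed
    show "exp (L (Complex (-1) u) + Ln (1 - Complex (-1) u)) = exp (P (-1) (Complex (-1) u) + H (Complex (-1) u))"
      if u: "u \<in> S" for u
    proof -
      have ne: "Complex (-1) u \<noteq> 1" by (simp add: complex_eq_iff)
      have "exp (P (-1) (Complex (-1) u) + H (Complex (-1) u)) = xi (Complex (-1) u)"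
      proof (rule exp_P_H[OF bnd[OF u]])
        fix \<rho> assume "\<rho> \<in> NT"
        thus "Complex (-1) u \<noteq> \<rho>" using NT_D(2)[of \<rho>] by auto
      qed simp_all
      also have "\<dots> = - zeta (Complex (-1) u) * (1 - Complex (-1) u)" using ne by (simp add: xi_def algebra_simps)
      also have "- zeta (Complex (-1) u) = exp (L (Complex (-1) u))" by (rule L(2)[symmetric]) simp
      finally show ?thesis using ne by (simp add: exp_add)
    qed
    have m1: "Complex (-1) 0 = -1" "Complex (-1) 0 = of_real (-1)" by (simp_all add: complex_eq_iff)
    show "L (Complex (-1) 0) + Ln (1 - Complex (-1) 0) = P (-1) (Complex (-1) 0) + H (Complex (-1) 0)"
    proof (rule exp_eq_real)
      have "0 \<in> S" by (simp add: S_def)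
      thus "exp (L (Complex (-1) 0) + Ln (1 - Complex (-1) 0)) = exp (P (-1) (Complex (-1) 0) + H (Complex (-1) 0))"
        by (rule \<open>\<And>u. u \<in> S \<Longrightarrow> exp (L (Complex (-1) u) + Ln (1 - Complex (-1) u)) = exp (P (-1) (Complex (-1) u) + H (Complex (-1) u))\<close>)
      have "Im (Ln (of_real 2)) = 0" by (subst Ln_of_real) simp_all
      thus "Im (L (Complex (-1) 0) + Ln (1 - Complex (-1) 0)) = 0"
        unfolding m1(1) using L(3) by simp
      have "Im (P (-1) (of_real (-1))) = 0"
        by (rule Im_P_real) (use slit[of _ 0] in \<open>simp_all only: m1(2) complex_cnj_minus complex_cnj_one not_False_eq_True\<close>)
      moreover have "Im (H (of_real (-1))) = 0" by (rule Im_H_real) auto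
      ultimately show "Im (P (-1) (Complex (-1) 0) + H (Complex (-1) 0)) = 0" unfolding m1(2) by simp
    qed
  qed (auto simp: S_def)
  thus ?thesis using L(4)[of "Complex (-1) t"] by simp
qed

end

section \<open>Polynomial bounds for the terms of the factorisation\<close>

locale xi_log_bound = xi_log +
  fixes K d :: real
  assumes K: "K \<ge> 0" and count: "real (\<Sum>z\<in>zeros_in xi R. zero_mult xi z) \<le> K * R\<^sup>2"
    and g_bound: "\<And>s. norm s \<le> R / 2 \<Longrightarrow> norm (g s) \<le> K * R\<^sup>2"
    and d: "d > 0" "\<And>\<rho>. xi \<rho> = 0 \<Longrightarrow> d \<le> norm \<rho>"
begin

lemma mu_sum_bound:
  fixes f :: "complex \<Rightarrow> complex"
  assumes A: "A \<subseteq> zeros_in xi R" and f: "\<And>\<rho>. \<rho> \<in> A \<Longrightarrow> norm (f \<rho>) \<le> B" and B: "B \<ge> 0"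
  shows "norm (\<Sum>\<rho>\<in>A. mu \<rho> * f \<rho>) \<le> K * R\<^sup>2 * B"
proof -
  have "norm (\<Sum>\<rho>\<in>A. mu \<rho> * f \<rho>) \<le> (\<Sum>\<rho>\<in>A. real (zero_mult xi \<rho>) * B)"
  proof (rule sum_norm_le)
    fix \<rho> assume "\<rho> \<in> A"
    from f[OF this] show "norm (mu \<rho> * f \<rho>) \<le> real (zero_mult xi \<rho>) * B"
      unfolding norm_mult norm_of_nat by (intro mult_left_mono) auto
  qed
  also have "\<dots> = (\<Sum>\<rho>\<in>A. real (zero_mult xi \<rho>)) * B" by (rule sum_distrib_right[symmetric])
  also have "(\<Sum>\<rho>\<in>A. real (zero_mult xi \<rho>)) \<le> (\<Sum>\<rho>\<in>zeros_in xi R. real (zero_mult xi \<rho>))"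
    by (rule sum_mono2[OF xi.finite_zeros_in A]) simp
  also have "\<dots> \<le> K * R\<^sup>2" using count by simp
  finally show ?thesis using B by (simp add: mult_right_mono)
qed

lemma NT_subset: "NT \<subseteq> zeros_in xi R" and TR_subset: "TR \<subseteq> zeros_in xi R"
  by (auto simp: NT_def TR_def)

lemma ln_NT_bound:
  assumes "\<rho> \<in> NT"
  shows "norm (complex_of_real (ln (norm \<rho>))) \<le> R + 1 / d"
proof -
  have "norm (complex_of_real (ln (norm \<rho>))) = \<bar>ln (norm \<rho>)\<bar>" by (rule norm_of_real)
  also have "\<dots> \<le> norm \<rho> + 1 / norm \<rho>" by (rule abs_ln_le) (use NT_D(6)[OF assms] in simp)
  also have "1 / norm \<rho> \<le> 1 / d" using d(1) d(2)[OF NT_D(7)[OF assms]] NT_D(6)[OF assms]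
    by (intro divide_left_mono mult_pos_pos) auto
  finally show ?thesis using NT_D(5)[OF assms] by simp
qed

text \<open>Each principal logarithm is at most
  \<open>norm s + norm \<rho> + 6 \<le> 2 * R + 6\<close>, each normalising term at most
  \<open>R + 1 / d\<close>, and there are at most \<open>K * R^2\<close> zeros.\<close>

lemma P_bound:
  assumes e: "e = 1 \<or> e = (-1::complex)" and s: "norm s \<le> R"
    and ne: "\<And>\<rho>. \<rho> \<in> NT \<Longrightarrow> norm (s - \<rho>) \<ge> 1 / 2"
  shows "norm (P e s) \<le> K * R\<^sup>2 * (3 * R + 6 + 1 / d)"
  unfolding P_def
proof (rule mu_sum_bound[OF NT_subset])
  fix \<rho> assume \<rho>: "\<rho> \<in> NT"
  have ne1: "norm (e * (s - \<rho>)) = norm (s - \<rho>)" using e by (auto simp: norm_mult)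
  have "norm (Ln (e * (s - \<rho>)) - of_real (ln (norm \<rho>))) \<le> norm (Ln (e * (s - \<rho>))) + norm (complex_of_real (ln (norm \<rho>)))"
    by (rule norm_triangle_ineq4)
  also have "norm (Ln (e * (s - \<rho>))) \<le> norm (s - \<rho>) + 6"
    unfolding ne1[symmetric] by (rule norm_Ln_le_half) (simp only: ne1 ne[OF \<rho>])
  also have "norm (s - \<rho>) \<le> norm s + norm \<rho>" by (rule norm_triangle_ineq4)
  also note ln_NT_bound[OF \<rho>]
  finally have 1: "norm (Ln (e * (s - \<rho>)) - of_real (ln (norm \<rho>))) \<le> norm s + norm \<rho> + 6 + (R + 1 / d)" by simp
  show "norm (Ln (e * (s - \<rho>)) - of_real (ln (norm \<rho>))) \<le> 3 * R + 6 + 1 / d"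
    using 1 s NT_D(5)[OF \<rho>] by simp
qed (use R d in simp)

lemma H_bound:
  assumes s: "norm s \<le> R / 2" "-1 \<le> Re s"
  shows "norm (H s) \<le> K * R\<^sup>2 * (R + 8)"
proof -
  have "norm (\<Sum>\<rho>\<in>TR. mu \<rho> * Ln (1 - s / \<rho>)) \<le> K * R\<^sup>2 * (R + 7)"
  proof (rule mu_sum_bound[OF TR_subset])
    fix \<rho> assume \<rho>: "\<rho> \<in> TR"
    have "1 - 1 / 2 \<le> Re (1 - s / \<rho>)" by (rule Re_TR_factor[OF \<rho>]) (use s in auto)
    also have "\<dots> \<le> norm (1 - s / \<rho>)" by (rule complex_Re_le_cmod)
    finally have "norm (Ln (1 - s / \<rho>)) \<le> norm (1 - s / \<rho>) + 6" by (intro norm_Ln_le_half) simp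
    also have "norm (1 - s / \<rho>) \<le> 1 + norm (s / \<rho>)" using norm_triangle_ineq4[of 1 "s / \<rho>"] by simp
    also have "norm (s / \<rho>) = norm s / norm \<rho>" by (rule norm_divide)
    also have "\<dots> \<le> norm s / 1"
    proof (rule divide_left_mono)
      show "1 \<le> norm \<rho>" using TR_D(2)[OF \<rho>] abs_Re_le_cmod[of \<rho>] by simp
      hence "0 < norm \<rho>" by linarith
      thus "0 < norm \<rho> * 1" by simp
    qed simp
    finally show "norm (Ln (1 - s / \<rho>)) \<le> R + 7" using s R by simp
  qed (use R in simp)
  moreover have "norm (g s) \<le> K * R\<^sup>2" by (rule g_bound[OF s(1)])
  ultimately have "norm (H s) \<le> K * R\<^sup>2 * (R + 7) + K * R\<^sup>2"
    unfolding H_def using norm_triangle_le add_mono by blast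
  also have "\<dots> = K * R\<^sup>2 * (R + 8)" by (simp add: algebra_simps)
  finally show ?thesis .
qed

text \<open>The identity of branches is read backwards: \<open>log_neg_zeta\<close> is
  \<open>P (-1) + H\<close> minus one principal logarithm, so it inherits their polynomial
  size.\<close>

lemma log_neg_zeta_bound:
  assumes t: "\<bar>t\<bar> + 2 < R / 2"
  shows "norm (log_neg_zeta (Complex (-1) t)) \<le> K * R\<^sup>2 * (4 * R + 14 + 1 / d) + (R + 6)"
proof -
  define s where "s = Complex (-1) t"
  have ns: "norm s \<le> 1 + \<bar>t\<bar>" using cmod_le[of s] by (simp add: s_def)
  have "log_neg_zeta s = P (-1) s + H s - Ln (1 - s)"
    unfolding s_def using log_neg_zeta_eq[of t] t R by (simp add: algebra_simps)
  hence "norm (log_neg_zeta s) \<le> norm (P (-1) s) + norm (H s) + norm (Ln (1 - s))"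
    using norm_triangle_ineq4[of "P (-1) s + H s" "Ln (1 - s)"] norm_triangle_ineq[of "P (-1) s" "H s"] by simp
  also have "norm (P (-1) s) \<le> K * R\<^sup>2 * (3 * R + 6 + 1 / d)"
  proof (rule P_bound)
    show "norm s \<le> R" using ns t R by simp
    fix \<rho> assume "\<rho> \<in> NT"
    from NT_D(2)[OF this] abs_Re_le_cmod[of "s - \<rho>"] show "1 / 2 \<le> norm (s - \<rho>)" by (simp add: s_def)
  qed simp
  also have "norm (H s) \<le> K * R\<^sup>2 * (R + 8)" by (rule H_bound) (use ns t in \<open>simp_all add: s_def\<close>)
  also have "norm (Ln (1 - s)) \<le> norm (1 - s) + 6"
    by (rule norm_Ln_le_half) (use abs_Re_le_cmod[of "1 - s"] in \<open>simp add: s_def\<close>)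
  also have "norm (1 - s) \<le> 1 + norm s" using norm_triangle_ineq4[of 1 s] by simp
  also have "1 + norm s \<le> R" using ns t R by simp
  finally show ?thesis unfolding s_def by (simp add: algebra_simps)
qed

end

section \<open>Sums over zeros\<close>

lemma square_exp_le: "real n ^ 2 * exp (- real n) \<le> 8 * exp (- (1 / 2)) ^ n"
proof -
  define u where "u = real n / 2"
  have u: "u \<ge> 0" by (simp add: u_def)
  have "1 + u + u\<^sup>2 / 2 \<le> exp u" by (rule exp_lower_Taylor_quadratic[OF u])
  hence "u\<^sup>2 / 2 \<le> exp u" using u by simp
  hence "real n ^ 2 \<le> 8 * exp u" by (simp add: u_def power_divide)
  hence "real n ^ 2 * exp (- real n) \<le> 8 * exp u * exp (- real n)" by (rule mult_right_mono) simp
  also have "\<dots> = 8 * exp (u + - real n)" by (simp only: exp_add mult.assoc)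
  also have "u + - real n = real n * - (1 / 2)" by (simp add: u_def)
  also have "exp (real n * - (1 / 2)) = exp (- (1 / 2)) ^ n" by (rule exp_of_nat_mult)
  finally show ?thesis .
qed

text \<open>The count \<open>K * n^2\<close> in the disc of radius \<open>n\<close> is weighted with
  \<open>exp (- n)\<close> and summed over \<open>n\<close>, a discrete partial summation;
  \<open>square_exp_le\<close> makes the result geometric.\<close>

lemma zeros_exp_summable: "(\<lambda>\<rho>. real (zero_mult xi \<rho>) * exp (- norm \<rho>)) summable_on {\<rho>. xi \<rho> = 0}"
proof -
  obtain K where K: "K \<ge> 0" "\<And>R. R \<ge> 1 \<Longrightarrow> real (\<Sum>z\<in>zeros_in xi R. zero_mult xi z) \<le> K * R\<^sup>2"
    using xi_factorization by metis
  define G where "G = (\<Sum>n. exp (- (1 / 2) :: real) ^ n)"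
  have geo: "summable (\<lambda>n. exp (- (1 / 2) :: real) ^ n)" by (rule summable_geometric) simp
  have cnt: "(\<Sum>\<rho>\<in>zeros_in xi (real n). real (zero_mult xi \<rho>)) \<le> K * (real n)\<^sup>2" for n :: nat
  proof (cases "n = 0")
    case True
    thus ?thesis by (simp add: zeros_in_def)
  next
    case False
    thus ?thesis using K(2)[of "real n"] by simp
  qed
  have bd: "(\<Sum>\<rho>\<in>F. real (zero_mult xi \<rho>) * exp (- norm \<rho>)) \<le> exp 1 * (8 * K) * G"
    if F: "finite F" "F \<subseteq> {\<rho>. xi \<rho> = 0}" for F
  proof -
    define k where "k = (\<lambda>\<rho>::complex. Suc (nat \<lfloor>norm \<rho>\<rfloor>))"
    define N where "N = Suc (\<Sum>\<rho>\<in>F. k \<rho>)"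
    \<comment> \<open>\<open>k \<rho>\<close> is the first integer above \<open>norm \<rho>\<close>.
      The single term \<open>c \<rho> (k \<rho>)\<close> already dominates
      \<open>exp (- norm \<rho>)\<close>; rounding up costs the factor \<open>exp 1\<close>.\<close>
    define c where "c = (\<lambda>(\<rho>::complex) n. if norm \<rho> < real n then exp 1 * exp (- real n) else 0 :: real)"
    have c0: "c \<rho> n \<ge> 0" for \<rho> n by (simp add: c_def)
    have kN: "k \<rho> < N" if "\<rho> \<in> F" for \<rho>
      using member_le_sum[OF that, of k] F(1) by (simp add: N_def)
    have pt: "exp (- norm \<rho>) \<le> (\<Sum>n<N. c \<rho> n)" if \<rho>: "\<rho> \<in> F" for \<rho>
    proof -
      have fl: "real_of_int \<lfloor>norm \<rho>\<rfloor> \<le> norm \<rho>" "norm \<rho> < real_of_int \<lfloor>norm \<rho>\<rfloor> + 1"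
        by (rule of_int_floor_le, rule real_of_int_floor_add_one_gt)
      have rk: "real (k \<rho>) = real_of_int \<lfloor>norm \<rho>\<rfloor> + 1" by (simp add: k_def)
      have "- norm \<rho> \<le> 1 + - real (k \<rho>)" using fl rk by simp
      hence "exp (- norm \<rho>) \<le> exp (1 + - real (k \<rho>))" by simp
      also have "\<dots> = exp 1 * exp (- real (k \<rho>))" by (rule exp_add)
      also have "\<dots> = c \<rho> (k \<rho>)" using fl rk by (simp add: c_def)
      also have "\<dots> \<le> (\<Sum>n<N. c \<rho> n)" by (rule member_le_sum) (use kN[OF \<rho>] c0 in auto)
      finally show ?thesis .
    qed
    have "(\<Sum>\<rho>\<in>F. real (zero_mult xi \<rho>) * exp (- norm \<rho>)) \<le> (\<Sum>\<rho>\<in>F. real (zero_mult xi \<rho>) * (\<Sum>n<N. c \<rho> n))"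
      by (intro sum_mono mult_left_mono pt) auto
    also have "\<dots> = (\<Sum>n<N. \<Sum>\<rho>\<in>F. real (zero_mult xi \<rho>) * c \<rho> n)"
      unfolding sum_distrib_left by (rule sum.swap)
    also have "\<dots> \<le> (\<Sum>n<N. exp 1 * (8 * K) * exp (- (1 / 2)) ^ n)"
    proof (rule sum_mono)
      fix n
      have "(\<Sum>\<rho>\<in>F. real (zero_mult xi \<rho>) * c \<rho> n)
          = (\<Sum>\<rho>\<in>{\<rho> \<in> F. norm \<rho> < real n}. real (zero_mult xi \<rho>) * (exp 1 * exp (- real n)))"
        unfolding c_def by (subst sum.inter_filter[OF F(1)]) (intro sum.cong refl, simp)
      also have "\<dots> = (\<Sum>\<rho>\<in>{\<rho> \<in> F. norm \<rho> < real n}. real (zero_mult xi \<rho>)) * (exp 1 * exp (- real n))"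
        by (rule sum_distrib_right[symmetric])
      also have "(\<Sum>\<rho>\<in>{\<rho> \<in> F. norm \<rho> < real n}. real (zero_mult xi \<rho>)) \<le> (\<Sum>\<rho>\<in>zeros_in xi (real n). real (zero_mult xi \<rho>))"
        by (rule sum_mono2[OF xi.finite_zeros_in]) (use F(2) in \<open>auto simp: zeros_in_def\<close>)
      also note cnt[of n]
      also have "K * (real n)\<^sup>2 * (exp 1 * exp (- real n)) = exp 1 * K * ((real n)\<^sup>2 * exp (- real n))" by simp
      also have "\<dots> \<le> exp 1 * K * (8 * exp (- (1 / 2)) ^ n)"
        using K(1) by (intro mult_left_mono square_exp_le) auto
      also have "\<dots> = exp 1 * (8 * K) * exp (- (1 / 2)) ^ n" by simp
      finally show "(\<Sum>\<rho>\<in>F. real (zero_mult xi \<rho>) * c \<rho> n) \<le> exp 1 * (8 * K) * exp (- (1 / 2)) ^ n"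
        by (simp add: mult_right_mono)
    qed
    also have "\<dots> = exp 1 * (8 * K) * (\<Sum>n<N. exp (- (1 / 2)) ^ n)" by (rule sum_distrib_left[symmetric])
    also have "(\<Sum>n<N. exp (- (1 / 2) :: real) ^ n) \<le> G"
      unfolding G_def by (rule sum_le_suminf[OF geo]) auto
    finally show ?thesis using K(1) by (simp add: mult_left_mono)
  qed
  show ?thesis
    by (rule nonneg_bdd_above_summable_on) (use bd in \<open>auto intro!: bdd_aboveI[where M = "exp 1 * (8 * K) * G"]\<close>)
qed

lemma cube_le_exp:
  assumes u: "(u::real) \<ge> 0"
  shows "(u + 3) ^ 3 \<le> 216 * exp (u / 2)"
proof -
  have "6 * (1 + u / 6) \<le> 6 * exp (u / 6)" by (intro mult_left_mono exp_ge_add_one_self) auto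
  hence "u + 3 \<le> 6 * exp (u / 6)" by simp
  hence "(u + 3) ^ 3 \<le> (6 * exp (u / 6)) ^ 3" using u by (intro power_mono) auto
  also have "\<dots> = 216 * exp (u / 6) ^ 3" by (simp add: power_mult_distrib)
  also have "exp (u / 6) ^ 3 = exp (u / 2)" by (simp add: exp_of_nat_mult[symmetric])
  finally show ?thesis .
qed

text \<open>Each \<open>t\<close> uses its own disc, while \<open>K\<close> and \<open>d\<close> are
  the same for all. The bound is cubic in \<open>\<bar>t\<bar>\<close> and is weakened to an
  exponential that \<open>\<phi>\<close> still beats.\<close>

lemma log_neg_zeta_growth:
  obtains A where "A \<ge> 0" "\<And>t. norm (log_neg_zeta (Complex (-1) t)) \<le> A * exp (\<bar>t\<bar> / 2)"
proof -
  obtain K where K: "K \<ge> 0"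
    "\<And>R. R \<ge> 1 \<Longrightarrow> \<exists>g. g holomorphic_on ball 0 R \<and> g 0 = Ln (xi 0) \<and>
       (\<forall>s. norm s < R \<longrightarrow> xi s = zero_poly xi R s * exp (g s)) \<and>
       (\<forall>s. norm s \<le> R / 2 \<longrightarrow> norm (g s) \<le> K * R\<^sup>2)"
    "\<And>R. R \<ge> 1 \<Longrightarrow> real (\<Sum>z\<in>zeros_in xi R. zero_mult xi z) \<le> K * R\<^sup>2"
    using xi_factorization by metis
  obtain d where d: "d > 0" "\<And>\<rho>. xi \<rho> = 0 \<Longrightarrow> d \<le> norm \<rho>" using xi_zeros_away_from_0 by blast
  define B where "B = K * (18 + 1 / d) + 7"
  have B0: "B \<ge> 0" using K(1) d(1) by (simp add: B_def)
  have "norm (log_neg_zeta (Complex (-1) t)) \<le> B * 8 * 216 * exp (\<bar>t\<bar> / 2)" for t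
  proof -
    \<comment> \<open>Just large enough for \<open>\<bar>t\<bar> + 2 < R / 2\<close>, as the bound
      on \<open>g\<close> holds in the half disc.\<close>
    define R where "R = 2 * (\<bar>t\<bar> + 3)"
    have R4: "R \<ge> 4" by (simp add: R_def)
    hence R1: "R \<ge> 1" by simp
    obtain g where g: "g holomorphic_on ball 0 R" "g 0 = Ln (xi 0)"
       "\<And>s. norm s < R \<Longrightarrow> xi s = zero_poly xi R s * exp (g s)"
       "\<And>s. norm s \<le> R / 2 \<Longrightarrow> norm (g s) \<le> K * R\<^sup>2" using K(2)[OF R1] by metis
    interpret xi_log_bound R g K d
      by unfold_locales (rule R4 g K(1) K(3)[OF R1] d | assumption)+
    have "norm (log_neg_zeta (Complex (-1) t)) \<le> K * R\<^sup>2 * (4 * R + 14 + 1 / d) + (R + 6)"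
      by (rule log_neg_zeta_bound) (simp add: R_def)
    also have "\<dots> \<le> K * R\<^sup>2 * (R * (18 + 1 / d)) + 7 * R ^ 3"
    proof (rule add_mono)
      have "1 / d * 1 \<le> 1 / d * R" using d(1) R1 by (intro mult_left_mono) auto
      hence "4 * R + 14 + 1 / d \<le> R * (18 + 1 / d)" using R1 by (simp add: algebra_simps)
      thus "K * R\<^sup>2 * (4 * R + 14 + 1 / d) \<le> K * R\<^sup>2 * (R * (18 + 1 / d))"
        using K(1) by (intro mult_left_mono) auto
      have "R \<le> R ^ 3" using R1 self_le_power[of R 3] by simp
      thus "R + 6 \<le> 7 * R ^ 3" using R1 by simp
    qed
    also have "\<dots> = B * R ^ 3" by (simp add: B_def algebra_simps power2_eq_square power3_eq_cube)
    also have "R ^ 3 = 8 * (\<bar>t\<bar> + 3) ^ 3" unfolding R_def power_mult_distrib by simp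
    also have "\<dots> \<le> 8 * (216 * exp (\<bar>t\<bar> / 2))" by (intro mult_left_mono cube_le_exp) auto
    finally show ?thesis using B0 by (simp add: mult_left_mono)
  qed
  thus ?thesis using that[of "B * 8 * 216"] B0 by simp
qed

lemma log_neg_zeta_line_continuous: "continuous_on A (\<lambda>t. log_neg_zeta (Complex (-1) t))"
proof -
  obtain L where L: "continuous_on {z. Re z = -1} L" "\<And>z. Re z = -1 \<Longrightarrow> log_neg_zeta z = L z"
    using log_neg_zeta_line by metis
  have "continuous_on A (\<lambda>t. L (Complex (-1) t))"
    by (rule continuous_on_compose2[OF L(1) continuous_Complex]) auto
  moreover have "log_neg_zeta (Complex (-1) t) = L (Complex (-1) t)" for t by (rule L(2)) simp
  ultimately show ?thesis by simp
qed

lemma log_zeta_line_continuous: "continuous_on A (\<lambda>t. log_zeta (Complex 2 t))"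
  by (rule continuous_on_compose2[OF log_zeta_continuous continuous_Complex]) auto

context smoothed
begin

text \<open>If \<open>norm \<rho> \<ge> 2\<close>, then
  \<open>\<bar>Im \<rho>\<bar> \<ge> norm \<rho> - 1 \<ge> 1\<close> and \<open>Re_Phi_bound\<close>
  compares with \<open>zeros_exp_summable\<close>. The remaining zeros are finite in number.\<close>

lemma summable_Phi: "(\<lambda>\<rho>. real (zero_mult xi \<rho>) * Re (\<Phi> \<rho>)) summable_on nontrivial_zeros"
proof -
  define f where "f = (\<lambda>\<rho>. real (zero_mult xi \<rho>) * Re (\<Phi> \<rho>))"
  define F where "F = {\<rho> \<in> nontrivial_zeros. norm \<rho> < 2}"
  define G where "G = {\<rho> \<in> nontrivial_zeros. norm \<rho> \<ge> 2}"
  have "F \<subseteq> zeros_in xi 2" using nontrivial_zero_xi by (auto simp: F_def zeros_in_def)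
  hence "finite F" using xi.finite_zeros_in by (rule finite_subset)
  hence sF: "f summable_on F" by (rule summable_on_finite)
  have "(\<lambda>\<rho>. real (zero_mult xi \<rho>) * exp (- norm \<rho>)) summable_on G"
    by (rule summable_on_subset_banach[OF zeros_exp_summable]) (use nontrivial_zero_xi in \<open>auto simp: G_def\<close>)
  hence sG': "(\<lambda>\<rho>. decay_const * exp 1 * (real (zero_mult xi \<rho>) * exp (- norm \<rho>))) summable_on G"
    by (rule summable_on_cmult_right)
  have "(\<lambda>\<rho>. norm (f \<rho>)) summable_on G"
  proof (rule Infinite_Sum.abs_summable_on_comparison_test'[OF sG'])
    fix \<rho> assume "\<rho> \<in> G"
    hence nt: "\<rho> \<in> nontrivial_zeros" and n: "norm \<rho> \<ge> 2" by (auto simp: G_def)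
    note st = nontrivial_zeros_strip[OF nt]
    have "norm \<rho> \<le> \<bar>Re \<rho>\<bar> + \<bar>Im \<rho>\<bar>" by (rule cmod_le)
    hence im: "\<bar>Im \<rho>\<bar> \<ge> norm \<rho> - 1" using st by simp
    have "\<bar>Re (\<Phi> (Complex (Re \<rho>) (Im \<rho>)))\<bar> \<le> decay_const * exp (- \<bar>Im \<rho>\<bar>)"
      by (rule Re_Phi_bound) (use st im n in auto)
    hence "\<bar>Re (\<Phi> \<rho>)\<bar> \<le> decay_const * exp (- \<bar>Im \<rho>\<bar>)" by simp
    also have "\<dots> \<le> decay_const * exp (1 + - norm \<rho>)"
      using im decay_const_pos by (intro mult_left_mono) auto
    also have "\<dots> = decay_const * exp 1 * exp (- norm \<rho>)" by (simp only: exp_add mult.assoc)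
    finally have "real (zero_mult xi \<rho>) * \<bar>Re (\<Phi> \<rho>)\<bar> \<le> real (zero_mult xi \<rho>) * (decay_const * exp 1 * exp (- norm \<rho>))"
      by (rule mult_left_mono) simp
    thus "norm (f \<rho>) \<le> decay_const * exp 1 * (real (zero_mult xi \<rho>) * exp (- norm \<rho>))"
      by (simp add: f_def abs_mult mult_ac)
  qed
  hence sG: "f summable_on G" by (rule Infinite_Sum.abs_summable_summable)
  have "f summable_on (F \<union> G)" by (rule summable_on_Un_disjoint[OF sF sG]) (auto simp: F_def G_def)
  moreover have "F \<union> G = nontrivial_zeros" by (auto simp: F_def G_def)
  ultimately show ?thesis by (simp add: f_def)
qed

lemma log_neg_zeta_phi:
  obtains A where "integrable lborel (\<lambda>t. \<phi> (Complex (-1) t) * log_neg_zeta (Complex (-1) t))"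
    "\<And>T. norm ((\<integral>t. \<phi> (Complex (-1) t) * log_neg_zeta (Complex (-1) t) \<partial>lborel)
      - integral {- T..T} (\<lambda>t. \<phi> (Complex (-1) t) * log_neg_zeta (Complex (-1) t)))
      \<le> A * exp (- T / 4) * exp_const"
proof -
  obtain A where A: "A \<ge> 0" "\<And>t. norm (log_neg_zeta (Complex (-1) t)) \<le> A * exp (\<bar>t\<bar> / 2)"
    using log_neg_zeta_growth by blast
  define f where "f = (\<lambda>t. \<phi> (Complex (-1) t) * log_neg_zeta (Complex (-1) t))"
  have m: "f \<in> borel_measurable lborel"
    unfolding f_def by (simp, intro borel_measurable_continuous_onI continuous_intros
        continuous_phi_line log_neg_zeta_line_continuous) auto
  have bd: "norm (f t) \<le> decay_const * A * exp (- \<bar>t\<bar> / 2)" for t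
  proof -
    have "norm (f t) \<le> (decay_const * exp (- \<bar>t\<bar>)) * (A * exp (\<bar>t\<bar> / 2))"
      unfolding f_def norm_mult using decay_const_pos by (intro mult_mono norm_phi_line A) auto
    also have "\<dots> = decay_const * A * exp (- \<bar>t\<bar> + \<bar>t\<bar> / 2)" by (simp only: exp_add mult_ac)
    also have "- \<bar>t\<bar> + \<bar>t\<bar> / 2 = - \<bar>t\<bar> / 2" by simp
    finally show ?thesis .
  qed
  show ?thesis
    by (rule that[of "decay_const * A"])
       (use integrable_exp_decay[OF m bd] truncation_error[OF m bd] in \<open>simp_all add: f_def\<close>)
qed

lemma log_zeta_phi:
  obtains A where "integrable lborel (\<lambda>t. \<phi> (Complex 2 t) * log_zeta (Complex 2 t))"
    "\<And>T. norm ((\<integral>t. \<phi> (Complex 2 t) * log_zeta (Complex 2 t) \<partial>lborel)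
      - integral {- T..T} (\<lambda>t. \<phi> (Complex 2 t) * log_zeta (Complex 2 t)))
      \<le> A * exp (- T / 4) * exp_const"
proof -
  define Z where "Z = (\<Sum>n. real n powr (-2))"
  have b: "norm (log_zeta (Complex 2 t)) \<le> Z * (1 + \<bar>t\<bar>)" for t
  proof -
    have 1: "norm (log_zeta (Complex 2 t)) \<le> Z" unfolding Z_def by (rule norm_log_zeta_le) simp
    hence "Z \<ge> 0" using norm_ge_zero order_trans by blast
    hence "Z * \<bar>t\<bar> \<ge> 0" by simp
    thus ?thesis using 1 by (simp add: distrib_left)
  qed
  show ?thesis
    by (rule that[of "2 * decay_const * Z"]; rule phi_line_mult[OF _ log_zeta_line_continuous b]) simp_all
qed

end

section \<open>The truncated formula and the limit\<close>

text \<open>One linear computation for both lines. The index 1 stands for the pole, whose logarithm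
  sits on the other side of the equation.\<close>

lemma integral_log_expansion:
  fixes p F h :: "real \<Rightarrow> complex" and l :: "complex \<Rightarrow> real \<Rightarrow> complex"
  assumes A: "finite A" and pc: "continuous_on {a..b} p"
    and lc: "\<And>\<rho>. \<rho> \<in> insert 1 A \<Longrightarrow> continuous_on {a..b} (l \<rho>)" and hc: "continuous_on {a..b} h"
    and eq: "\<And>t. t \<in> {a..b} \<Longrightarrow> F t + l 1 t = (\<Sum>\<rho>\<in>A. m \<rho> * (l \<rho> t - c \<rho>)) + h t"
  shows "integral {a..b} (\<lambda>t. p t * F t)
    = (\<Sum>\<rho>\<in>A. m \<rho> * integral {a..b} (\<lambda>t. p t * l \<rho> t)) - (\<Sum>\<rho>\<in>A. m \<rho> * c \<rho>) * integral {a..b} p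
      + integral {a..b} (\<lambda>t. p t * h t) - integral {a..b} (\<lambda>t. p t * l 1 t)"
proof -
  define k where "k = (\<Sum>\<rho>\<in>A. m \<rho> * c \<rho>)"
  have hi: "((\<lambda>t. p t * f t) has_integral integral {a..b} (\<lambda>t. p t * f t)) {a..b}"
    if "continuous_on {a..b} f" for f
    by (intro integrable_integral integrable_continuous_interval continuous_on_mult pc that)
  have pi: "(p has_integral integral {a..b} p) {a..b}"
    by (intro integrable_integral integrable_continuous_interval pc)
  have hs: "((\<lambda>t. (\<Sum>\<rho>\<in>A. m \<rho> * (p t * l \<rho> t)) - k * p t + p t * h t - p t * l 1 t) has_integral
      (\<Sum>\<rho>\<in>A. m \<rho> * integral {a..b} (\<lambda>t. p t * l \<rho> t)) - k * integral {a..b} p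
      + integral {a..b} (\<lambda>t. p t * h t) - integral {a..b} (\<lambda>t. p t * l 1 t)) {a..b}"
    by (intro has_integral_diff has_integral_add has_integral_sum has_integral_mult_right hi pi hc A lc) simp_all
  have e: "(\<Sum>\<rho>\<in>A. m \<rho> * (p t * l \<rho> t)) - k * p t + p t * h t - p t * l 1 t = p t * F t"
    if t: "t \<in> {a..b}" for t
  proof -
    have "(\<Sum>\<rho>\<in>A. m \<rho> * (l \<rho> t - c \<rho>)) = (\<Sum>\<rho>\<in>A. m \<rho> * l \<rho> t) - k"
      unfolding k_def sum_subtractf[symmetric] by (simp add: right_diff_distrib)
    hence F: "F t = (\<Sum>\<rho>\<in>A. m \<rho> * l \<rho> t) - k + h t - l 1 t"
      using eq[OF t] by (simp add: algebra_simps)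
    have "(\<Sum>\<rho>\<in>A. m \<rho> * (p t * l \<rho> t)) = p t * (\<Sum>\<rho>\<in>A. m \<rho> * l \<rho> t)"
      unfolding sum_distrib_left by (intro sum.cong refl) simp
    thus ?thesis unfolding F by (simp add: algebra_simps)
  qed
  have "((\<lambda>t. p t * F t) has_integral
      (\<Sum>\<rho>\<in>A. m \<rho> * integral {a..b} (\<lambda>t. p t * l \<rho> t)) - k * integral {a..b} p
      + integral {a..b} (\<lambda>t. p t * h t) - integral {a..b} (\<lambda>t. p t * l 1 t)) {a..b}"
    by (rule has_integral_eq[OF e hs])
  from integral_unique[OF this] show ?thesis unfolding k_def .
qed

context smoothed
begin

lemma phi_trunc_diff:
  "norm (integral {- T..T} (\<lambda>t. \<phi> (Complex 2 t)) - integral {- T..T} (\<lambda>t. \<phi> (Complex (-1) t)) - 2 * of_real pi)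
     \<le> 4 * decay_const * exp (- T / 4) * exp_const"
proof -
  define I where "I = (\<lambda>c. \<integral>t. \<phi> (Complex c t) \<partial>lborel)"
  define J where "J = (\<lambda>c. integral {- T..T} (\<lambda>t. \<phi> (Complex c t)))"
  define q where "q = decay_const * exp (- T / 4) * exp_const"
  have t: "norm (I c - J c) \<le> 2 * q" if "c = -1 \<or> c = 2" for c
    using phi_line_mult(2)[OF that, of "\<lambda>_. 1" 1 T] by (simp add: I_def J_def q_def mult.assoc)
  have "I 2 - I (-1) = 2 * of_real pi" unfolding I_def by (rule phi_line_diff)
  hence "J 2 - J (-1) - 2 * of_real pi = (I (-1) - J (-1)) - (I 2 - J 2)" by (simp add: algebra_simps)
  also have "norm \<dots> \<le> norm (I (-1) - J (-1)) + norm (I 2 - J 2)" by (rule norm_triangle_ineq4)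
  also have "\<dots> \<le> 2 * q + 2 * q" by (intro add_mono t) auto
  finally have "norm (J 2 - J (-1) - 2 * of_real pi) \<le> 4 * q" by simp
  thus ?thesis unfolding J_def q_def mult.assoc .
qed

lemma truncated_log_zeta:
  assumes "xi_log R g" and T: "T \<ge> 0" "T + 2 < R"
  shows "integral {- T..T} (\<lambda>t. \<phi> (Complex 2 t) * log_zeta (Complex 2 t))
    = (\<Sum>\<rho>\<in>xi_log.NT R. of_nat (zero_mult xi \<rho>) * integral {- T..T} (\<lambda>t. \<phi> (Complex 2 t) * Ln (Complex 2 t - \<rho>)))
      - (\<Sum>\<rho>\<in>xi_log.NT R. of_nat (zero_mult xi \<rho>) * of_real (ln (norm \<rho>))) * integral {- T..T} (\<lambda>t. \<phi> (Complex 2 t))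
      + integral {- T..T} (\<lambda>t. \<phi> (Complex 2 t) * xi_log.H R g (Complex 2 t))
      - integral {- T..T} (\<lambda>t. \<phi> (Complex 2 t) * Ln (Complex 2 t - 1))"
proof -
  interpret xi_log R g by fact
  show ?thesis
  proof (rule integral_log_expansion[OF finite_NT])
    show "continuous_on {- T..T} (\<lambda>t. \<phi> (Complex 2 t))" by (rule phi_line_continuous_on) simp
    show "continuous_on {- T..T} (\<lambda>t. Ln (Complex 2 t - \<rho>))" if "\<rho> \<in> insert 1 NT" for \<rho>
      by (rule continuous_on_subset[OF Ln_line_continuous]) (use that NT_D(3)[of \<rho>] in auto)
    show "continuous_on {- T..T} (\<lambda>t. H (Complex 2 t))"
    proof (rule H_continuous_on[OF continuous_Complex])
      fix t assume "t \<in> {- T..T}"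
      hence "norm (Complex 2 t) < R" using T by (intro norm_line_less[of _ _ T]) auto
      thus "norm (Complex 2 t) < R \<and> - 2 < Re (Complex 2 t)" by simp
    qed
    show "log_zeta (Complex 2 t) + Ln (Complex 2 t - 1)
        = (\<Sum>\<rho>\<in>NT. mu \<rho> * (Ln (Complex 2 t - \<rho>) - of_real (ln (norm \<rho>)))) + H (Complex 2 t)"
      if t: "t \<in> {- T..T}" for t
    proof -
      have "\<bar>t\<bar> + 2 < R" using t T by auto
      from log_zeta_eq[OF this] show ?thesis by (simp add: P_def)
    qed
  qed
qed

lemma truncated_log_neg_zeta:
  assumes "xi_log R g" and T: "T \<ge> 0" "T + 2 < R"
  shows "integral {- T..T} (\<lambda>t. \<phi> (Complex (-1) t) * log_neg_zeta (Complex (-1) t))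
    = (\<Sum>\<rho>\<in>xi_log.NT R. of_nat (zero_mult xi \<rho>) * integral {- T..T} (\<lambda>t. \<phi> (Complex (-1) t) * Ln (\<rho> - Complex (-1) t)))
      - (\<Sum>\<rho>\<in>xi_log.NT R. of_nat (zero_mult xi \<rho>) * of_real (ln (norm \<rho>))) * integral {- T..T} (\<lambda>t. \<phi> (Complex (-1) t))
      + integral {- T..T} (\<lambda>t. \<phi> (Complex (-1) t) * xi_log.H R g (Complex (-1) t))
      - integral {- T..T} (\<lambda>t. \<phi> (Complex (-1) t) * Ln (1 - Complex (-1) t))"
proof -
  interpret xi_log R g by fact
  show ?thesis
  proof (rule integral_log_expansion[OF finite_NT])
    show "continuous_on {- T..T} (\<lambda>t. \<phi> (Complex (-1) t))" by (rule phi_line_continuous_on) simp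
    show "continuous_on {- T..T} (\<lambda>t. Ln (\<rho> - Complex (-1) t))" if "\<rho> \<in> insert 1 NT" for \<rho>
      by (rule continuous_on_subset[OF Ln_line_continuous']) (use that NT_D(2)[of \<rho>] in auto)
    show "continuous_on {- T..T} (\<lambda>t. H (Complex (-1) t))"
    proof (rule H_continuous_on[OF continuous_Complex])
      fix t assume "t \<in> {- T..T}"
      hence "norm (Complex (-1) t) < R" using T by (intro norm_line_less[of _ _ T]) auto
      thus "norm (Complex (-1) t) < R \<and> - 2 < Re (Complex (-1) t)" by simp
    qed
    show "log_neg_zeta (Complex (-1) t) + Ln (1 - Complex (-1) t)
        = (\<Sum>\<rho>\<in>NT. mu \<rho> * (Ln (\<rho> - Complex (-1) t) - of_real (ln (norm \<rho>)))) + H (Complex (-1) t)"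
      if t: "t \<in> {- T..T}" for t
    proof -
      have "\<bar>t\<bar> + 2 < R" using t T by auto
      from log_neg_zeta_eq[OF this] show ?thesis by (simp add: P_def)
    qed
  qed
qed

text \<open>Conjugate pairs cancel all imaginary parts. Of \<open>Ln \<rho>\<close> only
  \<open>ln (norm \<rho>)\<close> survives, and of \<open>\<Phi> \<rho>\<close> only
  \<open>Re (\<Phi> \<rho>)\<close>.\<close>

lemma sum_log_int:
  assumes "xi_log R g"
  shows "(\<Sum>\<rho>\<in>xi_log.NT R. of_nat (zero_mult xi \<rho>) * log_int \<rho>)
     = 2 * of_real pi * (\<Sum>\<rho>\<in>xi_log.NT R. of_nat (zero_mult xi \<rho>) * of_real (ln (norm \<rho>)))
       - 2 * of_real pi * of_real (\<Sum>\<rho>\<in>xi_log.NT R. real (zero_mult xi \<rho>) * Re (\<Phi> \<rho>))"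
proof -
  interpret xi_log R g by fact
  have slit: "\<rho> \<notin> \<real>\<^sub>\<le>\<^sub>0" if "\<rho> \<in> NT" for \<rho> using NT_D(4)[OF that] by (simp add: complex_nonpos_Reals_iff)
  define f where "f = (\<lambda>\<rho>. Ln \<rho> - of_real (ln (norm \<rho>)) - \<Phi> \<rho>)"
  have im: "Im (\<Sum>\<rho>\<in>NT. mu \<rho> * f \<rho>) = 0"
  proof (rule cnj_sum_symmetric[OF NT_cnj])
    fix \<rho> assume \<rho>: "\<rho> \<in> NT"
    show "mu (cnj \<rho>) * f (cnj \<rho>) = cnj (mu \<rho> * f \<rho>)"
      using cnj_Ln[OF slit[OF \<rho>]] Phi_cnj[OF slit[OF \<rho>]] by (simp add: f_def mu_cnj[OF \<rho>])
  qed
  have re: "Re (\<Sum>\<rho>\<in>NT. mu \<rho> * f \<rho>) = - (\<Sum>\<rho>\<in>NT. real (zero_mult xi \<rho>) * Re (\<Phi> \<rho>))"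
    unfolding Re_sum sum_negf[symmetric]
  proof (intro sum.cong refl)
    fix \<rho> assume "\<rho> \<in> NT"
    hence "Re (f \<rho>) = - Re (\<Phi> \<rho>)" using NT_D(6)[of \<rho>] by (simp add: f_def)
    thus "Re (mu \<rho> * f \<rho>) = - (real (zero_mult xi \<rho>) * Re (\<Phi> \<rho>))" by simp
  qed
  have F: "(\<Sum>\<rho>\<in>NT. mu \<rho> * f \<rho>) = - of_real (\<Sum>\<rho>\<in>NT. real (zero_mult xi \<rho>) * Re (\<Phi> \<rho>))"
    using im re by (simp only: complex_eq_iff Re_complex_of_real Im_complex_of_real uminus_complex.simps) simp
  have "(\<Sum>\<rho>\<in>NT. mu \<rho> * log_int \<rho>) = (\<Sum>\<rho>\<in>NT. 2 * of_real pi * (mu \<rho> * of_real (ln (norm \<rho>))) + 2 * of_real pi * (mu \<rho> * f \<rho>))"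
  proof (intro sum.cong refl)
    fix \<rho> assume "\<rho> \<in> NT"
    hence l: "log_int \<rho> = 2 * of_real pi * (Ln \<rho> - \<Phi> \<rho>)" by (intro log_int_eq NT_D)
    show "mu \<rho> * log_int \<rho> = 2 * of_real pi * (mu \<rho> * of_real (ln (norm \<rho>))) + 2 * of_real pi * (mu \<rho> * f \<rho>)"
      unfolding l f_def by (simp add: algebra_simps)
  qed
  also have "\<dots> = 2 * of_real pi * (\<Sum>\<rho>\<in>NT. mu \<rho> * of_real (ln (norm \<rho>))) + 2 * of_real pi * (\<Sum>\<rho>\<in>NT. mu \<rho> * f \<rho>)"
    unfolding sum.distrib sum_distrib_left ..
  finally show ?thesis unfolding F by simp
qed

text \<open>\<open>R = 4 * T\<close> with \<open>T \<ge> 3\<close> puts the rectangle of height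
  \<open>T\<close> inside the half disc where \<open>H\<close> is bounded. The four errors come from
  truncating the zero integrals, truncating the integrals of \<open>\<phi>\<close>, shifting
  \<open>H\<close>, and truncating the integral of the pole.\<close>

lemma truncated_formula:
  assumes "xi_log_bound R g K d" and T: "T \<ge> 3" and RT: "R = 4 * T"
  shows "norm (integral {- T..T} (\<lambda>t. \<phi> (Complex 2 t) * log_zeta (Complex 2 t))
      - integral {- T..T} (\<lambda>t. \<phi> (Complex (-1) t) * log_neg_zeta (Complex (-1) t))
      - 2 * of_real pi * (\<Phi> 1 - of_real (\<Sum>\<rho>\<in>xi_log.NT R. real (zero_mult xi \<rho>) * Re (\<Phi> \<rho>)) - of_real (ln 2)))
    \<le> K * R\<^sup>2 * (4 * decay_const * (6 + R) * exp (- T / 4) * exp_const)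
      + K * R\<^sup>2 * (R + 1 / d) * (4 * decay_const * exp (- T / 4) * exp_const)
      + 6 * (decay_const * exp (- T) * (K * R\<^sup>2 * (R + 8)))
      + 4 * decay_const * (6 + 1) * exp (- T / 4) * exp_const"
proof -
  interpret xi_log_bound R g K d by fact
  have xl: "xi_log R g" by (rule xi_log_axioms)
  have T0: "T \<ge> 0" "T + 2 < R" using T RT by auto
  define I2 where "I2 = integral {- T..T} (\<lambda>t. \<phi> (Complex 2 t) * log_zeta (Complex 2 t))"
  define I1 where "I1 = integral {- T..T} (\<lambda>t. \<phi> (Complex (-1) t) * log_neg_zeta (Complex (-1) t))"
  define J2 where "J2 = integral {- T..T} (\<lambda>t. \<phi> (Complex 2 t))"
  define J1 where "J1 = integral {- T..T} (\<lambda>t. \<phi> (Complex (-1) t))"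
  define S2 where "S2 = integral {- T..T} (\<lambda>t. \<phi> (Complex 2 t) * H (Complex 2 t))"
  define S1 where "S1 = integral {- T..T} (\<lambda>t. \<phi> (Complex (-1) t) * H (Complex (-1) t))"
  define c where "c = (\<Sum>\<rho>\<in>NT. mu \<rho> * of_real (ln (norm \<rho>)))"
  define W where "W = complex_of_real (\<Sum>\<rho>\<in>NT. real (zero_mult xi \<rho>) * Re (\<Phi> \<rho>))"
  define A where "A = (\<Sum>\<rho>\<in>NT. mu \<rho> * log_int \<rho>)"
  define B where "B = (\<Sum>\<rho>\<in>NT. mu \<rho> * log_int_trunc \<rho> T)"
  define p where "p = 2 * complex_of_real pi"
  have I: "I2 - I1 = B - c * (J2 - J1) + (S2 - S1) - log_int_trunc 1 T"
  proof -
    have "B = (\<Sum>\<rho>\<in>NT. mu \<rho> * integral {- T..T} (\<lambda>t. \<phi> (Complex 2 t) * Ln (Complex 2 t - \<rho>)))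
       - (\<Sum>\<rho>\<in>NT. mu \<rho> * integral {- T..T} (\<lambda>t. \<phi> (Complex (-1) t) * Ln (\<rho> - Complex (-1) t)))"
      unfolding B_def log_int_trunc_def right_diff_distrib sum_subtractf ..
    thus ?thesis
      unfolding I2_def I1_def J2_def J1_def S2_def S1_def c_def log_int_trunc_def
        truncated_log_zeta[OF xl T0] truncated_log_neg_zeta[OF xl T0] by (simp add: algebra_simps)
  qed
  have A: "A = p * c - p * W" unfolding A_def p_def c_def W_def by (rule sum_log_int[OF xl])
  have P1: "p * \<Phi> 1 = - log_int 1" unfolding log_int_1 p_def by simp
  have H0: "p * of_real (ln 2) = - (p * H 0)" unfolding H_0 by simp
  \<comment> \<open>The possibly large sum \<open>c\<close> of the terms
    \<open>ln (norm \<rho>)\<close> enters \<open>A\<close> with factor \<open>2 * pi\<close> and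
    the truncated formula with factor \<open>J2 - J1\<close>; only the small difference multiplies
    it.\<close>
  have "I2 - I1 - p * (\<Phi> 1 - W - of_real (ln 2))
      = - (A - B) - c * (J2 - J1 - p) + (S2 - S1 - p * H 0) + (log_int 1 - log_int_trunc 1 T)"
  proof -
    have "p * (\<Phi> 1 - W - of_real (ln 2)) = p * \<Phi> 1 - p * W - p * of_real (ln 2)" by (simp add: right_diff_distrib)
    also have "\<dots> = - log_int 1 + (A - p * c) + p * H 0" unfolding P1 H0 A by simp
    finally show ?thesis unfolding I by (simp add: algebra_simps)
  qed
  also have "norm \<dots> \<le> norm (A - B) + norm (c * (J2 - J1 - p)) + norm (S2 - S1 - p * H 0) + norm (log_int 1 - log_int_trunc 1 T)"
  proof -
    have "norm (- a - b + u + v) \<le> norm a + norm b + norm u + norm v" for a b u v :: complex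
      using norm_triangle_ineq[of "- a - b + u" v] norm_triangle_ineq[of "- a - b" u] norm_triangle_ineq4[of "- a" b]
      by simp
    thus ?thesis .
  qed
  also have "norm (A - B) \<le> K * R\<^sup>2 * (4 * decay_const * (6 + R) * exp (- T / 4) * exp_const)"
  proof -
    have "A - B = (\<Sum>\<rho>\<in>NT. mu \<rho> * (log_int \<rho> - log_int_trunc \<rho> T))"
      unfolding A_def B_def right_diff_distrib sum_subtractf ..
    moreover have "norm (\<Sum>\<rho>\<in>NT. mu \<rho> * (log_int \<rho> - log_int_trunc \<rho> T)) \<le> K * R\<^sup>2 * (4 * decay_const * (6 + R) * exp (- T / 4) * exp_const)"
    proof (rule mu_sum_bound[OF NT_subset])
      fix \<rho> assume \<rho>: "\<rho> \<in> NT"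
      have "norm (log_int \<rho> - log_int_trunc \<rho> T) \<le> 4 * decay_const * (6 + norm \<rho>) * exp (- T / 4) * exp_const"
        by (rule log_int_truncation) (use NT_D[OF \<rho>] in auto)
      also have "\<dots> \<le> 4 * decay_const * (6 + R) * exp (- T / 4) * exp_const"
        using NT_D(5)[OF \<rho>] decay_const_pos exp_const_nonneg by (intro mult_right_mono mult_left_mono) auto
      finally show "norm (log_int \<rho> - log_int_trunc \<rho> T) \<le> 4 * decay_const * (6 + R) * exp (- T / 4) * exp_const" .
    qed (use decay_const_pos exp_const_nonneg RT T in simp)
    ultimately show ?thesis by simp
  qed
  also have "norm (c * (J2 - J1 - p)) \<le> K * R\<^sup>2 * (R + 1 / d) * (4 * decay_const * exp (- T / 4) * exp_const)"
    unfolding norm_mult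
  proof (rule mult_mono)
    show "norm c \<le> K * R\<^sup>2 * (R + 1 / d)" unfolding c_def
      by (rule mu_sum_bound[OF NT_subset ln_NT_bound]) (use RT T d in simp_all)
    show "norm (J2 - J1 - p) \<le> 4 * decay_const * exp (- T / 4) * exp_const"
      unfolding J2_def J1_def p_def by (rule phi_trunc_diff)
  qed (use K RT T d in simp_all)
  also have "norm (S2 - S1 - p * H 0) \<le> 6 * (decay_const * exp (- T) * (K * R\<^sup>2 * (R + 8)))"
    unfolding S2_def S1_def p_def
  proof (rule shift_bound[OF H_hol])
    show "open (ball 0 R \<inter> {s. - 2 < Re s})" by (intro open_Int open_ball open_halfspace_Re_gt)
    show "cbox (Complex (- 1) (- T)) (Complex 2 T) \<subseteq> ball 0 R \<inter> {s. - 2 < Re s}"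
    proof
      fix s assume "s \<in> cbox (Complex (- 1) (- T)) (Complex 2 T)"
      hence s: "-1 \<le> Re s" "Re s \<le> 2" "\<bar>Im s\<bar> \<le> T" by (auto simp: in_cbox_complex_iff)
      hence "norm s < R" using cmod_le[of s] T0 by linarith
      thus "s \<in> ball 0 R \<inter> {s. - 2 < Re s}" using s by simp
    qed
    show "T \<ge> 1" using T by simp
    fix s assume s: "-1 \<le> Re s" "Re s \<le> 2" "\<bar>Im s\<bar> = T"
    show "norm (H s) \<le> K * R\<^sup>2 * (R + 8)"
      by (rule H_bound) (use s cmod_le[of s] T RT in simp_all)
  qed
  also have "norm (log_int 1 - log_int_trunc 1 T) \<le> 4 * decay_const * (6 + 1) * exp (- T / 4) * exp_const"
    using log_int_truncation[of 1 T] by simp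
  finally show ?thesis unfolding I2_def I1_def W_def p_def by simp
qed

end

section \<open>Passage to the limit\<close>

context smoothed
begin

text \<open>The truncated formula at \<open>T = n\<close> involves exactly the zeros with
  \<open>norm \<rho> < 4 * n\<close>. These sets exhaust the nontrivial zeros, so by
  \<open>summable_Phi\<close> the partial sums converge to the infinite sum, and all errors tend to
  0.\<close>

lemma log_integral_difference:
  "(\<integral>t. \<phi> (Complex 2 t) * log_zeta (Complex 2 t) \<partial>lborel)
     - (\<integral>t. \<phi> (Complex (-1) t) * log_neg_zeta (Complex (-1) t) \<partial>lborel)
   = 2 * of_real pi * (\<Phi> 1
       - of_real (\<Sum>\<^sub>\<infinity>\<rho>\<in>nontrivial_zeros. real (zero_mult xi \<rho>) * Re (\<Phi> \<rho>)) - of_real (ln 2))"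
proof -
  obtain K where K: "K \<ge> 0"
    "\<And>R. R \<ge> 1 \<Longrightarrow> \<exists>g. g holomorphic_on ball 0 R \<and> g 0 = Ln (xi 0) \<and>
       (\<forall>s. norm s < R \<longrightarrow> xi s = zero_poly xi R s * exp (g s)) \<and>
       (\<forall>s. norm s \<le> R / 2 \<longrightarrow> norm (g s) \<le> K * R\<^sup>2)"
    "\<And>R. R \<ge> 1 \<Longrightarrow> real (\<Sum>z\<in>zeros_in xi R. zero_mult xi z) \<le> K * R\<^sup>2"
    using xi_factorization by metis
  obtain d where d: "d > 0" "\<And>\<rho>. xi \<rho> = 0 \<Longrightarrow> d \<le> norm \<rho>" using xi_zeros_away_from_0 by blast
  define V2 where "V2 = (\<integral>t. \<phi> (Complex 2 t) * log_zeta (Complex 2 t) \<partial>lborel)"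
  define V1 where "V1 = (\<integral>t. \<phi> (Complex (-1) t) * log_neg_zeta (Complex (-1) t) \<partial>lborel)"
  define I2 where "I2 = (\<lambda>T. integral {- T..T} (\<lambda>t. \<phi> (Complex 2 t) * log_zeta (Complex 2 t)))"
  define I1 where "I1 = (\<lambda>T. integral {- T..T} (\<lambda>t. \<phi> (Complex (-1) t) * log_neg_zeta (Complex (-1) t)))"
  obtain A2 where A2: "\<And>T. norm (V2 - I2 T) \<le> A2 * exp (- T / 4) * exp_const"
    unfolding V2_def I2_def using log_zeta_phi by blast
  obtain A1 where A1: "\<And>T. norm (V1 - I1 T) \<le> A1 * exp (- T / 4) * exp_const"
    unfolding V1_def I1_def using log_neg_zeta_phi by blast
  define S where "S = (\<lambda>F. \<Sum>\<rho>\<in>F. real (zero_mult xi \<rho>) * Re (\<Phi> \<rho>))"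
  define Z where "Z = (\<lambda>n::nat. {\<rho> \<in> nontrivial_zeros. norm \<rho> < 4 * real n})"
  define X where "X = (\<lambda>s. 2 * of_real pi * (\<Phi> 1 - of_real s - of_real (ln 2)) :: complex)"
  define D where "D = decay_const"
  define E where "E = exp_const"
  define err where "err = (\<lambda>n::nat. K * (4 * real n)\<^sup>2 * (4 * D * (6 + 4 * real n) * exp (- real n / 4) * E)
      + K * (4 * real n)\<^sup>2 * (4 * real n + 1 / d) * (4 * D * exp (- real n / 4) * E)
      + 6 * (D * exp (- real n) * (K * (4 * real n)\<^sup>2 * (4 * real n + 8)))
      + 4 * D * (6 + 1) * exp (- real n / 4) * E)"
  have trunc: "norm (I2 (real n) - I1 (real n) - X (S (Z n))) \<le> err n" if n: "n \<ge> 3" for n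
  proof -
    define R where "R = 4 * real n"
    have R4: "R \<ge> 4" using n by (simp add: R_def)
    hence R1: "R \<ge> 1" by simp
    obtain g where g: "g holomorphic_on ball 0 R" "g 0 = Ln (xi 0)"
       "\<And>s. norm s < R \<Longrightarrow> xi s = zero_poly xi R s * exp (g s)"
       "\<And>s. norm s \<le> R / 2 \<Longrightarrow> norm (g s) \<le> K * R\<^sup>2" using K(2)[OF R1] by metis
    have xb: "xi_log_bound R g K d"
      by unfold_locales (rule R4 g K(1) K(3)[OF R1] d | assumption)+
    have "xi_log R g" using xb by (rule xi_log_bound.axioms)
    hence NT: "xi_log.NT R = Z n" unfolding Z_def by (simp add: xi_log.NT_eq R_def)
    have n3: "3 \<le> real n" using n by simp
    from truncated_formula[OF xb n3 R_def]
    show ?thesis unfolding NT unfolding I2_def I1_def X_def S_def err_def D_def E_def R_def .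
  qed
  have err0: "err \<longlonglongrightarrow> 0"
  proof -
    \<comment> \<open>With \<open>K\<close>, \<open>D\<close>, \<open>E\<close> and \<open>d\<close>
      split off, only explicit products of polynomials and exponentials in \<open>n\<close>
      remain.\<close>
    define f1 where "f1 = (\<lambda>n::nat. (4 * real n)\<^sup>2 * (6 + 4 * real n) * exp (- real n / 4))"
    define f2 where "f2 = (\<lambda>n::nat. (4 * real n)\<^sup>2 * (4 * real n) * exp (- real n / 4))"
    define f3 where "f3 = (\<lambda>n::nat. (4 * real n)\<^sup>2 * exp (- real n / 4))"
    define f4 where "f4 = (\<lambda>n::nat. (4 * real n)\<^sup>2 * (4 * real n + 8) * exp (- real n))"
    define f5 where "f5 = (\<lambda>n::nat. exp (- real n / 4))"
    have f: "f1 \<longlonglongrightarrow> 0" "f2 \<longlonglongrightarrow> 0" "f3 \<longlonglongrightarrow> 0" "f4 \<longlonglongrightarrow> 0" "f5 \<longlonglongrightarrow> 0"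
      unfolding f1_def f2_def f3_def f4_def f5_def by real_asymp+
    have "(\<lambda>n. 4 * K * D * E * f1 n + 4 * K * D * E * f2 n + 4 * K * D * E / d * f3 n + 6 * D * K * f4 n + 28 * D * E * f5 n)
        \<longlonglongrightarrow> 4 * K * D * E * 0 + 4 * K * D * E * 0 + 4 * K * D * E / d * 0 + 6 * D * K * 0 + 28 * D * E * 0"
      by (intro tendsto_add tendsto_mult_left f)
    moreover have "err = (\<lambda>n. 4 * K * D * E * f1 n + 4 * K * D * E * f2 n + 4 * K * D * E / d * f3 n + 6 * D * K * f4 n + 28 * D * E * f5 n)"
      unfolding err_def f1_def f2_def f3_def f4_def f5_def by (rule ext) (simp add: algebra_simps)
    ultimately show ?thesis by simp
  qed
  define tail where "tail = (\<lambda>n::nat. A2 * exp (- real n / 4) * exp_const + A1 * exp (- real n / 4) * exp_const)"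
  have tail0: "tail \<longlonglongrightarrow> 0"
  proof -
    have e: "(\<lambda>n::nat. exp (- real n / 4)) \<longlonglongrightarrow> 0" by real_asymp
    have "tail \<longlonglongrightarrow> A2 * 0 * exp_const + A1 * 0 * exp_const"
      unfolding tail_def by (intro tendsto_add tendsto_mult_left tendsto_mult_right e)
    thus ?thesis by simp
  qed
  have bound: "norm (V2 - V1 - X (S (Z n))) \<le> tail n + err n" if n: "n \<ge> 3" for n
  proof -
    have "V2 - V1 - X (S (Z n)) = (V2 - I2 (real n)) - (V1 - I1 (real n)) + (I2 (real n) - I1 (real n) - X (S (Z n)))" by simp
    also have "norm \<dots> \<le> norm (V2 - I2 (real n)) + norm (V1 - I1 (real n)) + norm (I2 (real n) - I1 (real n) - X (S (Z n)))"
      by (intro norm_triangle_le add_mono norm_triangle_ineq4 order_refl)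
    also have "\<dots> \<le> tail n + err n" unfolding tail_def by (intro add_mono A2 A1 trunc n)
    finally show ?thesis .
  qed
  have "(\<lambda>n. V2 - V1 - X (S (Z n))) \<longlonglongrightarrow> 0"
  proof (rule Lim_null_comparison)
    show "eventually (\<lambda>n. norm (V2 - V1 - X (S (Z n))) \<le> tail n + err n) sequentially"
      using eventually_ge_at_top[of 3] by eventually_elim (rule bound)
    show "(\<lambda>n. tail n + err n) \<longlonglongrightarrow> 0" using tendsto_add[OF tail0 err0] by simp
  qed
  hence "(\<lambda>n. V2 - V1 - (V2 - V1 - X (S (Z n)))) \<longlonglongrightarrow> V2 - V1 - 0" by (intro tendsto_diff tendsto_const)
  hence lim1: "(\<lambda>n. X (S (Z n))) \<longlonglongrightarrow> V2 - V1" by simp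
  define s where "s = (\<Sum>\<^sub>\<infinity>\<rho>\<in>nontrivial_zeros. real (zero_mult xi \<rho>) * Re (\<Phi> \<rho>))"
  have "(S \<longlongrightarrow> s) (finite_subsets_at_top nontrivial_zeros)"
    unfolding S_def s_def by (rule infsum_tendsto[OF summable_Phi])
  moreover have "filterlim Z (finite_subsets_at_top nontrivial_zeros) sequentially"
    unfolding filterlim_finite_subsets_at_top
  proof (intro allI impI)
    fix Y assume "finite Y \<and> Y \<subseteq> nontrivial_zeros"
    hence Y: "finite Y" "Y \<subseteq> nontrivial_zeros" by auto
    \<comment> \<open>The sum of the norms bounds each one, so a single radius captures the finite
      set \<open>Y\<close>.\<close>
    obtain n0 :: nat where n0: "(\<Sum>\<rho>\<in>Y. norm \<rho>) < real n0" using reals_Archimedean2 by blast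
    show "eventually (\<lambda>n. finite (Z n) \<and> Y \<subseteq> Z n \<and> Z n \<subseteq> nontrivial_zeros) sequentially"
      using eventually_ge_at_top[of n0]
    proof eventually_elim
      case (elim n)
      have "Z n \<subseteq> zeros_in xi (4 * real n)" using nontrivial_zero_xi by (auto simp: Z_def zeros_in_def)
      hence "finite (Z n)" using xi.finite_zeros_in by (rule finite_subset)
      moreover have "\<rho> \<in> Z n" if \<rho>: "\<rho> \<in> Y" for \<rho>
      proof -
        have "norm \<rho> \<le> (\<Sum>\<rho>\<in>Y. norm \<rho>)" by (rule member_le_sum[OF \<rho>]) (use Y in auto)
        hence "norm \<rho> < 4 * real n" using n0 elim by simp
        thus ?thesis using \<rho> Y(2) by (auto simp: Z_def)
      qed
      ultimately show ?case by (auto simp: Z_def)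
    qed
  qed
  ultimately have "(\<lambda>n. S (Z n)) \<longlonglongrightarrow> s" by (rule filterlim_compose)
  hence "(\<lambda>n. X (S (Z n))) \<longlonglongrightarrow> X s"
    unfolding X_def by (intro tendsto_intros)
  from LIMSEQ_unique[OF lim1 this] show ?thesis unfolding V2_def V1_def X_def s_def .
qed

end

theorem theorem4p7:
  fixes x lam :: real and \<Phi> :: "complex \<Rightarrow> complex"
  assumes "x > 0" and "lam > 0"
    and "is_Phi_hat x lam \<Phi>"
  shows "vline_integrable 2 (\<lambda>s. phi_hat x lam s * log_zeta s) \<and>
    vline_integrable (- 1) (\<lambda>s. phi_hat x lam s * log_neg_zeta s) \<and>
    (\<lambda>\<rho>. of_int (zorder zeta \<rho>) * Re (\<Phi> \<rho>)) summable_on nontrivial_zeros \<and>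
    1 / (2 * of_real pi * \<i>) * vline_integral 2 (\<lambda>s. phi_hat x lam s * log_zeta s) =
      \<Phi> 1
      - of_real (\<Sum>\<^sub>\<infinity>\<rho>\<in>nontrivial_zeros. of_int (zorder zeta \<rho>) * Re (\<Phi> \<rho>))
      - of_real (ln 2)
      + 1 / (2 * of_real pi * \<i>) * vline_integral (- 1) (\<lambda>s. phi_hat x lam s * log_neg_zeta s)"
proof (intro conjI)
  interpret smoothed x lam \<Phi> by unfold_locales (rule assms)+
  have mult: "of_int (zorder zeta \<rho>) * Re (\<Phi> \<rho>) = real (zero_mult xi \<rho>) * Re (\<Phi> \<rho>)"
    if "\<rho> \<in> nontrivial_zeros" for \<rho>
    unfolding of_int_zorder_zeta[OF that] ..
  show "vline_integrable 2 (\<lambda>s. phi_hat x lam s * log_zeta s)"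
    unfolding vline_integrable_def using log_zeta_phi by blast
  show "vline_integrable (- 1) (\<lambda>s. phi_hat x lam s * log_neg_zeta s)"
    unfolding vline_integrable_def using log_neg_zeta_phi by blast
  show "(\<lambda>\<rho>. of_int (zorder zeta \<rho>) * Re (\<Phi> \<rho>)) summable_on nontrivial_zeros"
    by (rule iffD2[OF summable_on_cong[OF mult] summable_Phi])
  define V2 where "V2 = (\<integral>t. \<phi> (Complex 2 t) * log_zeta (Complex 2 t) \<partial>lborel)"
  define V1 where "V1 = (\<integral>t. \<phi> (Complex (-1) t) * log_neg_zeta (Complex (-1) t) \<partial>lborel)"
  define s where "s = (\<Sum>\<^sub>\<infinity>\<rho>\<in>nontrivial_zeros. real (zero_mult xi \<rho>) * Re (\<Phi> \<rho>))"
  have s: "(\<Sum>\<^sub>\<infinity>\<rho>\<in>nontrivial_zeros. of_int (zorder zeta \<rho>) * Re (\<Phi> \<rho>)) = s"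
    unfolding s_def by (rule infsum_cong[OF mult])
  have "V2 - V1 = 2 * of_real pi * (\<Phi> 1 - of_real s - of_real (ln 2))"
    unfolding V2_def V1_def s_def by (rule log_integral_difference)
  hence "V2 = 2 * of_real pi * (\<Phi> 1 - of_real s - of_real (ln 2)) + V1" by (simp add: algebra_simps)
  hence "1 / (2 * of_real pi * \<i>) * (\<i> * V2) = \<Phi> 1 - of_real s - of_real (ln 2) + 1 / (2 * of_real pi * \<i>) * (\<i> * V1)"
    by (simp add: field_simps)
  thus "1 / (2 * of_real pi * \<i>) * vline_integral 2 (\<lambda>s. phi_hat x lam s * log_zeta s) =
      \<Phi> 1
      - of_real (\<Sum>\<^sub>\<infinity>\<rho>\<in>nontrivial_zeros. of_int (zorder zeta \<rho>) * Re (\<Phi> \<rho>))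
      - of_real (ln 2)
      + 1 / (2 * of_real pi * \<i>) * vline_integral (- 1) (\<lambda>s. phi_hat x lam s * log_neg_zeta s)"
    unfolding s vline_integral_def V2_def V1_def .
qed

end
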